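(* Let $k$ be an algebraically closed field, let $Q$ be a Dynkin quiver of type $\mathbb{A}_n$, $\mathbb{D}_n$ or $\mathbb{E}_{6,7,8}$, let $R^+$ be the set of positive roots of $Q$, and let $\Lambda$ be the preprojective algebra associated to $Q$ over $k$. Let $M$ be a finite-dimensional $\Lambda$-module with $\operatorname{Ext}^1_\Lambda(M,M) = 0$. Then the number of pairwise non-isomorphic indecomposable direct summands of $M$ is at most $|R^+|$.
   Context: Preprojective algebra: let $Q=(Q_0,Q_1)$ be a quiver which is an orientation of a simply laced Dynkin diagram. Its double $\overline{Q}$ is obtained by adding, for each arrow $a: i \to j$ of $Q$, an arrow $\bar{a}: j \to i$. Then $\Lambda = k\overline{Q}/\big(\sum_{a \in Q_1} (a\bar{a} - \bar{a}a)\big)$, which is a finite-dimensional $k$-algebra since $Q$ is Dynkin. *)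

theory Defs
  imports
    "Graph_Theory.Arc_Walk"
    "HOL-Algebra.QuotRing"
    "HOL-Algebra.Module"
    "HOL-Computational_Algebra.Polynomial"
begin

section \<open>Dynkin quivers\<close>

text \<open>
  A quiver is a directed multigraph \<open>(verts, arcs, tail, head)\<close>; an arrow \<open>a\<close> goes from
  \<open>tail a\<close> to \<open>head a\<close>.  The simply laced Dynkin diagrams are numbered so that there is a
  chain \<open>0 - 1 - ... \<close>; in types D and E the last vertex \<open>n - 1\<close> is the short arm, attached to
  the chain of the other \<open>n - 1\<close> vertices at \<open>n - 3\<close> and at \<open>2\<close> respectively.
\<close>

inductive dynkin_diagram :: "nat \<Rightarrow> nat set set \<Rightarrow> bool" where
  type_A: "n \<ge> 1 \<Longrightarrow> dynkin_diagram n {{i, Suc i} | i. Suc i < n}"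
| type_D: "n \<ge> 4 \<Longrightarrow> dynkin_diagram n (insert {n - 3, n - 1} {{i, Suc i} | i. Suc i < n - 1})"
| type_E: "n \<in> {6, 7, 8} \<Longrightarrow> dynkin_diagram n (insert {2, n - 1} {{i, Suc i} | i. Suc i < n - 1})"

text \<open>
  The injectivity in the second \<open>bij_betw\<close> says that every edge of the diagram carries exactly
  one arrow.
\<close>

definition dynkin_quiver :: "('v, 'e) pre_digraph \<Rightarrow> bool" where
  "dynkin_quiver Q \<longleftrightarrow> (\<exists>n E \<phi>. dynkin_diagram n E \<and> bij_betw \<phi> {..<n} (verts Q) \<and>
     bij_betw (\<lambda>a. {tail Q a, head Q a}) (arcs Q) ((`) \<phi> ` E))"


section \<open>Roots\<close>

text \<open>
  Vectors of the root lattice are functions on the vertices; all roots vanish outside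
  \<open>verts Q\<close>.  The roots are the Weyl group orbits of the simple roots.
\<close>

definition symmetric_form :: "('v, 'e) pre_digraph \<Rightarrow> ('v \<Rightarrow> int) \<Rightarrow> ('v \<Rightarrow> int) \<Rightarrow> int" where
  "symmetric_form Q \<alpha> \<beta> = (\<Sum>i\<in>verts Q. 2 * \<alpha> i * \<beta> i)
     - (\<Sum>a\<in>arcs Q. \<alpha> (tail Q a) * \<beta> (head Q a) + \<alpha> (head Q a) * \<beta> (tail Q a))"

definition simple_root :: "'v \<Rightarrow> 'v \<Rightarrow> int" where
  "simple_root i = (\<lambda>j. if j = i then 1 else 0)"

definition simple_reflection :: "('v, 'e) pre_digraph \<Rightarrow> 'v \<Rightarrow> ('v \<Rightarrow> int) \<Rightarrow> 'v \<Rightarrow> int" where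
  "simple_reflection Q i \<alpha> = (\<lambda>j. \<alpha> j - symmetric_form Q \<alpha> (simple_root i) * simple_root i j)"

inductive_set roots :: "('v, 'e) pre_digraph \<Rightarrow> ('v \<Rightarrow> int) set" for Q where
  simple: "i \<in> verts Q \<Longrightarrow> simple_root i \<in> roots Q"
| reflection: "\<alpha> \<in> roots Q \<Longrightarrow> i \<in> verts Q \<Longrightarrow> simple_reflection Q i \<alpha> \<in> roots Q"

definition positive_roots :: "('v, 'e) pre_digraph \<Rightarrow> ('v \<Rightarrow> int) set" where
  "positive_roots Q = {\<alpha> \<in> roots Q. \<forall>i. \<alpha> i \<ge> 0}"


section \<open>Path algebras\<close>

text \<open>A path is given by its source, its arrows in the order of traversal, and its target.\<close>

type_synonym ('v, 'e) path = "'v \<times> 'e list \<times> 'v"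

definition paths :: "('v, 'e) pre_digraph \<Rightarrow> ('v, 'e) path set" where
  "paths Q = {(u, p, v). pre_digraph.awalk Q u p v}"

text \<open>All pairs \<open>(x, y)\<close> of paths such that \<open>y\<close> followed by \<open>x\<close> is the given path.\<close>

definition factorizations ::
    "('v, 'e) pre_digraph \<Rightarrow> ('v, 'e) path \<Rightarrow> (('v, 'e) path \<times> ('v, 'e) path) set" where
  "factorizations Q z = {((v, q, w), (u, p, v)) | u v w p q.
     (v, q, w) \<in> paths Q \<and> (u, p, v) \<in> paths Q \<and> z = (u, p @ q, w)}"

text \<open>
  Elements are finitely supported functions on the set of paths.  Products are written like
  compositions of maps (\<open>f \<otimes> g\<close> is \<open>g\<close> followed by \<open>f\<close>), so that left modules are covariant
  representations of the quiver.
\<close>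

definition path_algebra ::
    "('v, 'e) pre_digraph \<Rightarrow> (('v, 'e) path \<Rightarrow> 'k::field) ring" where
  "path_algebra Q =
     \<lparr>carrier = {f. finite {z. f z \<noteq> 0} \<and> {z. f z \<noteq> 0} \<subseteq> paths Q},
      monoid.mult = (\<lambda>f g z. \<Sum>(x, y)\<in>factorizations Q z. f x * g y),
      one = (\<lambda>(u, p, v). if u \<in> verts Q \<and> p = [] \<and> u = v then 1 else 0),
      zero = (\<lambda>_. 0),
      add = (\<lambda>f g z. f z + g z)\<rparr>"

definition arrow :: "('v, 'e) pre_digraph \<Rightarrow> 'e \<Rightarrow> ('v, 'e) path \<Rightarrow> 'k::field" where
  "arrow Q a = (\<lambda>z. if z = (tail Q a, [a], head Q a) then 1 else 0)"


section \<open>Preprojective algebras\<close>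

text \<open>The arrow \<open>Inl a\<close> is the original arrow \<open>a\<close>, and \<open>Inr a\<close> is its reverse.\<close>

definition double_quiver :: "('v, 'e) pre_digraph \<Rightarrow> ('v, 'e + 'e) pre_digraph" where
  "double_quiver Q =
     \<lparr>verts = verts Q, arcs = arcs Q <+> arcs Q,
      tail = case_sum (tail Q) (head Q), head = case_sum (head Q) (tail Q)\<rparr>"

definition preprojective_relation ::
    "('v, 'e) pre_digraph \<Rightarrow> ('v, 'e + 'e) path \<Rightarrow> 'k::field" where
  "preprojective_relation Q =
     (let D = double_quiver Q; P = path_algebra D in
      \<Oplus>\<^bsub>P\<^esub>a\<in>arcs Q. (arrow D (Inl a) \<otimes>\<^bsub>P\<^esub> arrow D (Inr a)) \<ominus>\<^bsub>P\<^esub>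
                    (arrow D (Inr a) \<otimes>\<^bsub>P\<^esub> arrow D (Inl a)))"

definition preprojective_ideal ::
    "('v, 'e) pre_digraph \<Rightarrow> (('v, 'e + 'e) path \<Rightarrow> 'k::field) set" where
  "preprojective_ideal Q =
     Idl\<^bsub>path_algebra (double_quiver Q)\<^esub> {preprojective_relation Q}"

definition preprojective_algebra ::
    "('v, 'e) pre_digraph \<Rightarrow> (('v, 'e + 'e) path \<Rightarrow> 'k::field) set ring" where
  "preprojective_algebra Q = path_algebra (double_quiver Q) Quot preprojective_ideal Q"

text \<open>The structure map \<open>k \<rightarrow> \<Lambda>\<close>, sending \<open>c\<close> to the class of \<open>c\<close> times the identity.\<close>

definition preprojective_scalar ::
    "('v, 'e) pre_digraph \<Rightarrow> 'k::field \<Rightarrow> (('v, 'e + 'e) path \<Rightarrow> 'k) set" where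
  "preprojective_scalar Q c =
     (let P = path_algebra (double_quiver Q) in
      preprojective_ideal Q +>\<^bsub>P\<^esub> (\<lambda>z. c * \<one>\<^bsub>P\<^esub> z))"


section \<open>Modules\<close>

text \<open>
  The library's \<open>module\<close> locale requires a commutative ring; this is the same set of axioms for
  an arbitrary ring.  The ring-specific fields \<open>mult\<close> and \<open>one\<close> of the record \<open>M\<close> are not used.
\<close>

locale left_module = R?: ring R + M?: abelian_group M for R (structure) and M (structure) +
  assumes smult_closed:
      "\<lbrakk>a \<in> carrier R; x \<in> carrier M\<rbrakk> \<Longrightarrow> a \<odot>\<^bsub>M\<^esub> x \<in> carrier M"
    and smult_l_distr:
      "\<lbrakk>a \<in> carrier R; b \<in> carrier R; x \<in> carrier M\<rbrakk> \<Longrightarrow>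
       (a \<oplus> b) \<odot>\<^bsub>M\<^esub> x = a \<odot>\<^bsub>M\<^esub> x \<oplus>\<^bsub>M\<^esub> b \<odot>\<^bsub>M\<^esub> x"
    and smult_r_distr:
      "\<lbrakk>a \<in> carrier R; x \<in> carrier M; y \<in> carrier M\<rbrakk> \<Longrightarrow>
       a \<odot>\<^bsub>M\<^esub> (x \<oplus>\<^bsub>M\<^esub> y) = a \<odot>\<^bsub>M\<^esub> x \<oplus>\<^bsub>M\<^esub> a \<odot>\<^bsub>M\<^esub> y"
    and smult_assoc:
      "\<lbrakk>a \<in> carrier R; b \<in> carrier R; x \<in> carrier M\<rbrakk> \<Longrightarrow>
       (a \<otimes> b) \<odot>\<^bsub>M\<^esub> x = a \<odot>\<^bsub>M\<^esub> (b \<odot>\<^bsub>M\<^esub> x)"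
    and smult_one:
      "x \<in> carrier M \<Longrightarrow> \<one> \<odot>\<^bsub>M\<^esub> x = x"

text \<open>Finite dimension over \<open>k\<close>, for modules over a ring with structure map \<open>\<sigma> : k \<rightarrow> R\<close>.\<close>

definition finite_dimensional :: "('k::field \<Rightarrow> 'r) \<Rightarrow> ('r, 'm) module \<Rightarrow> bool" where
  "finite_dimensional \<sigma> M \<longleftrightarrow>
     (\<exists>B. finite B \<and> B \<subseteq> carrier M \<and>
       (\<forall>x\<in>carrier M. \<exists>c. x = (\<Oplus>\<^bsub>M\<^esub>b\<in>B. \<sigma> (c b) \<odot>\<^bsub>M\<^esub> b)))"

definition module_homs ::
    "'r ring \<Rightarrow> ('r, 'm) module \<Rightarrow> ('r, 'n) module \<Rightarrow> ('m \<Rightarrow> 'n) set" where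
  "module_homs R M N = {f \<in> carrier M \<rightarrow> carrier N.
     (\<forall>x\<in>carrier M. \<forall>y\<in>carrier M. f (x \<oplus>\<^bsub>M\<^esub> y) = f x \<oplus>\<^bsub>N\<^esub> f y) \<and>
     (\<forall>a\<in>carrier R. \<forall>x\<in>carrier M. f (a \<odot>\<^bsub>M\<^esub> x) = a \<odot>\<^bsub>N\<^esub> f x)}"

definition module_iso :: "'r ring \<Rightarrow> ('r, 'm) module \<Rightarrow> ('r, 'n) module \<Rightarrow> bool" where
  "module_iso R M N \<longleftrightarrow> (\<exists>f\<in>module_homs R M N. bij_betw f (carrier M) (carrier N))"


subsection \<open>Indecomposable direct summands\<close>

definition complementary :: "'r ring \<Rightarrow> ('r, 'm) module \<Rightarrow> 'm set \<Rightarrow> 'm set \<Rightarrow> bool" where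
  "complementary R M U V \<longleftrightarrow> submodule U R M \<and> submodule V R M \<and>
     U \<inter> V = {\<zero>\<^bsub>M\<^esub>} \<and> U <+>\<^bsub>M\<^esub> V = carrier M"

definition indecomposable :: "'r ring \<Rightarrow> ('r, 'm) module \<Rightarrow> bool" where
  "indecomposable R M \<longleftrightarrow> carrier M \<noteq> {\<zero>\<^bsub>M\<^esub>} \<and>
     (\<forall>U V. complementary R M U V \<longrightarrow> U = {\<zero>\<^bsub>M\<^esub>} \<or> V = {\<zero>\<^bsub>M\<^esub>})"

definition indecomposable_summands :: "'r ring \<Rightarrow> ('r, 'm) module \<Rightarrow> 'm set set" where
  "indecomposable_summands R M =
     {U. (\<exists>V. complementary R M U V) \<and> indecomposable R (M\<lparr>carrier := U\<rparr>)}"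

definition indecomposable_summand_classes ::
    "'r ring \<Rightarrow> ('r, 'm) module \<Rightarrow> 'm set set set" where
  "indecomposable_summand_classes R M =
     indecomposable_summands R M //
       {(U, V). U \<in> indecomposable_summands R M \<and> V \<in> indecomposable_summands R M \<and>
                module_iso R (M\<lparr>carrier := U\<rparr>) (M\<lparr>carrier := V\<rparr>)}"


subsection \<open>Extensions\<close>

text \<open>
  \<open>Ext\<^sup>1(M, N)\<close> is the set of Yoneda equivalence classes of short exact sequences
  \<open>0 \<rightarrow> N \<rightarrow> E \<rightarrow> M \<rightarrow> 0\<close>.  The underlying set of the middle term of such a sequence is in
  bijection with \<open>N \<times> M\<close>, so nothing is lost by taking middle terms carried by the product
  type.  The zero element is the class of the split sequence.
\<close>

definition extensions ::
    "'r ring \<Rightarrow> ('r, 'm) module \<Rightarrow> ('r, 'n) module \<Rightarrow>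
     (('r, 'n \<times> 'm) module \<times> ('n \<Rightarrow> 'n \<times> 'm) \<times> ('n \<times> 'm \<Rightarrow> 'm)) set" where
  "extensions R M N = {(E, i, p). left_module R E \<and>
     i \<in> module_homs R N E \<and> p \<in> module_homs R E M \<and>
     inj_on i (carrier N) \<and>
     i ` carrier N = {x \<in> carrier E. p x = \<zero>\<^bsub>M\<^esub>} \<and>
     p ` carrier E = carrier M}"

text \<open>By the five lemma the comparison map is an isomorphism, so this relation is symmetric.\<close>

definition extension_equiv ::
    "'r ring \<Rightarrow> ('r, 'm) module \<Rightarrow> ('r, 'n) module \<Rightarrow>
     ((('r, 'n \<times> 'm) module \<times> ('n \<Rightarrow> 'n \<times> 'm) \<times> ('n \<times> 'm \<Rightarrow> 'm)) \<times>
      (('r, 'n \<times> 'm) module \<times> ('n \<Rightarrow> 'n \<times> 'm) \<times> ('n \<times> 'm \<Rightarrow> 'm))) set" where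
  "extension_equiv R M N = {((E, i, p), (E', i', p')).
     (E, i, p) \<in> extensions R M N \<and> (E', i', p') \<in> extensions R M N \<and>
     (\<exists>\<phi>\<in>module_homs R E E'.
        (\<forall>x\<in>carrier N. \<phi> (i x) = i' x) \<and> (\<forall>y\<in>carrier E. p' (\<phi> y) = p y))}"

definition direct_sum ::
    "('r, 'n) module \<Rightarrow> ('r, 'm) module \<Rightarrow> ('r, 'n \<times> 'm) module" where
  "direct_sum N M =
     \<lparr>carrier = carrier N \<times> carrier M,
      monoid.mult = (\<lambda>(x, y) (x', y'). (x \<otimes>\<^bsub>N\<^esub> x', y \<otimes>\<^bsub>M\<^esub> y')),
      one = (\<one>\<^bsub>N\<^esub>, \<one>\<^bsub>M\<^esub>),
      zero = (\<zero>\<^bsub>N\<^esub>, \<zero>\<^bsub>M\<^esub>),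
      add = (\<lambda>(x, y) (x', y'). (x \<oplus>\<^bsub>N\<^esub> x', y \<oplus>\<^bsub>M\<^esub> y')),
      module.smult = (\<lambda>a (x, y). (a \<odot>\<^bsub>N\<^esub> x, a \<odot>\<^bsub>M\<^esub> y))\<rparr>"

definition split_extension ::
    "('r, 'm) module \<Rightarrow> ('r, 'n) module \<Rightarrow>
     ('r, 'n \<times> 'm) module \<times> ('n \<Rightarrow> 'n \<times> 'm) \<times> ('n \<times> 'm \<Rightarrow> 'm)" where
  "split_extension M N = (direct_sum N M, \<lambda>x. (x, \<zero>\<^bsub>M\<^esub>), snd)"

definition Ext1 ::
    "'r ring \<Rightarrow> ('r, 'm) module \<Rightarrow> ('r, 'n) module \<Rightarrow>
     (('r, 'n \<times> 'm) module \<times> ('n \<Rightarrow> 'n \<times> 'm) \<times> ('n \<times> 'm \<Rightarrow> 'm)) set set" where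
  "Ext1 R M N = extensions R M N // extension_equiv R M N"

definition Ext1_zero ::
    "'r ring \<Rightarrow> ('r, 'm) module \<Rightarrow> ('r, 'n) module \<Rightarrow>
     (('r, 'n \<times> 'm) module \<times> ('n \<Rightarrow> 'n \<times> 'm) \<times> ('n \<times> 'm \<Rightarrow> 'm)) set" where
  "Ext1_zero R M N = extension_equiv R M N `` {split_extension M N}"

end

theory Submission
  imports Defs "Jordan_Normal_Form.Determinant" "HOL-Library.Function_Algebras"
begin

text \<open>
  A module over the preprojective algebra \<open>\<Lambda>\<close> is a representation of
  \<open>Q\<close>, given by maps \<open>T a\<close> along the arrows, together with maps
  \<open>\<phi> a\<close> against the arrows such that the sum of all \<open>T a \<phi> a - \<phi>
  a T a\<close> vanishes. For a fixed representation \<open>X\<close> of \<open>Q\<close> this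
  condition is linear in \<open>\<phi>\<close>, so the \<open>\<Lambda>\<close>-structures
  extending \<open>X\<close> form a vector space, on which the automorphisms of \<open>X\<close>
  act. The proof rests on two facts.

  First, a rigid \<open>\<Lambda>\<close>-module is determined by its restriction to
  \<open>Q\<close>. A structure \<open>\<psi>\<close> extending \<open>X\<close> gives a
  derivation of the path algebra and hence a self-extension of \<open>M\<close>; as this splits,
  \<open>\<psi>\<close> is of the form \<open>\<phi> g - g \<phi>\<close> with \<open>g\<close> an
  endomorphism of \<open>X\<close> (\<open>rigid_S\<close>). Thus the orbit of a rigid
  \<open>\<phi>\<close> has full tangent space. Rather than with dimensions of orbits, the
  argument goes along the line joining two structures: solving a linear system with polynomial
  coefficients shows that all but finitely many of its points are isomorphic to
  \<open>\<phi>\<close> (\<open>generic_deformation\<close>). If both ends are rigid, some point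
  is isomorphic to both, because the field is infinite (\<open>rigid_unique\<close>,
  \<open>rigid_iso\<close>).

  Second, a representation of \<open>Q\<close> is determined by at most \<open>|R\<^sup>+|\<close>
  additive multiplicities. Reflecting again and again at a sink, each time one that is lowest for
  a height function on the vertices, the \<open>k\<close>-th reflection deletes a number of copies
  of the simple representation at the sink, and this number is the \<open>k\<close>-th
  multiplicity (\<open>top_mult\<close>). Transporting a deleted copy back to the start yields a
  summand whose dimension vector is the positive root \<open>s\<^bsub>i0\<^esub> ...
  s\<^bsub>ik-1\<^esub> e\<^bsub>ik\<^esub>\<close>, and distinct \<open>k\<close> give distinct
  roots (\<open>beta_nonneg\<close>, \<open>inj_beta\<close>). Since the Tits form is positive
  definite, every representation is reflected to zero after finitely many steps, so that it can be
  rebuilt from its multiplicities (\<open>rep_iso_of_mult_eq\<close>).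

  Now suppose that \<open>M\<close> had more than \<open>|R\<^sup>+|\<close> non-isomorphic
  indecomposable summands. Their multiplicity vectors satisfy a nontrivial integer relation
  (\<open>integer_relation\<close>). Separating the positive and the negative coefficients gives
  two direct sums of copies of the summands with the same multiplicities, hence with isomorphic
  restrictions to \<open>Q\<close>. Both sums are rigid, since \<open>M\<close> is
  (\<open>rigid_SJ\<close>), so they are isomorphic as \<open>\<Lambda>\<close>-modules. But they
  have no indecomposable summand in common and are not both zero, contradicting the Krull-Schmidt
  theorem (\<open>no_common_iso\<close>, \<open>card_le_active\<close>).

  All vector spaces occurring in the linear part of the proof are subspaces of one space
  \<open>W\<close> that contains independent copies of itself, so that direct sums and kernels can
  be formed without changing the type; linear maps are total maps on \<open>W\<close> of which
  only the values on the subspaces matter.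
\<close>

section \<open>Finite-dimensional subspaces\<close>

text \<open>
  The linear algebra takes place inside an ambient space of arbitrary dimension; its
  finite-dimensional subspaces are the objects of interest.
\<close>

locale vspace = vector_space scale
  for scale :: "'k::field \<Rightarrow> 'w::ab_group_add \<Rightarrow> 'w" (infixr \<open>*s\<close> 75)
begin

sublocale pair: vector_space_pair scale scale ..

abbreviation lin :: "('w \<Rightarrow> 'w) \<Rightarrow> bool" where
  "lin \<equiv> Vector_Spaces.linear scale scale"

lemma linI:
  assumes "\<And>x y. f (x + y) = f x + f y" "\<And>c x. f (c *s x) = c *s f x"
  shows "lin f"
  using assms by (simp add: Vector_Spaces.linear_iff vector_space_axioms)

lemmas lin_0 = pair.linear_0
  and lin_add = pair.linear_add
  and lin_scale = pair.linear_scale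
  and lin_diff = pair.linear_diff
  and lin_sum = pair.linear_sum
  and lin_subspace_image = pair.linear_subspace_image

lemma lin_comp: "lin f \<Longrightarrow> lin g \<Longrightarrow> lin (\<lambda>x. f (g x))"
  by (rule linI) (simp_all add: lin_add lin_scale)

lemma lin_plus: "lin f \<Longrightarrow> lin g \<Longrightarrow> lin (\<lambda>x. f x + g x)"
  by (rule linI) (simp_all add: lin_add lin_scale scale_right_distrib algebra_simps)

lemma lin_minus: "lin f \<Longrightarrow> lin g \<Longrightarrow> lin (\<lambda>x. f x - g x)"
  by (rule linI) (simp_all add: lin_add lin_scale scale_right_diff_distrib algebra_simps)

lemma lin_smult: "lin f \<Longrightarrow> lin (\<lambda>x. c *s f x)"
  by (rule linI) (simp_all add: lin_add lin_scale scale_right_distrib mult.commute)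

lemma lin_zero: "lin (\<lambda>x. 0)"
  by (rule linI) simp_all

lemma lin_ident: "lin (\<lambda>x. x)"
  by (rule linI) simp_all

lemma lin_setsum: "(\<And>i. i \<in> I \<Longrightarrow> lin (f i)) \<Longrightarrow> lin (\<lambda>x. \<Sum>i\<in>I. f i x)"
  by (rule linI) (simp_all add: lin_add lin_scale sum.distrib scale_sum_right)

lemma subspace_lin_kernel: "lin f \<Longrightarrow> subspace S \<Longrightarrow> subspace {x \<in> S. f x = 0}"
  by (rule subspaceI) (auto simp: lin_add lin_scale lin_0 subspace_0 subspace_add subspace_scale)

lemma lin_inj_on: "lin f \<Longrightarrow> subspace S \<Longrightarrow> (\<And>x. x \<in> S \<Longrightarrow> f x = 0 \<Longrightarrow> x = 0) \<Longrightarrow> inj_on f S"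
  by (smt (verit) inj_onI lin_diff right_minus_eq subspace_diff)

definition fdim :: "'w set \<Rightarrow> bool" where
  "fdim S \<longleftrightarrow> subspace S \<and> (\<exists>B. finite B \<and> S \<subseteq> span B)"

lemma fdim_subspaceD: "fdim S \<Longrightarrow> subspace S"
  by (simp add: fdim_def)

lemma fdim_basis:
  assumes "fdim S"
  obtains B where "finite B" "independent B" "B \<subseteq> S" "span B = S" "card B = dim S"
proof -
  obtain B where B: "B \<subseteq> S" "independent B" "S \<subseteq> span B" "card B = dim S"
    using basis_exists by blast
  moreover have "finite B"
    using assms B independent_span_bound unfolding fdim_def by (metis order_trans)
  moreover have "span B = S"
    using assms B span_subspace unfolding fdim_def by blast
  ultimately show thesis using that by blast
qed

lemma fdim_subset: "fdim S \<Longrightarrow> subspace T \<Longrightarrow> T \<subseteq> S \<Longrightarrow> fdim T"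
  unfolding fdim_def by (meson order_trans)

lemma fdim_zero: "fdim {0}"
  unfolding fdim_def by (auto intro!: exI[of _ "{}"])

lemma dim_zero_space [simp]: "dim {0} = 0"
  by (metis card.empty dim_span_eq_card_independent independent_empty span_empty)

lemma fdim_dim_0:
  assumes "fdim S" "dim S = 0" shows "S = {0}"
  using fdim_basis[OF assms(1)] assms(2) by (metis card_0_eq span_empty)

lemma fdim_image:
  assumes "fdim S" "lin f" shows "fdim (f ` S)"
proof -
  obtain B where B: "finite B" "span B = S" using fdim_basis[OF assms(1)] by metis
  have "f ` S = span (f ` B)" using pair.linear_span_image[OF assms(2)] B by simp
  then show ?thesis using B unfolding fdim_def by auto
qed

definition dsum :: "'w set \<Rightarrow> 'w set \<Rightarrow> 'w set \<Rightarrow> bool" where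
  "dsum S T T' \<longleftrightarrow> subspace T \<and> subspace T' \<and> T \<inter> T' = {0} \<and> S = {x + y | x y. x \<in> T \<and> y \<in> T'}"

lemma dsumE:
  assumes "dsum S T T'" "x \<in> S" obtains a b where "a \<in> T" "b \<in> T'" "x = a + b"
  using assms unfolding dsum_def by blast

lemma dsum_subset: assumes "dsum S T T'" shows "T \<subseteq> S" "T' \<subseteq> S"
proof -
  have *: "x + y \<in> S" if "x \<in> T" "y \<in> T'" for x y using assms that unfolding dsum_def by blast
  have "0 \<in> T" "0 \<in> T'" using assms unfolding dsum_def by blast+
  then show "T \<subseteq> S" "T' \<subseteq> S" using * by fastforce+
qed

lemma dsum_subspace: assumes "dsum S T T'" shows "subspace S" "subspace T" "subspace T'"
  using assms subspace_sums[of T T'] unfolding dsum_def by auto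

lemma dsum_unique:
  assumes "dsum S T T'" "a \<in> T" "b \<in> T'" "c \<in> T" "d \<in> T'" "a + b = c + d"
  shows "a = c" "b = d"
proof -
  have "a - c = d - b" using assms(6) by (simp add: algebra_simps)
  moreover have "a - c \<in> T" "d - b \<in> T'"
    using assms subspace_diff unfolding dsum_def by blast+
  ultimately have "a - c \<in> T \<inter> T'" by auto
  then have "a - c = 0" using assms(1) unfolding dsum_def by blast
  then show "a = c" "b = d" using assms(6) by auto
qed

lemma independent_Un_trivial_Int:
  assumes "independent B" "independent C" "span B \<inter> span C = {0}"
  shows "independent (B \<union> C)" "B \<inter> C = {}"
proof -
  have half: "a \<notin> span (B \<union> C - {a})"
    if a: "a \<in> B" and B: "independent B" and C: "independent C" and BC: "span B \<inter> span C = {0}"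
    for a B C
  proof
    assume "a \<in> span (B \<union> C - {a})"
    moreover have "B \<union> C - {a} \<subseteq> (B - {a}) \<union> C" by blast
    ultimately have "a \<in> span ((B - {a}) \<union> C)" using span_mono by blast
    then obtain x y where xy: "x \<in> span (B - {a})" "y \<in> span C" "a = x + y"
      unfolding span_Un by blast
    have "x \<in> span B" using xy(1) span_mono[of "B - {a}" B] by blast
    then have "y \<in> span B" using xy(3) a span_base[of a B] by (metis add_diff_cancel_left' span_diff)
    then have "y = 0" using xy(2) BC by blast
    then show False using xy a B by (metis add.right_neutral dependent_def)
  qed
  show "B \<inter> C = {}"
  proof (rule ccontr)
    assume "B \<inter> C \<noteq> {}"
    then obtain a where "a \<in> B" "a \<in> C" by blast
    then have "a \<in> span B \<inter> span C" by (simp add: span_base)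
    then have "0 \<in> B" using assms(3) \<open>a \<in> B\<close> by auto
    then show False using assms(1) dependent_zero by metis
  qed
  show "independent (B \<union> C)"
    unfolding dependent_def
  proof
    assume "\<exists>a\<in>B \<union> C. a \<in> span (B \<union> C - {a})"
    then obtain a where a: "a \<in> B \<or> a \<in> C" "a \<in> span (B \<union> C - {a})" by blast
    show False using half[OF _ assms] half[OF _ assms(2,1)] assms(3) a by (auto simp: Un_commute Int_commute)
  qed
qed

lemma dim_dsum:
  assumes "dsum S T T'" "fdim T" "fdim T'"
  shows "fdim S" "dim S = dim T + dim T'"
proof -
  obtain B where B: "finite B" "independent B" "B \<subseteq> T" "span B = T" "card B = dim T"
    using fdim_basis[OF assms(2)] .
  obtain C where C: "finite C" "independent C" "C \<subseteq> T'" "span C = T'" "card C = dim T'"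
    using fdim_basis[OF assms(3)] .
  have i: "independent (B \<union> C)" "B \<inter> C = {}"
  proof -
    have "span B \<inter> span C = {0}" using assms(1) B(4) C(4) unfolding dsum_def by simp
    then show "independent (B \<union> C)" "B \<inter> C = {}" using independent_Un_trivial_Int[OF B(2) C(2)] by blast+
  qed
  have S: "span (B \<union> C) = S" using assms(1) unfolding span_Un dsum_def B C by simp
  then have "dim S = card (B \<union> C)" using i by (metis dim_span_eq_card_independent)
  then show "dim S = dim T + dim T'" using B C i by (simp add: card_Un_disjoint)
  show "fdim S" unfolding fdim_def using S B C dsum_subspace[OF assms(1)] by (metis finite_Un order_refl)
qed

lemma exists_complement:
  assumes "subspace S" "subspace T" "T \<subseteq> S"
  obtains T' where "dsum S T T'"
proof -
  obtain B where B: "B \<subseteq> T" "independent B" "T \<subseteq> span B" using maximal_independent_subset by blast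
  have TB: "span B = T" using B assms span_subspace by blast
  obtain C where C: "B \<subseteq> C" "C \<subseteq> S" "independent C" "S \<subseteq> span C"
    using maximal_independent_subset_extend[of B S] B assms by blast
  have SC: "span C = S" using C assms span_subspace by blast
  obtain h where h: "lin h" "\<forall>x\<in>C. h x = (if x \<in> B then x else 0)"
    using pair.linear_independent_extend[OF C(3), of "\<lambda>x. if x \<in> B then x else 0"] by blast
  have h1: "h x = x" if "x \<in> T" for x
  proof (rule pair.linear_eq_on[OF h(1) linear_ident, of x B])
    show "x \<in> span B" using that TB by simp
  qed (use h(2) C(1) in auto)
  have h2: "h x = 0" if "x \<in> span (C - B)" for x
    using pair.linear_eq_0_on_span[OF h(1), of "C - B" x] h(2) that by auto
  have "dsum S T (span (C - B))"
    unfolding dsum_def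
  proof (intro conjI)
    show "T \<inter> span (C - B) = {0}" using h1 h2 assms subspace_0 span_zero by force
    have "B \<union> (C - B) = C" using C by blast
    then show "S = {x + y |x y. x \<in> T \<and> y \<in> span (C - B)}" using span_Un[of B "C - B"] SC TB by simp
  qed (use assms in auto)
  then show thesis using that by blast
qed

lemma lin_on_dsum:
  assumes "dsum S T T'" "lin f" "lin g"
  obtains h where "lin h" "\<And>x. x \<in> T \<Longrightarrow> h x = f x" "\<And>x. x \<in> T' \<Longrightarrow> h x = g x"
proof -
  obtain B where B: "B \<subseteq> T" "independent B" "T \<subseteq> span B" using maximal_independent_subset by blast
  obtain C where C: "C \<subseteq> T'" "independent C" "T' \<subseteq> span C" using maximal_independent_subset by blast
  have sp: "span B = T" "span C = T'" using B C assms span_subspace unfolding dsum_def by blast+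
  have i: "independent (B \<union> C)" "B \<inter> C = {}"
  proof -
    have "span B \<inter> span C = {0}" using assms(1) sp unfolding dsum_def by simp
    then show "independent (B \<union> C)" "B \<inter> C = {}" using independent_Un_trivial_Int[OF B(2) C(2)] by blast+
  qed
  obtain h where h: "lin h" "\<forall>x\<in>B \<union> C. h x = (if x \<in> B then f x else g x)"
    using pair.linear_independent_extend[OF i(1), of "\<lambda>x. if x \<in> B then f x else g x"] by blast
  show thesis
  proof (rule that[OF h(1)])
    show "h x = f x" if "x \<in> T" for x
      by (rule pair.linear_eq_on[OF h(1) assms(2), of x B]) (use h(2) that sp in auto)
    show "h x = g x" if "x \<in> T'" for x
      by (rule pair.linear_eq_on[OF h(1) assms(3), of x C]) (use h(2) i(2) that sp in auto)
  qed
qed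

lemma dsumI:
  assumes "subspace T" "subspace T'" "T \<subseteq> S" "T' \<subseteq> S" "subspace S"
    and "\<And>x. x \<in> T \<Longrightarrow> x \<in> T' \<Longrightarrow> x = 0"
    and "\<And>x. x \<in> S \<Longrightarrow> \<exists>a\<in>T. \<exists>b\<in>T'. x = a + b"
  shows "dsum S T T'"
proof -
  have "T \<inter> T' = {0}" using assms subspace_0 by blast
  moreover have "S = {x + y | x y. x \<in> T \<and> y \<in> T'}" using assms subspace_add[of S] by blast
  ultimately show ?thesis unfolding dsum_def using assms by blast
qed

text \<open>
  Moving a summand \<open>Z\<close> of \<open>W\<close> over to the complement of
  \<open>W\<close>: this makes the complement of \<open>T\<close> contain a prescribed subspace
  \<open>Z\<close>.
\<close>

lemma dsum_assoc:
  assumes S: "dsum S W C" and W: "dsum W T Z"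
  obtains Z' where "dsum S T Z'" "Z \<subseteq> Z'"
proof -
  define Z' where "Z' = {x + y | x y. x \<in> Z \<and> y \<in> C}"
  note sS = dsum_subspace[OF S] dsum_subset[OF S]
  note sW = dsum_subspace[OF W] dsum_subset[OF W]
  have sub: "subspace Z'" unfolding Z'_def using subspace_sums[OF sW(3) sS(3)] .
  have "dsum S T Z'"
  proof (rule dsumI)
    show "T \<subseteq> S" using sS sW by blast
    show "Z' \<subseteq> S" unfolding Z'_def using sS(1) sS sW subspace_add[OF sS(1)] by blast
    fix x assume x: "x \<in> T" "x \<in> Z'"
    then obtain z c where zc: "z \<in> Z" "c \<in> C" "x = z + c" unfolding Z'_def by blast
    have "x = z" using dsum_unique[OF S, of x 0 z c] x zc sW sS(3) subspace_0 by auto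
    then show "x = 0" using x zc W unfolding dsum_def by blast
  next
    fix x assume "x \<in> S"
    then obtain w c where wc: "w \<in> W" "c \<in> C" "x = w + c" using dsumE[OF S] by metis
    then obtain t z where tz: "t \<in> T" "z \<in> Z" "w = t + z" using dsumE[OF W] by metis
    show "\<exists>a\<in>T. \<exists>b\<in>Z'. x = a + b" unfolding Z'_def using wc tz by (force simp: add.assoc)
  qed (use sS sW sub in auto)
  moreover have "Z \<subseteq> Z'" unfolding Z'_def using subspace_0[OF sS(3)] by force
  ultimately show thesis using that by blast
qed

lemma dim_inj_image:
  assumes "fdim S" "lin f" "inj_on f S" shows "dim (f ` S) = dim S"
proof -
  obtain B where B: "finite B" "independent B" "B \<subseteq> S" "span B = S" "card B = dim S"
    using fdim_basis[OF assms(1)] .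
  have "independent (f ` B)" using pair.linear_independent_injective_image[OF assms(2) B(2)] B assms by simp
  moreover have "f ` S = span (f ` B)" using pair.linear_span_image[OF assms(2)] B by simp
  ultimately have "dim (f ` S) = card (f ` B)" by (metis dim_span_eq_card_independent)
  also have "\<dots> = card B" using assms B by (meson card_image inj_on_subset)
  finally show ?thesis using B by simp
qed

lemma rank_nullity:
  assumes "fdim S" "lin f"
  shows "dim S = dim (f ` S) + dim {x \<in> S. f x = 0}"
proof -
  let ?K = "{x \<in> S. f x = 0}"
  have K: "subspace ?K" using assms subspace_lin_kernel fdim_subspaceD by blast
  obtain T where T: "dsum S ?K T"
    using exists_complement[of S ?K] K assms fdim_subspaceD by blast
  have fK: "fdim ?K" "fdim T"
    using fdim_subset[OF assms(1)] dsum_subspace[OF T] dsum_subset[OF T] by blast+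
  have "inj_on f T"
  proof (rule lin_inj_on[OF assms(2) dsum_subspace(3)[OF T]])
    fix x assume "x \<in> T" "f x = 0"
    then have "x \<in> ?K \<inter> T" using dsum_subset[OF T] by blast
    then show "x = 0" using T unfolding dsum_def by blast
  qed
  moreover have "f ` S = f ` T"
  proof
    show "f ` S \<subseteq> f ` T"
    proof
      fix y assume "y \<in> f ` S"
      then obtain x where x: "x \<in> S" "y = f x" by blast
      obtain a b where "a \<in> ?K" "b \<in> T" "x = a + b" using dsumE[OF T x(1)] .
      then show "y \<in> f ` T" using x lin_add[OF assms(2)] by force
    qed
  qed (use dsum_subset[OF T] in blast)
  ultimately show ?thesis using dim_inj_image[OF fK(2) assms(2)] dim_dsum[OF T fK] by simp
qed

lemma dim_subspace_le:
  assumes "fdim S" "subspace T" "T \<subseteq> S" shows "dim T \<le> dim S"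
  using exists_complement[OF fdim_subspaceD[OF assms(1)] assms(2,3)] dim_dsum
    fdim_subset[OF assms(1)] dsum_subspace dsum_subset by (metis le_add1)

lemma subspace_eq_of_dim:
  assumes "fdim S" "subspace T" "T \<subseteq> S" "dim S \<le> dim T" shows "T = S"
proof -
  obtain T' where T': "dsum S T T'" using exists_complement[OF fdim_subspaceD[OF assms(1)] assms(2,3)] .
  have f: "fdim T" "fdim T'" using fdim_subset[OF assms(1)] dsum_subspace[OF T'] dsum_subset[OF T'] by blast+
  have "dim T' = 0" using dim_dsum[OF T' f] assms(4) by simp
  then have "T' = {0}" using fdim_dim_0 f by blast
  then show ?thesis using T' unfolding dsum_def by auto
qed

lemma exists_iso_of_dim:
  assumes "fdim S" "fdim T" "dim S = dim T"
  obtains f where "lin f" "bij_betw f S T"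
proof -
  obtain B where B: "finite B" "independent B" "B \<subseteq> S" "span B = S" "card B = dim S"
    using fdim_basis[OF assms(1)] .
  obtain C where C: "finite C" "independent C" "C \<subseteq> T" "span C = T" "card C = dim T"
    using fdim_basis[OF assms(2)] .
  show thesis
    using pair.finite_basis_to_basis_subspace_isomorphism
      [OF fdim_subspaceD[OF assms(1)] fdim_subspaceD[OF assms(2)] assms(3) B(1,3,2) _ B(5) C(1,3,2) _ C(5)]
      B(4) C(4) that unfolding bij_betw_def by auto
qed

lemma lin_left_inverse_on:
  assumes "lin f" "subspace S" "inj_on f S"
  obtains g where "lin g" "\<And>x. g x \<in> S" "\<And>x. x \<in> S \<Longrightarrow> g (f x) = x"
  using pair.linear_exists_left_inverse_on[OF assms] by (metis rangeI subsetD)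

text \<open>
  An isomorphism \<open>P\<close> between the sources of \<open>A\<close> and \<open>A'\<close>
  that matches their kernels induces an isomorphism of the images. It extends to the targets
  because equality of dimensions makes the complements of the images isomorphic.
\<close>

lemma iso_along_maps:
  assumes fd: "subspace N" "fdim X" "fdim X'" and dim: "dim X = dim X'"
    and lins: "lin A" "lin A'" "lin P"
    and sub: "A ` N \<subseteq> X" "A' ` N' \<subseteq> X'"
    and P: "P ` N = N'" and ker: "\<And>x. x \<in> N \<Longrightarrow> A x = 0 \<longleftrightarrow> A' (P x) = 0"
  obtains g where "lin g" "bij_betw g X X'" "\<And>x. x \<in> N \<Longrightarrow> g (A x) = A' (P x)"
proof -
  obtain R where R: "lin R" "\<And>v. R v \<in> N" "\<And>v. v \<in> A ` N \<Longrightarrow> A (R v) = v"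
    using pair.linear_exists_right_inverse_on[OF lins(1) fd(1)] by (metis rangeI subsetD)
  define g0 where "g0 = (\<lambda>v. A' (P (R v)))"
  have g0: "lin g0" unfolding g0_def by (rule lin_comp[OF lins(2) lin_comp[OF lins(3) R(1)]])
  have g0A: "g0 (A x) = A' (P x)" if x: "x \<in> N" for x
  proof -
    have "A (R (A x) - x) = 0" using x R(3) by (simp add: lin_diff lins)
    then have "A' (P (R (A x) - x)) = 0" using ker x R(2) fd(1) subspace_diff by blast
    then show ?thesis unfolding g0_def by (simp add: lin_diff lins)
  qed
  have N': "subspace N'" using lin_subspace_image[OF lins(3) fd(1)] P by simp
  have s: "subspace (A ` N)" "subspace (A' ` N')" using lin_subspace_image lins fd N' by blast+
  obtain C where C: "dsum X (A ` N) C" using exists_complement[OF fdim_subspaceD[OF fd(2)] s(1) sub(1)] .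
  obtain C' where C': "dsum X' (A' ` N') C'" using exists_complement[OF fdim_subspaceD[OF fd(3)] s(2) sub(2)] .
  have f: "fdim (A ` N)" "fdim C" "fdim (A' ` N')" "fdim C'"
    using fdim_subset[OF fd(2)] fdim_subset[OF fd(3)] dsum_subspace[OF C] dsum_subset[OF C]
      dsum_subspace[OF C'] dsum_subset[OF C'] by simp_all
  have inj0: "inj_on g0 (A ` N)"
    by (rule lin_inj_on[OF g0 s(1)]) (use g0A ker in auto)
  have im0: "g0 ` A ` N = A' ` N'" using g0A P by (auto simp: image_iff)
  have "dim (A' ` N') = dim (A ` N)" using dim_inj_image[OF f(1) g0 inj0] im0 by simp
  then have "dim C = dim C'" using dim_dsum[OF C f(1,2)] dim_dsum[OF C' f(3,4)] dim by simp
  then obtain c where c: "lin c" "bij_betw c C C'" using exists_iso_of_dim f by blast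
  obtain g where g: "lin g" "\<And>x. x \<in> A ` N \<Longrightarrow> g x = g0 x" "\<And>x. x \<in> C \<Longrightarrow> g x = c x"
    using lin_on_dsum[OF C g0 c(1)] by metis
  have "g ` X = X'"
  proof
    show "g ` X \<subseteq> X'"
    proof clarify
      fix x assume "x \<in> X"
      then obtain a b where ab: "a \<in> A ` N" "b \<in> C" "x = a + b" using dsumE[OF C] by metis
      have "g x = g0 a + c b" using ab g by (simp add: lin_add)
      moreover have "g0 a \<in> A' ` N'" "c b \<in> C'" using ab im0 c(2) bij_betwE by blast+
      ultimately show "g x \<in> X'" using C' unfolding dsum_def by blast
    qed
    show "X' \<subseteq> g ` X"
    proof
      fix y assume "y \<in> X'"
      then obtain a' b' where ab: "a' \<in> A' ` N'" "b' \<in> C'" "y = a' + b'" using dsumE[OF C'] by metis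
      obtain a b where "a \<in> A ` N" "g0 a = a'" "b \<in> C" "c b = b'"
        using ab im0 c(2) unfolding bij_betw_def by (metis image_iff)
      then have "y = g (a + b)" "a + b \<in> X" using ab g C unfolding dsum_def by (auto simp: lin_add)
      then show "y \<in> g ` X" by blast
    qed
  qed
  moreover have "inj_on g X"
  proof (rule lin_inj_on[OF g(1) fdim_subspaceD[OF fd(2)]])
    fix x assume "x \<in> X" and 0: "g x = 0"
    then obtain a b where ab: "a \<in> A ` N" "b \<in> C" "x = a + b" using dsumE[OF C] by metis
    have "g0 a + c b = 0 + 0" using ab g 0 by (simp add: lin_add)
    moreover have "g0 a \<in> A' ` N'" "c b \<in> C'" using ab im0 c(2) bij_betwE by blast+
    ultimately have "g0 a = 0" "c b = 0"
      using dsum_unique[OF C'] f fdim_subspaceD subspace_0 by metis+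
    then have "a = 0" "b = 0"
      using ab inj0 c f fdim_subspaceD lin_0 g0 subspace_0 unfolding bij_betw_def inj_on_def by metis+
    then show "x = 0" using ab by simp
  qed
  ultimately show thesis using that g g0A unfolding bij_betw_def by (metis image_eqI)
qed

end

section \<open>The quadratic form of a quiver\<close>

text \<open>
  Reflection functors see a quiver mostly as an undirected multigraph: \<open>inc i\<close> are
  the arrows at \<open>i\<close>, and \<open>opp a i\<close> is the end of \<open>a\<close> other
  than \<open>i\<close>. In which direction an arrow acts is recorded separately, by a height
  function on the vertices.
\<close>

locale loop_free_quiver =
  fixes V :: "'v set" and A :: "'e set" and tl hd :: "'e \<Rightarrow> 'v"
  assumes finV: "finite V" and finA: "finite A"
    and tlV: "a \<in> A \<Longrightarrow> tl a \<in> V" and hdV: "a \<in> A \<Longrightarrow> hd a \<in> V"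
    and no_loop: "a \<in> A \<Longrightarrow> tl a \<noteq> hd a"
begin

definition inc :: "'v \<Rightarrow> 'e set" where
  "inc i = {a \<in> A. tl a = i \<or> hd a = i}"

definition opp :: "'e \<Rightarrow> 'v \<Rightarrow> 'v" where
  "opp a i = (if tl a = i then hd a else tl a)"

lemma finite_inc [simp]: "finite (inc i)" unfolding inc_def using finA by simp

lemma inc_A: "a \<in> inc i \<Longrightarrow> a \<in> A" unfolding inc_def by simp

lemma opp_V: "a \<in> inc i \<Longrightarrow> opp a i \<in> V" unfolding inc_def opp_def using tlV hdV by auto

lemma opp_neq: "a \<in> inc i \<Longrightarrow> opp a i \<noteq> i" unfolding inc_def opp_def using no_loop by fastforce

lemma inc_opp: "a \<in> inc i \<Longrightarrow> a \<in> inc (opp a i)" unfolding inc_def opp_def by auto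

lemma opp_opp: "a \<in> inc i \<Longrightarrow> opp a (opp a i) = i" unfolding inc_def opp_def by auto

lemma inc_two: "a \<in> inc i \<Longrightarrow> a \<in> inc j \<Longrightarrow> j \<noteq> i \<Longrightarrow> opp a j = i \<and> opp a i = j"
  unfolding inc_def opp_def by auto

text \<open>
  The symmetrised Euler form of the quiver; \<open>pairing \<alpha> i\<close> is its value against
  the simple root at \<open>i\<close>.
\<close>

definition form :: "('v \<Rightarrow> int) \<Rightarrow> ('v \<Rightarrow> int) \<Rightarrow> int" where
  "form \<alpha> \<beta> = (\<Sum>i\<in>V. 2 * \<alpha> i * \<beta> i)
     - (\<Sum>a\<in>A. \<alpha> (tl a) * \<beta> (hd a) + \<alpha> (hd a) * \<beta> (tl a))"

definition unit_vec :: "'v \<Rightarrow> 'v \<Rightarrow> int" where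
  "unit_vec i = (\<lambda>j. if j = i then 1 else 0)"

definition pairing :: "('v \<Rightarrow> int) \<Rightarrow> 'v \<Rightarrow> int" where
  "pairing \<alpha> i = 2 * \<alpha> i - (\<Sum>a\<in>inc i. \<alpha> (opp a i))"

definition reflect :: "'v \<Rightarrow> ('v \<Rightarrow> int) \<Rightarrow> 'v \<Rightarrow> int" where
  "reflect i \<alpha> = (\<lambda>j. \<alpha> j - pairing \<alpha> i * unit_vec i j)"

lemma form_unit_vec: assumes "i \<in> V" shows "form \<alpha> (unit_vec i) = pairing \<alpha> i"
proof -
  have "(\<Sum>a\<in>A. \<alpha> (tl a) * unit_vec i (hd a) + \<alpha> (hd a) * unit_vec i (tl a)) =
     (\<Sum>a\<in>A. if tl a = i \<or> hd a = i then \<alpha> (opp a i) else 0)"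
    by (rule sum.cong) (auto simp: unit_vec_def opp_def no_loop)
  also have "\<dots> = (\<Sum>a\<in>inc i. \<alpha> (opp a i))"
    unfolding inc_def by (rule sum.inter_filter[symmetric]) (rule finA)
  finally show ?thesis unfolding form_def pairing_def using assms finV by (simp add: unit_vec_def if_distrib sum.delta cong: if_cong)
qed

lemma form_commute: "form \<alpha> \<beta> = form \<beta> \<alpha>"
  unfolding form_def by (simp add: mult.commute mult.left_commute add.commute)

lemma form_add_scaled: "form \<alpha> (\<lambda>j. \<beta> j + c * \<gamma> j) = form \<alpha> \<beta> + c * form \<alpha> \<gamma>"
  unfolding form_def by (simp add: algebra_simps sum.distrib sum_distrib_left sum_subtractf)

lemma form_sum: "form \<alpha> (\<lambda>j. \<Sum>i\<in>I. \<beta> i j) = (\<Sum>i\<in>I. form \<alpha> (\<beta> i))"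
proof (induction I rule: infinite_finite_induct)
  case (insert x F)
  then show ?case using form_add_scaled[of \<alpha> "\<beta> x" 1 "\<lambda>j. \<Sum>i\<in>F. \<beta> i j"] by simp
qed (simp_all add: form_def)

lemma form_scaled: "form \<alpha> (\<lambda>j. c * \<beta> j) = c * form \<alpha> \<beta>"
  using form_add_scaled[of \<alpha> "\<lambda>_. 0" c \<beta>] by (simp add: form_def)

lemma form_eq_pairing: "form \<alpha> \<beta> = (\<Sum>v\<in>V. \<beta> v * pairing \<alpha> v)"
proof -
  have "form \<alpha> \<beta> = form \<alpha> (\<lambda>j. \<Sum>v\<in>V. \<beta> v * unit_vec v j)"
    unfolding form_def using tlV hdV finV
    by (intro arg_cong2[of _ _ _ _ "(-)"] sum.cong) (auto simp: unit_vec_def if_distrib sum.delta' cong: if_cong)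
  then show ?thesis by (simp add: form_sum form_scaled form_unit_vec)
qed

lemma form_reflect: assumes "i \<in> V" shows "form (reflect i \<alpha>) (reflect i \<alpha>) = form \<alpha> \<alpha>"
proof -
  have r: "reflect i \<alpha> = (\<lambda>j. \<alpha> j + (- pairing \<alpha> i) * unit_vec i j)" unfolding reflect_def by auto
  have 1: "form \<beta> (reflect i \<alpha>) = form \<beta> \<alpha> - pairing \<alpha> i * form \<beta> (unit_vec i)" for \<beta>
    unfolding r by (subst form_add_scaled) simp
  have u: "form (unit_vec i) (unit_vec i) = 2"
    using assms finV no_loop unfolding form_def unit_vec_def
    by (subst sum.neutral[of A]) (auto simp: if_distrib sum.delta cong: if_cong)
  have "form (reflect i \<alpha>) (reflect i \<alpha>) = form (reflect i \<alpha>) \<alpha> - pairing \<alpha> i * form (reflect i \<alpha>) (unit_vec i)" by (rule 1)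
  also have "\<dots> = form \<alpha> (reflect i \<alpha>) - pairing \<alpha> i * form (unit_vec i) (reflect i \<alpha>)" by (simp add: form_commute)
  also have "\<dots> = form \<alpha> \<alpha>" unfolding 1 u using form_unit_vec[OF assms] by (simp add: form_commute[of "unit_vec i"])
  finally show ?thesis .
qed

lemma reflect_at: "reflect i \<alpha> i = (\<Sum>a\<in>inc i. \<alpha> (opp a i)) - \<alpha> i"
  unfolding reflect_def pairing_def unit_vec_def by simp

lemma reflect_other: "j \<noteq> i \<Longrightarrow> reflect i \<alpha> j = \<alpha> j"
  unfolding reflect_def unit_vec_def by simp

lemma reflect_reflect: "reflect i (reflect i \<alpha>) = \<alpha>"
proof
  fix j
  have "(\<Sum>a\<in>inc i. reflect i \<alpha> (opp a i)) = (\<Sum>a\<in>inc i. \<alpha> (opp a i))"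
    by (rule sum.cong) (auto simp: reflect_other opp_neq)
  then show "reflect i (reflect i \<alpha>) j = \<alpha> j" by (cases "j = i") (simp_all add: reflect_at reflect_other)
qed

end

section \<open>Integer relations and generic invertibility\<close>

text \<open>
  More vectors than coordinates are linearly dependent. Gaussian elimination by
  cross-multiplication keeps the coefficients integral.
\<close>

lemma integer_relation:
  fixes f :: "'i \<Rightarrow> 'k \<Rightarrow> int"
  assumes "finite K" "finite I" "card K < card I"
  shows "\<exists>b. (\<exists>i\<in>I. b i \<noteq> 0) \<and> (\<forall>k\<in>K. (\<Sum>i\<in>I. b i * f i k) = 0)"
  using assms
proof (induction K arbitrary: I f)
  case empty
  then obtain i where "i \<in> I" by fastforce
  then show ?case by (intro exI[of _ "\<lambda>_. 1"]) auto
next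
  case (insert k K)
  show ?case
  proof (cases "\<forall>i\<in>I. f i k = 0")
    case True
    have "card K < card I" using insert by simp
    then show ?thesis using insert.IH[OF insert.prems(1), of f] True by auto
  next
    case False
    then obtain p where p: "p \<in> I" "f p k \<noteq> 0" by blast
    (* pivot on the vector p, and eliminate coordinate k from the other vectors *)
    define I' where "I' = I - {p}"
    have I': "finite I'" "card K < card I'" using insert p unfolding I'_def by auto
    obtain b' where b': "\<exists>i\<in>I'. b' i \<noteq> 0"
      "\<And>l. l \<in> K \<Longrightarrow> (\<Sum>i\<in>I'. b' i * (f p k * f i l - f i k * f p l)) = 0"
      using insert.IH[OF I', of "\<lambda>i l. f p k * f i l - f i k * f p l"] by blast
    define b where "b i = (if i = p then - (\<Sum>i\<in>I'. b' i * f i k) else b' i * f p k)" for i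
    have s: "(\<Sum>i\<in>I. b i * f i l) = (\<Sum>i\<in>I'. b' i * (f p k * f i l - f i k * f p l))" for l
    proof -
      have "(\<Sum>i\<in>I. b i * f i l) = b p * f p l + (\<Sum>i\<in>I'. b i * f i l)"
        unfolding I'_def using p insert.prems by (simp add: sum.remove)
      also have "(\<Sum>i\<in>I'. b i * f i l) = (\<Sum>i\<in>I'. b' i * f p k * f i l)"
        by (rule sum.cong) (auto simp: b_def I'_def)
      also have "b p = - (\<Sum>i\<in>I'. b' i * f i k)" by (simp add: b_def)
      finally have e: "(\<Sum>i\<in>I. b i * f i l) = (\<Sum>i\<in>I'. b' i * f p k * f i l) - (\<Sum>i\<in>I'. b' i * f i k) * f p l"
        by simp
      show ?thesis
        unfolding e by (simp add: sum_distrib_right right_diff_distrib sum_subtractf mult.assoc)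
    qed
    have "(\<Sum>i\<in>I. b i * f i l) = 0" if "l \<in> insert k K" for l
    proof (cases "l = k")
      case True
      show ?thesis unfolding s True by (rule sum.neutral) simp
    qed (use that b'(2) s in auto)
    moreover have "\<exists>i\<in>I. b i \<noteq> 0" using b'(1) p(2) unfolding I'_def b_def by auto
    ultimately show ?thesis by blast
  qed
qed

lemma poly_det: "poly (det M) t = det (map_mat (\<lambda>p. poly p t) M)"
proof -
  interpret comm_ring_hom "\<lambda>p. poly p t" by unfold_locales auto
  show ?thesis by (rule hom_det[symmetric])
qed

text \<open>
  The determinant of a polynomial matrix that is the identity at \<open>0\<close> is a nonzero
  polynomial, and away from its roots the matrix is invertible.
\<close>

lemma poly_matrix_generic_injective:
  fixes M :: "'i \<Rightarrow> 'i \<Rightarrow> 'a::field poly"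
  assumes I: "finite I" and M0: "\<And>i j. i \<in> I \<Longrightarrow> j \<in> I \<Longrightarrow> poly (M i j) 0 = (if i = j then 1 else 0)"
  shows "\<exists>d. d \<noteq> 0 \<and> (\<forall>t c. poly d t \<noteq> 0 \<longrightarrow> (\<forall>i\<in>I. (\<Sum>j\<in>I. poly (M i j) t * c j) = 0) \<longrightarrow> (\<forall>j\<in>I. c j = 0))"
proof -
  define n where "n = card I"
  obtain f where f: "bij_betw f {0..<n} I" using ex_bij_betw_nat_finite[OF I] n_def by blast
  have fI: "f i \<in> I" if "i < n" for i using f that unfolding bij_betw_def by auto
  define A where "A = mat n n (\<lambda>(i, j). M (f i) (f j))"
  have A: "A \<in> carrier_mat n n" unfolding A_def by simp
  have ev: "map_mat (\<lambda>p. poly p t) A = mat n n (\<lambda>(i, j). poly (M (f i) (f j)) t)" for t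
    unfolding A_def by (rule eq_matI) auto
  have "map_mat (\<lambda>p. poly p 0) A = 1\<^sub>m n"
    unfolding ev by (rule eq_matI) (use M0 fI f in \<open>auto simp: bij_betw_def inj_on_def\<close>)
  then have "poly (det A) 0 = 1" unfolding poly_det by simp
  then have "det A \<noteq> 0" by auto
  moreover have "\<forall>j\<in>I. c j = 0"
    if d: "poly (det A) t \<noteq> 0" and c: "\<forall>i\<in>I. (\<Sum>j\<in>I. poly (M i j) t * c j) = 0" for t c
  proof -
    let ?B = "map_mat (\<lambda>p. poly p t) A"
    let ?v = "vec n (\<lambda>j. c (f j))"
    have B: "?B \<in> carrier_mat n n" using A by simp
    have "?B *\<^sub>v ?v = 0\<^sub>v n"
    proof (rule eq_vecI)
      fix i assume i: "i < dim_vec (0\<^sub>v n)"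
      have "(?B *\<^sub>v ?v) $ i = (\<Sum>j = 0..<n. poly (M (f i) (f j)) t * c (f j))"
        using i unfolding ev by (simp add: scalar_prod_def)
      also have "\<dots> = (\<Sum>j\<in>I. poly (M (f i) j) t * c j)" by (rule sum.reindex_bij_betw[OF f])
      also have "\<dots> = 0" using c fI i by simp
      finally show "(?B *\<^sub>v ?v) $ i = 0\<^sub>v n $ i" using i by simp
    qed (use A in simp)
    moreover have "det ?B \<noteq> 0" using d unfolding poly_det .
    ultimately have v: "?v = 0\<^sub>v n" using det_0_iff_vec_prod_zero_field[OF B] vec_carrier by metis
    show ?thesis
    proof
      fix j assume "j \<in> I"
      then obtain i where "i < n" "j = f i" using f unfolding bij_betw_def by auto
      then show "c j = 0" using arg_cong[OF v, of "\<lambda>v. v $ i"] by simp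
    qed
  qed
  ultimately show ?thesis by blast
qed

text \<open>
  The equation is \<open>(1 + t B) y = - t s w\<close>. It has a solution that is polynomial in
  \<open>t\<close> when \<open>s\<close> is taken to be the determinant of \<open>1 + t B\<close>,
  by means of the adjugate matrix.
\<close>

lemma resolvent_polys:
  fixes B :: "'i \<Rightarrow> 'i \<Rightarrow> 'a::field" and w :: "'i \<Rightarrow> 'a"
  assumes I: "finite I"
  shows "\<exists>s y. poly s 0 = 1 \<and> (\<forall>i\<in>I. poly (y i) 0 = 0) \<and>
    (\<forall>t. \<forall>i\<in>I. poly (y i) t + t * (\<Sum>j\<in>I. B i j * poly (y j) t) = - (t * poly s t * w i))"
proof -
  define n where "n = card I"
  obtain f where f: "bij_betw f {0..<n} I" using ex_bij_betw_nat_finite[OF I] n_def by blast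
  have inj: "inj_on f {0..<n}" using f unfolding bij_betw_def by blast
  define A :: "'a poly mat" where "A = mat n n (\<lambda>(i, j). (if i = j then 1 else 0) + [:0, B (f i) (f j):])"
  have A: "A \<in> carrier_mat n n" unfolding A_def by simp
  define s where "s = det A"
  have "map_mat (\<lambda>p. poly p 0) A = 1\<^sub>m n" unfolding A_def by (rule eq_matI) auto
  then have s0: "poly s 0 = 1" unfolding s_def poly_det by simp
  define W :: "'a poly vec" where "W = vec n (\<lambda>k. [:0, - w (f k):])"
  (* A is the matrix 1 + t B and W the vector - t w over the polynomial ring *)
  define Y where "Y = adj_mat A *\<^sub>v W"
  have adj: "adj_mat A \<in> carrier_mat n n" "A * adj_mat A = det A \<cdot>\<^sub>m 1\<^sub>m n" using adj_mat[OF A] by auto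
  have "A *\<^sub>v Y = (A * adj_mat A) *\<^sub>v W"
    unfolding Y_def using assoc_mult_mat_vec[OF A adj(1)] by (simp add: W_def)
  moreover have "(s \<cdot>\<^sub>m 1\<^sub>m n) *\<^sub>v W = s \<cdot>\<^sub>v W"
    by (rule eq_vecI) (auto simp: W_def)
  ultimately have AY: "A *\<^sub>v Y = s \<cdot>\<^sub>v W" unfolding adj(2) s_def by simp
  have Yd: "dim_vec Y = n" unfolding Y_def using adj by simp
  define y where "y i = Y $ (the_inv_into {0..<n} f i)" for i
  have yf: "y (f i) = Y $ i" if "i < n" for i unfolding y_def using the_inv_into_f_f[OF inj] that by simp
  have eq: "y (f i) + (\<Sum>j=0..<n. [:0, B (f i) (f j):] * y (f j)) = s * [:0, - w (f i):]" if i: "i < n" for i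
  proof -
    have "(A *\<^sub>v Y) $ i = (\<Sum>j=0..<n. ((if i = j then 1 else 0) + [:0, B (f i) (f j):]) * y (f j))"
      using i Yd unfolding A_def by (simp add: scalar_prod_def yf)
    also have "\<dots> = (\<Sum>j=0..<n. if i = j then y (f j) else 0) + (\<Sum>j=0..<n. [:0, B (f i) (f j):] * y (f j))"
      unfolding sum.distrib[symmetric] by (rule sum.cong) (auto simp: algebra_simps)
    also have "(\<Sum>j=0..<n. if i = j then y (f j) else 0) = y (f i)" using i by simp
    finally show ?thesis using i AY by (simp add: W_def)
  qed
  have 1: "poly (y i) t + t * (\<Sum>j\<in>I. B i j * poly (y j) t) = - (t * poly s t * w i)" if "i \<in> I" for i t
  proof -
    obtain k where k: "k < n" "i = f k" using f \<open>i \<in> I\<close> unfolding bij_betw_def by auto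
    have "(\<Sum>j=0..<n. t * (B (f k) (f j) * poly (y (f j)) t)) = (\<Sum>j\<in>I. t * (B i j * poly (y j) t))"
      unfolding k(2) by (rule sum.reindex_bij_betw[OF f])
    then show ?thesis
      using arg_cong[OF eq[OF k(1)], of "\<lambda>p. poly p t"] unfolding k(2)
      by (simp add: poly_sum sum_distrib_left algebra_simps)
  qed
  have "poly (y i) 0 = 0" if "i \<in> I" for i using 1[OF that, of 0] by simp
  then show ?thesis using s0 1 by blast
qed

context vspace begin

lemma polynomial_family_generic_bij:
  assumes S: "fdim S" and E: "finite E" and lins: "\<And>e. e \<in> E \<Longrightarrow> lin e" and maps: "\<And>e. e \<in> E \<Longrightarrow> e ` S \<subseteq> S"
    and s: "poly s 0 = 1" and y: "\<And>e. e \<in> E \<Longrightarrow> poly (y e) 0 = 0"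
  shows "finite {t. \<not> bij_betw (\<lambda>x. poly s t *s x + (\<Sum>e\<in>E. poly (y e) t *s e x)) S S}"
proof -
  obtain B where B: "finite B" "independent B" "B \<subseteq> S" "span B = S" "card B = dim S"
    using fdim_basis[OF S] .
  let ?r = "representation B"
  define M where "M b c = s * [: if b = c then 1 else 0 :] + (\<Sum>e\<in>E. y e * [: ?r (e c) b :])" for b c
  have M0: "poly (M b c) 0 = (if b = c then 1 else 0)" for b c
    unfolding M_def using s y by (simp add: poly_sum)
  have "\<exists>d. d \<noteq> 0 \<and> (\<forall>t c. poly d t \<noteq> 0 \<longrightarrow> (\<forall>b\<in>B. (\<Sum>c'\<in>B. poly (M b c') t * c c') = 0) \<longrightarrow> (\<forall>b\<in>B. c b = 0))"
    by (rule poly_matrix_generic_injective[OF B(1)]) (rule M0)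
  then obtain d where d': "d \<noteq> 0 \<and> (\<forall>t c. poly d t \<noteq> 0 \<longrightarrow> (\<forall>b\<in>B. (\<Sum>c'\<in>B. poly (M b c') t * c c') = 0) \<longrightarrow> (\<forall>b\<in>B. c b = 0))"
    by (rule exE)
  note d = d'[THEN conjunct1] d'[THEN conjunct2, THEN spec, THEN spec, THEN mp, THEN mp]
  have "bij_betw (\<lambda>x. poly s t *s x + (\<Sum>e\<in>E. poly (y e) t *s e x)) S S" if t: "poly d t \<noteq> 0" for t
  proof -
    define g where "g x = poly s t *s x + (\<Sum>e\<in>E. poly (y e) t *s e x)" for x
    have "lin (\<lambda>x. \<Sum>e\<in>E. poly (y e) t *s e x)" by (rule lin_setsum, rule lin_smult, erule lins)
    then have gl: "lin g" unfolding g_def[abs_def] by (rule lin_plus[OF lin_smult[OF lin_ident]])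
    have gS: "g ` S \<subseteq> S"
      unfolding g_def using fdim_subspaceD[OF S] maps
      by (auto intro!: subspace_add subspace_scale subspace_sum)
    have "inj_on g S"
    proof (rule lin_inj_on[OF gl fdim_subspaceD[OF S]])
      fix x assume x: "x \<in> S" and gx: "g x = 0"
      have xr: "x = (\<Sum>c\<in>B. ?r x c *s c)"
        using sum_representation_eq[OF B(2) _ B(1) order_refl, of x] x B(4) by simp
      have "(\<Sum>c\<in>B. poly (M b c) t * ?r x c) = 0" if b: "b \<in> B" for b
      proof -
        have rl: "?r (c *s u + v) b = c * ?r u b + ?r v b" if "u \<in> S" "v \<in> S" for c u v
          using that B(4) by (simp add: representation_add[OF B(2)] representation_scale[OF B(2)] subspace_scale[OF fdim_subspaceD[OF S]])
        have rs: "?r (\<Sum>i\<in>J. f i) b = (\<Sum>i\<in>J. ?r (f i) b)" if "\<And>i. i \<in> J \<Longrightarrow> f i \<in> S" for J and f :: "'z \<Rightarrow> 'w"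
          using representation_sum[OF B(2), of J f] that B(4) by simp
        have rsc: "?r (c *s u) b = c * ?r u b" if "u \<in> S" for c u
          using representation_scale[OF B(2)] that B(4) by simp
        have sS: "c *s u \<in> S" if "u \<in> S" for c u using that subspace_scale fdim_subspaceD[OF S] by blast
        have eS: "e c \<in> S" if "e \<in> E" "c \<in> S" for e c using maps that by blast
        have ex: "?r (e x) b = (\<Sum>c\<in>B. ?r x c * ?r (e c) b)" if e: "e \<in> E" for e
        proof -
          have "e x = (\<Sum>c\<in>B. ?r x c *s e c)"
            by (subst xr) (simp add: lin_sum[OF lins[OF e]] lin_scale[OF lins[OF e]])
          then show ?thesis using rs[of B "\<lambda>c. ?r x c *s e c"] rsc sS eS[OF e] B(3) by (simp add: subset_iff)
        qed
        have "0 = ?r (g x) b" unfolding gx by (simp add: representation_zero)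
        also have "\<dots> = poly s t * ?r x b + ?r (\<Sum>e\<in>E. poly (y e) t *s e x) b"
          unfolding g_def by (rule rl[OF x]) (use eS x fdim_subspaceD[OF S] in \<open>auto intro!: subspace_sum subspace_scale\<close>)
        also have "?r (\<Sum>e\<in>E. poly (y e) t *s e x) b = (\<Sum>e\<in>E. poly (y e) t * ?r (e x) b)"
          using rs[of E "\<lambda>e. poly (y e) t *s e x"] rsc sS eS x by simp
        also have "\<dots> = (\<Sum>e\<in>E. \<Sum>c\<in>B. poly (y e) t * ?r (e c) b * ?r x c)"
          by (rule sum.cong) (auto simp: ex sum_distrib_left algebra_simps)
        also have "\<dots> = (\<Sum>c\<in>B. \<Sum>e\<in>E. poly (y e) t * ?r (e c) b * ?r x c)" by (rule sum.swap)
        also have "poly s t * ?r x b = (\<Sum>c\<in>B. poly s t * (if b = c then 1 else 0) * ?r x c)"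
          using b B(1) by (simp add: if_distrib if_distribR sum.delta cong: if_cong)
        finally show ?thesis
          unfolding M_def by (simp add: poly_sum sum_distrib_left sum_distrib_right sum.distrib algebra_simps)
      qed
      then have "\<forall>b\<in>B. (\<Sum>c\<in>B. poly (M b c) t * ?r x c) = 0" by blast
      then have "\<forall>b\<in>B. ?r x b = 0" by (rule d(2)[OF t])
      then show "x = 0" using xr by simp
    qed
    moreover from this have "g ` S = S"
      using subspace_eq_of_dim[OF S lin_subspace_image[OF gl fdim_subspaceD[OF S]] gS] dim_inj_image[OF S gl] by simp
    ultimately show ?thesis unfolding g_def[abs_def] bij_betw_def by blast
  qed
  then have "{t. \<not> bij_betw (\<lambda>x. poly s t *s x + (\<Sum>e\<in>E. poly (y e) t *s e x)) S S} \<subseteq> {t. poly d t = 0}"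
    by blast
  then show ?thesis using poly_roots_finite[OF d(1)] finite_subset by blast
qed

text \<open>
  Spaces of endomorphisms. A predicate is used because the functions on \<open>W\<close> are not
  themselves vectors of the locale.
\<close>

definition lin_closed :: "('w \<Rightarrow> 'w) set \<Rightarrow> bool" where
  "lin_closed C \<longleftrightarrow> (\<forall>g\<in>C. lin g) \<and> (\<lambda>x. 0) \<in> C \<and> (\<forall>g\<in>C. \<forall>h\<in>C. (\<lambda>x. g x + h x) \<in> C) \<and> (\<forall>c. \<forall>g\<in>C. (\<lambda>x. c *s g x) \<in> C)"

lemma lin_closed_add: "lin_closed C \<Longrightarrow> g \<in> C \<Longrightarrow> h \<in> C \<Longrightarrow> (\<lambda>x. g x + h x) \<in> C"
  unfolding lin_closed_def by simp

lemma lin_closed_scale: "lin_closed C \<Longrightarrow> g \<in> C \<Longrightarrow> (\<lambda>x. c *s g x) \<in> C"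
  unfolding lin_closed_def by simp

lemma lin_closed_sum:
  assumes "lin_closed C" "\<And>e. e \<in> E \<Longrightarrow> e \<in> C"
  shows "(\<lambda>x. \<Sum>e\<in>E. u e *s e x) \<in> C"
  using assms(2)
proof (induction E rule: infinite_finite_induct)
  case (insert e E)
  have "(\<lambda>x. u e *s e x) \<in> C" by (rule lin_closed_scale[OF assms(1)]) (use insert in simp)
  moreover have "(\<lambda>x. \<Sum>e\<in>E. u e *s e x) \<in> C" using insert by simp
  ultimately have "(\<lambda>x. u e *s e x + (\<Sum>e\<in>E. u e *s e x)) \<in> C" by (rule lin_closed_add[OF assms(1)])
  then show ?case using insert by simp
qed (use assms(1) in \<open>auto simp: lin_closed_def\<close>)

text \<open>
  A space of endomorphisms of a finite-dimensional \<open>S\<close> is spanned by finitely many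
  elements, as far as their values on finitely many vectors are concerned. Induction on these
  vectors: the endomorphisms vanishing on the earlier ones have finitely many independent values
  at the next.
\<close>

lemma finite_spanning_on:
  assumes C: "lin_closed C" and S: "fdim S" and maps: "\<And>g. g \<in> C \<Longrightarrow> g ` S \<subseteq> S" and B: "finite B" "B \<subseteq> S"
  shows "\<exists>E. finite E \<and> E \<subseteq> C \<and> (\<forall>g\<in>C. \<exists>u. \<forall>b\<in>B. g b = (\<Sum>e\<in>E. u e *s e b))"
  using B
proof (induction B)
  case empty
  show ?case by (intro exI[of _ "{}"]) auto
next
  case (insert b B)
  then obtain E where E: "finite E" "E \<subseteq> C" "\<forall>g\<in>C. \<exists>u. \<forall>b\<in>B. g b = (\<Sum>e\<in>E. u e *s e b)" by auto
  define C' where "C' = {g \<in> C. \<forall>c\<in>B. g c = 0}"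
  define R where "R = (\<lambda>g. g b) ` C'"
  have C': "lin_closed C'" using C unfolding lin_closed_def C'_def by auto
  have "R \<subseteq> S" using maps insert unfolding R_def C'_def by blast
  moreover have "subspace R"
  proof (rule subspaceI)
    show "0 \<in> R" using C' unfolding R_def lin_closed_def by (auto intro: image_eqI[of _ _ "\<lambda>x. 0"])
    show "x + y \<in> R" if xy: "x \<in> R" "y \<in> R" for x y
    proof -
      obtain g h where gh: "g \<in> C'" "h \<in> C'" "x = g b" "y = h b" using xy unfolding R_def by blast
      show ?thesis unfolding R_def
        by (rule image_eqI[OF _ lin_closed_add[OF C' gh(1,2)]]) (simp add: gh)
    qed
    show "c *s x \<in> R" if x: "x \<in> R" for c x
    proof -
      obtain g where g: "g \<in> C'" "x = g b" using x unfolding R_def by blast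
      show ?thesis unfolding R_def
        by (rule image_eqI[OF _ lin_closed_scale[OF C' g(1), of c]]) (simp add: g)
    qed
  qed
  ultimately have "fdim R" using fdim_subset[OF S] by blast
  then obtain D where D: "finite D" "D \<subseteq> R" "span D = R" by (rule fdim_basis)
  have "\<forall>x\<in>D. \<exists>g\<in>C'. g b = x" using D unfolding R_def by auto
  then obtain G where G: "\<And>x. x \<in> D \<Longrightarrow> G x \<in> C' \<and> G x b = x" by metis
  have Ginj: "inj_on G D" by (rule inj_onI) (metis G)
  let ?E = "E \<union> G ` D"
  have fin: "finite ?E" using E D by simp
  show ?case
  proof (intro exI[of _ ?E] conjI ballI)
    show "finite ?E" by (rule fin)
    show "?E \<subseteq> C" using E G unfolding C'_def by blast
    fix g assume g: "g \<in> C"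
    obtain u where u: "\<forall>b\<in>B. g b = (\<Sum>e\<in>E. u e *s e b)" using E g by blast
    define k where "k = (\<lambda>x. g x + (- 1) *s (\<Sum>e\<in>E. u e *s e x))"
    have Eu: "(\<lambda>x. \<Sum>e\<in>E. u e *s e x) \<in> C" using lin_closed_sum[OF C] E(2) by blast
    have "k \<in> C" unfolding k_def by (rule lin_closed_add[OF C g lin_closed_scale[OF C Eu]])
    then have "k \<in> C'" unfolding C'_def k_def using u by simp
    then have "k b \<in> span D" unfolding D(3) R_def by blast
    then obtain v where v: "k b = (\<Sum>x\<in>D. v x *s x)" unfolding span_finite[OF D(1)] by auto
    define u' where "u' e = (if e \<in> E then u e else 0) + (if e \<in> G ` D then v (e b) else 0)" for e
    have s: "(\<Sum>e\<in>?E. u' e *s e c) = (\<Sum>e\<in>E. u e *s e c) + (\<Sum>x\<in>D. v x *s G x c)" for c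
    proof -
      have "(\<Sum>e\<in>?E. u' e *s e c) = (\<Sum>e\<in>?E. if e \<in> E then u e *s e c else 0) + (\<Sum>e\<in>?E. if e \<in> G ` D then v (e b) *s e c else 0)"
        unfolding sum.distrib[symmetric] by (rule sum.cong) (auto simp: u'_def scale_left_distrib)
      also have "(\<Sum>e\<in>?E. if e \<in> E then u e *s e c else 0) = (\<Sum>e\<in>E. u e *s e c)"
        by (rule sum.mono_neutral_cong_right[OF fin]) auto
      also have "(\<Sum>e\<in>?E. if e \<in> G ` D then v (e b) *s e c else 0) = (\<Sum>e\<in>G ` D. v (e b) *s e c)"
        by (rule sum.mono_neutral_cong_right[OF fin]) auto
      also have "\<dots> = (\<Sum>x\<in>D. v x *s G x c)" using G by (simp add: sum.reindex[OF Ginj])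
      finally show ?thesis .
    qed
    show "\<exists>u. \<forall>c\<in>insert b B. g c = (\<Sum>e\<in>?E. u e *s e c)"
    proof (intro exI[of _ u'] ballI)
      fix c assume "c \<in> insert b B"
      then consider "c = b" | "c \<in> B" by blast
      then show "g c = (\<Sum>e\<in>?E. u' e *s e c)"
      proof cases
        case 1
        have "(\<Sum>x\<in>D. v x *s G x b) = k b" unfolding v using G by simp
        then show ?thesis unfolding s 1 k_def by simp
      next
        case 2
        have "(\<Sum>x\<in>D. v x *s G x c) = 0" using G 2 unfolding C'_def by (auto intro!: sum.neutral)
        then show ?thesis unfolding s using u 2 by simp
      qed
    qed
  qed
qed

text \<open>
  The hypothesis says that all first-order deformations \<open>(\<phi>' - \<phi>) g\<close> are
  induced by \<open>C\<close>. The point \<open>\<phi> + t (\<phi>' - \<phi>)\<close> of the line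
  is conjugate to \<open>\<phi>\<close> by \<open>g\<close> if \<open>\<phi> g - g \<phi> + t
  (\<phi>' - \<phi>) g = 0\<close>. With \<open>g = s + \<Sum> y\<^sub>e e\<close> for a spanning
  family of \<open>C\<close>, the hypothesis expresses every term through the commutators
  \<open>\<phi> e - e \<phi>\<close>, and it is enough that their coefficients vanish. This is the
  system of \<open>resolvent_polys\<close>; the solution is the identity at \<open>t = 0\<close>
  and hence invertible for all but finitely many \<open>t\<close>.
\<close>

lemma generic_deformation:
  assumes C: "lin_closed C" and one: "(\<lambda>x. x) \<in> C" and S: "fdim S" and maps: "\<And>g. g \<in> C \<Longrightarrow> g ` S \<subseteq> S"
    and \<phi>: "\<And>a. a \<in> A \<Longrightarrow> lin (\<phi> a)" "\<And>a. a \<in> A \<Longrightarrow> \<phi> a ` S \<subseteq> S"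
    and \<phi>': "\<And>a. a \<in> A \<Longrightarrow> lin (\<phi>' a)"
    and hyp: "\<And>g. g \<in> C \<Longrightarrow> \<exists>h\<in>C. \<forall>a\<in>A. \<forall>x\<in>S. \<phi>' a (g x) - \<phi> a (g x) = \<phi> a (h x) - h (\<phi> a x)"
  shows "finite {t. \<not> (\<exists>g\<in>C. bij_betw g S S \<and>
    (\<forall>a\<in>A. \<forall>x\<in>S. \<phi> a (g x) + t *s (\<phi>' a (g x) - \<phi> a (g x)) = g (\<phi> a x)))}"
proof -
  obtain D where D: "finite D" "independent D" "D \<subseteq> S" "span D = S" using fdim_basis[OF S] by metis
  obtain E where E: "finite E" "E \<subseteq> C" "\<forall>g\<in>C. \<exists>u. \<forall>b\<in>D. g b = (\<Sum>e\<in>E. u e *s e b)"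
    using finite_spanning_on[OF C S maps D(1,3)] by blast
  have linC: "lin g" if "g \<in> C" for g using C that unfolding lin_closed_def by blast
  have El: "lin e" if "e \<in> E" for e using linC E(2) that by blast
  have span: "\<exists>u. \<forall>x\<in>S. g x = (\<Sum>e\<in>E. u e *s e x)" if g: "g \<in> C" for g
  proof -
    obtain u where u: "\<forall>b\<in>D. g b = (\<Sum>e\<in>E. u e *s e b)" using E g by blast
    have "g x = (\<Sum>e\<in>E. u e *s e x)" if "x \<in> S" for x
    proof (rule pair.linear_eq_on[OF linC[OF g]])
      show "lin (\<lambda>x. \<Sum>e\<in>E. u e *s e x)" by (rule lin_setsum) (rule lin_smult[OF El])
      show "x \<in> span D" using that D by simp
    qed (use u in blast)
    then show ?thesis by blast
  qed
  define f where "f e a x = \<phi> a (e x) - e (\<phi> a x)" for e a x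
  have ex: "\<exists>u. \<forall>a\<in>A. \<forall>x\<in>S. \<phi>' a (g x) - \<phi> a (g x) = (\<Sum>e\<in>E. u e *s f e a x)" if g: "g \<in> C" for g
  proof -
    obtain h where h: "h \<in> C" "\<forall>a\<in>A. \<forall>x\<in>S. \<phi>' a (g x) - \<phi> a (g x) = \<phi> a (h x) - h (\<phi> a x)" using hyp[OF g] by blast
    obtain u where u: "\<forall>x\<in>S. h x = (\<Sum>e\<in>E. u e *s e x)" using span[OF h(1)] by blast
    have "\<phi> a (h x) - h (\<phi> a x) = (\<Sum>e\<in>E. u e *s f e a x)" if "a \<in> A" "x \<in> S" for a x
    proof -
      have "\<phi> a x \<in> S" using \<phi> that by blast
      then show ?thesis using u that unfolding f_def
        by (simp add: lin_sum[OF \<phi>(1)] lin_scale[OF \<phi>(1)] scale_right_diff_distrib sum_subtractf)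
    qed
    then show ?thesis using h(2) by auto
  qed
  (* w and B are the coordinates of the deformation (\<phi>' - \<phi>) g for g the identity and
     for g = e *)
  obtain w where w: "\<forall>a\<in>A. \<forall>x\<in>S. \<phi>' a x - \<phi> a x = (\<Sum>e\<in>E. w e *s f e a x)" using ex[OF one] by blast
  have "\<forall>e\<in>E. \<exists>u. \<forall>a\<in>A. \<forall>x\<in>S. \<phi>' a (e x) - \<phi> a (e x) = (\<Sum>d\<in>E. u d *s f d a x)" using ex E(2) by blast
  then obtain B where B: "\<And>e a x. e \<in> E \<Longrightarrow> a \<in> A \<Longrightarrow> x \<in> S \<Longrightarrow> \<phi>' a (e x) - \<phi> a (e x) = (\<Sum>d\<in>E. B e d *s f d a x)" by metis
  obtain s y where s: "poly s 0 = 1" and y: "\<forall>e\<in>E. poly (y e) 0 = 0"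
    and sy: "\<And>t d. d \<in> E \<Longrightarrow> poly (y d) t + t * (\<Sum>e\<in>E. B e d * poly (y e) t) = - (t * poly s t * w d)"
    using resolvent_polys[OF E(1), of "\<lambda>d e. B e d" w] by blast
  define g where "g t x = poly s t *s x + (\<Sum>e\<in>E. poly (y e) t *s e x)" for t x
  have gC: "g t \<in> C" for t
  proof -
    have "(\<lambda>x. \<Sum>e\<in>E. poly (y e) t *s e x) \<in> C" by (rule lin_closed_sum[OF C]) (use E(2) in blast)
    then show ?thesis unfolding g_def[abs_def] by (rule lin_closed_add[OF C lin_closed_scale[OF C one]])
  qed
  have geq: "\<phi> a (g t x) + t *s (\<phi>' a (g t x) - \<phi> a (g t x)) = g t (\<phi> a x)" if a: "a \<in> A" and x: "x \<in> S" for a x t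
  proof -
    have 1: "\<phi> a (g t x) - g t (\<phi> a x) = (\<Sum>e\<in>E. poly (y e) t *s f e a x)"
      unfolding g_def f_def using a
      by (simp add: lin_add[OF \<phi>(1)] lin_sum[OF \<phi>(1)] lin_scale[OF \<phi>(1)] scale_right_diff_distrib sum_subtractf)
    have "\<phi>' a (g t x) - \<phi> a (g t x) = poly s t *s (\<phi>' a x - \<phi> a x) + (\<Sum>e\<in>E. poly (y e) t *s (\<phi>' a (e x) - \<phi> a (e x)))"
      unfolding g_def using a
      by (simp add: lin_add[OF \<phi>(1)] lin_sum[OF \<phi>(1)] lin_scale[OF \<phi>(1)] lin_add[OF \<phi>'] lin_sum[OF \<phi>'] lin_scale[OF \<phi>']
          scale_right_diff_distrib sum_subtractf)
    also have "\<dots> = (\<Sum>d\<in>E. (poly s t * w d) *s f d a x) + (\<Sum>e\<in>E. \<Sum>d\<in>E. (poly (y e) t * B e d) *s f d a x)"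
      using w B a x by (simp add: scale_sum_right)
    also have "(\<Sum>e\<in>E. \<Sum>d\<in>E. (poly (y e) t * B e d) *s f d a x) = (\<Sum>d\<in>E. \<Sum>e\<in>E. (poly (y e) t * B e d) *s f d a x)"
      by (rule sum.swap)
    also have "(\<Sum>d\<in>E. (poly s t * w d) *s f d a x) + \<dots> = (\<Sum>d\<in>E. (poly s t * w d + (\<Sum>e\<in>E. B e d * poly (y e) t)) *s f d a x)"
      by (simp add: sum.distrib scale_left_distrib scale_sum_left mult.commute)
    finally have 2: "t *s (\<phi>' a (g t x) - \<phi> a (g t x)) = (\<Sum>d\<in>E. (t * (poly s t * w d + (\<Sum>e\<in>E. B e d * poly (y e) t))) *s f d a x)"
      by (simp add: scale_sum_right)
    have "(\<phi> a (g t x) - g t (\<phi> a x)) + t *s (\<phi>' a (g t x) - \<phi> a (g t x)) =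
       (\<Sum>d\<in>E. (poly (y d) t + t * (poly s t * w d + (\<Sum>e\<in>E. B e d * poly (y e) t))) *s f d a x)"
      unfolding 1 2 by (simp add: sum.distrib scale_left_distrib)
    also have "\<dots> = 0"
    proof (rule sum.neutral, rule ballI)
      fix d assume "d \<in> E"
      then have "poly (y d) t + t * (poly s t * w d + (\<Sum>e\<in>E. B e d * poly (y e) t)) = 0"
      proof -
        have "poly (y d) t + t * (poly s t * w d + (\<Sum>e\<in>E. B e d * poly (y e) t)) =
          (poly (y d) t + t * (\<Sum>e\<in>E. B e d * poly (y e) t)) + t * poly s t * w d"
          by (simp only: distrib_left ac_simps)
        also have "\<dots> = 0" using sy[OF \<open>d \<in> E\<close>, of t] by simp
        finally show ?thesis .
      qed
      then show "(poly (y d) t + t * (poly s t * w d + (\<Sum>e\<in>E. B e d * poly (y e) t))) *s f d a x = 0" by simp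
    qed
    finally show ?thesis by (simp add: algebra_simps)
  qed
  have "{t. \<not> (\<exists>g\<in>C. bij_betw g S S \<and>
    (\<forall>a\<in>A. \<forall>x\<in>S. \<phi> a (g x) + t *s (\<phi>' a (g x) - \<phi> a (g x)) = g (\<phi> a x)))}
    \<subseteq> {t. \<not> bij_betw (\<lambda>x. poly s t *s x + (\<Sum>e\<in>E. poly (y e) t *s e x)) S S}"
    using gC geq unfolding g_def[abs_def] by blast
  moreover have "finite {t. \<not> bij_betw (\<lambda>x. poly s t *s x + (\<Sum>e\<in>E. poly (y e) t *s e x)) S S}"
    by (rule polynomial_family_generic_bij[OF S E(1) El _ s]) (use maps E(2) y in blast)+
  ultimately show ?thesis using finite_subset by blast
qed

end

section \<open>Reflections of representations at sinks\<close>

text \<open>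
  Independent copies of the ambient space inside itself, one for each label: \<open>ins a\<close>
  embeds the copy, and \<open>up a\<close> projects onto it. They replace external direct sums.
\<close>

locale slots = vspace scale
  for scale :: "'k::field \<Rightarrow> 'w::ab_group_add \<Rightarrow> 'w" (infixr \<open>*s\<close> 75) +
  fixes ins up :: "'e \<Rightarrow> 'w \<Rightarrow> 'w"
  assumes lin_ins: "Vector_Spaces.linear scale scale (ins a)"
    and lin_up: "Vector_Spaces.linear scale scale (up a)"
    and up_ins: "up a (ins b y) = (if a = b then y else 0)"
begin

text \<open>
  The internal direct sum of the \<open>Y a\<close>, each placed into its own copy of the ambient
  space, and the block diagonal map on it.
\<close>

definition fam :: "'e set \<Rightarrow> ('e \<Rightarrow> 'w set) \<Rightarrow> 'w set" where
  "fam I Y = {x. (\<forall>a\<in>I. up a x \<in> Y a) \<and> x = (\<Sum>a\<in>I. ins a (up a x))}"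

definition diag :: "'e set \<Rightarrow> ('e \<Rightarrow> 'w \<Rightarrow> 'w) \<Rightarrow> 'w \<Rightarrow> 'w" where
  "diag I g x = (\<Sum>a\<in>I. ins a (g a (up a x)))"

lemma up_sum_ins: "finite I \<Longrightarrow> up a (\<Sum>b\<in>I. ins b (y b)) = (if a \<in> I then y a else 0)"
  by (simp add: lin_sum[OF lin_up] up_ins)

lemma lin_diag: "(\<And>a. a \<in> I \<Longrightarrow> lin (g a)) \<Longrightarrow> lin (diag I g)"
  unfolding diag_def[abs_def] by (rule lin_setsum) (blast intro: lin_comp[OF lin_ins lin_comp] lin_up)

lemma famI: "finite I \<Longrightarrow> (\<And>a. a \<in> I \<Longrightarrow> y a \<in> Y a) \<Longrightarrow> (\<Sum>a\<in>I. ins a (y a)) \<in> fam I Y"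
  unfolding fam_def by (simp add: up_sum_ins)

lemma fam_up: "x \<in> fam I Y \<Longrightarrow> a \<in> I \<Longrightarrow> up a x \<in> Y a"
  unfolding fam_def by blast

lemma fam_eq_sum: "x \<in> fam I Y \<Longrightarrow> x = (\<Sum>a\<in>I. ins a (up a x))"
  unfolding fam_def by blast

lemma fam_eqI: "x \<in> fam I Y \<Longrightarrow> x' \<in> fam I Y' \<Longrightarrow> (\<And>a. a \<in> I \<Longrightarrow> up a x = up a x') \<Longrightarrow> x = x'"
  using fam_eq_sum[of x I Y] fam_eq_sum[of x' I Y'] by simp

lemma fam_subset: "(\<And>a. a \<in> I \<Longrightarrow> Y a \<subseteq> Z a) \<Longrightarrow> fam I Y \<subseteq> fam I Z"
  unfolding fam_def by blast

lemma ins_in_fam: "finite I \<Longrightarrow> b \<in> I \<Longrightarrow> y \<in> Y b \<Longrightarrow> (\<And>a. a \<in> I \<Longrightarrow> 0 \<in> Y a) \<Longrightarrow> ins b y \<in> fam I Y"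
proof -
  assume a: "finite I" "b \<in> I" "y \<in> Y b" "\<And>a. a \<in> I \<Longrightarrow> 0 \<in> Y a"
  have "(\<Sum>a\<in>I. ins a (if a = b then y else 0)) = (\<Sum>a\<in>I. if a = b then ins b y else 0)"
    by (rule sum.cong) (auto simp: lin_0[OF lin_ins])
  also have "\<dots> = ins b y" using a by simp
  finally show ?thesis using famI[OF a(1), of "\<lambda>a. if a = b then y else 0" Y] a by auto
qed

lemma subspace_fam: "(\<And>a. a \<in> I \<Longrightarrow> subspace (Y a)) \<Longrightarrow> subspace (fam I Y)"
  unfolding fam_def
  by (rule subspaceI)
    (auto simp: lin_0[OF lin_up] lin_0[OF lin_ins] lin_add[OF lin_up] lin_add[OF lin_ins] sum.distrib
      lin_scale[OF lin_up] lin_scale[OF lin_ins] subspace_0 subspace_add subspace_scale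
      simp flip: scale_sum_right)

lemma up_diag: "finite I \<Longrightarrow> a \<in> I \<Longrightarrow> up a (diag I g x) = g a (up a x)"
  unfolding diag_def by (simp add: up_sum_ins)

lemma diag_in_fam: "finite I \<Longrightarrow> (\<And>a. a \<in> I \<Longrightarrow> g a (up a x) \<in> Z a) \<Longrightarrow> diag I g x \<in> fam I Z"
  unfolding diag_def by (rule famI)

lemma bij_betw_diag:
  assumes I: "finite I" and g: "\<And>a. a \<in> I \<Longrightarrow> bij_betw (g a) (Y a) (Z a)"
  shows "bij_betw (diag I g) (fam I Y) (fam I Z)"
proof -
  have "inj_on (diag I g) (fam I Y)"
  proof (rule inj_onI)
    fix x x' assume x: "x \<in> fam I Y" "x' \<in> fam I Y" "diag I g x = diag I g x'"
    show "x = x'"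
    proof (rule fam_eqI[OF x(1,2)])
      fix a assume a: "a \<in> I"
      have "g a (up a x) = g a (up a x')" using up_diag[OF I a] x(3) by metis
      then show "up a x = up a x'" using g[OF a] fam_up[OF x(1) a] fam_up[OF x(2) a]
        unfolding bij_betw_def inj_on_def by blast
    qed
  qed
  moreover have "diag I g ` fam I Y = fam I Z"
  proof
    show "diag I g ` fam I Y \<subseteq> fam I Z"
    proof clarify
      fix x assume "x \<in> fam I Y"
      then show "diag I g x \<in> fam I Z" using diag_in_fam[OF I] fam_up g bij_betwE by metis
    qed
    show "fam I Z \<subseteq> diag I g ` fam I Y"
    proof
      fix z assume z: "z \<in> fam I Z"
      have "\<forall>a\<in>I. \<exists>y\<in>Y a. g a y = up a z" using g fam_up[OF z] unfolding bij_betw_def by (metis image_iff)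
      then obtain y where y: "\<And>a. a \<in> I \<Longrightarrow> y a \<in> Y a \<and> g a (y a) = up a z" by metis
      let ?x = "\<Sum>a\<in>I. ins a (y a)"
      have "?x \<in> fam I Y" using famI[OF I] y by blast
      moreover have "diag I g ?x = z"
      proof -
        have "diag I g ?x = (\<Sum>a\<in>I. ins a (up a z))"
          unfolding diag_def by (rule sum.cong) (auto simp: up_sum_ins I y)
        then show ?thesis using fam_eq_sum[OF z] by simp
      qed
      ultimately show "z \<in> diag I g ` fam I Y" by blast
    qed
  qed
  ultimately show ?thesis unfolding bij_betw_def by blast
qed

lemma dsum_fam:
  assumes I: "finite I" and d: "\<And>a. a \<in> I \<Longrightarrow> dsum (Y a) (T a) (T' a)"
  shows "dsum (fam I Y) (fam I T) (fam I T')"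
proof (rule dsumI)
  show "subspace (fam I T)" "subspace (fam I T')" "subspace (fam I Y)"
    using d dsum_subspace by (blast intro: subspace_fam)+
  show "fam I T \<subseteq> fam I Y" "fam I T' \<subseteq> fam I Y" using d dsum_subset by (blast intro!: fam_subset)+
  fix x assume x: "x \<in> fam I T" "x \<in> fam I T'"
  have "up a x = 0" if "a \<in> I" for a
    using fam_up[OF x(1) that] fam_up[OF x(2) that] d[OF that] unfolding dsum_def by blast
  then show "x = 0" using fam_eq_sum[OF x(1)] by (simp add: lin_0[OF lin_ins])
next
  fix x assume x: "x \<in> fam I Y"
  have "\<forall>a\<in>I. \<exists>t\<in>T a. \<exists>t'\<in>T' a. up a x = t + t'" using d fam_up[OF x] dsumE by metis
  then obtain t t' where t: "\<And>a. a \<in> I \<Longrightarrow> t a \<in> T a \<and> t' a \<in> T' a \<and> up a x = t a + t' a" by metis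
  have "x = (\<Sum>a\<in>I. ins a (t a)) + (\<Sum>a\<in>I. ins a (t' a))"
    by (subst fam_eq_sum[OF x]) (simp add: t lin_add[OF lin_ins] sum.distrib)
  then show "\<exists>a\<in>fam I T. \<exists>b\<in>fam I T'. x = a + b"
    using famI[OF I, of t T] famI[OF I, of t' T'] t by blast
qed

lemma dim_fam:
  assumes "finite I" "\<And>a. a \<in> I \<Longrightarrow> fdim (Y a)"
  shows "fdim (fam I Y) \<and> dim (fam I Y) = (\<Sum>a\<in>I. dim (Y a))"
  using assms
proof (induction I)
  case empty
  have "fam {} Y = {0}" unfolding fam_def by auto
  then show ?case using fdim_zero by simp
next
  case (insert b I)
  let ?B = "ins b ` Y b"
  have fI: "finite (insert b I)" using insert by simp
  have Y0: "0 \<in> Y a" if "a \<in> insert b I" for a using insert.prems that fdim_subspaceD subspace_0 by blast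
  have inj: "inj_on (ins b) (Y b)" by (rule inj_onI) (metis up_ins)
  have fB: "fdim ?B" "dim ?B = dim (Y b)"
    using fdim_image[OF insert.prems lin_ins] dim_inj_image[OF insert.prems lin_ins inj] by auto
  have IH: "fdim (fam I Y)" "dim (fam I Y) = (\<Sum>a\<in>I. dim (Y a))" using insert by auto
  have "dsum (fam (insert b I) Y) ?B (fam I Y)"
  proof (rule dsumI)
    show "subspace ?B" "subspace (fam I Y)" using fB IH fdim_subspaceD by blast+
    show "subspace (fam (insert b I) Y)" using insert.prems fdim_subspaceD by (blast intro: subspace_fam)
    show "?B \<subseteq> fam (insert b I) Y" using ins_in_fam[OF fI] Y0 by blast
    have upb: "up b x = 0" if "x \<in> fam I Y" for x
      using up_sum_ins[OF insert(1), of b "\<lambda>a. up a x"] fam_eq_sum[OF that] insert(2) by metis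
    show "fam I Y \<subseteq> fam (insert b I) Y"
    proof
      fix x assume x: "x \<in> fam I Y"
      show "x \<in> fam (insert b I) Y"
        using x upb[OF x] Y0 insert(1,2) unfolding fam_def by (auto simp: lin_0[OF lin_ins])
    qed
    fix x assume "x \<in> ?B" "x \<in> fam I Y"
    then show "x = 0" using upb[of x] up_ins[of b b] lin_0[OF lin_ins] by auto
  next
    fix x assume x: "x \<in> fam (insert b I) Y"
    have "x = ins b (up b x) + (\<Sum>a\<in>I. ins a (up a x))" using fam_eq_sum[OF x] insert(1,2) by simp
    moreover have "ins b (up b x) \<in> ?B" "(\<Sum>a\<in>I. ins a (up a x)) \<in> fam I Y"
      using fam_up[OF x] famI[OF insert(1)] by auto
    ultimately show "\<exists>a\<in>?B. \<exists>b\<in>fam I Y. x = a + b" by blast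
  qed
  then show ?case using dim_dsum[OF _ fB(1) IH(1)] fB IH insert by simp
qed

end

text \<open>
  A representation is considered relative to a height function \<open>h\<close>: the arrow
  \<open>a\<close> acts from its higher to its lower end, whatever its direction in the quiver.
  Reflecting at a sink \<open>i\<close> then amounts to raising \<open>h i\<close> by
  \<open>2\<close>, which turns all arrows at \<open>i\<close> around, and to replacing the space
  at \<open>i\<close> by the kernel of the map \<open>sm i F\<close> from the sum of the
  neighbouring spaces. The new maps out of \<open>i\<close> are the projections \<open>up
  a\<close>.
\<close>

locale quiver_reps = slots scale ins up + loop_free_quiver V A tl hd
  for scale :: "'k::field \<Rightarrow> 'w::ab_group_add \<Rightarrow> 'w" (infixr \<open>*s\<close> 75)
  and ins up :: "'e \<Rightarrow> 'w \<Rightarrow> 'w"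
  and V :: "'v set" and A :: "'e set" and tl hd :: "'e \<Rightarrow> 'v"
begin

definition sink :: "('v \<Rightarrow> int) \<Rightarrow> 'v \<Rightarrow> bool" where
  "sink h i \<longleftrightarrow> i \<in> V \<and> (\<forall>a\<in>inc i. h (opp a i) = h i + 1)"

definition rep :: "('v \<Rightarrow> int) \<Rightarrow> ('v \<Rightarrow> 'w set) \<Rightarrow> ('e \<Rightarrow> 'w \<Rightarrow> 'w) \<Rightarrow> bool" where
  "rep h X F \<longleftrightarrow> (\<forall>v\<in>V. fdim (X v)) \<and> (\<forall>a\<in>A. lin (F a)) \<and>
     (\<forall>i. \<forall>a\<in>inc i. h (opp a i) = h i + 1 \<longrightarrow> F a ` X (opp a i) \<subseteq> X i)"

definition nbs :: "'v \<Rightarrow> ('v \<Rightarrow> 'w set) \<Rightarrow> 'w set" where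
  "nbs i X = fam (inc i) (\<lambda>a. X (opp a i))"

definition sm :: "'v \<Rightarrow> ('e \<Rightarrow> 'w \<Rightarrow> 'w) \<Rightarrow> 'w \<Rightarrow> 'w" where
  "sm i F x = (\<Sum>a\<in>inc i. F a (up a x))"

definition rX :: "'v \<Rightarrow> ('v \<Rightarrow> 'w set) \<Rightarrow> ('e \<Rightarrow> 'w \<Rightarrow> 'w) \<Rightarrow> 'v \<Rightarrow> 'w set" where
  "rX i X F = X(i := {x \<in> nbs i X. sm i F x = 0})"

definition rF :: "'v \<Rightarrow> ('e \<Rightarrow> 'w \<Rightarrow> 'w) \<Rightarrow> 'e \<Rightarrow> 'w \<Rightarrow> 'w" where
  "rF i F = (\<lambda>a. if a \<in> inc i then up a else F a)"

definition rh :: "'v \<Rightarrow> ('v \<Rightarrow> int) \<Rightarrow> 'v \<Rightarrow> int" where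
  "rh i h = h(i := h i + 2)"

text \<open>
  The corank of the map from the neighbours, which is the multiplicity of the simple
  representation at the sink \<open>i\<close> as a direct summand.
\<close>

definition cok :: "'v \<Rightarrow> ('v \<Rightarrow> 'w set) \<Rightarrow> ('e \<Rightarrow> 'w \<Rightarrow> 'w) \<Rightarrow> nat" where
  "cok i X F = dim (X i) - dim (sm i F ` nbs i X)"

definition rep_iso where
  "rep_iso h X F Y G \<longleftrightarrow> (\<exists>g. (\<forall>v\<in>V. lin (g v) \<and> bij_betw (g v) (X v) (Y v)) \<and>
     (\<forall>i. \<forall>a\<in>inc i. h (opp a i) = h i + 1 \<longrightarrow>
        (\<forall>x\<in>X (opp a i). G a (g (opp a i) x) = g i (F a x))))"

lemma repD:
  assumes "rep h X F"
  shows "v \<in> V \<Longrightarrow> fdim (X v)" "a \<in> A \<Longrightarrow> lin (F a)"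
    "a \<in> inc i \<Longrightarrow> h (opp a i) = h i + 1 \<Longrightarrow> x \<in> X (opp a i) \<Longrightarrow> F a x \<in> X i"
  using assms unfolding rep_def by blast+

lemma sinkD: assumes "sink h i" shows "i \<in> V" "a \<in> inc i \<Longrightarrow> h (opp a i) = h i + 1"
  using assms unfolding sink_def by blast+

lemma lin_sm: "rep h X F \<Longrightarrow> lin (sm i F)"
  unfolding sm_def[abs_def] by (rule lin_setsum) (metis inc_A lin_comp lin_up repD(2))

lemma nbs_dim:
  assumes "rep h X F"
  shows "fdim (nbs i X)" "dim (nbs i X) = (\<Sum>a\<in>inc i. dim (X (opp a i)))"
  using dim_fam[of "inc i" "\<lambda>a. X (opp a i)"] repD(1)[OF assms] opp_V unfolding nbs_def by auto

lemma sm_nbs: "rep h X F \<Longrightarrow> sink h i \<Longrightarrow> sm i F ` nbs i X \<subseteq> X i"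
  unfolding sm_def nbs_def
  by (auto intro!: subspace_sum fdim_subspaceD[OF repD(1)] sinkD(1) dest: repD(3) sinkD(2) fam_up)

lemma rX_other [simp]: "j \<noteq> i \<Longrightarrow> rX i X F j = X j" unfolding rX_def by simp

lemma rX_same: "rX i X F i = {x \<in> nbs i X. sm i F x = 0}" unfolding rX_def by simp

lemma rh_step:
  assumes "sink h i" "a \<in> inc j" "rh i h (opp a j) = rh i h j + 1"
  shows "j \<noteq> i" "a \<in> inc i \<and> opp a j = i \<and> opp a i = j \<or> a \<notin> inc i \<and> opp a j \<noteq> i \<and> h (opp a j) = h j + 1"
proof -
  have ne: "opp a j \<noteq> j" using opp_neq assms by blast
  show ji: "j \<noteq> i" using assms(3) sinkD(2)[OF assms(1), of a] assms(2) ne unfolding rh_def by auto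
  show "a \<in> inc i \<and> opp a j = i \<and> opp a i = j \<or> a \<notin> inc i \<and> opp a j \<noteq> i \<and> h (opp a j) = h j + 1"
    using assms inc_two[of a i j] inc_opp[of a j] ji unfolding rh_def by (auto split: if_splits)
qed

lemma rh_outward: "sink h i \<Longrightarrow> a \<in> inc i \<Longrightarrow> rh i h (opp a (opp a i)) = rh i h (opp a i) + 1"
  using sinkD(2)[of h i a] opp_opp[of a i] opp_neq[of a i] unfolding rh_def by simp

lemma h_step:
  assumes "sink h i" "a \<in> inc j" "h (opp a j) = h j + 1" "j \<noteq> i"
  shows "a \<notin> inc i" "opp a j \<noteq> i" "rh i h (opp a j) = rh i h j + 1"
proof -
  show 1: "a \<notin> inc i"
    using sinkD(2)[OF assms(1), of a] inc_two[of a i j] assms by auto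
  show 2: "opp a j \<noteq> i" using 1 inc_opp assms(2) by metis
  show "rh i h (opp a j) = rh i h j + 1" using 2 assms unfolding rh_def by simp
qed

lemma rep_reflect:
  assumes X: "rep h X F" and i: "sink h i"
  shows "rep (rh i h) (rX i X F) (rF i F)"
  unfolding rep_def
proof (intro conjI ballI allI impI)
  fix v assume v: "v \<in> V"
  have n: "fdim (nbs i X)" using nbs_dim[OF X] by blast
  have "fdim (rX i X F i)" unfolding rX_same
    by (rule fdim_subset[OF n subspace_lin_kernel[OF lin_sm[OF X] fdim_subspaceD[OF n]]]) blast
  then show "fdim (rX i X F v)" using repD(1)[OF X v] by (cases "v = i") auto
next
  fix a assume "a \<in> A" then show "lin (rF i F a)" unfolding rF_def using repD(2)[OF X] lin_up by simp
next
  fix j a assume a: "a \<in> inc j" "rh i h (opp a j) = rh i h j + 1"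
  show "rF i F a ` rX i X F (opp a j) \<subseteq> rX i X F j"
    using rh_step[OF i a] repD(3)[OF X a(1)] fam_up[of _ "inc i" "\<lambda>a. X (opp a i)" a]
    unfolding rF_def by (auto simp: rX_same nbs_def)
qed

lemma rank_le:
  assumes X: "rep h X F" and i: "sink h i" shows "dim (sm i F ` nbs i X) \<le> dim (X i)"
proof -
  have "subspace (sm i F ` nbs i X)"
    using lin_subspace_image[OF lin_sm[OF X]] nbs_dim[OF X] fdim_subspaceD by blast
  then show ?thesis using dim_subspace_le[OF repD(1)[OF X sinkD(1)[OF i]]] sm_nbs[OF X i] by blast
qed

text \<open>
  Rank-nullity for the map from the neighbours. When \<open>cok\<close> vanishes this is the
  formula for a simple reflection.
\<close>

lemma dim_reflect:
  assumes X: "rep h X F" and i: "sink h i"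
  shows "dim (rX i X F i) + dim (X i) = (\<Sum>a\<in>inc i. dim (X (opp a i))) + cok i X F"
  using rank_nullity[OF nbs_dim(1)[OF X] lin_sm[OF X], of i i] nbs_dim(2)[OF X, of i] rank_le[OF X i]
  unfolding cok_def rX_same by simp

text \<open>
  An isomorphism of representations acts diagonally on the sum of the neighbouring spaces, and so
  restricts to the kernels.
\<close>

lemma rep_iso_reflect:
  assumes X: "rep h X F" and Y: "rep h Y G" and i: "sink h i" and iso: "rep_iso h X F Y G"
  shows "rep_iso (rh i h) (rX i X F) (rF i F) (rX i Y G) (rF i G)" "cok i X F = cok i Y G"
proof -
  obtain g where g: "\<And>v. v \<in> V \<Longrightarrow> lin (g v)" "\<And>v. v \<in> V \<Longrightarrow> bij_betw (g v) (X v) (Y v)"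
    and com: "\<And>j a x. a \<in> inc j \<Longrightarrow> h (opp a j) = h j + 1 \<Longrightarrow> x \<in> X (opp a j) \<Longrightarrow>
       G a (g (opp a j) x) = g j (F a x)"
    using iso unfolding rep_iso_def by blast
  define D where "D = diag (inc i) (\<lambda>a. g (opp a i))"
  have Dl: "lin D" unfolding D_def using g opp_V by (blast intro: lin_diag)
  have Db: "bij_betw D (nbs i X) (nbs i Y)"
    unfolding D_def nbs_def using g opp_V by (blast intro: bij_betw_diag finite_inc)
  have iV: "i \<in> V" using sinkD i by blast
  have smD: "sm i G (D x) = g i (sm i F x)" if x: "x \<in> nbs i X" for x
  proof -
    have "sm i G (D x) = (\<Sum>a\<in>inc i. G a (g (opp a i) (up a x)))"
      unfolding sm_def D_def by (simp add: up_diag)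
    also have "\<dots> = (\<Sum>a\<in>inc i. g i (F a (up a x)))"
    proof (rule sum.cong)
      fix a assume a: "a \<in> inc i"
      have "up a x \<in> X (opp a i)" using fam_up[OF _ a] x unfolding nbs_def by blast
      then show "G a (g (opp a i) (up a x)) = g i (F a (up a x))" using com[OF a sinkD(2)[OF i a]] by blast
    qed simp
    finally show ?thesis unfolding sm_def by (simp add: lin_sum[OF g(1)[OF iV]])
  qed
  have inj: "g i y = 0 \<longleftrightarrow> y = 0" if "y \<in> X i" for y
    using g(2)[OF iV] that lin_0[OF g(1)[OF iV]] repD(1)[OF X iV] fdim_subspaceD subspace_0
    unfolding bij_betw_def inj_on_def by metis
  have ker: "bij_betw D (rX i X F i) (rX i Y G i)"
  proof -
    have "D ` {x \<in> nbs i X. sm i F x = 0} = {x \<in> nbs i Y. sm i G x = 0}"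
    proof (intro subset_antisym subsetI)
      fix y assume "y \<in> D ` {x \<in> nbs i X. sm i F x = 0}"
      then show "y \<in> {x \<in> nbs i Y. sm i G x = 0}"
        using Db smD lin_0[OF g(1)[OF iV]] unfolding bij_betw_def by auto
    next
      fix y assume y: "y \<in> {x \<in> nbs i Y. sm i G x = 0}"
      then obtain x where x: "x \<in> nbs i X" "y = D x" using Db unfolding bij_betw_def by blast
      then have "sm i F x = 0" using smD inj sm_nbs[OF X i] y by force
      then show "y \<in> D ` {x \<in> nbs i X. sm i F x = 0}" using x by blast
    qed
    then show ?thesis using Db unfolding bij_betw_def rX_same by (auto intro: inj_on_subset)
  qed
  show "rep_iso (rh i h) (rX i X F) (rF i F) (rX i Y G) (rF i G)"
    unfolding rep_iso_def
  proof (intro exI[of _ "g(i := D)"] conjI ballI allI impI)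
    fix v assume "v \<in> V"
    then show "lin ((g(i := D)) v)" "bij_betw ((g(i := D)) v) (rX i X F v) (rX i Y G v)"
      using g Dl ker by (cases "v = i"; simp)+
  next
    fix j a x assume a: "a \<in> inc j" "rh i h (opp a j) = rh i h j + 1" and x: "x \<in> rX i X F (opp a j)"
    show "rF i G a ((g(i := D)) (opp a j) x) = (g(i := D)) j (rF i F a x)"
      using rh_step[OF i a] com[OF a(1)] x unfolding rF_def D_def by (auto simp: up_diag)
  qed
  have "sm i G ` nbs i Y = g i ` sm i F ` nbs i X"
    using Db smD unfolding bij_betw_def by (metis (no_types, lifting) image_cong image_image)
  moreover have "inj_on (g i) (sm i F ` nbs i X)"
    using g(2)[OF iV] sm_nbs[OF X i] inj_on_subset unfolding bij_betw_def by blast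
  moreover have "fdim (sm i F ` nbs i X)" using fdim_image[OF nbs_dim(1)[OF X] lin_sm[OF X]] by blast
  ultimately have 1: "dim (sm i G ` nbs i Y) = dim (sm i F ` nbs i X)"
    using dim_inj_image[OF _ g(1)[OF iV]] by metis
  have "dim (Y i) = dim (X i)"
    using dim_inj_image[OF repD(1)[OF X iV] g(1)[OF iV]] g(2)[OF iV] unfolding bij_betw_def by metis
  then show "cok i X F = cok i Y G" unfolding cok_def using 1 by simp
qed

text \<open>
  The neighbours of \<open>i\<close>, the kernel, and the dimension at \<open>i\<close> together
  determine the representation: the space at \<open>i\<close> is the sum of the neighbours modulo
  the kernel, plus a number of copies of the simple representation.
\<close>

lemma rep_iso_of_reflections:
  assumes X: "rep h X F" and Y: "rep h Y G" and i: "sink h i"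
    and iso: "rep_iso (rh i h) (rX i X F) (rF i F) (rX i Y G) (rF i G)"
    and dim: "dim (X i) = dim (Y i)"
  shows "rep_iso h X F Y G"
proof -
  obtain g where g: "\<And>v. v \<in> V \<Longrightarrow> lin (g v)" "\<And>v. v \<in> V \<Longrightarrow> bij_betw (g v) (rX i X F v) (rX i Y G v)"
    and com: "\<And>j a x. a \<in> inc j \<Longrightarrow> rh i h (opp a j) = rh i h j + 1 \<Longrightarrow> x \<in> rX i X F (opp a j) \<Longrightarrow>
       rF i G a (g (opp a j) x) = g j (rF i F a x)"
    using iso unfolding rep_iso_def by blast
  have iV: "i \<in> V" using sinkD i by blast
  have gb: "bij_betw (g v) (X v) (Y v)" if "v \<in> V" "v \<noteq> i" for v using g(2)[OF that(1)] that by simp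
  define P where "P = diag (inc i) (\<lambda>a. g (opp a i))"
  have Pl: "lin P" unfolding P_def using g opp_V by (blast intro: lin_diag)
  have Pb: "bij_betw P (nbs i X) (nbs i Y)"
    unfolding P_def nbs_def using gb opp_V opp_neq by (blast intro: bij_betw_diag finite_inc)
  have Pg: "P x = g i x" if x: "x \<in> rX i X F i" for x
  proof -
    have gx: "g i x \<in> fam (inc i) (\<lambda>a. Y (opp a i))"
      using g(2)[OF iV] x unfolding bij_betw_def rX_same nbs_def by blast
    have xn: "x \<in> fam (inc i) (\<lambda>a. X (opp a i))" using x unfolding rX_same nbs_def by blast
    show ?thesis
    proof (rule fam_eqI[OF _ gx])
      show "P x \<in> fam (inc i) (\<lambda>a. Y (opp a i))" using Pb xn unfolding bij_betw_def nbs_def by blast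
      fix a assume a: "a \<in> inc i"
      have "up a (g i x) = g (opp a i) (up a x)"
        using com[OF inc_opp[OF a] rh_outward[OF i a]] x a opp_opp[OF a] unfolding rF_def by simp
      then show "up a (P x) = up a (g i x)" unfolding P_def using a by (simp add: up_diag)
    qed
  qed
  have ker: "sm i F x = 0 \<longleftrightarrow> sm i G (P x) = 0" if x: "x \<in> nbs i X" for x
  proof
    assume "sm i F x = 0"
    then have xr: "x \<in> rX i X F i" using x unfolding rX_same by blast
    then have "g i x \<in> rX i Y G i" using g(2)[OF iV] unfolding bij_betw_def by blast
    then show "sm i G (P x) = 0" using Pg[OF xr] unfolding rX_same by simp
  next
    assume "sm i G (P x) = 0"
    then have "P x \<in> rX i Y G i" using x Pb unfolding rX_same bij_betw_def by blast
    then obtain x' where x': "x' \<in> rX i X F i" "P x = g i x'" using g(2)[OF iV] unfolding bij_betw_def by blast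
    then have "P x = P x'" "x' \<in> nbs i X" "sm i F x' = 0" using Pg unfolding rX_same by auto
    then show "sm i F x = 0" using x Pb unfolding bij_betw_def inj_on_def by metis
  qed
  obtain gi where gi: "lin gi" "bij_betw gi (X i) (Y i)" "\<And>x. x \<in> nbs i X \<Longrightarrow> gi (sm i F x) = sm i G (P x)"
  proof (rule iso_along_maps[of "nbs i X" "X i" "Y i" "sm i F" "sm i G" P "nbs i Y"])
    show "subspace (nbs i X)" using nbs_dim(1)[OF X] fdim_subspaceD by blast
    show "P ` nbs i X = nbs i Y" using Pb unfolding bij_betw_def by blast
  qed (use repD(1)[OF X iV] repD(1)[OF Y iV] dim lin_sm[OF X] lin_sm[OF Y] Pl sm_nbs[OF X i] sm_nbs[OF Y i] ker in auto)
  show ?thesis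
    unfolding rep_iso_def
  proof (intro exI[of _ "g(i := gi)"] conjI ballI allI impI)
    fix v assume "v \<in> V"
    then show "lin ((g(i := gi)) v)" "bij_betw ((g(i := gi)) v) (X v) (Y v)"
      using g gb gi by (cases "v = i"; simp)+
  next
    fix j a x assume a: "a \<in> inc j" "h (opp a j) = h j + 1" and x: "x \<in> X (opp a j)"
    show "G a ((g(i := gi)) (opp a j) x) = (g(i := gi)) j (F a x)"
    proof (cases "j = i")
      case True
      have ia: "a \<in> inc i" using a True by simp
      have 0: "0 \<in> X (opp b i)" if "b \<in> inc i" for b
        using repD(1)[OF X opp_V[OF that]] fdim_subspaceD subspace_0 by blast
      have n: "ins a x \<in> nbs i X"
        unfolding nbs_def using ins_in_fam[OF finite_inc ia, of x "\<lambda>a. X (opp a i)"] x True 0 by simp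
      have s: "sm i H (ins a y) = H a y" if "\<And>b. b \<in> inc i \<Longrightarrow> lin (H b)" for H y
      proof -
        have "sm i H (ins a y) = (\<Sum>b\<in>inc i. if b = a then H a y else 0)"
          unfolding sm_def by (rule sum.cong) (auto simp: up_ins lin_0[OF that])
        then show ?thesis using ia by simp
      qed
      have Pi: "P (ins a x) = ins a (g (opp a i) x)"
      proof -
        have "P (ins a x) = (\<Sum>b\<in>inc i. if b = a then ins a (g (opp a i) x) else 0)"
          unfolding P_def diag_def by (rule sum.cong) (auto simp: up_ins lin_0[OF g(1)] lin_0[OF lin_ins] opp_V)
        then show ?thesis using ia by simp
      qed
      have "gi (F a x) = G a (g (opp a i) x)"
        using gi(3)[OF n] s repD(2)[OF X] repD(2)[OF Y] inc_A Pi by simp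
      then show ?thesis using True opp_neq[OF ia] by simp
    next
      case False
      show ?thesis
        using com[OF a(1) h_step(3)[OF i a False]] h_step[OF i a False] x False unfolding rF_def by simp
    qed
  qed
qed

subsection \<open>Decompositions\<close>

definition rep_dsum where
  "rep_dsum h X F T T' \<longleftrightarrow> rep h X F \<and> rep h T F \<and> rep h T' F \<and> (\<forall>v\<in>V. dsum (X v) (T v) (T' v))"

lemma nbs_dsum: "(\<And>v. v \<in> V \<Longrightarrow> dsum (X v) (T v) (T' v)) \<Longrightarrow> dsum (nbs i X) (nbs i T) (nbs i T')"
  unfolding nbs_def by (blast intro: dsum_fam opp_V finite_inc)

lemma rep_dsum_reflect:
  assumes D: "rep_dsum h X F T T'" and i: "sink h i"
  shows "rep_dsum (rh i h) (rX i X F) (rF i F) (rX i T F) (rX i T' F)"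
    "cok i X F = cok i T F + cok i T' F"
proof -
  have X: "rep h X F" and T: "rep h T F" and T': "rep h T' F"
    and d: "\<And>v. v \<in> V \<Longrightarrow> dsum (X v) (T v) (T' v)"
    using D unfolding rep_dsum_def by blast+
  have iV: "i \<in> V" using sinkD i by blast
  note N = nbs_dsum[of X T T' i, OF d]
  note sT = sm_nbs[OF T i] and sT' = sm_nbs[OF T' i]
  note ls = lin_sm[OF X, of i]
  have k: "dsum (rX i X F i) (rX i T F i) (rX i T' F i)"
  proof (rule dsumI)
    show "subspace (rX i T F i)" "subspace (rX i T' F i)" "subspace (rX i X F i)"
      using repD(1)[OF rep_reflect[OF T i] iV] repD(1)[OF rep_reflect[OF T' i] iV]
        repD(1)[OF rep_reflect[OF X i] iV] fdim_subspaceD by blast+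
    show "rX i T F i \<subseteq> rX i X F i" "rX i T' F i \<subseteq> rX i X F i"
      using dsum_subset[OF N] unfolding rX_same by blast+
    fix x assume "x \<in> rX i T F i" "x \<in> rX i T' F i"
    then show "x = 0" using N unfolding rX_same dsum_def by blast
  next
    fix x assume x: "x \<in> rX i X F i"
    then obtain a b where ab: "a \<in> nbs i T" "b \<in> nbs i T'" "x = a + b"
      using dsumE[OF N] unfolding rX_same by blast
    have "sm i F a + sm i F b = 0 + 0" using x ab ls unfolding rX_same by (simp add: lin_add)
    moreover have "sm i F a \<in> T i" "sm i F b \<in> T' i" using ab sT sT' by blast+
    ultimately have "sm i F a = 0" "sm i F b = 0"
      using dsum_unique[OF d[OF iV]] dsum_subspace[OF d[OF iV]] subspace_0 by metis+
    then show "\<exists>a\<in>rX i T F i. \<exists>b\<in>rX i T' F i. x = a + b" using ab unfolding rX_same by blast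
  qed
  have "dsum (rX i X F v) (rX i T F v) (rX i T' F v)" if "v \<in> V" for v
    using k d[OF that] by (cases "v = i") auto
  then show "rep_dsum (rh i h) (rX i X F) (rF i F) (rX i T F) (rX i T' F)"
    unfolding rep_dsum_def using rep_reflect[OF X i] rep_reflect[OF T i] rep_reflect[OF T' i] by blast
  have f: "fdim (sm i F ` nbs i T)" "fdim (sm i F ` nbs i T')"
    using fdim_image[OF _ ls] nbs_dim(1)[OF T] nbs_dim(1)[OF T'] by blast+
  have im: "dsum (sm i F ` nbs i X) (sm i F ` nbs i T) (sm i F ` nbs i T')"
  proof (rule dsumI)
    show "subspace (sm i F ` nbs i T)" "subspace (sm i F ` nbs i T')" using f fdim_subspaceD by blast+
    show "subspace (sm i F ` nbs i X)" using lin_subspace_image[OF ls] dsum_subspace(1)[OF N] by blast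
    show "sm i F ` nbs i T \<subseteq> sm i F ` nbs i X" "sm i F ` nbs i T' \<subseteq> sm i F ` nbs i X"
      using dsum_subset[OF N] by blast+
    fix x assume "x \<in> sm i F ` nbs i T" "x \<in> sm i F ` nbs i T'"
    then have "x \<in> T i \<inter> T' i" using sT sT' by blast
    then show "x = 0" using d[OF iV] unfolding dsum_def by blast
  next
    fix x assume "x \<in> sm i F ` nbs i X"
    then obtain a b where "a \<in> nbs i T" "b \<in> nbs i T'" "x = sm i F (a + b)"
      using dsumE[OF N] by blast
    then show "\<exists>a\<in>sm i F ` nbs i T. \<exists>b\<in>sm i F ` nbs i T'. x = a + b" using lin_add[OF ls] by blast
  qed
  have "dim (X i) = dim (T i) + dim (T' i)"
    using dim_dsum[OF d[OF iV]] repD(1)[OF T iV] repD(1)[OF T' iV] by blast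
  then show "cok i X F = cok i T F + cok i T' F"
    unfolding cok_def using dim_dsum(2)[OF im f] rank_le[OF T i] rank_le[OF T' i] by simp
qed

text \<open>
  The inverse reflection of a decomposition. At \<open>i\<close> the first summand is the image of
  its neighbours; the complement takes in all of the cokernel, so that the first summand acquires
  no simple direct summand at \<open>i\<close>.
\<close>

lemma rep_dsum_unreflect:
  assumes X: "rep h X F" and i: "sink h i"
    and D: "rep_dsum (rh i h) (rX i X F) (rF i F) T1 T1'"
  obtains T T' where "rep_dsum h X F T T'" "\<And>v. v \<in> V \<Longrightarrow> rX i T F v = T1 v" "sm i F ` nbs i T = T i"
proof -
  have T1: "rep (rh i h) T1 (rF i F)" and T1': "rep (rh i h) T1' (rF i F)"
    and d1: "\<And>v. v \<in> V \<Longrightarrow> dsum (rX i X F v) (T1 v) (T1' v)"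
    using D unfolding rep_dsum_def by blast+
  have iV: "i \<in> V" using sinkD i by blast
  note ls = lin_sm[OF X, of i]
  define N where "N = nbs i T1"
  define N' where "N' = nbs i T1'"
  have dn: "dsum (X (opp a i)) (T1 (opp a i)) (T1' (opp a i))" if "a \<in> inc i" for a
    using d1[OF opp_V[OF that]] opp_neq[OF that] by simp
  have NN: "dsum (nbs i X) N N'"
    unfolding N_def N'_def nbs_def by (rule dsum_fam) (use dn in auto)
  have fN: "fdim N" "fdim N'" unfolding N_def N'_def using nbs_dim(1)[OF T1] nbs_dim(1)[OF T1'] by blast+
  have upN: "x \<in> N" if x: "x \<in> U i" "x \<in> nbs i X" and U: "rep (rh i h) U (rF i F)" and NU: "N = nbs i U" for x U N
    unfolding NU nbs_def fam_def
  proof (intro CollectI conjI ballI)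
    fix a assume a: "a \<in> inc i"
    show "up a x \<in> U (opp a i)"
      using repD(3)[OF U inc_opp[OF a] rh_outward[OF i a]] x(1) opp_opp[OF a] a unfolding rF_def by auto
  next
    show "x = (\<Sum>a\<in>inc i. ins a (up a x))" using x(2) fam_eq_sum unfolding nbs_def by blast
  qed
  have k1: "T1 i \<subseteq> N" and k1': "T1' i \<subseteq> N'"
    using upN[OF _ _ T1 N_def] upN[OF _ _ T1' N'_def] dsum_subset[OF d1[OF iV]] unfolding rX_same by blast+
  have kerT: "{x \<in> N. sm i F x = 0} = T1 i" and sep: "\<And>x y. x \<in> N \<Longrightarrow> y \<in> N' \<Longrightarrow> sm i F x = sm i F y \<Longrightarrow> sm i F x = 0"
  proof -
    have split: "x \<in> T1 i \<and> - y \<in> T1' i" if xy: "x \<in> N" "y \<in> N'" "sm i F x = sm i F y" for x y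
    proof -
      have "x - y \<in> nbs i X" using subspace_diff[OF dsum_subspace(1)[OF NN]] xy(1,2) dsum_subset[OF NN] by blast
      then have "x - y \<in> rX i X F i" using xy ls unfolding rX_same by (simp add: lin_diff)
      then obtain p q where pq: "p \<in> T1 i" "q \<in> T1' i" "x - y = p + q" using dsumE[OF d1[OF iV]] by blast
      have e: "x + (- y) = p + q" "- y \<in> N'" using pq xy(2) subspace_neg[OF dsum_subspace(3)[OF NN]] by auto
      have "p \<in> N" "q \<in> N'" using pq k1 k1' by blast+
      then have "x = p" "- y = q" using dsum_unique[OF NN xy(1) e(2) _ _ e(1)] by simp_all
      then show ?thesis using pq by simp
    qed
    have z: "sm i F x = 0" if "x \<in> T1 i" for x using that dsum_subset[OF d1[OF iV]] unfolding rX_same by blast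
    show "{x \<in> N. sm i F x = 0} = T1 i"
    proof
      show "{x \<in> N. sm i F x = 0} \<subseteq> T1 i"
        using split[of _ 0] dsum_subspace(3)[OF NN] subspace_0 lin_0[OF ls] by auto
    qed (use k1 z in blast)
    show "sm i F x = 0" if "x \<in> N" "y \<in> N'" "sm i F x = sm i F y" for x y using split[OF that] z by blast
  qed
  have sN: "subspace (sm i F ` N)" "subspace (sm i F ` N')" "subspace (sm i F ` nbs i X)"
    using lin_subspace_image[OF ls] dsum_subspace[OF NN] by blast+
  have im: "dsum (sm i F ` nbs i X) (sm i F ` N) (sm i F ` N')"
  proof (rule dsumI[OF sN(1,2) _ _ sN(3)])
    show "sm i F ` N \<subseteq> sm i F ` nbs i X" "sm i F ` N' \<subseteq> sm i F ` nbs i X" using dsum_subset[OF NN] by blast+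
    show "x = 0" if "x \<in> sm i F ` N" "x \<in> sm i F ` N'" for x using sep that by blast
    fix x assume "x \<in> sm i F ` nbs i X"
    then obtain a b where "a \<in> N" "b \<in> N'" "x = sm i F (a + b)" using dsumE[OF NN] by blast
    then show "\<exists>a\<in>sm i F ` N. \<exists>b\<in>sm i F ` N'. x = a + b" using lin_add[OF ls] by blast
  qed
  obtain C where C: "dsum (X i) (sm i F ` nbs i X) C"
    using exists_complement[OF fdim_subspaceD[OF repD(1)[OF X iV]] sN(3) sm_nbs[OF X i]] .
  obtain Z where Z: "dsum (X i) (sm i F ` N) Z" "sm i F ` N' \<subseteq> Z" using dsum_assoc[OF C im] .
  define T where "T = T1(i := sm i F ` N)"
  define T' where "T' = T1'(i := Z)"
  have d: "dsum (X v) (T v) (T' v)" if "v \<in> V" for v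
    using d1[OF that] Z(1) unfolding T_def T'_def by (cases "v = i") auto
  have fd: "fdim (T v)" "fdim (T' v)" if "v \<in> V" for v
    using fdim_subset[OF repD(1)[OF X that]] dsum_subspace[OF d[OF that]] dsum_subset[OF d[OF that]] by blast+
  have sub: "rep h U F"
    if U: "U = U1(i := W)" "rep (rh i h) U1 (rF i F)" "sm i F ` nbs i U1 \<subseteq> W" "\<And>v. v \<in> V \<Longrightarrow> fdim (U v)" for U U1 W
    unfolding rep_def
  proof (intro conjI ballI allI impI)
    fix j a assume a: "a \<in> inc j" "h (opp a j) = h j + 1"
    show "F a ` U (opp a j) \<subseteq> U j"
    proof (cases "j = i")
      case True
      have ia: "a \<in> inc i" using a True by simp
      have 0: "0 \<in> U1 (opp b i)" if "b \<in> inc i" for b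
        using repD(1)[OF U(2) opp_V[OF that]] fdim_subspaceD subspace_0 by blast
      have s: "sm i F (ins a y) = F a y" for y
      proof -
        have "sm i F (ins a y) = (\<Sum>b\<in>inc i. if b = a then F a y else 0)"
          unfolding sm_def by (rule sum.cong) (auto simp: up_ins lin_0[OF repD(2)[OF X inc_A]])
        then show ?thesis using ia by simp
      qed
      have "ins a y \<in> nbs i U1" if "y \<in> U1 (opp a i)" for y
        unfolding nbs_def using ins_in_fam[OF finite_inc ia, of y "\<lambda>a. U1 (opp a i)"] that 0 by simp
      then have "F a y \<in> W" if "y \<in> U1 (opp a i)" for y using U(3) s that by (metis imageI subsetD)
      then show ?thesis using True U(1) opp_neq[OF ia] by auto
    next
      case False
      show ?thesis
        using repD(3)[OF U(2) a(1) h_step(3)[OF i a False]] h_step[OF i a False] False U(1) unfolding rF_def by auto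
    qed
  qed (use U(4) repD(2)[OF X] in auto)
  have TN: "nbs i T = N"
    unfolding N_def nbs_def T_def fam_def using opp_neq by auto
  show thesis
  proof (rule that[of T T'])
    show "rep_dsum h X F T T'"
      unfolding rep_dsum_def using X d sub[OF T_def T1 _ fd(1)] sub[OF T'_def T1' _ fd(2)] Z(2)
      unfolding N_def N'_def by blast
    show "rX i T F v = T1 v" if "v \<in> V" for v
      using kerT TN by (cases "v = i") (auto simp: rX_same T_def)
    show "sm i F ` nbs i T = T i" using TN unfolding T_def by simp
  qed
qed

text \<open>
  No arrow leaves a sink, so a vector at the sink spans a subrepresentation; if it lies outside
  the image of the neighbours, it can be split off.
\<close>

lemma simple_summand:
  assumes X: "rep h X F" and i: "sink h i" and c: "cok i X F \<noteq> 0"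
  obtains T T' where "rep_dsum h X F T T'" "\<And>v. v \<in> V \<Longrightarrow> dim (T v) = (if v = i then 1 else 0)"
proof -
  have iV: "i \<in> V" using sinkD i by blast
  let ?Z = "sm i F ` nbs i X"
  have Z: "subspace ?Z" using lin_subspace_image[OF lin_sm[OF X]] nbs_dim(1)[OF X] fdim_subspaceD by blast
  have "?Z \<noteq> X i" using c unfolding cok_def by auto
  then obtain c where c: "c \<in> X i" "c \<notin> ?Z" using sm_nbs[OF X i] by blast
  define W where "W = {x + y | x y. x \<in> span {c} \<and> y \<in> ?Z}"
  have sX: "subspace (X i)" using repD(1)[OF X iV] fdim_subspaceD by blast
  have cX: "span {c} \<subseteq> X i" using c sX by (simp add: span_minimal)
  have "span {c} \<inter> ?Z = {0}"
  proof -
    have "x = 0" if x: "x \<in> span {c}" "x \<in> ?Z" for x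
    proof (rule ccontr)
      obtain k where k: "x = k *s c" using x(1) by (auto simp: span_singleton)
      assume "x \<noteq> 0"
      then have "c = inverse k *s x" using k by simp
      then show False using c(2) x(2) Z subspace_scale by metis
    qed
    then show ?thesis using span_zero subspace_0[OF Z] by blast
  qed
  then have dW: "dsum W (span {c}) ?Z" unfolding dsum_def W_def using Z by auto
  have WX: "W \<subseteq> X i" unfolding W_def using cX sm_nbs[OF X i] subspace_add[OF sX] by blast
  obtain C where C: "dsum (X i) W C" using exists_complement[OF sX dsum_subspace(1)[OF dW] WX] .
  obtain Z' where Z': "dsum (X i) (span {c}) Z'" "?Z \<subseteq> Z'" using dsum_assoc[OF C dW] .
  define T where "T = (\<lambda>v. if v = i then span {c} else {0})"
  define T' where "T' = X(i := Z')"
  have d: "dsum (X v) (T v) (T' v)" if "v \<in> V" for v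
  proof (cases "v = i")
    case False
    have "subspace (X v)" using repD(1)[OF X that] fdim_subspaceD by blast
    then show ?thesis using False unfolding T_def T'_def dsum_def by (auto simp: subspace_0)
  qed (simp add: T_def T'_def Z'(1))
  have fd: "fdim (T v)" "fdim (T' v)" if "v \<in> V" for v
    using fdim_subset[OF repD(1)[OF X that]] dsum_subspace[OF d[OF that]] dsum_subset[OF d[OF that]] by blast+
  have ns: "\<not> h i = h j + 1" if "a \<in> inc j" "opp a j = i" for a j
    using sinkD(2)[OF i, of a] inc_opp[OF that(1)] opp_opp[OF that(1)] that(2) by auto
  have 1: "rep h T F"
    unfolding rep_def
  proof (intro conjI ballI allI impI)
    fix j a assume a: "a \<in> inc j" "h (opp a j) = h j + 1"
    then have "opp a j \<noteq> i" using ns by auto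
    then show "F a ` T (opp a j) \<subseteq> T j"
      using lin_0[OF repD(2)[OF X inc_A[OF a(1)]]] span_zero unfolding T_def by auto
  qed (use fd repD(2)[OF X] in auto)
  have 2: "rep h T' F"
    unfolding rep_def
  proof (intro conjI ballI allI impI)
    fix j a assume a: "a \<in> inc j" "h (opp a j) = h j + 1"
    then have ne: "opp a j \<noteq> i" using ns by auto
    show "F a ` T' (opp a j) \<subseteq> T' j"
    proof (cases "j = i")
      case True
      have ia: "a \<in> inc i" using a True by simp
      have 0: "0 \<in> X (opp b i)" if "b \<in> inc i" for b
        using repD(1)[OF X opp_V[OF that]] fdim_subspaceD subspace_0 by blast
      have s: "sm i F (ins a y) = F a y" for y
      proof -
        have "sm i F (ins a y) = (\<Sum>b\<in>inc i. if b = a then F a y else 0)"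
          unfolding sm_def by (rule sum.cong) (auto simp: up_ins lin_0[OF repD(2)[OF X inc_A]])
        then show ?thesis using ia by simp
      qed
      have "ins a y \<in> nbs i X" if "y \<in> X (opp a i)" for y
        unfolding nbs_def using ins_in_fam[OF finite_inc ia, of y "\<lambda>a. X (opp a i)"] that 0 by simp
      then have "F a y \<in> Z'" if "y \<in> X (opp a i)" for y using Z'(2) s that by (metis imageI subsetD)
      then show ?thesis using True ne unfolding T'_def by auto
    next
      case False
      then show ?thesis using ne repD(3)[OF X a] unfolding T'_def by auto
    qed
  qed (use fd repD(2)[OF X] in auto)
  have "independent {c}" using c subspace_0[OF Z] by auto
  then have "dim (span {c}) = 1" using dim_span_eq_card_independent by fastforce
  then have "dim (T v) = (if v = i then 1 else 0)" for v unfolding T_def by simp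
  then show thesis using that 1 2 d X unfolding rep_dsum_def by blast
qed

end

section \<open>Sequences of reflections\<close>

context quiver_reps begin

subsection \<open>Reflections of dimension vectors\<close>

definition dv :: "('v \<Rightarrow> 'w set) \<Rightarrow> 'v \<Rightarrow> int" where
  "dv X = (\<lambda>v. if v \<in> V then int (dim (X v)) else 0)"

text \<open>
  On dimension vectors the functor is the simple reflection, up to the copies of the simple
  representation that it deletes.
\<close>

lemma dv_reflect:
  assumes "rep h X F" "sink h i"
  shows "dv (rX i X F) = (\<lambda>v. reflect i (dv X) v + int (cok i X F) * unit_vec i v)"
proof
  fix v
  have "i \<in> V" using assms sinkD by blast
  have *: "(\<Sum>a\<in>inc i. dv X (opp a i)) = int (\<Sum>a\<in>inc i. dim (X (opp a i)))"
    unfolding of_nat_sum by (rule sum.cong) (use opp_V in \<open>auto simp: dv_def\<close>)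
  show "dv (rX i X F) v = reflect i (dv X) v + int (cok i X F) * unit_vec i v"
  proof (cases "v = i")
    case True
    have "int (dim (rX i X F i)) + int (dim (X i)) = (\<Sum>a\<in>inc i. int (dim (X (opp a i)))) + int (cok i X F)"
      using arg_cong[OF dim_reflect[OF assms], of int] by simp
    then show ?thesis using True \<open>i \<in> V\<close> * by (simp add: reflect_at unit_vec_def dv_def)
  qed (simp add: reflect_other unit_vec_def dv_def)
qed

subsection \<open>The reflection sequence\<close>

definition graded :: "('v \<Rightarrow> int) \<Rightarrow> bool" where
  "graded h \<longleftrightarrow> (\<forall>a\<in>A. \<bar>h (tl a) - h (hd a)\<bar> = 1)"

text \<open>
  A vertex of minimal height is a sink. Always choosing such a vertex makes the sequence of
  reflections explicit and lets every vertex recur.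
\<close>

definition pick :: "('v \<Rightarrow> int) \<Rightarrow> 'v" where
  "pick h = (SOME i. i \<in> V \<and> (\<forall>v\<in>V. h i \<le> h v))"

primrec hs :: "('v \<Rightarrow> int) \<Rightarrow> nat \<Rightarrow> 'v \<Rightarrow> int" where
  "hs h 0 = h"
| "hs h (Suc k) = rh (pick (hs h k)) (hs h k)"

abbreviation ik :: "('v \<Rightarrow> int) \<Rightarrow> nat \<Rightarrow> 'v" where
  "ik h k \<equiv> pick (hs h k)"

primrec Fs :: "('v \<Rightarrow> int) \<Rightarrow> ('e \<Rightarrow> 'w \<Rightarrow> 'w) \<Rightarrow> nat \<Rightarrow> 'e \<Rightarrow> 'w \<Rightarrow> 'w" where
  "Fs h F 0 = F"
| "Fs h F (Suc k) = rF (ik h k) (Fs h F k)"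

primrec Xs :: "('v \<Rightarrow> int) \<Rightarrow> ('v \<Rightarrow> 'w set) \<Rightarrow> ('e \<Rightarrow> 'w \<Rightarrow> 'w) \<Rightarrow> nat \<Rightarrow> 'v \<Rightarrow> 'w set" where
  "Xs h X F 0 = X"
| "Xs h X F (Suc k) = rX (ik h k) (Xs h X F k) (Fs h F k)"

definition top_mult :: "('v \<Rightarrow> int) \<Rightarrow> ('v \<Rightarrow> 'w set) \<Rightarrow> ('e \<Rightarrow> 'w \<Rightarrow> 'w) \<Rightarrow> nat \<Rightarrow> nat" where
  "top_mult h X F k = cok (ik h k) (Xs h X F k) (Fs h F k)"

lemma pick_min:
  assumes "V \<noteq> {}" shows "pick h \<in> V" "v \<in> V \<Longrightarrow> h (pick h) \<le> h v"
proof -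
  have "\<exists>i\<in>V. \<forall>v\<in>V. h i \<le> h v"
    by (rule bexI[of _ "arg_min_on h V"]) (use arg_min_least[OF finV assms] arg_min_if_finite(1)[OF finV assms] in auto)
  then have "pick h \<in> V \<and> (\<forall>v\<in>V. h (pick h) \<le> h v)"
    unfolding pick_def Bex_def by (rule someI_ex)
  then show "pick h \<in> V" "v \<in> V \<Longrightarrow> h (pick h) \<le> h v" by simp_all
qed

lemma graded_inc: "graded h \<Longrightarrow> a \<in> inc i \<Longrightarrow> h (opp a i) = h i + 1 \<or> h (opp a i) = h i - 1"
  unfolding graded_def inc_def opp_def by (auto simp: abs_if split: if_splits)

lemma sink_pick: assumes "V \<noteq> {}" "graded h" shows "sink h (pick h)"
  unfolding sink_def using pick_min(1)[OF assms(1), of h] pick_min(2)[OF assms(1), where h = h] graded_inc[OF assms(2)] opp_V by fastforce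

lemma graded_rh:
  assumes g: "graded h" and i: "sink h i" shows "graded (rh i h)"
  unfolding graded_def
proof
  fix a assume a: "a \<in> A"
  have "\<bar>h (tl a) - h (hd a)\<bar> = 1" using g a unfolding graded_def by blast
  moreover have "h (hd a) = h i + 1" if "tl a = i" using sinkD(2)[OF i, of a] that a unfolding inc_def opp_def by auto
  moreover have "h (tl a) = h i + 1" if "hd a = i"
    using sinkD(2)[OF i, of a] that a no_loop[OF a] unfolding inc_def opp_def by auto
  ultimately show "\<bar>rh i h (tl a) - rh i h (hd a)\<bar> = 1" unfolding rh_def using no_loop[OF a] by auto
qed

lemma hs_shift: "hs h (m + k) = hs (hs h m) k"
  by (induction k) auto

text \<open>
  While \<open>v\<close> is passed over, only vertices of height at most that of \<open>v\<close>
  are raised, and this can happen only finitely often.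
\<close>

lemma pick_recurrent:
  assumes V: "V \<noteq> {}" and v: "v \<in> V"
  shows "\<exists>k'\<ge>k. ik h k' = v"
proof (rule ccontr)
  assume no: "\<not> (\<exists>k'\<ge>k. ik h k' = v)"
  define b where "b = hs h k v"
  have const: "hs h (k + m) v = b" for m
  proof (induction m)
    case (Suc m)
    have "ik h (k + m) \<noteq> v" using no by auto
    then show ?case using Suc by (simp add: rh_def)
  qed (simp add: b_def)
  define \<Phi> where "\<Phi> m = (\<Sum>u\<in>V. nat (b + 1 - hs h (k + m) u))" for m
  have dec: "\<Phi> (Suc m) < \<Phi> m" for m
    unfolding \<Phi>_def
  proof (rule sum_strict_mono_ex1[OF finV])
    let ?i = "ik h (k + m)"
    have "hs h (k + m) ?i \<le> b" using pick_min(2)[OF V v, of "hs h (k + m)"] const by simp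
    then show "\<exists>a\<in>V. nat (b + 1 - hs h (k + Suc m) a) < nat (b + 1 - hs h (k + m) a)"
      by (intro bexI[of _ ?i] pick_min V) (simp add: rh_def)
  qed (auto simp: rh_def)
  have "\<Phi> m + m \<le> \<Phi> 0" for m
  proof (induction m)
    case (Suc m) then show ?case using dec[of m] by simp
  qed simp
  from this[of "Suc (\<Phi> 0)"] show False by simp
qed

context
  fixes h :: "'v \<Rightarrow> int"
  assumes V: "V \<noteq> {}" and h: "graded h"
begin

lemma sink_ik: "sink (hs h k) (ik h k) \<and> graded (hs h k)"
proof (induction k)
  case (Suc k)
  then have "graded (hs h (Suc k))" using graded_rh by simp
  then show ?case using sink_pick[OF V] by blast
qed (use sink_pick V h in simp)

lemma rep_Xs: "rep h X F \<Longrightarrow> rep (hs h k) (Xs h X F k) (Fs h F k)"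
  by (induction k) (auto intro: rep_reflect simp: sink_ik)

lemma mult_iso:
  assumes "rep h X F" "rep h Y G" "rep_iso h X F Y G"
  shows "top_mult h X F k = top_mult h Y G k"
proof -
  have iso: "rep_iso (hs h k) (Xs h X F k) (Fs h F k) (Xs h Y G k) (Fs h G k)" for k
  proof (induction k)
    case (Suc k)
    then show ?case using rep_iso_reflect(1)[OF rep_Xs[OF assms(1)] rep_Xs[OF assms(2)]] sink_ik by simp
  qed (use assms in simp)
  show ?thesis unfolding top_mult_def
    using rep_iso_reflect(2)[OF rep_Xs[OF assms(1)] rep_Xs[OF assms(2)] _ iso] sink_ik by blast
qed

lemma mult_dsum:
  assumes "rep_dsum h X F T T'"
  shows "top_mult h X F k = top_mult h T F k + top_mult h T' F k"
proof -
  have "rep_dsum (hs h k) (Xs h X F k) (Fs h F k) (Xs h T F k) (Xs h T' F k)" for k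
  proof (induction k)
    case (Suc k)
    then show ?case using rep_dsum_reflect(1) sink_ik by simp
  qed (use assms in simp)
  then show ?thesis unfolding top_mult_def using rep_dsum_reflect(2) sink_ik by blast
qed

subsection \<open>Roots\<close>

primrec rw :: "nat \<Rightarrow> nat \<Rightarrow> ('v \<Rightarrow> int) \<Rightarrow> 'v \<Rightarrow> int" where
  "rw j 0 \<alpha> = \<alpha>"
| "rw j (Suc n) \<alpha> = reflect (ik h j) (rw (Suc j) n \<alpha>)"

text \<open>
  The vector \<open>s\<^bsub>i0\<^esub> ... s\<^bsub>ik-1\<^esub> e\<^bsub>ik\<^esub>\<close> for
  the sequence of sinks \<open>i0, i1, ...\<close>; here \<open>rw j n\<close> is the product of
  the \<open>n\<close> simple reflections starting with the \<open>j\<close>-th.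
\<close>

definition beta :: "nat \<Rightarrow> 'v \<Rightarrow> int" where
  "beta k = rw 0 k (unit_vec (ik h k))"

text \<open>
  The steps at which at least one representation loses a simple summand. For a Dynkin quiver they
  correspond to the indecomposable representations.
\<close>

definition active :: "nat set" where
  "active = {k. \<exists>X F. rep h X F \<and> top_mult h X F k \<noteq> 0}"

lemma rw_add: "rw j (m + n) \<alpha> = rw j m (rw (j + m) n \<alpha>)"
  by (induction m arbitrary: j) simp_all

lemma rw_inj: "rw j n \<alpha> = rw j n \<beta> \<Longrightarrow> \<alpha> = \<beta>"
proof (induction n arbitrary: j)
  case (Suc n)
  then show ?case by (metis reflect_reflect rw.simps(2))
qed simp

text \<open>
  A simple summand present at step \<open>k\<close> is carried back one reflection at a time. The
  last clause records that the transported summand is generated by the neighbours at the sink, so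
  that its dimension vector changes by the simple reflection alone.
\<close>

lemma summand_transport:
  assumes X: "rep h X F" and c: "top_mult h X F k \<noteq> 0" and n: "n \<le> k"
  shows "\<exists>T T'. rep_dsum (hs h (k - n)) (Xs h X F (k - n)) (Fs h F (k - n)) T T' \<and>
    dv T = rw (k - n) n (unit_vec (ik h k)) \<and>
    (n > 0 \<longrightarrow> sm (ik h (k - n)) (Fs h F (k - n)) ` nbs (ik h (k - n)) T = T (ik h (k - n)))"
  using n
proof (induction n)
  case 0
  obtain T T' where T: "rep_dsum (hs h k) (Xs h X F k) (Fs h F k) T T'"
    "\<And>v. v \<in> V \<Longrightarrow> dim (T v) = (if v = ik h k then 1 else 0)"
    using simple_summand[OF rep_Xs[OF X] _ c[unfolded top_mult_def]] sink_ik by blast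
  have "ik h k \<in> V" using pick_min V by blast
  then have "dv T = unit_vec (ik h k)" using T(2) unfolding dv_def unit_vec_def by auto
  then show ?case using T(1) by auto
next
  case (Suc n)
  define j where "j = k - Suc n"
  have j: "k - n = Suc j" using Suc j_def by simp
  obtain T1 T1' where T1: "rep_dsum (hs h (Suc j)) (Xs h X F (Suc j)) (Fs h F (Suc j)) T1 T1'"
    "dv T1 = rw (Suc j) n (unit_vec (ik h k))" using Suc j by auto
  let ?i = "ik h j"
  have s: "sink (hs h j) ?i" using sink_ik by blast
  obtain T T' where T: "rep_dsum (hs h j) (Xs h X F j) (Fs h F j) T T'"
    "\<And>v. v \<in> V \<Longrightarrow> rX ?i T (Fs h F j) v = T1 v" "sm ?i (Fs h F j) ` nbs ?i T = T ?i"
    using rep_dsum_unreflect[OF rep_Xs[OF X] s T1(1)[unfolded hs.simps Xs.simps Fs.simps]] by metis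
  have r: "rep (hs h j) T (Fs h F j)" using T(1) unfolding rep_dsum_def by blast
  have "cok ?i T (Fs h F j) = 0" unfolding cok_def using T(3) by simp
  then have "dv (rX ?i T (Fs h F j)) = reflect ?i (dv T)" using dv_reflect[OF r s] by simp
  moreover have "dv (rX ?i T (Fs h F j)) = dv T1" using T(2) unfolding dv_def by auto
  ultimately have "dv T = reflect ?i (dv T1)" by (metis reflect_reflect)
  then have "dv T = rw j (Suc n) (unit_vec (ik h k))" using T1(2) by simp
  then show ?case using T j_def by auto
qed

lemma beta_nonneg: assumes "k \<in> active" shows "beta k v \<ge> 0"
proof -
  obtain X F where X: "rep h X F" "top_mult h X F k \<noteq> 0" using assms unfolding active_def by blast
  obtain T where "dv T = rw 0 k (unit_vec (ik h k))" using summand_transport[OF X, of k] by auto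
  then show ?thesis unfolding beta_def by (metis dv_def of_nat_0_le_iff order_refl)
qed

text \<open>
  If \<open>beta k = beta l\<close> with \<open>k < l\<close>, then the summand coming from step
  \<open>l\<close> has at step \<open>k\<close> the dimension vector of the simple representation
  at the sink. But it is generated by its neighbours there, which are zero.
\<close>

lemma inj_beta: "inj_on beta active"
proof (rule linorder_inj_onI')
  fix k l assume kl: "k \<in> active" "l \<in> active" "k < l"
  show "beta k \<noteq> beta l"
  proof
    assume eq: "beta k = beta l"
    let ?i = "ik h k"
    have iV: "?i \<in> V" using pick_min V by blast
    obtain X F where X: "rep h X F" "top_mult h X F l \<noteq> 0" using kl unfolding active_def by blast
    have "l - (l - k) = k" "l - k \<le> l" "l - k > 0" using kl by auto
    then obtain T where T: "dv T = rw k (l - k) (unit_vec (ik h l))" "rep (hs h k) T (Fs h F k)"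
      "sm ?i (Fs h F k) ` nbs ?i T = T ?i"
      using summand_transport[OF X, of "l - k"] unfolding rep_dsum_def by auto
    have "rw 0 k (unit_vec ?i) = rw 0 k (rw k (l - k) (unit_vec (ik h l)))"
      using eq rw_add[of 0 k "l - k"] kl(3) unfolding beta_def by simp
    then have u: "dv T = unit_vec ?i" using rw_inj T(1) by metis
    have "dim (T (opp a ?i)) = 0" if "a \<in> inc ?i" for a
      using fun_cong[OF u, of "opp a ?i"] opp_V[OF that] opp_neq[OF that] unfolding dv_def unit_vec_def by simp
    then have "dim (nbs ?i T) = 0" using nbs_dim(2)[OF T(2)] by simp
    then have "nbs ?i T = {0}" using fdim_dim_0 nbs_dim(1)[OF T(2)] by blast
    then have "T ?i = {0}" using T(3) lin_0[OF lin_sm[OF T(2)]] by auto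
    then show False using fun_cong[OF u, of ?i] iV unfolding dv_def unit_vec_def by simp
  qed
qed

subsection \<open>Completeness\<close>

text \<open>
  Backwards induction from a step at which both representations have been reflected to zero. The
  multiplicity at each step supplies the dimension at the sink, which the kernel does not
  determine.
\<close>

lemma iso_of_mult_eq:
  assumes X: "rep h X F" and Y: "rep h Y G" and eq: "\<And>k. top_mult h X F k = top_mult h Y G k"
    and zX: "\<And>v. v \<in> V \<Longrightarrow> dim (Xs h X F n v) = 0" and zY: "\<And>v. v \<in> V \<Longrightarrow> dim (Xs h Y G n v) = 0"
  shows "rep_iso h X F Y G"
proof -
  have "rep_iso (hs h (n - m)) (Xs h X F (n - m)) (Fs h F (n - m)) (Xs h Y G (n - m)) (Fs h G (n - m))"
    if "m \<le> n" for m
    using that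
  proof (induction m)
    case 0
    note rX = rep_Xs[OF X, of n] and rY = rep_Xs[OF Y, of n]
    have z: "Xs h X F n v = {0}" "Xs h Y G n v = {0}" if "v \<in> V" for v
      using fdim_dim_0 repD(1)[OF rX that] repD(1)[OF rY that] zX[OF that] zY[OF that] by blast+
    show ?case
      unfolding rep_iso_def
      by (rule exI[of _ "\<lambda>_ x. x"])
        (use z opp_V inc_A in \<open>auto simp: lin_ident bij_betw_def lin_0[OF repD(2)[OF rX]] lin_0[OF repD(2)[OF rY]]\<close>)
  next
    case (Suc m)
    define j where "j = n - Suc m"
    have j: "n - m = Suc j" using Suc j_def by simp
    let ?i = "ik h j"
    note rX = rep_Xs[OF X, of j] and rY = rep_Xs[OF Y, of j]
    have s: "sink (hs h j) ?i" using sink_ik by blast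
    have iso: "rep_iso (rh ?i (hs h j)) (rX ?i (Xs h X F j) (Fs h F j)) (rF ?i (Fs h F j))
       (rX ?i (Xs h Y G j) (Fs h G j)) (rF ?i (Fs h G j))"
      using Suc j by simp
    have d: "dim (rX ?i (Xs h X F j) (Fs h F j) v) = dim (rX ?i (Xs h Y G j) (Fs h G j) v)" if v: "v \<in> V" for v
    proof -
      obtain g where "lin (g v)" "bij_betw (g v) (rX ?i (Xs h X F j) (Fs h F j) v) (rX ?i (Xs h Y G j) (Fs h G j) v)"
        using iso v unfolding rep_iso_def by blast
      then show ?thesis using dim_inj_image[OF repD(1)[OF rep_reflect[OF rX s] v]] unfolding bij_betw_def by metis
    qed
    have "(\<Sum>a\<in>inc ?i. dim (Xs h X F j (opp a ?i))) = (\<Sum>a\<in>inc ?i. dim (Xs h Y G j (opp a ?i)))"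
    proof (rule sum.cong)
      fix a assume a: "a \<in> inc ?i"
      show "dim (Xs h X F j (opp a ?i)) = dim (Xs h Y G j (opp a ?i))" using d[OF opp_V[OF a]] opp_neq[OF a] by simp
    qed simp
    moreover have "?i \<in> V" using s sinkD by blast
    ultimately have "dim (Xs h X F j ?i) = dim (Xs h Y G j ?i)"
      using dim_reflect[OF rX s] dim_reflect[OF rY s] d[of ?i] eq[of j] unfolding top_mult_def by simp
    then show ?case using rep_iso_of_reflections[OF rX rY s iso] j_def by simp
  qed
  from this[of n] show ?thesis by simp
qed

end

text \<open>
  Nonnegative vectors cannot be reflected forever. The form is invariant, so by coercivity the
  vectors \<open>d k\<close> are bounded. Let \<open>S n v\<close> be the sum of the values of
  \<open>d\<close> at \<open>v\<close> over the steps before \<open>n\<close> that reflect at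
  \<open>v\<close>. Its pairing with a simple root telescopes to a difference of the bounded
  quantities \<open>A0\<close>, hence \<open>form (S n) (S n)\<close> grows at most linearly in
  \<open>S n\<close>. Coercivity makes it grow quadratically, so \<open>S n\<close> is bounded,
  and only finitely many values are nonzero at their own step.
\<close>

lemma reflection_sequence_vanishes:
  assumes V: "V \<noteq> {}" and h: "graded h" and C: "C > 0"
    and coercive: "\<And>\<alpha>. (\<Sum>v\<in>V. (\<alpha> v)\<^sup>2) \<le> C * form \<alpha> \<alpha>"
    and nonneg: "\<And>k v. d k v \<ge> 0"
    and step: "\<And>k. d (Suc k) = reflect (ik h k) (d k)"
  shows "\<exists>n. \<forall>v\<in>V. d n v = 0"
proof -
  note sik = sink_ik[OF V h]
  have iV: "ik h k \<in> V" for k using pick_min V by blast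
  define R where "R = C * form (d 0) (d 0)"
  have q: "form (d k) (d k) = form (d 0) (d 0)" for k
    by (induction k) (simp_all add: step form_reflect iV)
  have dR: "d k v \<le> R" if "v \<in> V" for k v
  proof -
    have "d k v \<le> (d k v)\<^sup>2" using nonneg[of k v] by (cases "d k v = 0") (auto simp: power2_eq_square mult_le_cancel_left1)
    also have "\<dots> \<le> (\<Sum>v\<in>V. (d k v)\<^sup>2)" by (rule member_le_sum) (use that finV in auto)
    also have "\<dots> \<le> R" using coercive[of "d k"] unfolding q[of k] R_def .
    finally show ?thesis .
  qed
  have R0: "R \<ge> 0" using dR[OF iV] nonneg order_trans by blast
  define S where "S n v = (\<Sum>k<n. if ik h k = v then d k v else 0)" for n v
  (* the arrows at v that act out of v at step k *)
  define low where "low k v = {a \<in> inc v. hs h k (opp a v) < hs h k v}" for k v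
  define A0 where "A0 k v = d k v - (\<Sum>a\<in>low k v. d k (opp a v))" for k v
  have prS: "pairing (S n) v = A0 0 v - A0 n v" for n v
  proof (induction n)
    case 0 show ?case by (simp add: S_def pairing_def)
  next
    case (Suc n)
    let ?i = "ik h n"
    let ?y = "d n ?i"
    have s: "sink (hs h n) ?i" using sik by blast
    have SS: "S (Suc n) u = S n u + (if ?i = u then ?y else 0)" for u unfolding S_def by simp
    have "pairing (S (Suc n)) v = pairing (S n) v + (2 * (if ?i = v then ?y else 0) - (\<Sum>a\<in>inc v. if ?i = opp a v then ?y else 0))"
      unfolding pairing_def SS by (simp add: sum.distrib algebra_simps)
    moreover have "A0 n v - A0 (Suc n) v = 2 * (if ?i = v then ?y else 0) - (\<Sum>a\<in>inc v. if ?i = opp a v then ?y else 0)"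
    proof (cases "v = ?i")
      case True
      have l1: "low n v = {}" unfolding low_def True using sinkD(2)[OF s] by auto
      have l2: "low (Suc n) v = inc v"
        unfolding low_def True using sinkD(2)[OF s] opp_neq by (auto simp: rh_def)
      have "(\<Sum>a\<in>inc v. d (Suc n) (opp a v)) = (\<Sum>a\<in>inc v. d n (opp a v))"
        by (rule sum.cong) (use True opp_neq step reflect_other in auto)
      moreover have "(\<Sum>a\<in>inc v. if ?i = opp a v then ?y else 0) = 0"
      proof (rule sum.neutral, rule ballI)
        fix a assume "a \<in> inc v"
        then show "(if ?i = opp a v then ?y else 0) = 0" using opp_neq[of a v] True by auto
      qed
      ultimately show ?thesis unfolding A0_def l1 l2 using True by (simp add: step reflect_at)
    next
      case False
      have l: "low n v = low (Suc n) v \<union> {a \<in> inc v. opp a v = ?i}"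
        "low (Suc n) v \<inter> {a \<in> inc v. opp a v = ?i} = {}"
      proof -
        have "hs h n ?i < hs h n v \<and> \<not> hs h (Suc n) ?i < hs h (Suc n) v" if "a \<in> inc v" "opp a v = ?i" for a
          using sinkD(2)[OF s, of a] inc_opp[OF that(1)] opp_opp[OF that(1)] that(2) False by (auto simp: rh_def)
        moreover have "hs h n (opp a v) < hs h n v \<longleftrightarrow> hs h (Suc n) (opp a v) < hs h (Suc n) v"
          if "a \<in> inc v" "opp a v \<noteq> ?i" for a using that False by (simp add: rh_def)
        ultimately show "low n v = low (Suc n) v \<union> {a \<in> inc v. opp a v = ?i}"
          "low (Suc n) v \<inter> {a \<in> inc v. opp a v = ?i} = {}"
          unfolding low_def by fastforce+
      qed
      have "(\<Sum>a\<in>low n v. d n (opp a v)) = (\<Sum>a\<in>low (Suc n) v. d n (opp a v)) + (\<Sum>a\<in>{a \<in> inc v. opp a v = ?i}. d n (opp a v))"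
        unfolding l(1) by (rule sum.union_disjoint) (use l(2) in \<open>auto simp: low_def\<close>)
      moreover have "(\<Sum>a\<in>low (Suc n) v. d n (opp a v)) = (\<Sum>a\<in>low (Suc n) v. d (Suc n) (opp a v))"
      proof (rule sum.cong)
        fix a assume a: "a \<in> low (Suc n) v"
        then have "opp a v \<noteq> ?i" using l(2) unfolding low_def by blast
        then show "d n (opp a v) = d (Suc n) (opp a v)" by (simp add: step reflect_other)
      qed simp
      moreover have "(\<Sum>a\<in>{a \<in> inc v. opp a v = ?i}. d n (opp a v)) = (\<Sum>a\<in>inc v. if ?i = opp a v then ?y else 0)"
        by (subst sum.inter_filter[OF finite_inc]) (rule sum.cong, auto)
      ultimately show ?thesis unfolding A0_def using False by (simp add: step reflect_other)
    qed
    ultimately show ?case using Suc by simp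
  qed
  define R' where "R' = R * (1 + int (card A))"
  have sumlow: "0 \<le> (\<Sum>a\<in>low k v. d k (opp a v))" "(\<Sum>a\<in>low k v. d k (opp a v)) \<le> R * int (card A)" for k v
  proof -
    show "0 \<le> (\<Sum>a\<in>low k v. d k (opp a v))" by (rule sum_nonneg) (rule nonneg)
    have "(\<Sum>a\<in>low k v. d k (opp a v)) \<le> (\<Sum>a\<in>low k v. R)" by (rule sum_mono) (use dR opp_V in \<open>auto simp: low_def\<close>)
    also have "\<dots> = R * int (card (low k v))" by simp
    also have "\<dots> \<le> R * int (card A)"
      by (rule mult_left_mono) (use R0 in \<open>auto intro!: card_mono finA simp: low_def inc_def\<close>)
    finally show "(\<Sum>a\<in>low k v. d k (opp a v)) \<le> R * int (card A)" .
  qed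
  have prb: "pairing (S n) v \<le> R'" if "v \<in> V" for n v
    using sumlow(1)[of 0 v] sumlow(2)[of n v] dR[OF that, of 0] nonneg[of n v]
    unfolding prS A0_def R'_def by (simp add: algebra_simps)
  have S0: "S n v \<ge> 0" for n v unfolding S_def using nonneg by (auto intro: sum_nonneg)
  define M where "M = C * R'"
  have "R' \<ge> 0" unfolding R'_def using R0 by simp
  then have M0: "M \<ge> 0" unfolding M_def using C by simp
  have SM: "(\<Sum>v\<in>V. (S n v)\<^sup>2) \<le> M * (\<Sum>v\<in>V. S n v)" for n
  proof -
    have "form (S n) (S n) \<le> (\<Sum>v\<in>V. S n v * R')"
      unfolding form_eq_pairing by (rule sum_mono) (use prb S0 mult_left_mono in blast)
    then have "form (S n) (S n) \<le> R' * (\<Sum>v\<in>V. S n v)" by (simp add: sum_distrib_left mult.commute)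
    then have "C * form (S n) (S n) \<le> C * (R' * (\<Sum>v\<in>V. S n v))" using C by (intro mult_left_mono) auto
    then show ?thesis using coercive[of "S n"] unfolding M_def by simp
  qed
  (* an entry above L contradicts SM, as each of the other entries contributes at least -
     M\<^sup>2 *)
  define L where "L = M + int (card V) * M\<^sup>2"
  have Sb: "S n w \<le> L" if w: "w \<in> V" for n w
  proof (rule ccontr)
    assume "\<not> S n w \<le> L"
    then have big: "S n w > L" by simp
    have each: "- M\<^sup>2 \<le> (S n v)\<^sup>2 - M * S n v" for v
    proof -
      have "0 \<le> (S n v - M)\<^sup>2 + M * S n v" using M0 S0[of n v] by simp
      then show ?thesis by (simp add: power2_diff algebra_simps)
    qed
    have "(S n w)\<^sup>2 - M * S n w - (\<Sum>v\<in>V - {w}. M\<^sup>2) \<le> (S n w)\<^sup>2 - M * S n w + (\<Sum>v\<in>V - {w}. (S n v)\<^sup>2 - M * S n v)"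
      using sum_mono[of "V - {w}" "\<lambda>_. - M\<^sup>2" "\<lambda>v. (S n v)\<^sup>2 - M * S n v"] each by (simp add: sum_negf)
    also have "\<dots> = (\<Sum>v\<in>V. (S n v)\<^sup>2 - M * S n v)" by (rule sum.remove[OF finV w, symmetric])
    also have "\<dots> \<le> 0" using SM[of n] by (simp add: sum_subtractf sum_distrib_left)
    finally have "S n w * (S n w - M) \<le> (\<Sum>v\<in>V - {w}. M\<^sup>2)" by (simp add: power2_eq_square algebra_simps)
    also have "\<dots> \<le> int (card V) * M\<^sup>2" using finV w by (simp add: mult_right_mono)
    finally have 1: "S n w * (S n w - M) \<le> int (card V) * M\<^sup>2" .
    have 2: "S n w - M > int (card V) * M\<^sup>2" using big unfolding L_def by simp
    then have "S n w - M > 0" by (smt (verit) mult_nonneg_nonneg of_nat_0_le_iff zero_le_power2)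
    then have "S n w - M \<le> S n w * (S n w - M)" using M0 by (simp add: mult_le_cancel_right1)
    then show False using 1 2 by simp
  qed
  have tot: "(\<Sum>k<n. d k (ik h k)) \<le> int (card V) * L" for n
  proof -
    have "(\<Sum>k<n. d k (ik h k)) = (\<Sum>k<n. \<Sum>v\<in>V. if ik h k = v then d k v else 0)"
      by (rule sum.cong) (use iV finV in auto)
    also have "\<dots> = (\<Sum>v\<in>V. S n v)" unfolding S_def by (rule sum.swap)
    also have "\<dots> \<le> (\<Sum>v\<in>V. L)" by (rule sum_mono) (rule Sb)
    finally show ?thesis by simp
  qed
  have "finite {k. d k (ik h k) \<noteq> 0}"
  proof (rule finite_if_finite_subsets_card_bdd[of _ "nat (int (card V) * L)", THEN conjunct1])
    fix Z assume Z: "Z \<subseteq> {k. d k (ik h k) \<noteq> 0}" "finite Z"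
    then obtain n where n: "Z \<subseteq> {..<n}" using finite_nat_set_iff_bounded[of Z] by auto
    have "int (card Z) = (\<Sum>k\<in>Z. 1)" by simp
    also have "\<dots> \<le> (\<Sum>k\<in>Z. d k (ik h k))"
      by (rule sum_mono) (use Z nonneg in \<open>smt (verit) mem_Collect_eq subsetD\<close>)
    also have "\<dots> \<le> (\<Sum>k<n. d k (ik h k))" by (rule sum_mono2) (use n nonneg in auto)
    also have "\<dots> \<le> int (card V) * L" by (rule tot)
    finally show "card Z \<le> nat (int (card V) * L)" by simp
  qed
  then obtain n where "\<And>k. d k (ik h k) \<noteq> 0 \<Longrightarrow> k < n" unfolding finite_nat_set_iff_bounded by blast
  (* from step n on, each vertex has the value 0 when its turn comes, and has not changed before *)
  then have n: "d k (ik h k) = 0" if "k \<ge> n" for k using that by (meson not_less)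
  have "d n v = 0" if v: "v \<in> V" for v
  proof -
    obtain k where k: "k \<ge> n" "ik h k = v" using pick_recurrent[OF V v] by blast
    have down: "d n v = 0" if "n \<le> k" "d k v = 0" for k
      using that
    proof (induction k rule: dec_induct)
      case (step m)
      have "d m v = 0"
      proof (cases "ik h m = v")
        case False then show ?thesis using step(4) assms(6)[of m] reflect_other by metis
      next
        case True then show ?thesis using n[of m] step(1) by simp
      qed
      then show ?case using step by blast
    qed simp
    show ?thesis using down[OF k(1)] n[OF k(1)] k(2) by simp
  qed
  then show ?thesis by blast
qed

text \<open>
  Once no simple summands are deleted any more, the dimension vectors change by simple
  reflections.
\<close>

lemma eventually_zero:
  assumes V: "V \<noteq> {}" and h: "graded h" and C: "C > 0"
    and coercive: "\<And>\<alpha>. (\<Sum>v\<in>V. (\<alpha> v)\<^sup>2) \<le> C * form \<alpha> \<alpha>"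
    and X: "rep h X F" and fin: "finite {k. top_mult h X F k \<noteq> 0}"
  shows "\<exists>n. \<forall>m\<ge>n. \<forall>v\<in>V. dim (Xs h X F m v) = 0"
proof -
  obtain k0 where k0: "\<And>k. k \<ge> k0 \<Longrightarrow> top_mult h X F k = 0"
    using fin unfolding finite_nat_set_iff_bounded by (metis (mono_tags, lifting) mem_Collect_eq not_less)
  have st: "dv (Xs h X F (Suc k)) = reflect (ik h k) (dv (Xs h X F k))" if "k \<ge> k0" for k
    using dv_reflect[OF rep_Xs[OF V h X]] sink_ik[OF V h] k0[OF that] unfolding top_mult_def by simp
  have "\<exists>n. \<forall>v\<in>V. dv (Xs h X F (k0 + n)) v = 0"
  proof (rule reflection_sequence_vanishes[OF V _ C coercive])
    show "graded (hs h k0)" using sink_ik[OF V h] by blast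
    show "dv (Xs h X F (k0 + Suc k)) = reflect (ik (hs h k0) k) (dv (Xs h X F (k0 + k)))" for k
      using st[of "k0 + k"] hs_shift by simp
  qed (simp add: dv_def)
  then obtain n where n: "\<And>v. v \<in> V \<Longrightarrow> dv (Xs h X F (k0 + n)) v = 0" by blast
  have "\<forall>v\<in>V. dv (Xs h X F m) v = 0" if "m \<ge> k0 + n" for m
    using that
  proof (induction m rule: dec_induct)
    case (step m)
    have "reflect (ik h m) (dv (Xs h X F m)) v = 0" if "v \<in> V" for v
      using step(3) opp_V that by (cases "v = ik h m") (auto simp: reflect_at reflect_other intro!: sum.neutral)
    then show ?case using st[of m] step(1) by simp
  qed (use n in blast)
  then show ?thesis unfolding dv_def by (metis of_nat_eq_0_iff)
qed

lemma rep_iso_of_mult_eq: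
  assumes V: "V \<noteq> {}" and h: "graded h" and C: "C > 0"
    and coercive: "\<And>\<alpha>. (\<Sum>v\<in>V. (\<alpha> v)\<^sup>2) \<le> C * form \<alpha> \<alpha>"
    and fin: "finite (active h)"
    and X: "rep h X F" and Y: "rep h Y G" and eq: "\<And>k. top_mult h X F k = top_mult h Y G k"
  shows "rep_iso h X F Y G"
proof -
  have "finite {k. top_mult h X F k \<noteq> 0}" "finite {k. top_mult h Y G k \<noteq> 0}"
    by (rule finite_subset[OF _ fin]; use X Y in \<open>auto simp: active_def[OF V h]\<close>)+
  then obtain n m where "\<And>k v. k \<ge> n \<Longrightarrow> v \<in> V \<Longrightarrow> dim (Xs h X F k v) = 0"
    "\<And>k v. k \<ge> m \<Longrightarrow> v \<in> V \<Longrightarrow> dim (Xs h Y G k v) = 0"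
    using eventually_zero[OF V h C coercive X] eventually_zero[OF V h C coercive Y] by metis
  then show ?thesis using iso_of_mult_eq[OF V h X Y eq, of "max n m"] by simp
qed

end

section \<open>Krull-Schmidt theory and rigid structures\<close>

context vspace begin

subsection \<open>Indecomposable spaces with operators\<close>

text \<open>
  A module structure enters only through a set \<open>\<Omega>\<close> of operators: submodules
  are the \<open>\<Omega>\<close>-stable subspaces, and homomorphisms are the linear maps
  commuting with \<open>\<Omega>\<close>.
\<close>

definition stable :: "('w \<Rightarrow> 'w) set \<Rightarrow> 'w set \<Rightarrow> bool" where
  "stable \<Omega> U \<longleftrightarrow> (\<forall>\<omega>\<in>\<Omega>. \<omega> ` U \<subseteq> U)"

definition commuting :: "('w \<Rightarrow> 'w) set \<Rightarrow> 'w set \<Rightarrow> ('w \<Rightarrow> 'w) \<Rightarrow> bool" where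
  "commuting \<Omega> U f \<longleftrightarrow> lin f \<and> (\<forall>\<omega>\<in>\<Omega>. \<forall>x\<in>U. f (\<omega> x) = \<omega> (f x))"

definition indec :: "('w \<Rightarrow> 'w) set \<Rightarrow> 'w set \<Rightarrow> bool" where
  "indec \<Omega> U \<longleftrightarrow> fdim U \<and> stable \<Omega> U \<and> U \<noteq> {0} \<and>
     (\<forall>W W'. dsum U W W' \<longrightarrow> stable \<Omega> W \<longrightarrow> stable \<Omega> W' \<longrightarrow> W = {0} \<or> W' = {0})"

lemma bij_betw_of_inj:
  assumes "fdim U" "lin f" "f ` U \<subseteq> U" "inj_on f U" shows "bij_betw f U U"
  using subspace_eq_of_dim[OF assms(1) lin_subspace_image[OF assms(2) fdim_subspaceD[OF assms(1)]] assms(3)]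
    dim_inj_image[OF assms(1,2,4)] assms(4) unfolding bij_betw_def by simp

lemma commuting_image_kernel:
  assumes f: "commuting \<Omega> U f" and st: "stable \<Omega> U" and lins: "\<And>\<omega>. \<omega> \<in> \<Omega> \<Longrightarrow> lin \<omega>"
  shows "stable \<Omega> (f ` U)" "stable \<Omega> {x \<in> U. f x = 0}"
proof -
  have c: "f (\<omega> x) = \<omega> (f x)" "\<omega> x \<in> U" if "\<omega> \<in> \<Omega>" "x \<in> U" for \<omega> x
    using f st that unfolding commuting_def stable_def by blast+
  show "stable \<Omega> (f ` U)" unfolding stable_def
  proof (intro ballI subsetI, elim imageE)
    fix \<omega> y z x assume "\<omega> \<in> \<Omega>" "y = \<omega> z" "z = f x" "x \<in> U"
    then show "y \<in> f ` U" using c[of \<omega> x] by (intro image_eqI[of _ _ "\<omega> x"]) auto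
  qed
  show "stable \<Omega> {x \<in> U. f x = 0}" unfolding stable_def using c lin_0[OF lins] by auto
qed

lemma funpow_props:
  assumes f: "commuting \<Omega> U f" "f ` U \<subseteq> U" and st: "stable \<Omega> U"
  shows "commuting \<Omega> U (f ^^ n)" "(f ^^ n) ` U \<subseteq> U"
proof -
  show 1: "(f ^^ n) ` U \<subseteq> U" for n
    by (induction n) (use f(2) in auto)
  show "commuting \<Omega> U (f ^^ n)"
  proof (induction n)
    case 0 show ?case using lin_ident by (simp add: commuting_def id_def)
  next
    case (Suc n)
    have "lin (\<lambda>x. f ((f ^^ n) x))"
      using lin_comp[of f "f ^^ n"] Suc f(1) unfolding commuting_def by blast
    then show ?case
      using Suc f(1) 1[of n] st unfolding commuting_def stable_def by (auto simp: comp_def image_subset_iff)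
  qed
qed

text \<open>
  Fitting's lemma: once the rank of the powers of \<open>f\<close> has become minimal, the space
  is the direct sum of the image and the kernel of that power.
\<close>

lemma fitting:
  assumes U: "indec \<Omega> U" and f: "commuting \<Omega> U f" "f ` U \<subseteq> U" and lins: "\<And>\<omega>. \<omega> \<in> \<Omega> \<Longrightarrow> lin \<omega>"
  shows "bij_betw f U U \<or> (\<exists>n. \<forall>x\<in>U. (f ^^ n) x = 0)"
proof -
  have fU: "fdim U" and st: "stable \<Omega> U" using U unfolding indec_def by auto
  note sU = fdim_subspaceD[OF fU]
  note P = funpow_props[OF f st]
  define r where "r n = dim ((f ^^ n) ` U)" for n
  obtain n where n: "0 < n" "\<And>m. 0 < m \<Longrightarrow> r n \<le> r m" using ex_has_least_nat[of "\<lambda>n. 0 < n" 1 r] by auto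
  let ?f = "f ^^ n"
  have lf: "lin ?f" using P(1) unfolding commuting_def by blast
  have W: "subspace (?f ` U)" and K: "subspace {x \<in> U. ?f x = 0}"
    using lin_subspace_image[OF lf sU] subspace_lin_kernel[OF lf sU] by auto
  have ff: "?f ` ?f ` U = ?f ` U"
  proof (rule subspace_eq_of_dim)
    show "fdim (?f ` U)" using fdim_image[OF fU lf] .
    show "subspace (?f ` ?f ` U)" using lin_subspace_image[OF lf W] .
    show "?f ` ?f ` U \<subseteq> ?f ` U" using P(2) by blast
    show "dim (?f ` U) \<le> dim (?f ` ?f ` U)" using n(2)[of "n + n"] n(1) unfolding r_def funpow_add image_comp by simp
  qed
  have "dsum U (?f ` U) {x \<in> U. ?f x = 0}"
  proof (rule dsumI[OF W K P(2) _ sU])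
    have inj: "inj_on ?f (?f ` U)"
    proof (rule lin_inj_on[OF lf W])
      fix x assume x: "x \<in> ?f ` U" "?f x = 0"
      have "dim {x \<in> ?f ` U. ?f x = 0} = 0"
        using rank_nullity[OF fdim_image[OF fU lf] lf] ff by simp
      then have "{x \<in> ?f ` U. ?f x = 0} = {0}"
        using fdim_dim_0 fdim_subset[OF fdim_image[OF fU lf] subspace_lin_kernel[OF lf W]] by blast
      then show "x = 0" using x by blast
    qed
    show "x = 0" if "x \<in> ?f ` U" "x \<in> {x \<in> U. ?f x = 0}" for x
      using inj_onD[OF inj, of x 0] that lin_0[OF lf] subspace_0[OF W] by auto
    fix x assume x: "x \<in> U"
    then have "?f x \<in> ?f ` ?f ` U" unfolding ff by blast
    then obtain y where y: "y \<in> ?f ` U" "?f x = ?f y" by blast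
    have "?f (x - y) = 0" using y lin_diff[OF lf] by simp
    moreover have "x - y \<in> U" using x y P(2) subspace_diff[OF sU] by blast
    ultimately show "\<exists>a\<in>?f ` U. \<exists>b\<in>{x \<in> U. ?f x = 0}. x = a + b"
      using y(1) by (intro bexI[of _ y] bexI[of _ "x - y"]) auto
  qed blast
  moreover have "stable \<Omega> (?f ` U)" "stable \<Omega> {x \<in> U. ?f x = 0}"
    using commuting_image_kernel[OF P(1) st lins] by blast+
  ultimately consider "?f ` U = {0}" | "{x \<in> U. ?f x = 0} = {0}" using U unfolding indec_def by blast
  then show ?thesis
  proof cases
    case 1 then show ?thesis by blast
  next
    case 2
    have lf1: "lin f" using f unfolding commuting_def by blast
    have "inj_on f U"
    proof (rule lin_inj_on[OF lf1 sU])
      fix x assume x: "x \<in> U" "f x = 0"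
      show "x = 0"
      proof (cases n)
        case 0 then show ?thesis using n by simp
      next
        case (Suc m)
        have "?f x = (f ^^ m) (f x)" unfolding Suc by (simp add: funpow_swap1)
        also have "\<dots> = 0" using x P(1)[of m] lin_0 unfolding commuting_def by simp
        finally show ?thesis using 2 x by blast
      qed
    qed
    then show ?thesis using bij_betw_of_inj[OF fU lf1 f(2)] by blast
  qed
qed

lemma commuting_inverse:
  assumes U: "subspace U" "stable \<Omega> U" and f: "commuting \<Omega> U f" "bij_betw f U U'"
  obtains g where "commuting \<Omega> U' g" "bij_betw g U' U" "\<And>x. x \<in> U \<Longrightarrow> g (f x) = x" "\<And>x. x \<in> U' \<Longrightarrow> f (g x) = x"
proof -
  obtain g where g: "lin g" "\<And>x. g x \<in> U" "\<And>x. x \<in> U \<Longrightarrow> g (f x) = x"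
    using lin_left_inverse_on[of f U] f U unfolding commuting_def bij_betw_def by metis
  have fg: "f (g y) = y" if y: "y \<in> U'" for y
  proof -
    obtain x where "x \<in> U" "y = f x" using y f(2) unfolding bij_betw_def by blast
    then show ?thesis using g by simp
  qed
  have "commuting \<Omega> U' g"
    unfolding commuting_def
  proof (intro conjI ballI g(1))
    fix \<omega> y assume o: "\<omega> \<in> \<Omega>" and y: "y \<in> U'"
    have "\<omega> (g y) \<in> U" using o g(2) U(2) unfolding stable_def by blast
    moreover have "f (\<omega> (g y)) = \<omega> y" using f(1) o g(2) fg[OF y] unfolding commuting_def by simp
    ultimately show "g (\<omega> y) = \<omega> (g y)" using g(3) by metis
  qed
  moreover have "bij_betw g U' U"
    by (rule bij_betwI[of _ _ _ f]) (use g fg f in \<open>auto simp: bij_betw_def\<close>)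
  ultimately show thesis using that g fg by blast
qed

text \<open>
  The endomorphism ring of an indecomposable module is local. If \<open>h s\<close> is not
  bijective, then composed with the inverse of the whole sum it is nilpotent, so the remaining sum
  is bijective.
\<close>

lemma some_summand_bij:
  assumes U: "indec \<Omega> U" and lins: "\<And>\<omega>. \<omega> \<in> \<Omega> \<Longrightarrow> lin \<omega>"
    and J: "finite J" and h: "\<And>s. s \<in> J \<Longrightarrow> commuting \<Omega> U (h s)" "\<And>s. s \<in> J \<Longrightarrow> h s ` U \<subseteq> U"
    and sum: "bij_betw (\<lambda>x. \<Sum>s\<in>J. h s x) U U"
  shows "\<exists>s\<in>J. bij_betw (h s) U U"
  using J h sum
proof (induction J)
  case empty
  have "fdim U" "U \<noteq> {0}" using U unfolding indec_def by auto
  then show ?case using empty(3) subspace_0[of U] fdim_subspaceD unfolding bij_betw_def by auto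
next
  case (insert s J)
  have fU: "fdim U" and st: "stable \<Omega> U" using U unfolding indec_def by auto
  note sU = fdim_subspaceD[OF fU]
  define u where "u x = (\<Sum>s\<in>insert s J. h s x)" for x
  define r where "r x = (\<Sum>s\<in>J. h s x)" for x
  have com_sum: "commuting \<Omega> U (\<lambda>x. \<Sum>s\<in>J'. h s x)" if "J' \<subseteq> insert s J" for J'
  proof -
    have l: "lin (\<lambda>x. \<Sum>s\<in>J'. h s x)"
      by (rule lin_setsum) (use insert.prems(1) that in \<open>auto simp: commuting_def\<close>)
    have "(\<Sum>s\<in>J'. h s (\<omega> x)) = \<omega> (\<Sum>s\<in>J'. h s x)" if "\<omega> \<in> \<Omega>" "x \<in> U" for \<omega> x
      unfolding lin_sum[OF lins[OF that(1)]]
      by (rule sum.cong) (use insert.prems(1) that \<open>J' \<subseteq> insert s J\<close> in \<open>auto simp: commuting_def\<close>)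
    then show ?thesis using l unfolding commuting_def by blast
  qed
  have cu: "commuting \<Omega> U u" and cr: "commuting \<Omega> U r" unfolding u_def[abs_def] r_def[abs_def] using com_sum by blast+
  have bu: "bij_betw u U U" using insert.prems(3) unfolding u_def[abs_def] .
  have rU: "r ` U \<subseteq> U" unfolding r_def using insert.prems(2) sU by (auto intro!: subspace_sum)
  have ur: "u x = h s x + r x" for x unfolding u_def r_def using insert by simp
  obtain k where k: "commuting \<Omega> U k" "bij_betw k U U" "\<And>x. x \<in> U \<Longrightarrow> k (u x) = x" "\<And>x. x \<in> U \<Longrightarrow> u (k x) = x"
    using commuting_inverse[OF sU st cu bu] by metis
  show ?case
  proof (cases "bij_betw (h s) U U")
    case False
    have hU: "h s ` U \<subseteq> U" and hc: "commuting \<Omega> U (h s)" using insert.prems by auto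
    (* k inverts the whole sum, so a vector killed by the remaining sum is fixed by ?n *)
    let ?n = "\<lambda>x. k (h s x)"
    have kl: "lin k" "lin (h s)" "lin r" using k hc cr unfolding commuting_def by blast+
    have nl: "lin ?n" by (rule lin_comp[OF kl(1,2)])
    have kU: "k ` U = U" "inj_on k U" using k(2) unfolding bij_betw_def by auto
    have nU: "?n ` U \<subseteq> U" using hU kU(1) by blast
    have nc: "commuting \<Omega> U ?n"
      using nl hc k(1) hU unfolding commuting_def by (auto simp: image_subset_iff)
    have "\<not> bij_betw ?n U U"
    proof
      assume b: "bij_betw ?n U U"
      have "inj_on (h s) U"
        using b unfolding bij_betw_def inj_on_def by metis
      then show False using bij_betw_of_inj[OF fU kl(2) hU] False by blast
    qed
    then obtain n where n: "\<forall>x\<in>U. (?n ^^ n) x = 0" using fitting[OF U nc nU lins] by blast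
    have "inj_on r U"
    proof (rule lin_inj_on[OF kl(3) sU])
      fix x assume x: "x \<in> U" "r x = 0"
      then have "?n x = x" using ur[of x] k(3)[OF x(1)] by simp
      then have "(?n ^^ m) x = x" for m by (induction m) auto
      then show "x = 0" using n x by metis
    qed
    then have "bij_betw r U U" using bij_betw_of_inj[OF fU kl(3) rU] by blast
    then show ?thesis using insert.IH insert.prems unfolding r_def[abs_def] by auto
  qed auto
qed

text \<open>
  The exchange step of the Krull-Schmidt theorem: the image of \<open>f\<close> splits off from
  \<open>U'\<close>, with complement the kernel of \<open>g\<close>.
\<close>

lemma iso_of_retract:
  assumes U: "indec \<Omega> U" and U': "indec \<Omega> U'" and lins: "\<And>\<omega>. \<omega> \<in> \<Omega> \<Longrightarrow> lin \<omega>"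
    and f: "commuting \<Omega> U f" "f ` U \<subseteq> U'" and g: "commuting \<Omega> U' g" "g ` U' \<subseteq> U"
    and b: "bij_betw (\<lambda>x. g (f x)) U U"
  shows "bij_betw f U U'"
proof -
  have fU: "fdim U" "fdim U'" and st: "stable \<Omega> U" "stable \<Omega> U'" using U U' unfolding indec_def by auto
  note sU = fdim_subspaceD[OF fU(1)] fdim_subspaceD[OF fU(2)]
  have l: "lin f" "lin g" using f g unfolding commuting_def by blast+
  have inj: "inj_on f U" using b unfolding bij_betw_def inj_on_def by metis
  have d: "dsum U' (f ` U) {y \<in> U'. g y = 0}"
  proof (rule dsumI[OF lin_subspace_image[OF l(1) sU(1)] subspace_lin_kernel[OF l(2) sU(2)] f(2) _ sU(2)])
    show "x = 0" if x: "x \<in> f ` U" "x \<in> {y \<in> U'. g y = 0}" for x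
    proof -
      obtain z where z: "z \<in> U" "x = f z" using x by blast
      then have "g (f z) = g (f 0)" using x l by (simp add: lin_0)
      then have "z = 0" using b z subspace_0[OF sU(1)] unfolding bij_betw_def inj_on_def by blast
      then show ?thesis using z l by (simp add: lin_0)
    qed
    fix y assume y: "y \<in> U'"
    then obtain x where x: "x \<in> U" "g (f x) = g y" using b g(2) unfolding bij_betw_def by (metis image_iff imageI subsetD)
    then have "y - f x \<in> {y \<in> U'. g y = 0}" using y f(2) subspace_diff[OF sU(2)] l by (auto simp: lin_diff)
    then show "\<exists>a\<in>f ` U. \<exists>b\<in>{y \<in> U'. g y = 0}. y = a + b"
      using x by (intro bexI[of _ "f x"] bexI[of _ "y - f x"]) auto
  qed blast
  moreover have "stable \<Omega> (f ` U)" "stable \<Omega> {y \<in> U'. g y = 0}"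
    using commuting_image_kernel[OF f(1) st(1) lins] commuting_image_kernel[OF g(1) st(2) lins] by blast+
  ultimately have "f ` U = {0} \<or> {y \<in> U'. g y = 0} = {0}" using U' unfolding indec_def by blast
  moreover have "f ` U \<noteq> {0}"
  proof
    assume "f ` U = {0}"
    then have "x = 0" if "x \<in> U" for x
      using inj that subspace_0[OF sU(1)] lin_0[OF l(1)] unfolding inj_on_def by (metis imageI singletonD)
    then show False using U subspace_0[OF sU(1)] unfolding indec_def by blast
  qed
  ultimately have "f ` U = U'" using d unfolding dsum_def by auto
  then show ?thesis using inj unfolding bij_betw_def by blast
qed

end

context quiver_reps begin

subsection \<open>Modules over the preprojective algebra in terms of operators\<close>

text \<open>
  Representations of \<open>Q\<close> as modules over the path algebra: \<open>e\<close> are the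
  idempotents at the vertices and \<open>T\<close> the arrows.
\<close>

definition qmod where
  "qmod S e T \<longleftrightarrow> fdim S \<and> (\<forall>v\<in>V. lin (e v) \<and> e v ` S \<subseteq> S) \<and> (\<forall>a\<in>A. lin (T a) \<and> T a ` S \<subseteq> S) \<and>
     (\<forall>x\<in>S. (\<Sum>v\<in>V. e v x) = x) \<and> (\<forall>u\<in>V. \<forall>v\<in>V. \<forall>x\<in>S. e u (e v x) = (if u = v then e v x else 0)) \<and>
     (\<forall>a\<in>A. \<forall>x\<in>S. T a (e (tl a) x) = T a x \<and> e (hd a) (T a x) = T a x)"

text \<open>
  The structures extending a representation of \<open>Q\<close> to a module over the preprojective
  algebra. They form a vector space, so they are at the same time the tangent vectors at each of
  them.
\<close>

definition tang where
  "tang S e T \<psi> \<longleftrightarrow> (\<forall>a\<in>A. lin (\<psi> a) \<and> \<psi> a ` S \<subseteq> S \<and> (\<forall>x\<in>S. \<psi> a (e (hd a) x) = \<psi> a x \<and> e (tl a) (\<psi> a x) = \<psi> a x)) \<and>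
     (\<forall>x\<in>S. (\<Sum>a\<in>A. T a (\<psi> a x) - \<psi> a (T a x)) = 0)"

definition qend where
  "qend S e T = {g. lin g \<and> g ` S \<subseteq> S \<and> (\<forall>v\<in>V. \<forall>x\<in>S. g (e v x) = e v (g x)) \<and> (\<forall>a\<in>A. \<forall>x\<in>S. g (T a x) = T a (g x))}"

text \<open>
  Every tangent vector comes from the infinitesimal action of the endomorphisms of the
  representation of \<open>Q\<close>.
\<close>

definition rigid where
  "rigid S e T \<phi> \<longleftrightarrow> (\<forall>\<psi>. tang S e T \<psi> \<longrightarrow>
     (\<exists>g\<in>qend S e T. \<forall>a\<in>A. \<forall>x\<in>S. \<psi> a x = \<phi> a (g x) - g (\<phi> a x)))"

lemma tangD:
  assumes "tang S e T \<psi>" "a \<in> A"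
  shows "lin (\<psi> a)" "x \<in> S \<Longrightarrow> \<psi> a x \<in> S" "x \<in> S \<Longrightarrow> \<psi> a (e (hd a) x) = \<psi> a x" "x \<in> S \<Longrightarrow> e (tl a) (\<psi> a x) = \<psi> a x"
  using assms unfolding tang_def by blast+

lemma tang_sum: "tang S e T \<psi> \<Longrightarrow> x \<in> S \<Longrightarrow> (\<Sum>a\<in>A. T a (\<psi> a x) - \<psi> a (T a x)) = 0"
  unfolding tang_def by blast

lemma qendD:
  assumes "g \<in> qend S e T"
  shows "lin g" "x \<in> S \<Longrightarrow> g x \<in> S" "v \<in> V \<Longrightarrow> x \<in> S \<Longrightarrow> g (e v x) = e v (g x)" "a \<in> A \<Longrightarrow> x \<in> S \<Longrightarrow> g (T a x) = T a (g x)"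
  using assms unfolding qend_def by blast+

lemma qmodD:
  assumes "qmod S e T"
  shows "fdim S" "v \<in> V \<Longrightarrow> lin (e v)" "a \<in> A \<Longrightarrow> lin (T a)"
    "v \<in> V \<Longrightarrow> x \<in> S \<Longrightarrow> e v x \<in> S" "a \<in> A \<Longrightarrow> x \<in> S \<Longrightarrow> T a x \<in> S"
    "x \<in> S \<Longrightarrow> (\<Sum>v\<in>V. e v x) = x" "u \<in> V \<Longrightarrow> v \<in> V \<Longrightarrow> x \<in> S \<Longrightarrow> e u (e v x) = (if u = v then e v x else 0)"
    "a \<in> A \<Longrightarrow> x \<in> S \<Longrightarrow> T a (e (tl a) x) = T a x" "a \<in> A \<Longrightarrow> x \<in> S \<Longrightarrow> e (hd a) (T a x) = T a x"
  using assms unfolding qmod_def by blast+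

text \<open>
  Composing with an endomorphism of the representation of \<open>Q\<close> preserves the defining
  relation.
\<close>

lemma tang_diff_comp:
  assumes S: "qmod S e T" and t: "tang S e T \<phi>" "tang S e T \<phi>'" and g: "g \<in> qend S e T"
  shows "tang S e T (\<lambda>a x. \<phi>' a (g x) - \<phi> a (g x))"
  unfolding tang_def
proof (intro conjI ballI)
  fix a assume a: "a \<in> A"
  show "lin (\<lambda>x. \<phi>' a (g x) - \<phi> a (g x))"
    using lin_minus[OF lin_comp[OF tangD(1)[OF t(2) a] qendD(1)[OF g]] lin_comp[OF tangD(1)[OF t(1) a] qendD(1)[OF g]]] .
  show "(\<lambda>x. \<phi>' a (g x) - \<phi> a (g x)) ` S \<subseteq> S"
    using tangD(2)[OF t(1) a] tangD(2)[OF t(2) a] qendD(2)[OF g] subspace_diff[OF fdim_subspaceD[OF qmodD(1)[OF S]]] by blast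
  fix x assume x: "x \<in> S"
  show "\<phi>' a (g (e (hd a) x)) - \<phi> a (g (e (hd a) x)) = \<phi>' a (g x) - \<phi> a (g x)"
    using tangD(3)[OF t(1) a] tangD(3)[OF t(2) a] qendD(2,3)[OF g] x hdV[OF a] by simp
  show "e (tl a) (\<phi>' a (g x) - \<phi> a (g x)) = \<phi>' a (g x) - \<phi> a (g x)"
    using tangD(4)[OF t(1) a] tangD(4)[OF t(2) a] qendD(2)[OF g x] lin_diff[OF qmodD(2)[OF S tlV[OF a]]] by simp
next
  fix x assume x: "x \<in> S"
  have "(\<Sum>a\<in>A. T a (\<phi>' a (g x) - \<phi> a (g x)) - (\<phi>' a (g (T a x)) - \<phi> a (g (T a x)))) =
     (\<Sum>a\<in>A. (T a (\<phi>' a (g x)) - \<phi>' a (T a (g x))) - (T a (\<phi> a (g x)) - \<phi> a (T a (g x))))"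
    by (rule sum.cong) (use x in \<open>auto simp: qendD(4)[OF g] lin_diff[OF qmodD(3)[OF S]]\<close>)
  also have "\<dots> = 0" using tang_sum[OF t(1) qendD(2)[OF g x]] tang_sum[OF t(2) qendD(2)[OF g x]] by (simp add: sum_subtractf)
  finally show "(\<Sum>a\<in>A. T a (\<phi>' a (g x) - \<phi> a (g x)) - (\<phi>' a (g (T a x)) - \<phi> a (g (T a x)))) = 0" .
qed

lemma lin_closed_qend: assumes S: "qmod S e T" shows "lin_closed (qend S e T)" "(\<lambda>x. x) \<in> qend S e T"
proof -
  note sS = fdim_subspaceD[OF qmodD(1)[OF S]]
  show "(\<lambda>x. x) \<in> qend S e T" unfolding qend_def using lin_ident by simp
  show "lin_closed (qend S e T)"
    unfolding lin_closed_def
  proof (intro conjI ballI allI)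
    show "(\<lambda>x. 0) \<in> qend S e T"
      unfolding qend_def using lin_zero subspace_0[OF sS] lin_0[OF qmodD(2)[OF S]] lin_0[OF qmodD(3)[OF S]] by auto
    fix g assume g: "g \<in> qend S e T"
    show "lin g" using qendD(1)[OF g] .
    show "(\<lambda>x. c *s g x) \<in> qend S e T" for c
      unfolding qend_def using lin_smult[OF qendD(1)[OF g]] qendD[OF g] subspace_scale[OF sS]
        lin_scale[OF qmodD(2)[OF S]] lin_scale[OF qmodD(3)[OF S]] by auto
    fix h assume h: "h \<in> qend S e T"
    show "(\<lambda>x. g x + h x) \<in> qend S e T"
      unfolding qend_def using lin_plus[OF qendD(1)[OF g] qendD(1)[OF h]] qendD[OF g] qendD[OF h] subspace_add[OF sS]
        lin_add[OF qmodD(2)[OF S]] lin_add[OF qmodD(3)[OF S]] by auto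
  qed
qed

text \<open>
  Rigidity of \<open>\<phi>\<close> is the hypothesis of \<open>generic_deformation\<close>,
  applied to the tangent vectors \<open>(\<phi>' - \<phi>) g\<close>.
\<close>

lemma rigid_deformation:
  assumes S: "qmod S e T" and t: "tang S e T \<phi>" "tang S e T \<phi>'" and r: "rigid S e T \<phi>"
  shows "finite {t. \<not> (\<exists>g\<in>qend S e T. bij_betw g S S \<and>
    (\<forall>a\<in>A. \<forall>x\<in>S. \<phi> a (g x) + t *s (\<phi>' a (g x) - \<phi> a (g x)) = g (\<phi> a x)))}"
proof (rule generic_deformation[OF lin_closed_qend[OF S] qmodD(1)[OF S]])
  fix g assume g: "g \<in> qend S e T"
  show "g ` S \<subseteq> S" using qendD(2)[OF g] by blast
  show "\<exists>h\<in>qend S e T. \<forall>a\<in>A. \<forall>x\<in>S. \<phi>' a (g x) - \<phi> a (g x) = \<phi> a (h x) - h (\<phi> a x)"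
    using r tang_diff_comp[OF S t g] unfolding rigid_def by blast
qed (use tangD[OF t(1)] tangD[OF t(2)] in blast)+

text \<open>
  All but finitely many points of the line from \<open>\<phi>\<close> to \<open>\<phi>'\<close>
  are isomorphic to \<open>\<phi>\<close>, and all but finitely many are isomorphic to
  \<open>\<phi>'\<close>. Over an infinite field one point is isomorphic to both.
\<close>

lemma rigid_unique:
  assumes inf: "infinite (UNIV :: 'k set)"
    and S: "qmod S e T" and t: "tang S e T \<phi>" "tang S e T \<phi>'" and r: "rigid S e T \<phi>" "rigid S e T \<phi>'"
  shows "\<exists>g\<in>qend S e T. bij_betw g S S \<and> (\<forall>a\<in>A. \<forall>x\<in>S. g (\<phi> a x) = \<phi>' a (g x))"
proof -
  let ?P = "\<lambda>\<phi> \<phi>' t. \<exists>g\<in>qend S e T. bij_betw g S S \<and>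
    (\<forall>a\<in>A. \<forall>x\<in>S. \<phi> a (g x) + t *s (\<phi>' a (g x) - \<phi> a (g x)) = g (\<phi> a x))"
  define Z where "Z = {t. \<not> ?P \<phi> \<phi>' t}"
  (* the point t of the line from \<phi> to \<phi>' is the point 1 - t of the line from \<phi>'
     to \<phi> *)
  define Z' where "Z' = {t. \<not> ?P \<phi>' \<phi> t}"
  have "finite Z" "finite Z'"
    unfolding Z_def Z'_def by (rule rigid_deformation[OF S t r(1)], rule rigid_deformation[OF S t(2,1) r(2)])
  then have "finite (Z \<union> (\<lambda>t. 1 - t) ` Z')" by simp
  then obtain t where t0: "t \<notin> Z \<union> (\<lambda>t. 1 - t) ` Z'"
    using ex_new_if_finite[OF inf] by blast
  have "t \<notin> Z" using t0 by blast
  then have p1: "?P \<phi> \<phi>' t" unfolding Z_def by simp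
  have "1 - t \<notin> Z'"
  proof
    assume "1 - t \<in> Z'"
    then have "1 - (1 - t) \<in> (\<lambda>t. 1 - t) ` Z'" by (rule imageI)
    then show False using t0 by simp
  qed
  then have p2: "?P \<phi>' \<phi> (1 - t)" unfolding Z'_def by simp
  obtain g1 where g1: "g1 \<in> qend S e T" "bij_betw g1 S S"
    "\<And>a x. a \<in> A \<Longrightarrow> x \<in> S \<Longrightarrow> \<phi> a (g1 x) + t *s (\<phi>' a (g1 x) - \<phi> a (g1 x)) = g1 (\<phi> a x)"
    using p1 by blast
  obtain g2 where g2: "g2 \<in> qend S e T" "bij_betw g2 S S"
    "\<And>a x. a \<in> A \<Longrightarrow> x \<in> S \<Longrightarrow> \<phi>' a (g2 x) + (1 - t) *s (\<phi> a (g2 x) - \<phi>' a (g2 x)) = g2 (\<phi>' a x)"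
    using p2 by blast
  let ?\<Omega> = "e ` V \<union> T ` A"
  note sS = fdim_subspaceD[OF qmodD(1)[OF S]]
  have st: "stable ?\<Omega> S" unfolding stable_def using qmodD(4,5)[OF S] by blast
  have c2: "commuting ?\<Omega> S g2" unfolding commuting_def using qendD[OF g2(1)] by auto
  obtain k where k: "commuting ?\<Omega> S k" "bij_betw k S S" "\<And>x. x \<in> S \<Longrightarrow> k (g2 x) = x" "\<And>x. x \<in> S \<Longrightarrow> g2 (k x) = x"
    using commuting_inverse[OF sS st c2 g2(2)] by metis
  have kS: "k x \<in> S" if "x \<in> S" for x using k(2) that unfolding bij_betw_def by blast
  have kl: "lin k" using k(1) unfolding commuting_def by blast
  have "(\<lambda>x. k (g1 x)) \<in> qend S e T"
    unfolding qend_def using lin_comp[OF kl qendD(1)[OF g1(1)]] kS qendD[OF g1(1)] k(1) unfolding commuting_def by auto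
  moreover have "bij_betw (\<lambda>x. k (g1 x)) S S" using bij_betw_trans[OF g1(2) k(2)] by (simp add: comp_def)
  moreover have "k (g1 (\<phi> a x)) = \<phi>' a (k (g1 x))" if a: "a \<in> A" and x: "x \<in> S" for a x
  proof -
    define y where "y = g1 x"
    have y: "y \<in> S" unfolding y_def using qendD(2)[OF g1(1) x] .
    have "g1 (\<phi> a x) = \<phi> a y + t *s (\<phi>' a y - \<phi> a y)" using g1(3)[OF a x] y_def by simp
    also have "\<dots> = \<phi>' a y + (1 - t) *s (\<phi> a y - \<phi>' a y)"
      by (simp add: scale_left_diff_distrib scale_right_diff_distrib)
    also have "\<dots> = g2 (\<phi>' a (k y))" using g2(3)[OF a kS[OF y]] k(4)[OF y] by simp
    finally show ?thesis using k(3)[OF tangD(2)[OF t(2) a kS[OF y]]] y_def by simp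
  qed
  ultimately show ?thesis by (intro bexI[of _ "\<lambda>x. k (g1 x)"]) auto
qed

text \<open>
  Transporting the structure of \<open>S'\<close> to \<open>S\<close> along \<open>P\<close>
  reduces the claim to two rigid structures on the same representation of \<open>Q\<close>.
\<close>

lemma rigid_iso:
  assumes inf: "infinite (UNIV :: 'k set)"
    and S: "qmod S e T" "tang S e T \<phi>" "rigid S e T \<phi>"
    and S': "qmod S' e T" "tang S' e T \<phi>" "rigid S' e T \<phi>"
    and P: "commuting (e ` V \<union> T ` A) S P" "bij_betw P S S'"
  shows "\<exists>\<Theta>. commuting (e ` V \<union> T ` A \<union> \<phi> ` A) S \<Theta> \<and> bij_betw \<Theta> S S'"
proof -
  let ?\<Omega> = "e ` V \<union> T ` A"
  note sS = fdim_subspaceD[OF qmodD(1)[OF S(1)]]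
  have st: "stable ?\<Omega> S" unfolding stable_def using qmodD(4,5)[OF S(1)] by blast
  obtain k where k: "commuting ?\<Omega> S' k" "bij_betw k S' S" "\<And>x. x \<in> S \<Longrightarrow> k (P x) = x" "\<And>x. x \<in> S' \<Longrightarrow> P (k x) = x"
    using commuting_inverse[OF sS st P] by metis
  have PS: "P x \<in> S'" if "x \<in> S" for x using P(2) that unfolding bij_betw_def by blast
  have kS: "k x \<in> S" if "x \<in> S'" for x using k(2) that unfolding bij_betw_def by blast
  have Pl: "lin P" and kl: "lin k" using P(1) k(1) unfolding commuting_def by blast+
  have Pc: "P (e v x) = e v (P x)" "P (T a x) = T a (P x)" if "v \<in> V" "a \<in> A" "x \<in> S" for v a x
    using P(1) that unfolding commuting_def by auto
  have PT: "P (T a x) = T a (P x)" if "a \<in> A" "x \<in> S" for a x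
    using P(1) that unfolding commuting_def by auto
  have Pe: "P (e v x) = e v (P x)" if "v \<in> V" "x \<in> S" for v x
    using P(1) that unfolding commuting_def by auto
  have kT: "k (T a x) = T a (k x)" if "a \<in> A" "x \<in> S'" for a x
    using k(1) that unfolding commuting_def by auto
  have ke: "k (e v x) = e v (k x)" if "v \<in> V" "x \<in> S'" for v x
    using k(1) that unfolding commuting_def by auto
  define \<phi>' where "\<phi>' a x = k (\<phi> a (P x))" for a x
  have conj_tang: "tang S e T (\<lambda>a x. k (\<psi> a (P x)))" if \<psi>: "tang S' e T \<psi>" for \<psi>
    unfolding tang_def
  proof (intro conjI ballI)
    fix a assume a: "a \<in> A"
    show "lin (\<lambda>x. k (\<psi> a (P x)))" using lin_comp[OF kl lin_comp[OF tangD(1)[OF \<psi> a] Pl]] .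
    show "(\<lambda>x. k (\<psi> a (P x))) ` S \<subseteq> S" using kS tangD(2)[OF \<psi> a] PS by blast
    fix x assume x: "x \<in> S"
    show "k (\<psi> a (P (e (hd a) x))) = k (\<psi> a (P x))" using Pe[OF hdV[OF a] x] tangD(3)[OF \<psi> a PS[OF x]] by simp
    show "e (tl a) (k (\<psi> a (P x))) = k (\<psi> a (P x))"
      using ke[OF tlV[OF a] tangD(2)[OF \<psi> a PS[OF x]]] tangD(4)[OF \<psi> a PS[OF x]] by simp
  next
    fix x assume x: "x \<in> S"
    have "(\<Sum>a\<in>A. T a (k (\<psi> a (P x))) - k (\<psi> a (P (T a x)))) = (\<Sum>a\<in>A. k (T a (\<psi> a (P x)) - \<psi> a (T a (P x))))"
      by (rule sum.cong) (use x kT tangD(2)[OF \<psi>] PS PT in \<open>auto simp: lin_diff[OF kl]\<close>)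
    also have "\<dots> = k 0" unfolding lin_sum[OF kl, symmetric] using tang_sum[OF \<psi> PS[OF x]] by simp
    finally show "(\<Sum>a\<in>A. T a (k (\<psi> a (P x))) - k (\<psi> a (P (T a x)))) = 0" using lin_0[OF kl] by simp
  qed
  have t': "tang S e T \<phi>'" unfolding \<phi>'_def[abs_def] by (rule conj_tang[OF S'(2)])
  have conj_tang': "tang S' e T (\<lambda>a x. P (\<psi> a (k x)))" if \<psi>: "tang S e T \<psi>" for \<psi>
    unfolding tang_def
  proof (intro conjI ballI)
    fix a assume a: "a \<in> A"
    show "lin (\<lambda>x. P (\<psi> a (k x)))" using lin_comp[OF Pl lin_comp[OF tangD(1)[OF \<psi> a] kl]] .
    show "(\<lambda>x. P (\<psi> a (k x))) ` S' \<subseteq> S'" using PS tangD(2)[OF \<psi> a] kS by blast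
    fix x assume x: "x \<in> S'"
    show "P (\<psi> a (k (e (hd a) x))) = P (\<psi> a (k x))" using ke[OF hdV[OF a] x] tangD(3)[OF \<psi> a kS[OF x]] by simp
    show "e (tl a) (P (\<psi> a (k x))) = P (\<psi> a (k x))"
      using Pe[OF tlV[OF a] tangD(2)[OF \<psi> a kS[OF x]]] tangD(4)[OF \<psi> a kS[OF x]] by simp
  next
    fix x assume x: "x \<in> S'"
    have "(\<Sum>a\<in>A. T a (P (\<psi> a (k x))) - P (\<psi> a (k (T a x)))) = (\<Sum>a\<in>A. P (T a (\<psi> a (k x)) - \<psi> a (T a (k x))))"
      by (rule sum.cong) (use x PT tangD(2)[OF \<psi>] kS kT in \<open>auto simp: lin_diff[OF Pl]\<close>)
    also have "\<dots> = P 0" unfolding lin_sum[OF Pl, symmetric] using tang_sum[OF \<psi> kS[OF x]] by simp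
    finally show "(\<Sum>a\<in>A. T a (P (\<psi> a (k x))) - P (\<psi> a (k (T a x)))) = 0" using lin_0[OF Pl] by simp
  qed
  have r': "rigid S e T \<phi>'"
    unfolding rigid_def
  proof (intro allI impI)
    fix \<psi> assume \<psi>: "tang S e T \<psi>"
    obtain g where g: "g \<in> qend S' e T" "\<And>a x. a \<in> A \<Longrightarrow> x \<in> S' \<Longrightarrow> P (\<psi> a (k x)) = \<phi> a (g x) - g (\<phi> a x)"
      using S'(3) conj_tang'[OF \<psi>] unfolding rigid_def by blast
    have "(\<lambda>x. k (g (P x))) \<in> qend S e T"
      unfolding qend_def using lin_comp[OF kl lin_comp[OF qendD(1)[OF g(1)] Pl]] kS qendD[OF g(1)] PS Pe PT ke kT by auto
    moreover have "\<psi> a x = \<phi>' a (k (g (P x))) - k (g (P (\<phi>' a x)))" if a: "a \<in> A" and x: "x \<in> S" for a x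
    proof -
      have "\<psi> a x = k (P (\<psi> a (k (P x))))" using k(3) x tangD(2)[OF \<psi> a] by simp
      also have "\<dots> = k (\<phi> a (g (P x))) - k (g (\<phi> a (P x)))" using g(2)[OF a PS[OF x]] lin_diff[OF kl] by simp
      also have "k (\<phi> a (g (P x))) = \<phi>' a (k (g (P x)))" unfolding \<phi>'_def using k(4) qendD(2)[OF g(1) PS[OF x]] by simp
      also have "k (g (\<phi> a (P x))) = k (g (P (\<phi>' a x)))" unfolding \<phi>'_def using k(4) tangD(2)[OF S'(2) a PS[OF x]] by simp
      finally show ?thesis .
    qed
    ultimately show "\<exists>g\<in>qend S e T. \<forall>a\<in>A. \<forall>x\<in>S. \<psi> a x = \<phi>' a (g x) - g (\<phi>' a x)"
      by (intro bexI[of _ "\<lambda>x. k (g (P x))"]) auto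
  qed
  obtain g where g: "g \<in> qend S e T" "bij_betw g S S" "\<And>a x. a \<in> A \<Longrightarrow> x \<in> S \<Longrightarrow> g (\<phi> a x) = \<phi>' a (g x)"
    using rigid_unique[OF inf S(1,2) t' S(3) r'] by blast
  have "P (g (\<phi> a x)) = \<phi> a (P (g x))" if "a \<in> A" "x \<in> S" for a x
    using g(3)[OF that] k(4) tangD(2)[OF S'(2) that(1) PS[OF qendD(2)[OF g(1) that(2)]]] unfolding \<phi>'_def by simp
  then have "commuting (?\<Omega> \<union> \<phi> ` A) S (\<lambda>x. P (g x))"
    unfolding commuting_def using lin_comp[OF Pl qendD(1)[OF g(1)]] Pe PT qendD[OF g(1)] by auto
  moreover have "bij_betw (\<lambda>x. P (g x)) S S'" using bij_betw_trans[OF g(2) P(2)] by (simp add: comp_def)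
  ultimately show ?thesis by blast
qed

text \<open>
  The two points of view on representations: the space at the vertex \<open>v\<close> is the image
  of the idempotent \<open>e v\<close>.
\<close>

lemma rep_of_qmod:
  assumes S: "qmod S e T" and h: "\<And>a. a \<in> A \<Longrightarrow> h (tl a) = h (hd a) + 1"
  shows "rep h (\<lambda>v. e v ` S) T"
  unfolding rep_def
proof (intro conjI ballI allI impI)
  show "fdim (e v ` S)" if "v \<in> V" for v using fdim_image[OF qmodD(1)[OF S] qmodD(2)[OF S that]] .
  show "lin (T a)" if "a \<in> A" for a using qmodD(3)[OF S that] .
  show "T a ` e (opp a i) ` S \<subseteq> e i ` S" if a: "a \<in> inc i" "h (opp a i) = h i + 1" for i a
  proof -
    have ht: "h (tl a) = h (hd a) + 1" by (rule h[OF inc_A[OF a(1)]])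
    have "tl a \<noteq> i"
    proof
      assume i: "tl a = i"
      then have "opp a i = hd a" unfolding opp_def by simp
      then show False using a(2) ht i by simp
    qed
    then have "opp a i = tl a" "i = hd a" using a(1) unfolding inc_def opp_def by auto
    moreover have "T a (e (tl a) x) \<in> e (hd a) ` S" if "x \<in> S" for x
    proof (rule image_eqI)
      have aA: "a \<in> A" using inc_A[OF a(1)] .
      have y: "e (tl a) x \<in> S" using qmodD(4)[OF S tlV[OF aA] that] .
      show "T a (e (tl a) x) = e (hd a) (T a (e (tl a) x))" "T a (e (tl a) x) \<in> S"
        by (rule qmodD(9)[OF S aA y, symmetric], rule qmodD(5)[OF S aA y])
    qed
    ultimately show ?thesis by (simp add: image_subset_iff)
  qed
qed

lemma iso_of_rep_iso:
  assumes S: "qmod S e T" and S': "qmod S' e T" and h: "\<And>a. a \<in> A \<Longrightarrow> h (tl a) = h (hd a) + 1"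
    and iso: "rep_iso h (\<lambda>v. e v ` S) T (\<lambda>v. e v ` S') T"
  shows "\<exists>P. commuting (e ` V \<union> T ` A) S P \<and> bij_betw P S S'"
proof -
  obtain g where g: "\<And>v. v \<in> V \<Longrightarrow> lin (g v)" "\<And>v. v \<in> V \<Longrightarrow> bij_betw (g v) (e v ` S) (e v ` S')"
    and com: "\<And>j a x. a \<in> inc j \<Longrightarrow> h (opp a j) = h j + 1 \<Longrightarrow> x \<in> e (opp a j) ` S \<Longrightarrow>
       T a (g (opp a j) x) = g j (T a x)"
    using iso unfolding rep_iso_def by blast
  have com': "T a (g (tl a) (e (tl a) x)) = g (hd a) (T a (e (tl a) x))" if "a \<in> A" "x \<in> S" for a x
    using com[of a "hd a" "e (tl a) x"] h[OF that(1)] that no_loop[OF that(1)] unfolding inc_def opp_def by auto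
  have gS: "g v (e v x) \<in> S'" "e v (g v (e v x)) = g v (e v x)" if "v \<in> V" "x \<in> S" for v x
  proof -
    have "g v (e v x) \<in> e v ` S'" using g(2)[OF that(1)] that(2) unfolding bij_betw_def by blast
    then show "g v (e v x) \<in> S'" "e v (g v (e v x)) = g v (e v x)" using qmodD(4,7)[OF S'] that by auto
  qed
  define P where "P x = (\<Sum>v\<in>V. g v (e v x))" for x
  have Pl: "lin P" unfolding P_def[abs_def] by (rule lin_setsum) (rule lin_comp[OF g(1) qmodD(2)[OF S]])
  note sS' = fdim_subspaceD[OF qmodD(1)[OF S']]
  have PS: "P x \<in> S'" if "x \<in> S" for x unfolding P_def using gS that by (auto intro: subspace_sum[OF sS'])
  have Pe: "P (e v x) = g v (e v x)" if "v \<in> V" "x \<in> S" for v x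
  proof -
    have "P (e v x) = (\<Sum>u\<in>V. if u = v then g v (e v x) else 0)"
      unfolding P_def by (rule sum.cong) (use that qmodD(7)[OF S] lin_0[OF g(1)] in auto)
    then show ?thesis using that finV by simp
  qed
  have eP: "e v (P x) = g v (e v x)" if v: "v \<in> V" and x: "x \<in> S" for v x
  proof -
    have "e v (P x) = (\<Sum>u\<in>V. e v (e u (g u (e u x))))"
      unfolding P_def lin_sum[OF qmodD(2)[OF S' v]] by (rule sum.cong) (use gS x in auto)
    also have "\<dots> = (\<Sum>u\<in>V. if u = v then g v (e v x) else 0)"
    proof (rule sum.cong)
      fix u assume u: "u \<in> V"
      show "e v (e u (g u (e u x))) = (if u = v then g v (e v x) else 0)"
        unfolding qmodD(7)[OF S' v u gS(1)[OF u x]] using gS(2)[OF u x] by auto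
    qed simp
    finally show ?thesis using v finV by simp
  qed
  have PT: "P (T a x) = T a (P x)" if a: "a \<in> A" and x: "x \<in> S" for a x
  proof -
    have "P (T a x) = P (e (hd a) (T a (e (tl a) x)))" using qmodD(8,9)[OF S a x] by simp
    also have "\<dots> = g (hd a) (T a (e (tl a) x))"
      using Pe[OF hdV[OF a] qmodD(5)[OF S a x]] qmodD(8,9)[OF S a x] by simp
    also have "\<dots> = T a (e (tl a) (P x))" using com'[OF a x] eP[OF tlV[OF a] x] by simp
    also have "\<dots> = T a (P x)" using qmodD(8)[OF S' a PS[OF x]] .
    finally show ?thesis .
  qed
  have "inj_on P S"
  proof (rule lin_inj_on[OF Pl fdim_subspaceD[OF qmodD(1)[OF S]]])
    fix x assume x: "x \<in> S" "P x = 0"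
    have "e v x = 0" if v: "v \<in> V" for v
    proof -
      have "g v (e v x) = g v (e v 0)" using eP[OF v x(1)] x(2) lin_0[OF qmodD(2)[OF S v]] lin_0[OF g(1)[OF v]] by simp
      moreover have "0 \<in> S" using subspace_0[OF fdim_subspaceD[OF qmodD(1)[OF S]]] .
      ultimately have "e v x = e v 0" using g(2)[OF v] x(1) unfolding bij_betw_def inj_on_def by blast
      then show ?thesis using lin_0[OF qmodD(2)[OF S v]] by simp
    qed
    then show "x = 0" using qmodD(6)[OF S x(1)] by simp
  qed
  moreover have "S' \<subseteq> P ` S"
  proof
    fix y assume y: "y \<in> S'"
    have "\<forall>v\<in>V. \<exists>x\<in>S. g v (e v x) = e v y" using g(2) y unfolding bij_betw_def by (metis imageE imageI)
    then obtain x where x: "\<And>v. v \<in> V \<Longrightarrow> x v \<in> S \<and> g v (e v (x v)) = e v y" by metis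
    let ?z = "\<Sum>v\<in>V. e v (x v)"
    have "?z \<in> S" using x qmodD(4)[OF S] by (auto intro: subspace_sum[OF fdim_subspaceD[OF qmodD(1)[OF S]]])
    moreover have "P ?z = (\<Sum>v\<in>V. e v y)" unfolding lin_sum[OF Pl] by (rule sum.cong) (use Pe x in auto)
    ultimately show "y \<in> P ` S" using qmodD(6)[OF S' y] by force
  qed
  ultimately have "bij_betw P S S'" using PS unfolding bij_betw_def by blast
  moreover have "commuting (e ` V \<union> T ` A) S P"
    unfolding commuting_def using Pl PT Pe eP by auto
  ultimately show ?thesis by blast
qed

end

section \<open>Rigid sums of summands\<close>

context vspace begin

lemma dsum_image:
  assumes d: "dsum S W W'" and f: "lin f" "f ` W \<subseteq> W" "f ` W' \<subseteq> W'"
  shows "dsum (f ` S) (f ` W) (f ` W')"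
proof (rule dsumI)
  note s = dsum_subspace[OF d] dsum_subset[OF d]
  show "subspace (f ` W)" "subspace (f ` W')" "subspace (f ` S)" using s lin_subspace_image[OF f(1)] by blast+
  show "f ` W \<subseteq> f ` S" "f ` W' \<subseteq> f ` S" using s by blast+
  show "x = 0" if "x \<in> f ` W" "x \<in> f ` W'" for x using that f(2,3) d unfolding dsum_def by blast
  fix x assume "x \<in> f ` S"
  then obtain a b where "a \<in> W" "b \<in> W'" "x = f (a + b)" using dsumE[OF d] by (metis imageE)
  then show "\<exists>a\<in>f ` W. \<exists>b\<in>f ` W'. x = a + b" using lin_add[OF f(1)] by blast
qed

end

context quiver_reps begin

lemma qmod_restrict:
  assumes S: "qmod S e T" and U: "subspace U" "U \<subseteq> S" "stable (e ` V \<union> T ` A) U"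
  shows "qmod U e T"
proof -
  have mem: "x \<in> S" if "x \<in> U" for x using U(2) that by blast
  show ?thesis
    unfolding qmod_def
  proof (intro conjI ballI)
    show "fdim U" using fdim_subset[OF qmodD(1)[OF S] U(1,2)] .
    show "lin (e v)" "e v ` U \<subseteq> U" if "v \<in> V" for v
      using qmodD(2)[OF S that] U(3) that unfolding stable_def by blast+
    show "lin (T a)" "T a ` U \<subseteq> U" if "a \<in> A" for a
      using qmodD(3)[OF S that] U(3) that unfolding stable_def by blast+
    show "(\<Sum>v\<in>V. e v x) = x" if "x \<in> U" for x using qmodD(6)[OF S mem[OF that]] .
    show "e u (e v x) = (if u = v then e v x else 0)" if "u \<in> V" "v \<in> V" "x \<in> U" for u v x
      using qmodD(7)[OF S that(1,2) mem[OF that(3)]] .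
    show "T a (e (tl a) x) = T a x" "e (hd a) (T a x) = T a x" if "a \<in> A" "x \<in> U" for a x
      using qmodD(8,9)[OF S that(1) mem[OF that(2)]] .
  qed
qed

lemma tang_restrict:
  assumes t: "tang S e T \<phi>" and U: "U \<subseteq> S" "stable (\<phi> ` A) U"
  shows "tang U e T \<phi>"
proof -
  have mem: "x \<in> S" if "x \<in> U" for x using U(1) that by blast
  have "\<phi> a ` U \<subseteq> U" if "a \<in> A" for a using U(2) that unfolding stable_def by blast
  then show ?thesis
    unfolding tang_def using tangD(1)[OF t] tangD(3,4)[OF t _ mem] tang_sum[OF t mem] by blast
qed

end

text \<open>
  A rigid module \<open>S\<close> with pairwise non-isomorphic indecomposable summands \<open>U
  i\<close>; \<open>\<pi> i\<close> is the projection of \<open>S\<close> onto \<open>U i\<close>.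
  The second family of copies of the ambient space serves to form sums in which a summand may be
  repeated: the label \<open>(i, j)\<close> stands for the \<open>j\<close>-th copy of \<open>U
  i\<close>.
\<close>

locale summand_family = quiver_reps scale ins up V A tl hd + copies: slots scale cins cup
  for scale :: "'k::field \<Rightarrow> 'w::ab_group_add \<Rightarrow> 'w" (infixr \<open>*s\<close> 75)
  and ins up :: "'e \<Rightarrow> 'w \<Rightarrow> 'w"
  and V :: "'v set" and A :: "'e set" and tl hd :: "'e \<Rightarrow> 'v"
  and cins cup :: "nat \<times> nat \<Rightarrow> 'w \<Rightarrow> 'w" +
  fixes S :: "'w set" and e :: "'v \<Rightarrow> 'w \<Rightarrow> 'w" and T \<phi> :: "'e \<Rightarrow> 'w \<Rightarrow> 'w"
    and I :: "nat set" and U :: "nat \<Rightarrow> 'w set" and \<pi> :: "nat \<Rightarrow> 'w \<Rightarrow> 'w" and h :: "'v \<Rightarrow> int"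
  assumes inf: "infinite (UNIV :: 'k set)"
    and S: "qmod S e T" and \<phi>: "tang S e T \<phi>" and rigid: "rigid S e T \<phi>"
    and h: "\<And>a. a \<in> A \<Longrightarrow> h (tl a) = h (hd a) + 1"
    and finI: "finite I"
    and US: "\<And>i. i \<in> I \<Longrightarrow> U i \<subseteq> S"
    and \<pi>U: "\<And>i x. i \<in> I \<Longrightarrow> x \<in> S \<Longrightarrow> \<pi> i x \<in> U i"
    and \<pi>_id: "\<And>i x. i \<in> I \<Longrightarrow> x \<in> U i \<Longrightarrow> \<pi> i x = x"
    and \<pi>_com: "\<And>i. i \<in> I \<Longrightarrow> commuting (e ` V \<union> T ` A \<union> \<phi> ` A) S (\<pi> i)"
    and indec: "\<And>i. i \<in> I \<Longrightarrow> indec (e ` V \<union> T ` A \<union> \<phi> ` A) (U i)"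
    and noniso: "\<And>i j f. i \<in> I \<Longrightarrow> j \<in> I \<Longrightarrow> i \<noteq> j \<Longrightarrow>
       commuting (e ` V \<union> T ` A \<union> \<phi> ` A) (U i) f \<Longrightarrow> \<not> bij_betw f (U i) (U j)"
begin

abbreviation \<Omega> :: "('w \<Rightarrow> 'w) set" where "\<Omega> \<equiv> e ` V \<union> T ` A \<union> \<phi> ` A"

lemma lin_\<Omega>: "\<omega> \<in> \<Omega> \<Longrightarrow> lin \<omega>"
  using qmodD(2,3)[OF S] tangD(1)[OF \<phi>] by blast

lemma fdim_U: "i \<in> I \<Longrightarrow> fdim (U i)" and stable_U: "i \<in> I \<Longrightarrow> stable \<Omega> (U i)"
  using indec unfolding indec_def by blast+

lemma qmod_U: "i \<in> I \<Longrightarrow> qmod (U i) e T"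
  by (rule qmod_restrict[OF S fdim_subspaceD[OF fdim_U] US])
    (use stable_U in \<open>auto simp: stable_def\<close>)

lemma \<pi>_lin: "i \<in> I \<Longrightarrow> lin (\<pi> i)"
  using \<pi>_com unfolding commuting_def by blast

lemma \<pi>_op: "i \<in> I \<Longrightarrow> \<omega> \<in> \<Omega> \<Longrightarrow> x \<in> S \<Longrightarrow> \<pi> i (\<omega> x) = \<omega> (\<pi> i x)"
  using \<pi>_com unfolding commuting_def by blast

lemma graded_h: "graded h"
  unfolding graded_def using h by simp

text \<open>
  The sum of the copies labelled by \<open>J\<close>, a module under the diagonal operators
  \<open>dg\<close>. These are formed with respect to a larger set \<open>J0\<close> of labels, so
  that sums over different sets are modules under the same operators.
\<close>

definition SJ :: "(nat \<times> nat) set \<Rightarrow> 'w set" where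
  "SJ J = copies.fam J (\<lambda>s. U (fst s))"

text \<open>The multiplicities of the restriction of \<open>U i\<close> to the quiver.\<close>

definition m :: "nat \<Rightarrow> nat \<Rightarrow> nat" where
  "m i k = top_mult h (\<lambda>v. e v ` U i) T k"

context
  fixes J0 :: "(nat \<times> nat) set"
  assumes fin0: "finite J0" and J0I: "fst ` J0 \<subseteq> I"
begin

definition dg :: "('w \<Rightarrow> 'w) \<Rightarrow> 'w \<Rightarrow> 'w" where
  "dg f = copies.diag J0 (\<lambda>_. f)"

lemma lin_dg: "lin f \<Longrightarrow> lin (dg f)"
  unfolding dg_def by (rule copies.lin_diag)

lemma cup_dg: "s \<in> J0 \<Longrightarrow> cup s (dg f x) = f (cup s x)"
  unfolding dg_def by (rule copies.up_diag[OF fin0])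

lemma dg_cins: "s \<in> J0 \<Longrightarrow> lin f \<Longrightarrow> dg f (cins s x) = cins s (f x)"
proof -
  assume s: "s \<in> J0" and f: "lin f"
  have "dg f (cins s x) = (\<Sum>t\<in>J0. if t = s then cins s (f x) else 0)"
    unfolding dg_def copies.diag_def
    by (rule sum.cong) (auto simp: copies.up_ins lin_0[OF f] lin_0[OF copies.lin_ins])
  then show ?thesis using s fin0 by simp
qed

context
  fixes J :: "(nat \<times> nat) set"
  assumes J: "J \<subseteq> J0"
begin

lemma finJ: "finite J" using J fin0 finite_subset by blast

lemma fstJ: "s \<in> J \<Longrightarrow> fst s \<in> I" using J J0I by blast

lemma SJ_cup: "x \<in> SJ J \<Longrightarrow> s \<in> J \<Longrightarrow> cup s x \<in> U (fst s)"
  unfolding SJ_def by (rule copies.fam_up)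

lemma SJ_cup_S: "x \<in> SJ J \<Longrightarrow> s \<in> J \<Longrightarrow> cup s x \<in> S"
  using SJ_cup US fstJ by blast

lemma SJ_eqI: "x \<in> SJ J \<Longrightarrow> y \<in> SJ J \<Longrightarrow> (\<And>s. s \<in> J \<Longrightarrow> cup s x = cup s y) \<Longrightarrow> x = y"
  unfolding SJ_def by (rule copies.fam_eqI)

lemma fdim_SJ: "fdim (SJ J)"
  unfolding SJ_def using copies.dim_fam[OF finJ, of "\<lambda>s. U (fst s)"] fdim_U[OF fstJ] by simp

lemma dg_SJ: assumes x: "x \<in> SJ J" and f: "lin f" "\<And>i. i \<in> I \<Longrightarrow> f ` U i \<subseteq> U i" shows "dg f x \<in> SJ J"
proof -
  have "cup s x = 0" if "s \<notin> J" for s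
    using copies.up_sum_ins[OF finJ, of s "\<lambda>s. cup s x"] that copies.fam_eq_sum[OF x[unfolded SJ_def]] by metis
  then have "dg f x = (\<Sum>s\<in>J. cins s (f (cup s x)))"
    unfolding dg_def copies.diag_def
    by (intro sum.mono_neutral_right[OF fin0 J]) (auto simp: lin_0[OF f(1)] lin_0[OF copies.lin_ins])
  also have "\<dots> \<in> SJ J"
    unfolding SJ_def by (rule copies.famI[OF finJ]) (use f(2) SJ_cup[OF x] fstJ in blast)
  finally show ?thesis .
qed

lemma dg_op_SJ: "x \<in> SJ J \<Longrightarrow> \<omega> \<in> \<Omega> \<Longrightarrow> dg \<omega> x \<in> SJ J"
  using dg_SJ[OF _ lin_\<Omega>, of x \<omega>] stable_U unfolding stable_def by blast

lemma cins_SJ: assumes "s \<in> J" "y \<in> U (fst s)" shows "cins s y \<in> SJ J"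
  unfolding SJ_def
proof (rule copies.ins_in_fam[OF finJ assms(1), of y "\<lambda>s. U (fst s)"])
  show "0 \<in> U (fst t)" if "t \<in> J" for t using subspace_0[OF fdim_subspaceD[OF fdim_U[OF fstJ[OF that]]]] .
qed (rule assms)

lemma qmod_SJ: "qmod (SJ J) (\<lambda>v. dg (e v)) (\<lambda>a. dg (T a))"
  unfolding qmod_def
proof (intro conjI ballI)
  show "fdim (SJ J)" by (rule fdim_SJ)
  show "lin (dg (e v))" if "v \<in> V" for v using lin_dg qmodD(2)[OF S that] .
  show "dg (e v) ` SJ J \<subseteq> SJ J" if "v \<in> V" for v using dg_op_SJ that by blast
  show "lin (dg (T a))" if "a \<in> A" for a using lin_dg qmodD(3)[OF S that] .
  show "dg (T a) ` SJ J \<subseteq> SJ J" if "a \<in> A" for a using dg_op_SJ that by blast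
  note sS = fdim_subspaceD[OF fdim_SJ]
  show "(\<Sum>v\<in>V. dg (e v) x) = x" if x: "x \<in> SJ J" for x
  proof (rule SJ_eqI[OF _ x])
    show "(\<Sum>v\<in>V. dg (e v) x) \<in> SJ J" using dg_op_SJ[OF x] by (auto intro: subspace_sum[OF sS])
    show "cup s (\<Sum>v\<in>V. dg (e v) x) = cup s x" if "s \<in> J" for s
      using qmodD(6)[OF S SJ_cup_S[OF x that]] subsetD[OF J that] by (simp add: lin_sum[OF copies.lin_up] cup_dg)
  qed
  show "dg (e u) (dg (e v) x) = (if u = v then dg (e v) x else 0)" if uv: "u \<in> V" "v \<in> V" and x: "x \<in> SJ J" for u v x
  proof (rule SJ_eqI)
    show "dg (e u) (dg (e v) x) \<in> SJ J" using dg_op_SJ[OF dg_op_SJ[OF x]] uv by blast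
    show "(if u = v then dg (e v) x else 0) \<in> SJ J" using dg_op_SJ[OF x] uv subspace_0[OF sS] by auto
    show "cup s (dg (e u) (dg (e v) x)) = cup s (if u = v then dg (e v) x else 0)" if "s \<in> J" for s
      using qmodD(7)[OF S uv SJ_cup_S[OF x that]] subsetD[OF J that] by (auto simp: lin_0[OF copies.lin_up] cup_dg)
  qed
  fix a x assume a: "a \<in> A" and x: "x \<in> SJ J"
  show "dg (T a) (dg (e (tl a)) x) = dg (T a) x"
  proof (rule SJ_eqI)
    show "dg (T a) (dg (e (tl a)) x) \<in> SJ J" "dg (T a) x \<in> SJ J"
      using dg_op_SJ[OF dg_op_SJ[OF x]] dg_op_SJ[OF x] a tlV[OF a] by blast+
    show "cup s (dg (T a) (dg (e (tl a)) x)) = cup s (dg (T a) x)" if "s \<in> J" for s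
      using qmodD(8)[OF S a SJ_cup_S[OF x that]] subsetD[OF J that] by (simp add: cup_dg)
  qed
  show "dg (e (hd a)) (dg (T a) x) = dg (T a) x"
  proof (rule SJ_eqI)
    show "dg (e (hd a)) (dg (T a) x) \<in> SJ J" "dg (T a) x \<in> SJ J"
      using dg_op_SJ[OF dg_op_SJ[OF x]] dg_op_SJ[OF x] a hdV[OF a] by blast+
    show "cup s (dg (e (hd a)) (dg (T a) x)) = cup s (dg (T a) x)" if "s \<in> J" for s
      using qmodD(9)[OF S a SJ_cup_S[OF x that]] subsetD[OF J that] by (simp add: cup_dg)
  qed
qed

lemma tang_SJ: "tang (SJ J) (\<lambda>v. dg (e v)) (\<lambda>a. dg (T a)) (\<lambda>a. dg (\<phi> a))"
  unfolding tang_def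
proof (intro conjI ballI)
  note sS = fdim_subspaceD[OF fdim_SJ]
  fix x assume x: "x \<in> SJ J"
  show "(\<Sum>a\<in>A. dg (T a) (dg (\<phi> a) x) - dg (\<phi> a) (dg (T a) x)) = 0"
  proof (rule SJ_eqI)
    show "(\<Sum>a\<in>A. dg (T a) (dg (\<phi> a) x) - dg (\<phi> a) (dg (T a) x)) \<in> SJ J"
      using dg_op_SJ[OF dg_op_SJ[OF x]] by (auto intro!: subspace_sum[OF sS] subspace_diff[OF sS])
    show "cup s (\<Sum>a\<in>A. dg (T a) (dg (\<phi> a) x) - dg (\<phi> a) (dg (T a) x)) = cup s 0" if "s \<in> J" for s
      using tang_sum[OF \<phi> SJ_cup_S[OF x that]] subsetD[OF J that] by (simp add: lin_sum[OF copies.lin_up] lin_diff[OF copies.lin_up] lin_0[OF copies.lin_up] cup_dg)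
  qed (rule subspace_0[OF sS])
next
  fix a assume a: "a \<in> A"
  show "lin (dg (\<phi> a))" using lin_dg tangD(1)[OF \<phi> a] .
  show "dg (\<phi> a) ` SJ J \<subseteq> SJ J" using dg_op_SJ a by blast
  fix x assume x: "x \<in> SJ J"
  show "dg (\<phi> a) (dg (e (hd a)) x) = dg (\<phi> a) x"
  proof (rule SJ_eqI)
    show "dg (\<phi> a) (dg (e (hd a)) x) \<in> SJ J" "dg (\<phi> a) x \<in> SJ J"
      using dg_op_SJ[OF dg_op_SJ[OF x]] dg_op_SJ[OF x] a hdV[OF a] by blast+
    show "cup s (dg (\<phi> a) (dg (e (hd a)) x)) = cup s (dg (\<phi> a) x)" if "s \<in> J" for s
      using tangD(3)[OF \<phi> a SJ_cup_S[OF x that]] subsetD[OF J that] by (simp add: cup_dg)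
  qed
  show "dg (e (tl a)) (dg (\<phi> a) x) = dg (\<phi> a) x"
  proof (rule SJ_eqI)
    show "dg (e (tl a)) (dg (\<phi> a) x) \<in> SJ J" "dg (\<phi> a) x \<in> SJ J"
      using dg_op_SJ[OF dg_op_SJ[OF x]] dg_op_SJ[OF x] a tlV[OF a] by blast+
    show "cup s (dg (e (tl a)) (dg (\<phi> a) x)) = cup s (dg (\<phi> a) x)" if "s \<in> J" for s
      using tangD(4)[OF \<phi> a SJ_cup_S[OF x that]] subsetD[OF J that] by (simp add: cup_dg)
  qed
qed

text \<open>
  A tangent vector on the sum has components \<open>\<psi>c s t\<close> from copy \<open>t\<close>
  to copy \<open>s\<close>. Extended by the projections, each of them is a tangent vector on
  \<open>S\<close>, so it comes from an endomorphism \<open>G s t\<close>; the compressions of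
  these are the matrix entries of the required endomorphism.
\<close>

lemma rigid_SJ: "rigid (SJ J) (\<lambda>v. dg (e v)) (\<lambda>a. dg (T a)) (\<lambda>a. dg (\<phi> a))"
  unfolding rigid_def
proof (intro allI impI)
  fix \<psi> assume \<psi>: "tang (SJ J) (\<lambda>v. dg (e v)) (\<lambda>a. dg (T a)) \<psi>"
  define \<psi>c where "\<psi>c s t a x = cup s (\<psi> a (cins t (\<pi> (fst t) x)))" for s t a x
  have in_SJ: "cins t (\<pi> (fst t) x) \<in> SJ J" if "t \<in> J" "x \<in> S" for t x
    using cins_SJ \<pi>U fstJ that by blast
  have op_in: "cins t (\<pi> (fst t) (\<omega> x)) = dg \<omega> (cins t (\<pi> (fst t) x))" if "t \<in> J" "x \<in> S" "\<omega> \<in> \<Omega>" for t x \<omega>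
    using \<pi>_op[OF fstJ[OF that(1)] that(3,2)] dg_cins[OF subsetD[OF J that(1)] lin_\<Omega>[OF that(3)]] by simp
  have \<psi>cU: "\<psi>c s t a x \<in> U (fst s)" if "s \<in> J" "t \<in> J" "a \<in> A" "x \<in> S" for s t a x
    unfolding \<psi>c_def using SJ_cup tangD(2)[OF \<psi>] in_SJ that by blast
  have tc: "tang S e T (\<psi>c s t)" if s: "s \<in> J" and t: "t \<in> J" for s t
    unfolding tang_def
  proof (intro conjI ballI)
    have sJ: "s \<in> J0" using s J by blast
    fix x assume x: "x \<in> S"
    define z where "z = cins t (\<pi> (fst t) x)"
    have z: "z \<in> SJ J" unfolding z_def by (rule in_SJ[OF t x])
    have "(\<Sum>a\<in>A. T a (\<psi>c s t a x) - \<psi>c s t a (T a x)) = (\<Sum>a\<in>A. cup s (dg (T a) (\<psi> a z) - \<psi> a (dg (T a) z)))"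
      by (rule sum.cong) (use op_in[OF t x] in \<open>auto simp: \<psi>c_def z_def lin_diff[OF copies.lin_up] cup_dg[OF sJ]\<close>)
    also have "\<dots> = cup s 0" unfolding lin_sum[OF copies.lin_up, symmetric] tang_sum[OF \<psi> z] ..
    finally show "(\<Sum>a\<in>A. T a (\<psi>c s t a x) - \<psi>c s t a (T a x)) = 0" by (simp add: lin_0[OF copies.lin_up])
  next
    have sJ: "s \<in> J0" using s J by blast
    fix a assume a: "a \<in> A"
    show "lin (\<psi>c s t a)"
      unfolding \<psi>c_def[abs_def]
      by (rule lin_comp[OF copies.lin_up lin_comp[OF tangD(1)[OF \<psi> a] lin_comp[OF copies.lin_ins \<pi>_lin[OF fstJ[OF t]]]]])
    show "\<psi>c s t a ` S \<subseteq> S" using \<psi>cU[OF s t a] US fstJ[OF s] by blast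
    fix x assume x: "x \<in> S"
    show "\<psi>c s t a (e (hd a) x) = \<psi>c s t a x"
      unfolding \<psi>c_def using op_in[OF t x, of "e (hd a)"] hdV[OF a] tangD(3)[OF \<psi> a in_SJ[OF t x]] by simp
    show "e (tl a) (\<psi>c s t a x) = \<psi>c s t a x"
      unfolding \<psi>c_def cup_dg[OF sJ, symmetric] tangD(4)[OF \<psi> a in_SJ[OF t x]] ..
  qed
  have "\<forall>s\<in>J. \<forall>t\<in>J. \<exists>g\<in>qend S e T. \<forall>a\<in>A. \<forall>x\<in>S. \<psi>c s t a x = \<phi> a (g x) - g (\<phi> a x)"
    using rigid tc unfolding rigid_def by blast
  then obtain G where G: "\<And>s t. s \<in> J \<Longrightarrow> t \<in> J \<Longrightarrow> G s t \<in> qend S e T"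
    "\<And>s t a x. s \<in> J \<Longrightarrow> t \<in> J \<Longrightarrow> a \<in> A \<Longrightarrow> x \<in> S \<Longrightarrow> \<psi>c s t a x = \<phi> a (G s t x) - G s t (\<phi> a x)" by metis
  define g where "g x = (\<Sum>s\<in>J. cins s (\<pi> (fst s) (\<Sum>t\<in>J. G s t (cup t x))))" for x
  have sum_S: "(\<Sum>t\<in>J. G s t (cup t x)) \<in> S" if "s \<in> J" "x \<in> SJ J" for s x
  proof (rule subspace_sum[OF fdim_subspaceD[OF qmodD(1)[OF S]]])
    show "G s t (cup t x) \<in> S" if t: "t \<in> J" for t
      by (rule qendD(2)[OF G(1)[OF \<open>s \<in> J\<close> t] SJ_cup_S[OF \<open>x \<in> SJ J\<close> t]])
  qed
  have gl: "lin g"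
  proof -
    have "lin (\<lambda>x. \<Sum>t\<in>J. G s t (cup t x))" if "s \<in> J" for s
      by (rule lin_setsum, rule lin_comp[OF qendD(1)[OF G(1)[OF that]] copies.lin_up])
    then show ?thesis unfolding g_def[abs_def]
      by (intro lin_setsum) (rule lin_comp[OF copies.lin_ins lin_comp[OF \<pi>_lin[OF fstJ]]])
  qed
  have gS: "g x \<in> SJ J" if "x \<in> SJ J" for x
    unfolding g_def SJ_def by (rule copies.famI[OF finJ]) (use \<pi>U fstJ sum_S that in blast)
  have cup_g: "cup s (g x) = \<pi> (fst s) (\<Sum>t\<in>J. G s t (cup t x))" if "s \<in> J" for s x
    unfolding g_def using that by (simp add: copies.up_sum_ins[OF finJ])
  have com: "g (dg \<omega> x) = dg \<omega> (g x)" if x: "x \<in> SJ J" and o: "\<omega> \<in> e ` V \<union> T ` A" for x \<omega>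
  proof (rule SJ_eqI)
    have o': "\<omega> \<in> \<Omega>" using o by blast
    show "g (dg \<omega> x) \<in> SJ J" "dg \<omega> (g x) \<in> SJ J" using gS dg_op_SJ x o' by blast+
    fix s assume s: "s \<in> J"
    have "(\<Sum>t\<in>J. G s t (cup t (dg \<omega> x))) = (\<Sum>t\<in>J. \<omega> (G s t (cup t x)))"
    proof (rule sum.cong)
      fix t assume t: "t \<in> J"
      have "t \<in> J0" using t J by blast
      then show "G s t (cup t (dg \<omega> x)) = \<omega> (G s t (cup t x))"
        using qendD(3,4)[OF G(1)[OF s t]] SJ_cup_S[OF x t] o by (auto simp: cup_dg)
    qed simp
    then have "cup s (g (dg \<omega> x)) = \<omega> (\<pi> (fst s) (\<Sum>t\<in>J. G s t (cup t x)))"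
      unfolding cup_g[OF s] using \<pi>_op[OF fstJ[OF s] o' sum_S[OF s x]] by (simp add: lin_sum[OF lin_\<Omega>[OF o']])
    moreover have "s \<in> J0" using s J by blast
    ultimately show "cup s (g (dg \<omega> x)) = cup s (dg \<omega> (g x))" by (simp add: cup_dg cup_g[OF s])
  qed
  have "g \<in> qend (SJ J) (\<lambda>v. dg (e v)) (\<lambda>a. dg (T a))"
    unfolding qend_def using gl gS com by blast
  moreover have "\<psi> a x = dg (\<phi> a) (g x) - g (dg (\<phi> a) x)" if a: "a \<in> A" and x: "x \<in> SJ J" for a x
  proof (rule SJ_eqI)
    show "\<psi> a x \<in> SJ J" using tangD(2)[OF \<psi> a x] .
    have p: "\<phi> a \<in> \<Omega>" using a by blast
    show "dg (\<phi> a) (g x) - g (dg (\<phi> a) x) \<in> SJ J"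
      using gS dg_op_SJ[OF _ p] x subspace_diff[OF fdim_subspaceD[OF fdim_SJ]] by blast
    fix s assume s: "s \<in> J"
    then have sJ: "s \<in> J0" using J by blast
    have xs: "x = (\<Sum>t\<in>J. cins t (cup t x))" using copies.fam_eq_sum x unfolding SJ_def by blast
    have "cup s (dg (\<phi> a) (g x) - g (dg (\<phi> a) x)) =
       \<phi> a (\<pi> (fst s) (\<Sum>t\<in>J. G s t (cup t x))) - \<pi> (fst s) (\<Sum>t\<in>J. G s t (cup t (dg (\<phi> a) x)))"
      by (simp add: lin_diff[OF copies.lin_up] cup_dg[OF sJ] cup_g[OF s])
    also have "\<dots> = \<pi> (fst s) (\<Sum>t\<in>J. \<phi> a (G s t (cup t x)) - G s t (\<phi> a (cup t x)))"
    proof -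
      have "(\<Sum>t\<in>J. G s t (cup t (dg (\<phi> a) x))) = (\<Sum>t\<in>J. G s t (\<phi> a (cup t x)))"
        by (rule sum.cong) (use J cup_dg in auto)
      then show ?thesis
        using \<pi>_op[OF fstJ[OF s] p sum_S[OF s x]]
        by (simp add: sum_subtractf lin_diff[OF \<pi>_lin[OF fstJ[OF s]]] lin_sum[OF tangD(1)[OF \<phi> a]])
    qed
    also have "(\<Sum>t\<in>J. \<phi> a (G s t (cup t x)) - G s t (\<phi> a (cup t x))) = (\<Sum>t\<in>J. \<psi>c s t a (cup t x))"
      by (rule sum.cong) (use G(2)[OF s _ a SJ_cup_S[OF x]] in auto)
    also have "\<dots> = (\<Sum>t\<in>J. cup s (\<psi> a (cins t (cup t x))))"
      unfolding \<psi>c_def by (rule sum.cong) (use \<pi>_id fstJ SJ_cup[OF x] in auto)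
    also have "\<dots> = cup s (\<psi> a x)"
      by (subst (2) xs) (simp add: lin_sum[OF copies.lin_up] lin_sum[OF tangD(1)[OF \<psi> a]])
    also have "\<pi> (fst s) (cup s (\<psi> a x)) = cup s (\<psi> a x)"
      using \<pi>_id[OF fstJ[OF s]] SJ_cup tangD(2)[OF \<psi> a x] s by blast
    finally show "cup s (\<psi> a x) = cup s (dg (\<phi> a) (g x) - g (dg (\<phi> a) x))" ..
  qed
  ultimately show "\<exists>g\<in>qend (SJ J) (\<lambda>v. dg (e v)) (\<lambda>a. dg (T a)). \<forall>a\<in>A. \<forall>x\<in>SJ J.
      \<psi> a x = dg (\<phi> a) (g x) - g (dg (\<phi> a) x)" by blast
qed

end

lemma dg_image: "\<omega> \<in> \<Omega> \<Longrightarrow> J \<subseteq> J0 \<Longrightarrow> dg \<omega> ` SJ J \<subseteq> SJ J"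
  using dg_op_SJ by blast

lemma top_mult_SJ:
  assumes V: "V \<noteq> {}" and J: "J \<subseteq> J0"
  shows "top_mult h (\<lambda>v. dg (e v) ` SJ J) (\<lambda>a. dg (T a)) k = (\<Sum>s\<in>J. m (fst s) k)"
proof -
  have rep: "rep h (\<lambda>v. dg (e v) ` SJ J) (\<lambda>a. dg (T a))" if "J \<subseteq> J0" for J
    using rep_of_qmod[where e = "\<lambda>v. dg (e v)", OF qmod_SJ[OF that], of h] h by blast
  have ds: "rep_dsum h (\<lambda>v. dg (e v) ` SJ (J \<union> J')) (\<lambda>a. dg (T a)) (\<lambda>v. dg (e v) ` SJ J) (\<lambda>v. dg (e v) ` SJ J')"
    if JJ: "J \<subseteq> J0" "J' \<subseteq> J0" "J \<inter> J' = {}" for J J'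
  proof -
    have JU: "J \<union> J' \<subseteq> J0" using JJ by blast
    have sub: "SJ K \<subseteq> SJ L" if K: "K \<subseteq> L" and L: "L \<subseteq> J0" for K L
    proof
      fix x assume x: "x \<in> SJ K"
      have KJ: "K \<subseteq> J0" using K L by blast
      have "x = (\<Sum>s\<in>K. cins s (cup s x))" using copies.fam_eq_sum x unfolding SJ_def by blast
      also have "\<dots> \<in> SJ L"
        by (rule subspace_sum[OF fdim_subspaceD[OF fdim_SJ[OF L]]]) (use cins_SJ[OF L] SJ_cup[OF KJ x] K in blast)
      finally show "x \<in> SJ L" .
    qed
    have zero: "cup s x = 0" if "x \<in> SJ K" "K \<subseteq> J0" "s \<notin> K" for x K s
      using copies.up_sum_ins[OF finJ[OF that(2)], of s "\<lambda>s. cup s x"] that copies.fam_eq_sum[of x K] unfolding SJ_def by metis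
    have "dsum (SJ (J \<union> J')) (SJ J) (SJ J')"
    proof (rule dsumI)
      show "subspace (SJ J)" "subspace (SJ J')" "subspace (SJ (J \<union> J'))"
        using fdim_subspaceD fdim_SJ JJ JU by blast+
      show "SJ J \<subseteq> SJ (J \<union> J')" "SJ J' \<subseteq> SJ (J \<union> J')" using sub JU by blast+
      show "x = 0" if x: "x \<in> SJ J" "x \<in> SJ J'" for x
      proof (rule SJ_eqI[OF JJ(1) x(1)])
        show "0 \<in> SJ J" using subspace_0 fdim_subspaceD fdim_SJ JJ by blast
        show "cup s x = cup s 0" if "s \<in> J" for s
          using zero[OF x(2) JJ(2), of s] JJ(3) that by (auto simp: lin_0[OF copies.lin_up])
      qed
      fix x assume x: "x \<in> SJ (J \<union> J')"
      have "x = (\<Sum>s\<in>J \<union> J'. cins s (cup s x))" using copies.fam_eq_sum x unfolding SJ_def by blast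
      also have "\<dots> = (\<Sum>s\<in>J. cins s (cup s x)) + (\<Sum>s\<in>J'. cins s (cup s x))"
        by (rule sum.union_disjoint) (use finJ JJ in auto)
      finally have "x = (\<Sum>s\<in>J. cins s (cup s x)) + (\<Sum>s\<in>J'. cins s (cup s x))" .
      moreover have "(\<Sum>s\<in>J. cins s (cup s x)) \<in> SJ J" "(\<Sum>s\<in>J'. cins s (cup s x)) \<in> SJ J'"
        unfolding SJ_def by (intro copies.famI finJ JJ; use SJ_cup[OF JU x] in blast)+
      ultimately show "\<exists>a\<in>SJ J. \<exists>b\<in>SJ J'. x = a + b" by blast
    qed
    then have "dsum (dg (e v) ` SJ (J \<union> J')) (dg (e v) ` SJ J) (dg (e v) ` SJ J')" if "v \<in> V" for v
      by (rule dsum_image) (use lin_dg lin_\<Omega> dg_image JJ that in blast)+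
    then show ?thesis unfolding rep_dsum_def using rep JJ JU by blast
  qed
  have single: "top_mult h (\<lambda>v. dg (e v) ` SJ {s}) (\<lambda>a. dg (T a)) k = m (fst s) k" if s: "s \<in> J0" for s
  proof -
    have sI: "fst s \<in> I" using J0I s by blast
    have ss: "{s} \<subseteq> J0" using s by blast
    have SJs: "SJ {s} = cins s ` U (fst s)"
      unfolding SJ_def copies.fam_def by (auto simp: copies.up_ins)
    have X: "rep h (\<lambda>v. e v ` U (fst s)) T" using rep_of_qmod[OF qmod_U[OF sI]] h by blast
    have "rep_iso h (\<lambda>v. e v ` U (fst s)) T (\<lambda>v. dg (e v) ` SJ {s}) (\<lambda>a. dg (T a))"
      unfolding rep_iso_def
    proof (intro exI[of _ "\<lambda>_. cins s"] conjI ballI allI impI)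
      fix v assume v: "v \<in> V"
      show "lin (cins s)" by (rule copies.lin_ins)
      have "inj (cins s)" by (rule injI) (metis copies.up_ins)
      moreover have "dg (e v) ` SJ {s} = cins s ` e v ` U (fst s)"
        unfolding SJs image_image using dg_cins[OF s qmodD(2)[OF S v]] by simp
      ultimately show "bij_betw (cins s) (e v ` U (fst s)) (dg (e v) ` SJ {s})"
        unfolding bij_betw_def by (metis inj_on_subset subset_UNIV)
    next
      fix i a x assume a: "a \<in> inc i"
      show "dg (T a) (cins s x) = cins s (T a x)" using dg_cins[OF s qmodD(3)[OF S inc_A[OF a]]] .
    qed
    from mult_iso[OF V graded_h X rep[OF ss] this] show ?thesis unfolding m_def by simp
  qed
  show ?thesis
    using finJ[OF J] J
  proof (induction J)
    case empty
    have "top_mult h (\<lambda>v. dg (e v) ` SJ {}) (\<lambda>a. dg (T a)) k = top_mult h (\<lambda>v. dg (e v) ` SJ {}) (\<lambda>a. dg (T a)) k + top_mult h (\<lambda>v. dg (e v) ` SJ {}) (\<lambda>a. dg (T a)) k"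
      using mult_dsum[OF V graded_h ds[of "{}" "{}"]] by simp
    then show ?case by simp
  next
    case (insert s J)
    then show ?case using mult_dsum[OF V graded_h ds[of "{s}" J]] single[of s] by simp
  qed
qed

text \<open>
  If \<open>\<Theta>\<close> were an isomorphism, the identity of a summand \<open>U (fst
  s0)\<close> of the source would be the sum of its passages \<open>g s (f s x)\<close> through
  the summands of the target. One of them is bijective, which makes the two summands isomorphic
  although their labels differ.
\<close>

lemma no_common_iso:
  assumes J: "J \<subseteq> J0" "J' \<subseteq> J0" and ne: "J \<noteq> {}" and dis: "fst ` J \<inter> fst ` J' = {}"
    and \<Theta>: "commuting (dg ` \<Omega>) (SJ J) \<Theta>" "bij_betw \<Theta> (SJ J) (SJ J')"
  shows False
proof -
  obtain s0 where s0: "s0 \<in> J" using ne by blast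
  let ?U = "U (fst s0)"
  have i0: "fst s0 \<in> I" using fstJ[OF J(1) s0] .
  have st: "stable (dg ` \<Omega>) (SJ J)" unfolding stable_def using dg_op_SJ[OF J(1)] by blast
  obtain k where k: "commuting (dg ` \<Omega>) (SJ J') k" "bij_betw k (SJ J') (SJ J)" "\<And>x. x \<in> SJ J \<Longrightarrow> k (\<Theta> x) = x"
    using commuting_inverse[OF fdim_subspaceD[OF fdim_SJ[OF J(1)]] st \<Theta>] by metis
  have lins: "lin \<Theta>" "lin k" using \<Theta> k unfolding commuting_def by blast+
  have \<Theta>S: "\<Theta> x \<in> SJ J'" if "x \<in> SJ J" for x using \<Theta>(2) that unfolding bij_betw_def by blast
  have kS: "k x \<in> SJ J" if "x \<in> SJ J'" for x using k(2) that unfolding bij_betw_def by blast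
  define f where "f s x = cup s (\<Theta> (cins s0 x))" for s x
  define g where "g s x = cup s0 (k (cins s x))" for s x
  have lf: "lin (f s)" for s unfolding f_def[abs_def] by (rule lin_comp[OF copies.lin_up lin_comp[OF lins(1) copies.lin_ins]])
  have lg: "lin (g s)" for s unfolding g_def[abs_def] by (rule lin_comp[OF copies.lin_up lin_comp[OF lins(2) copies.lin_ins]])
  have fU: "f s ` ?U \<subseteq> U (fst s)" if "s \<in> J'" for s
    unfolding f_def using SJ_cup[OF J(2) \<Theta>S[OF cins_SJ[OF J(1) s0]] that] by blast
  have gU: "g s ` U (fst s) \<subseteq> ?U" if "s \<in> J'" for s
    unfolding g_def using SJ_cup[OF J(1) kS[OF cins_SJ[OF J(2) that]] s0] by blast
  have fc: "commuting \<Omega> ?U (f s)" if s: "s \<in> J'" for s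
    unfolding commuting_def
  proof (intro conjI ballI lf)
    fix \<omega> x assume o: "\<omega> \<in> \<Omega>" and x: "x \<in> ?U"
    have "cins s0 (\<omega> x) = dg \<omega> (cins s0 x)" using dg_cins[OF subsetD[OF J(1) s0] lin_\<Omega>[OF o]] by simp
    moreover have "\<Theta> (dg \<omega> (cins s0 x)) = dg \<omega> (\<Theta> (cins s0 x))"
      using \<Theta>(1) o cins_SJ[OF J(1) s0 x] unfolding commuting_def by blast
    ultimately show "f s (\<omega> x) = \<omega> (f s x)" unfolding f_def using cup_dg[OF subsetD[OF J(2) s]] by simp
  qed
  have gc: "commuting \<Omega> (U (fst s)) (g s)" if s: "s \<in> J'" for s
    unfolding commuting_def
  proof (intro conjI ballI lg)
    fix \<omega> x assume o: "\<omega> \<in> \<Omega>" and x: "x \<in> U (fst s)"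
    have "cins s (\<omega> x) = dg \<omega> (cins s x)" using dg_cins[OF subsetD[OF J(2) s] lin_\<Omega>[OF o]] by simp
    moreover have "k (dg \<omega> (cins s x)) = dg \<omega> (k (cins s x))"
      using k(1) o cins_SJ[OF J(2) s x] unfolding commuting_def by blast
    ultimately show "g s (\<omega> x) = \<omega> (g s x)" unfolding g_def using cup_dg[OF subsetD[OF J(1) s0]] by simp
  qed
  have sum: "(\<Sum>s\<in>J'. g s (f s x)) = x" if x: "x \<in> ?U" for x
  proof -
    let ?y = "\<Theta> (cins s0 x)"
    have z: "cins s0 x \<in> SJ J" using cins_SJ[OF J(1) s0 x] .
    have y: "?y = (\<Sum>s\<in>J'. cins s (cup s ?y))" using copies.fam_eq_sum \<Theta>S[OF z] unfolding SJ_def by blast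
    have "(\<Sum>s\<in>J'. g s (f s x)) = cup s0 (k (\<Sum>s\<in>J'. cins s (cup s ?y)))"
      unfolding f_def g_def by (simp add: lin_sum[OF lins(2)] lin_sum[OF copies.lin_up])
    also have "\<dots> = cup s0 (k ?y)" using y by simp
    also have "\<dots> = x" using k(3)[OF z] copies.up_ins by simp
    finally show ?thesis .
  qed
  have "\<exists>s\<in>J'. bij_betw (\<lambda>x. g s (f s x)) ?U ?U"
  proof (rule some_summand_bij[OF indec[OF i0] lin_\<Omega> finJ[OF J(2)]])
    fix s assume s: "s \<in> J'"
    show "(\<lambda>x. g s (f s x)) ` ?U \<subseteq> ?U" using fU[OF s] gU[OF s] by blast
    have "g s (f s (\<omega> x)) = \<omega> (g s (f s x))" if "\<omega> \<in> \<Omega>" "x \<in> ?U" for \<omega> x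
      using fc[OF s] gc[OF s] fU[OF s] that unfolding commuting_def by (simp add: image_subset_iff)
    then show "commuting \<Omega> ?U (\<lambda>x. g s (f s x))" unfolding commuting_def using lin_comp[OF lg lf] by blast
  next
    show "bij_betw (\<lambda>x. \<Sum>s\<in>J'. g s (f s x)) ?U ?U"
    proof (rule bij_betw_imageI)
      show "inj_on (\<lambda>x. \<Sum>s\<in>J'. g s (f s x)) ?U" by (rule inj_onI) (simp add: sum)
      show "(\<lambda>x. \<Sum>s\<in>J'. g s (f s x)) ` ?U = ?U" by (simp add: sum)
    qed
  qed
  then obtain s where s: "s \<in> J'" "bij_betw (\<lambda>x. g s (f s x)) ?U ?U" by blast
  have iI: "fst s \<in> I" using fstJ[OF J(2) s(1)] .
  have "bij_betw (f s) ?U (U (fst s))"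
    by (rule iso_of_retract[OF indec[OF i0] indec[OF iI] lin_\<Omega> fc[OF s(1)] fU[OF s(1)] gc[OF s(1)] gU[OF s(1)] s(2)])
  moreover have "fst s0 \<noteq> fst s" using dis s0 s(1) by blast
  ultimately show False using noniso[OF i0 iI _ fc[OF s(1)]] by blast
qed

end

theorem card_le_active:
  assumes V: "V \<noteq> {}" and C: "C > 0"
    and coercive: "\<And>\<alpha>. (\<Sum>v\<in>V. (\<alpha> v)\<^sup>2) \<le> C * form \<alpha> \<alpha>"
    and fin: "finite (active h)"
  shows "card I \<le> card (active h)"
proof (rule ccontr)
  assume "\<not> card I \<le> card (active h)"
  then have "card (active h) < card I" by simp
  then obtain b where b: "\<exists>i\<in>I. b i \<noteq> 0" "\<And>k. k \<in> active h \<Longrightarrow> (\<Sum>i\<in>I. b i * int (m i k)) = 0"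
    using integer_relation[OF fin finI, of "\<lambda>i k. int (m i k)"] by blast
  have b0: "(\<Sum>i\<in>I. b i * int (m i k)) = 0" for k
  proof (cases "k \<in> active h")
    case False
    have "m i k = 0" if "i \<in> I" for i
    proof -
      have "rep h (\<lambda>v. e v ` U i) T" by (rule rep_of_qmod[OF qmod_U[OF that] h])
      moreover have "active h = {k. \<exists>X F. rep h X F \<and> top_mult h X F k \<noteq> 0}" by (rule active_def[OF V graded_h])
      ultimately show ?thesis using False unfolding m_def by blast
    qed
    then show ?thesis by simp
  qed (rule b(2))
  (* |b i| copies of U i, on the side given by the sign of b i *)
  define J0 where "J0 = (SIGMA i:I. {..<nat \<bar>b i\<bar>})"
  have fin0: "finite J0" unfolding J0_def using finI by auto
  have J0I: "fst ` J0 \<subseteq> I" unfolding J0_def by auto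
  define J where "J = {s \<in> J0. b (fst s) > 0}"
  define J' where "J' = {s \<in> J0. b (fst s) < 0}"
  have JJ: "J \<subseteq> J0" "J' \<subseteq> J0" "fst ` J \<inter> fst ` J' = {}" unfolding J_def J'_def by auto
  have cnt: "int (\<Sum>s\<in>{s \<in> J0. P (fst s)}. m (fst s) k) = (\<Sum>i\<in>I. if P i then \<bar>b i\<bar> * int (m i k) else 0)" for P k
  proof -
    have "{s \<in> J0. P (fst s)} = (SIGMA i:{i \<in> I. P i}. {..<nat \<bar>b i\<bar>})" unfolding J0_def by auto
    then have "(\<Sum>s\<in>{s \<in> J0. P (fst s)}. m (fst s) k) = (\<Sum>(i, t)\<in>(SIGMA i:{i \<in> I. P i}. {..<nat \<bar>b i\<bar>}). m i k)"
      by (simp add: case_prod_beta)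
    also have "\<dots> = (\<Sum>i\<in>{i \<in> I. P i}. \<Sum>t<nat \<bar>b i\<bar>. m i k)"
      by (rule sum.Sigma[symmetric]) (use finI in auto)
    finally have "(\<Sum>s\<in>{s \<in> J0. P (fst s)}. m (fst s) k) = (\<Sum>i\<in>{i \<in> I. P i}. \<Sum>t<nat \<bar>b i\<bar>. m i k)" .
    then have "int (\<Sum>s\<in>{s \<in> J0. P (fst s)}. m (fst s) k) = (\<Sum>i\<in>{i \<in> I. P i}. \<bar>b i\<bar> * int (m i k))" by simp
    then show ?thesis by (simp add: sum.inter_filter[OF finI])
  qed
  have eq: "(\<Sum>s\<in>J. m (fst s) k) = (\<Sum>s\<in>J'. m (fst s) k)" for k
  proof -
    have "int (\<Sum>s\<in>J. m (fst s) k) - int (\<Sum>s\<in>J'. m (fst s) k) =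
      (\<Sum>i\<in>I. (if b i > 0 then \<bar>b i\<bar> * int (m i k) else 0) - (if b i < 0 then \<bar>b i\<bar> * int (m i k) else 0))"
      unfolding J_def J'_def sum_subtractf using cnt[of k "\<lambda>i. b i > 0"] cnt[of k "\<lambda>i. b i < 0"] by simp
    also have "\<dots> = (\<Sum>i\<in>I. b i * int (m i k))" by (rule sum.cong) auto
    finally have "int (\<Sum>s\<in>J. m (fst s) k) = int (\<Sum>s\<in>J'. m (fst s) k)" unfolding b0 by (simp only: right_minus_eq)
    then show ?thesis by (simp only: of_nat_eq_iff)
  qed
  let ?e = "\<lambda>v. dg J0 (e v)" and ?T = "\<lambda>a. dg J0 (T a)" and ?p = "\<lambda>a. dg J0 (\<phi> a)"
  have iso: "\<exists>\<Theta>. commuting (dg J0 ` \<Omega>) (SJ K) \<Theta> \<and> bij_betw \<Theta> (SJ K) (SJ K')"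
    if K: "K \<subseteq> J0" "K' \<subseteq> J0" and eq: "\<And>k. (\<Sum>s\<in>K. m (fst s) k) = (\<Sum>s\<in>K'. m (fst s) k)" for K K'
  proof -
    note q = qmod_SJ[OF fin0 J0I] and t = tang_SJ[OF fin0 J0I] and r = rigid_SJ[OF fin0 J0I]
    have "rep_iso h (\<lambda>v. ?e v ` SJ K) ?T (\<lambda>v. ?e v ` SJ K') ?T"
    proof (rule rep_iso_of_mult_eq[OF V graded_h C coercive fin])
      show "rep h (\<lambda>v. ?e v ` SJ K) ?T" by (rule rep_of_qmod[OF q[OF K(1)] h])
      show "rep h (\<lambda>v. ?e v ` SJ K') ?T" by (rule rep_of_qmod[OF q[OF K(2)] h])
      show "top_mult h (\<lambda>v. ?e v ` SJ K) ?T k = top_mult h (\<lambda>v. ?e v ` SJ K') ?T k" for k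
        using top_mult_SJ[OF fin0 J0I V K(1)] top_mult_SJ[OF fin0 J0I V K(2)] eq by simp
    qed
    then obtain P where "commuting (?e ` V \<union> ?T ` A) (SJ K) P" "bij_betw P (SJ K) (SJ K')"
      using iso_of_rep_iso[OF q[OF K(1)] q[OF K(2)] h] by blast
    from rigid_iso[OF inf q[OF K(1)] t[OF K(1)] r[OF K(1)] q[OF K(2)] t[OF K(2)] r[OF K(2)] this]
    show ?thesis by (simp add: image_Un image_image)
  qed
  obtain i where i: "i \<in> I" "b i \<noteq> 0" using b(1) by blast
  have "(i, 0) \<in> J \<or> (i, 0) \<in> J'" using i unfolding J_def J'_def J0_def by auto
  then have "J \<noteq> {} \<or> J' \<noteq> {}" by blast
  then show False
  proof
    assume "J \<noteq> {}"
    then show False using no_common_iso[OF fin0 J0I JJ(1,2) _ JJ(3)] iso[OF JJ(1,2) eq] by blast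
  next
    assume "J' \<noteq> {}"
    then show False using no_common_iso[OF fin0 J0I JJ(2,1)] JJ(3) iso[OF JJ(2,1) eq[symmetric]] by blast
  qed
qed

end

section \<open>Dynkin quivers\<close>

subsection \<open>Positive definiteness\<close>

text \<open>
  The quadratic form of an arm with \<open>p\<close> vertices attached to the vertex
  \<open>p\<close>, where just so much of the square of \<open>y p\<close> is added that the form
  becomes semidefinite: \<open>arm_form_Suc\<close> writes it as a sum of squares.
\<close>

definition arm_form :: "(nat \<Rightarrow> real) \<Rightarrow> nat \<Rightarrow> real" where
  "arm_form y p = (\<Sum>k<p. 2 * (y k)\<^sup>2 - 2 * y k * y (Suc k)) + real p / (real p + 1) * (y p)\<^sup>2"

lemma arm_form_Suc:
  "arm_form y (Suc p) = arm_form y p +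
     (real p + 2) / (real p + 1) * (y p - (real p + 1) / (real p + 2) * y (Suc p))\<^sup>2"
proof -
  have sq: "b / a * (u - a / b * v)\<^sup>2 = b / a * u\<^sup>2 - 2 * u * v + a / b * v\<^sup>2"
    if "a \<noteq> 0" "b \<noteq> 0" for a b u v :: real
    using that by (simp add: power2_eq_square field_simps)
  have "real p / (real p + 1) + (real p + 2) / (real p + 1) = (2 * (real p + 1)) / (real p + 1)"
    by (simp add: add_divide_distrib[symmetric])
  moreover have "real p + 1 \<noteq> 0" by auto
  ultimately have "real p / (real p + 1) + (real p + 2) / (real p + 1) = 2"
    by (metis nonzero_mult_div_cancel_right)
  then have two: "real p / (real p + 1) * u + (real p + 2) / (real p + 1) * u = 2 * u" for u
    by (metis distrib_right)
  have "2 * (y p)\<^sup>2 - 2 * y p * y (Suc p) + (real p + 1) / (real p + 2) * (y (Suc p))\<^sup>2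
      = real p / (real p + 1) * (y p)\<^sup>2 +
     (real p + 2) / (real p + 1) * (y p - (real p + 1) / (real p + 2) * y (Suc p))\<^sup>2"
    using sq[of "real p + 1" "real p + 2" "y p" "y (Suc p)"] two[of "(y p)\<^sup>2"] by simp
  then show ?thesis unfolding arm_form_def by (simp add: add.commute)
qed

text \<open>
  If the form of the arm and its value at the end are small, then so are the other values, one
  after the other from the end.
\<close>

lemma arm_form_bound: "\<exists>K\<ge>0. \<forall>y. arm_form y p \<ge> 0 \<and> (\<Sum>k<p. (y k)\<^sup>2) \<le> K * (arm_form y p + (y p)\<^sup>2)"
proof (induction p)
  case 0
  show ?case by (intro exI[of _ 0]) (simp add: arm_form_def)
next
  case (Suc p)
  then obtain K where K: "K \<ge> 0" "\<And>y. arm_form y p \<ge> 0"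
    "\<And>y. (\<Sum>k<p. (y k)\<^sup>2) \<le> K * (arm_form y p + (y p)\<^sup>2)" by blast
  show ?case
  proof (intro exI[of _ "3 * K + 2"] conjI allI)
    fix y :: "nat \<Rightarrow> real"
    define c where "c = (real p + 1) / (real p + 2)"
    define e where "e = (real p + 2) / (real p + 1)"
    have c: "0 \<le> c" "c \<le> 1" and e: "1 \<le> e" unfolding c_def e_def by (auto simp: field_simps)
    define s where "s = (y p - c * y (Suc p))\<^sup>2"
    have s: "s \<ge> 0" unfolding s_def by simp
    have A: "arm_form y (Suc p) = arm_form y p + e * s" unfolding arm_form_Suc c_def e_def s_def ..
    have es: "s \<le> e * s" using s e by (simp add: mult_le_cancel_right1)
    show "0 \<le> arm_form y (Suc p)" using A K(2)[of y] es s by simp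
    have "(y p)\<^sup>2 \<le> 2 * s + 2 * (c * y (Suc p))\<^sup>2"
    proof -
      have "0 \<le> (y p - 2 * (c * y (Suc p)))\<^sup>2" by simp
      then show ?thesis unfolding s_def by (simp add: power2_eq_square algebra_simps)
    qed
    moreover have "(c * y (Suc p))\<^sup>2 \<le> (y (Suc p))\<^sup>2"
      using c by (simp add: power_mult_distrib mult_left_le_one_le power_le_one)
    ultimately have yp: "(y p)\<^sup>2 \<le> 2 * arm_form y (Suc p) + 2 * (y (Suc p))\<^sup>2"
      using A K(2)[of y] es by simp
    have "(\<Sum>k<Suc p. (y k)\<^sup>2) \<le> K * (arm_form y p + (y p)\<^sup>2) + (y p)\<^sup>2" using K(3)[of y] by simp
    also have "\<dots> \<le> K * (arm_form y (Suc p) + (2 * arm_form y (Suc p) + 2 * (y (Suc p))\<^sup>2)) + (2 * arm_form y (Suc p) + 2 * (y (Suc p))\<^sup>2)"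
      by (intro add_mono mult_left_mono yp K(1)) (use A es s yp in auto)
    also have "\<dots> \<le> (3 * K + 2) * (arm_form y (Suc p) + (y (Suc p))\<^sup>2)"
      using K(1) by (simp add: algebra_simps)
    finally show "(\<Sum>k<Suc p. (y k)\<^sup>2) \<le> (3 * K + 2) * (arm_form y (Suc p) + (y (Suc p))\<^sup>2)" .
  qed (use K in simp)
qed

lemma sum_split_at:
  fixes f :: "nat \<Rightarrow> real"
  shows "(\<Sum>i<Suc (c + q). f i) = (\<Sum>i<c. f i) + f c + (\<Sum>k<q. f (c + q - k))"
proof -
  have "(\<Sum>k<q. f (c + q - k)) = (\<Sum>k<q. f (Suc (c + (q - Suc k))))"
  proof (rule sum.cong)
    fix k assume "k \<in> {..<q}"
    then have "c + q - k = Suc (c + (q - Suc k))" by auto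
    then show "f (c + q - k) = f (Suc (c + (q - Suc k)))" by simp
  qed simp
  also have "\<dots> = (\<Sum>k<q. f (Suc (c + k)))" by (rule sum.nat_diff_reindex)
  finally have *: "(\<Sum>k<q. f (c + q - k)) = (\<Sum>k<q. f (Suc (c + k)))" .
  have "(\<Sum>i<Suc c + q. f i) = (\<Sum>i<Suc c. f i) + (\<Sum>k<q. f (Suc c + k))"
    by (induction q) simp_all
  then show ?thesis unfolding * by simp
qed

text \<open>
  The form of a tree with three arms of lengths \<open>c, q, r\<close> at a common vertex is the
  sum of the arm forms and of \<open>2 - c/(c+1) - q/(q+1) - r/(r+1)\<close> times the square at
  that vertex. The remaining factor is positive exactly for the Dynkin diagrams.
\<close>

lemma star_coercive:
  fixes c q r :: nat
  assumes r: "r \<le> 1" and pos: "real c / (real c + 1) + real q / (real q + 1) + real r / (real r + 1) < 2"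
  shows "\<exists>K>0. \<forall>x :: nat \<Rightarrow> real. (\<Sum>i<Suc (c + q) + r. (x i)\<^sup>2) \<le>
    K * (2 * (\<Sum>i<Suc (c + q) + r. (x i)\<^sup>2) - 2 * ((\<Sum>i<c + q. x i * x (Suc i)) + (if r = 1 then x c * x (Suc (c + q)) else 0)))"
proof -
  define \<delta> where "\<delta> = 2 - (real c / (real c + 1) + real q / (real q + 1) + real r / (real r + 1))"
  have \<delta>: "\<delta> > 0" using pos unfolding \<delta>_def by simp
  obtain K1 where K1: "K1 \<ge> 0" "\<And>y. arm_form y c \<ge> 0" "\<And>y. (\<Sum>k<c. (y k)\<^sup>2) \<le> K1 * (arm_form y c + (y c)\<^sup>2)"
    using arm_form_bound[of c] by blast
  obtain K2 where K2: "K2 \<ge> 0" "\<And>y. arm_form y q \<ge> 0" "\<And>y. (\<Sum>k<q. (y k)\<^sup>2) \<le> K2 * (arm_form y q + (y q)\<^sup>2)"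
    using arm_form_bound[of q] by blast
  obtain K3 where K3: "K3 \<ge> 0" "\<And>y. arm_form y r \<ge> 0" "\<And>y. (\<Sum>k<r. (y k)\<^sup>2) \<le> K3 * (arm_form y r + (y r)\<^sup>2)"
    using arm_form_bound[of r] by blast
  define K where "K = (K1 + K2 + K3) * (1 + 1 / \<delta>) + 1 / \<delta>"
  show ?thesis
  proof (intro exI[of _ K] conjI allI)
    show "K > 0" unfolding K_def using K1(1) K2(1) K3(1) \<delta> by (intro add_nonneg_pos mult_nonneg_nonneg) auto
    fix x :: "nat \<Rightarrow> real"
    (* the second and the third arm, numbered towards the common vertex c *)
    define z where "z = (\<lambda>k. x (c + q - k))"
    define w where "w = (\<lambda>k. if k < r then x (Suc (c + q)) else x c)"
    have zq: "z q = x c" and wr: "w r = x c" unfolding z_def w_def by auto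
    define T where "T = 2 * (\<Sum>i<Suc (c + q) + r. (x i)\<^sup>2) - 2 * ((\<Sum>i<c + q. x i * x (Suc i)) + (if r = 1 then x c * x (Suc (c + q)) else 0))"
    have sq: "(\<Sum>i<Suc (c + q) + r. (x i)\<^sup>2) = (\<Sum>k<c. (x k)\<^sup>2) + (x c)\<^sup>2 + (\<Sum>k<q. (z k)\<^sup>2) + (\<Sum>k<r. (w k)\<^sup>2)"
    proof -
      have "(\<Sum>i<Suc (c + q) + r. (x i)\<^sup>2) = (\<Sum>i<Suc (c + q). (x i)\<^sup>2) + (\<Sum>k<r. (w k)\<^sup>2)"
        using r by (cases r) (auto simp: w_def)
      then show ?thesis unfolding sum_split_at z_def by simp
    qed
    have pr: "(\<Sum>i<c + q. x i * x (Suc i)) = (\<Sum>k<c. x k * x (Suc k)) + (\<Sum>k<q. z k * z (Suc k))"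
    proof -
      have "(\<Sum>k<q. z k * z (Suc k)) = (\<Sum>k<q. x (c + (q - Suc k)) * x (Suc (c + (q - Suc k))))"
        by (rule sum.cong) (auto simp: z_def Suc_diff_Suc mult.commute)
      also have "\<dots> = (\<Sum>k<q. x (c + k) * x (Suc (c + k)))" by (rule sum.nat_diff_reindex)
      finally have *: "(\<Sum>k<q. z k * z (Suc k)) = (\<Sum>k<q. x (c + k) * x (Suc (c + k)))" .
      have "(\<Sum>i<c + q. x i * x (Suc i)) = (\<Sum>k<c. x k * x (Suc k)) + (\<Sum>k<q. x (c + k) * x (Suc (c + k)))"
        by (induction q) simp_all
      then show ?thesis using * by simp
    qed
    have wp: "(if r = 1 then x c * x (Suc (c + q)) else 0) = (\<Sum>k<r. w k * w (Suc k))"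
      using r by (cases r) (auto simp: w_def)
    have T: "T = arm_form x c + arm_form z q + arm_form w r + \<delta> * (x c)\<^sup>2"
      unfolding T_def sq pr wp arm_form_def zq wr \<delta>_def
      by (simp add: sum_subtractf sum_distrib_left algebra_simps)
    have a: "arm_form x c \<le> T" "arm_form z q \<le> T" "arm_form w r \<le> T" "\<delta> * (x c)\<^sup>2 \<le> T" "0 \<le> T"
      using T K1(2)[of x] K2(2)[of z] K3(2)[of w] \<delta> by (auto intro: add_nonneg_nonneg)
    have xc: "(x c)\<^sup>2 \<le> T / \<delta>" using a(4) \<delta> by (simp add: field_simps)
    have "(\<Sum>k<c. (x k)\<^sup>2) \<le> K1 * (T + T / \<delta>)"
      by (rule order_trans[OF K1(3)[of x] mult_left_mono]) (use a xc K1 in auto)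
    moreover have "(\<Sum>k<q. (z k)\<^sup>2) \<le> K2 * (T + T / \<delta>)"
      by (rule order_trans[OF K2(3)[of z] mult_left_mono]) (use a xc zq K2 in auto)
    moreover have "(\<Sum>k<r. (w k)\<^sup>2) \<le> K3 * (T + T / \<delta>)"
      by (rule order_trans[OF K3(3)[of w] mult_left_mono]) (use a xc wr K3 in auto)
    ultimately have "(\<Sum>i<Suc (c + q) + r. (x i)\<^sup>2) \<le> K * T"
      unfolding sq K_def using xc by (simp add: algebra_simps add_divide_distrib)
    then show "(\<Sum>i<Suc (c + q) + r. (x i)\<^sup>2) \<le>
    K * (2 * (\<Sum>i<Suc (c + q) + r. (x i)\<^sup>2) - 2 * ((\<Sum>i<c + q. x i * x (Suc i)) + (if r = 1 then x c * x (Suc (c + q)) else 0)))"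
      unfolding T_def .
  qed
qed

text \<open>
  A chain of \<open>c + q + 1\<close> vertices and, if \<open>r = 1\<close>, a further vertex
  attached to \<open>c\<close>. This covers all simply laced Dynkin diagrams.
\<close>

definition star_edges :: "nat \<Rightarrow> nat \<Rightarrow> nat \<Rightarrow> nat set set" where
  "star_edges c q r = (\<lambda>i. {i, Suc i}) ` {..<c + q} \<union> (if r = 1 then {{c, Suc (c + q)}} else {})"

lemma dynkin_diagram_star:
  assumes "dynkin_diagram n E"
  obtains c q r where "n = Suc (c + q) + r" "E = star_edges c q r" "r \<le> 1"
    "real c / (real c + 1) + real q / (real q + 1) + real r / (real r + 1) < 2"
  using assms
proof cases
  case type_A
  have "E = star_edges (n - 1) 0 0" unfolding type_A(1) star_edges_def by auto
  then show thesis using that[of "n - 1" 0 0] type_A(2) by (auto simp: field_simps)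
next
  case type_D
  have "E = star_edges (n - 3) 1 1"
    unfolding type_D(1) star_edges_def using type_D(2) by (auto simp: image_def)
  moreover have "real (n - 3) / (real (n - 3) + 1) < 1" by (simp add: field_simps)
  ultimately show thesis using that[of "n - 3" 1 1] type_D(2) by auto
next
  case type_E
  have n: "n = Suc (2 + (n - 4)) + 1" using type_E(2) by auto
  have "E = star_edges 2 (n - 4) 1"
    unfolding type_E(1) star_edges_def using type_E(2) by (auto simp: image_def)
  moreover have "real 2 / (real 2 + 1) + real (n - 4) / (real (n - 4) + 1) + real 1 / (real 1 + 1) < 2"
    using type_E(2) by auto
  ultimately show thesis using that[OF n, of] by auto
qed

lemma inj_on_edge: "inj_on (\<lambda>i. {i, Suc i}) A"
  by (auto simp: inj_on_def doubleton_eq_iff)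

lemma sum_star_edges:
  fixes g :: "nat set \<Rightarrow> 'a::comm_monoid_add"
  assumes "r \<le> 1"
  shows "(\<Sum>e\<in>star_edges c q r. g e) = (\<Sum>i<c + q. g {i, Suc i}) + (if r = 1 then g {c, Suc (c + q)} else 0)"
proof -
  have 1: "(\<Sum>e\<in>(\<lambda>i. {i, Suc i}) ` {..<c + q}. g e) = (\<Sum>i<c + q. g {i, Suc i})"
    by (simp add: sum.reindex[OF inj_on_edge])
  have "{c, Suc (c + q)} \<notin> (\<lambda>i. {i, Suc i}) ` {..<c + q}" by (auto simp: doubleton_eq_iff)
  then show ?thesis using 1 unfolding star_edges_def by (auto simp: add.commute)
qed

locale dynkin =
  fixes Q :: "('v, 'e) pre_digraph"
  assumes dynkin: "dynkin_quiver Q"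
begin

lemma star_param:
  obtains c q r \<phi> where "r \<le> 1" "real c / (real c + 1) + real q / (real q + 1) + real r / (real r + 1) < 2"
    "bij_betw \<phi> {..<Suc (c + q) + r} (verts Q)"
    "bij_betw (\<lambda>a. {tail Q a, head Q a}) (arcs Q) ((`) \<phi> ` star_edges c q r)"
proof -
  obtain n E \<phi> where d: "dynkin_diagram n E" "bij_betw \<phi> {..<n} (verts Q)"
    "bij_betw (\<lambda>a. {tail Q a, head Q a}) (arcs Q) ((`) \<phi> ` E)"
    using dynkin unfolding dynkin_quiver_def by blast
  obtain c q r where "n = Suc (c + q) + r" "E = star_edges c q r" "r \<le> 1"
    "real c / (real c + 1) + real q / (real q + 1) + real r / (real r + 1) < 2"
    using dynkin_diagram_star[OF d(1)] .
  then show thesis using that[of r c q \<phi>] d(2,3) by simp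
qed

lemma star_edge_subset: "e \<in> star_edges c q r \<Longrightarrow> r \<le> 1 \<Longrightarrow> e \<subseteq> {..<Suc (c + q) + r} \<and> card e = 2"
  unfolding star_edges_def by (auto split: if_splits)

sublocale loop_free_quiver "verts Q" "arcs Q" "tail Q" "head Q"
proof -
  obtain c q r \<phi> where r: "r \<le> 1" and pos: "real c / (real c + 1) + real q / (real q + 1) + real r / (real r + 1) < 2"
    and b: "bij_betw \<phi> {..<Suc (c + q) + r} (verts Q)"
    and e: "bij_betw (\<lambda>a. {tail Q a, head Q a}) (arcs Q) ((`) \<phi> ` star_edges c q r)"
    by (rule star_param)
  have ed: "{tail Q a, head Q a} \<subseteq> verts Q \<and> card {tail Q a, head Q a} = 2" if a: "a \<in> arcs Q" for a
  proof -
    obtain d where d: "d \<in> star_edges c q r" "{tail Q a, head Q a} = \<phi> ` d"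
      using e a unfolding bij_betw_def by blast
    have "d \<subseteq> {..<Suc (c + q) + r}" "card d = 2" using star_edge_subset[OF d(1) r] by auto
    then show ?thesis using b d(2) unfolding bij_betw_def by (metis card_image image_mono inj_on_subset)
  qed
  show "loop_free_quiver (verts Q) (arcs Q) (tail Q) (head Q)"
  proof
    show "finite (verts Q)" using b bij_betw_finite by blast
    show "finite (arcs Q)" using e bij_betw_finite[OF e] unfolding star_edges_def by auto
    fix a assume a: "a \<in> arcs Q"
    show "tail Q a \<in> verts Q" "head Q a \<in> verts Q" using ed[OF a] by auto
    show "tail Q a \<noteq> head Q a" using ed[OF a] by auto
  qed
qed

lemma verts_nonempty: "verts Q \<noteq> {}"
proof -
  obtain c q r \<phi> where "r \<le> 1" "real c / (real c + 1) + real q / (real q + 1) + real r / (real r + 1) < 2"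
    and b: "bij_betw \<phi> {..<Suc (c + q) + r} (verts Q)"
    and "bij_betw (\<lambda>a. {tail Q a, head Q a}) (arcs Q) ((`) \<phi> ` star_edges c q r)"
    by (rule star_param)
  show ?thesis using b unfolding bij_betw_def by auto
qed

lemma coercive: "\<exists>C>0. \<forall>\<alpha>. (\<Sum>v\<in>verts Q. (\<alpha> v)\<^sup>2) \<le> C * form \<alpha> \<alpha>"
proof -
  obtain c q r \<phi> where r: "r \<le> 1" and pos: "real c / (real c + 1) + real q / (real q + 1) + real r / (real r + 1) < 2"
    and b: "bij_betw \<phi> {..<Suc (c + q) + r} (verts Q)"
    and e: "bij_betw (\<lambda>a. {tail Q a, head Q a}) (arcs Q) ((`) \<phi> ` star_edges c q r)"
    by (rule star_param)
  obtain K where K: "K > 0" "\<And>x :: nat \<Rightarrow> real. (\<Sum>i<Suc (c + q) + r. (x i)\<^sup>2) \<le>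
    K * (2 * (\<Sum>i<Suc (c + q) + r. (x i)\<^sup>2) - 2 * ((\<Sum>i<c + q. x i * x (Suc i)) + (if r = 1 then x c * x (Suc (c + q)) else 0)))"
    using star_coercive[OF r pos] by blast
  have inj: "inj_on \<phi> {..<Suc (c + q) + r}" using b unfolding bij_betw_def by blast
  have f: "form \<alpha> \<alpha> = 2 * (\<Sum>i<Suc (c + q) + r. (\<alpha> (\<phi> i))\<^sup>2) -
     2 * ((\<Sum>i<c + q. \<alpha> (\<phi> i) * \<alpha> (\<phi> (Suc i))) + (if r = 1 then \<alpha> (\<phi> c) * \<alpha> (\<phi> (Suc (c + q))) else 0))" for \<alpha>
  proof -
    have "(\<Sum>i\<in>verts Q. 2 * \<alpha> i * \<alpha> i) = (\<Sum>i<Suc (c + q) + r. 2 * \<alpha> (\<phi> i) * \<alpha> (\<phi> i))"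
      by (rule sum.reindex_bij_betw[OF b, symmetric])
    then have 1: "(\<Sum>i\<in>verts Q. 2 * \<alpha> i * \<alpha> i) = 2 * (\<Sum>i<Suc (c + q) + r. (\<alpha> (\<phi> i))\<^sup>2)"
      by (simp add: sum_distrib_left power2_eq_square mult.assoc)
    have p: "prod \<alpha> {u, v} = \<alpha> u * \<alpha> v" if "u \<noteq> v" for u v using that by simp
    have "(\<Sum>a\<in>arcs Q. \<alpha> (tail Q a) * \<alpha> (head Q a) + \<alpha> (head Q a) * \<alpha> (tail Q a)) =
       2 * (\<Sum>a\<in>arcs Q. prod \<alpha> {tail Q a, head Q a})"
      unfolding sum_distrib_left by (rule sum.cong) (auto simp: p no_loop)
    also have "(\<Sum>a\<in>arcs Q. prod \<alpha> {tail Q a, head Q a}) = (\<Sum>d\<in>(`) \<phi> ` star_edges c q r. prod \<alpha> d)"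
      by (rule sum.reindex_bij_betw[OF e])
    also have "\<dots> = (\<Sum>d\<in>star_edges c q r. prod \<alpha> (\<phi> ` d))"
    proof -
      have "inj_on ((`) \<phi>) (star_edges c q r)"
        using star_edge_subset[OF _ r] inj inj_on_image_eq_iff by (smt (verit) inj_onI)
      then show ?thesis by (simp add: sum.reindex)
    qed
    also have "\<dots> = (\<Sum>i<c + q. prod \<alpha> (\<phi> ` {i, Suc i})) + (if r = 1 then prod \<alpha> (\<phi> ` {c, Suc (c + q)}) else 0)"
      by (rule sum_star_edges[OF r])
    also have "(\<Sum>i<c + q. prod \<alpha> (\<phi> ` {i, Suc i})) = (\<Sum>i<c + q. \<alpha> (\<phi> i) * \<alpha> (\<phi> (Suc i)))"
    proof (rule sum.cong)
      fix i assume "i \<in> {..<c + q}"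
      then have "\<phi> i \<noteq> \<phi> (Suc i)" using inj_on_contraD[OF inj, of i "Suc i"] by simp
      then show "prod \<alpha> (\<phi> ` {i, Suc i}) = \<alpha> (\<phi> i) * \<alpha> (\<phi> (Suc i))" by simp
    qed simp
    also have "(if r = 1 then prod \<alpha> (\<phi> ` {c, Suc (c + q)}) else 0) = (if r = 1 then \<alpha> (\<phi> c) * \<alpha> (\<phi> (Suc (c + q))) else 0)"
    proof (cases "r = 1")
      case True
      then have "\<phi> c \<noteq> \<phi> (Suc (c + q))" using inj_on_contraD[OF inj, of c "Suc (c + q)"] by simp
      then show ?thesis by simp
    qed simp
    finally show ?thesis unfolding form_def 1 by simp
  qed
  have main: "(\<Sum>v\<in>verts Q. (\<alpha> v)\<^sup>2) \<le> \<lceil>K\<rceil> * form \<alpha> \<alpha>" for \<alpha>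
  proof -
    have s: "(\<Sum>v\<in>verts Q. (\<alpha> v)\<^sup>2) = (\<Sum>i<Suc (c + q) + r. (\<alpha> (\<phi> i))\<^sup>2)"
      by (rule sum.reindex_bij_betw[OF b, symmetric])
    have "real_of_int (form \<alpha> \<alpha>) = 2 * (\<Sum>i<Suc (c + q) + r. (real_of_int (\<alpha> (\<phi> i)))\<^sup>2) -
       2 * ((\<Sum>i<c + q. real_of_int (\<alpha> (\<phi> i)) * real_of_int (\<alpha> (\<phi> (Suc i)))) +
         (if r = 1 then real_of_int (\<alpha> (\<phi> c)) * real_of_int (\<alpha> (\<phi> (Suc (c + q)))) else 0))"
      unfolding f by (simp del: sum.lessThan_Suc)
    then have 1: "real_of_int (\<Sum>v\<in>verts Q. (\<alpha> v)\<^sup>2) \<le> K * real_of_int (form \<alpha> \<alpha>)"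
      unfolding s using K(2)[of "\<lambda>i. real_of_int (\<alpha> (\<phi> i))"] by (simp del: sum.lessThan_Suc)
    have "0 \<le> real_of_int (\<Sum>v\<in>verts Q. (\<alpha> v)\<^sup>2)" by (simp add: sum_nonneg del: of_int_sum)
    then have "0 \<le> K * real_of_int (form \<alpha> \<alpha>)" using 1 by linarith
    then have "0 \<le> real_of_int (form \<alpha> \<alpha>)" using K(1) by (simp add: zero_le_mult_iff)
    then have "K * real_of_int (form \<alpha> \<alpha>) \<le> real_of_int \<lceil>K\<rceil> * real_of_int (form \<alpha> \<alpha>)"
      by (intro mult_right_mono) auto
    then have "real_of_int (\<Sum>v\<in>verts Q. (\<alpha> v)\<^sup>2) \<le> real_of_int (\<lceil>K\<rceil> * form \<alpha> \<alpha>)" using 1 by simp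
    then show ?thesis by (simp only: of_int_le_iff)
  qed
  show ?thesis using main K(1) by (intro exI[of _ "\<lceil>K\<rceil>"]) auto
qed

text \<open>
  A tree has no cycles that could obstruct a height function with a step of one along each arrow.
\<close>

lemma exists_height: "\<exists>h :: 'v \<Rightarrow> int. \<forall>a\<in>arcs Q. h (tail Q a) = h (head Q a) + 1"
proof -
  obtain c q r \<phi> where r: "r \<le> 1" and pos: "real c / (real c + 1) + real q / (real q + 1) + real r / (real r + 1) < 2"
    and b: "bij_betw \<phi> {..<Suc (c + q) + r} (verts Q)"
    and e: "bij_betw (\<lambda>a. {tail Q a, head Q a}) (arcs Q) ((`) \<phi> ` star_edges c q r)"
    by (rule star_param)
  have inj: "inj_on \<phi> {..<Suc (c + q) + r}" using b unfolding bij_betw_def by blast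
  (* the height falls by o' i j on the way from vertex i to vertex j *)
  define o' :: "nat \<Rightarrow> nat \<Rightarrow> int" where
    "o' i j = (if \<exists>a\<in>arcs Q. tail Q a = \<phi> i \<and> head Q a = \<phi> j then 1 else - 1)" for i j
  define g where "g i = (if i \<le> c + q then - (\<Sum>k<i. o' k (Suc k)) else - (\<Sum>k<c. o' k (Suc k)) - o' c i)" for i
  have g1: "g i = g (Suc i) + o' i (Suc i)" if "i < c + q" for i using that unfolding g_def by simp
  have g2: "g c = g (Suc (c + q)) + o' c (Suc (c + q))" unfolding g_def by simp
  define h where "h v = g (the_inv_into {..<Suc (c + q) + r} \<phi> v)" for v
  have h: "h (\<phi> i) = g i" if "i < Suc (c + q) + r" for i
    using the_inv_into_f_f[OF inj] that unfolding h_def by simp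
  show ?thesis
  proof (intro exI[of _ h] ballI)
    fix a assume a: "a \<in> arcs Q"
    then obtain d where d: "d \<in> star_edges c q r" "{tail Q a, head Q a} = \<phi> ` d"
      using e unfolding bij_betw_def by blast
    then obtain i j where ij: "d = {i, j}" "g i = g j + o' i j" "i < Suc (c + q) + r" "j < Suc (c + q) + r"
      unfolding star_edges_def using g1 g2 by (auto split: if_splits)
    consider "tail Q a = \<phi> i" "head Q a = \<phi> j" | "tail Q a = \<phi> j" "head Q a = \<phi> i"
      using d(2) ij(1) by (auto simp: doubleton_eq_iff)
    then show "h (tail Q a) = h (head Q a) + 1"
    proof cases
      case 1
      then have "o' i j = 1" unfolding o'_def using a by auto
      then show ?thesis using 1 ij h by simp
    next
      case 2
      have "\<not> (\<exists>a'\<in>arcs Q. tail Q a' = \<phi> i \<and> head Q a' = \<phi> j)"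
      proof
        assume "\<exists>a'\<in>arcs Q. tail Q a' = \<phi> i \<and> head Q a' = \<phi> j"
        then obtain a' where a': "a' \<in> arcs Q" "tail Q a' = \<phi> i" "head Q a' = \<phi> j" by blast
        then have "{tail Q a', head Q a'} = {tail Q a, head Q a}" using 2 by auto
        then have "a' = a" using e a a'(1) unfolding bij_betw_def inj_on_def by blast
        then show False using a' 2 no_loop[OF a] by simp
      qed
      then have "o' i j = - 1" unfolding o'_def by simp
      then show ?thesis using 2 ij h by simp
    qed
  qed
qed

lemma symmetric_form_eq: "symmetric_form Q = form"
  unfolding symmetric_form_def form_def by (intro ext) simp

lemma simple_root_eq: "simple_root = unit_vec"
  unfolding simple_root_def unit_vec_def by simp

lemma simple_reflection_eq: "i \<in> verts Q \<Longrightarrow> simple_reflection Q i = reflect i"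
  unfolding simple_reflection_def reflect_def symmetric_form_eq simple_root_eq
  by (intro ext) (simp add: form_unit_vec)

text \<open>Reflections preserve the form, so all roots have the norm of the simple ones.\<close>

lemma root_norm: "\<alpha> \<in> roots Q \<Longrightarrow> form \<alpha> \<alpha> = 2 \<and> (\<forall>v. v \<notin> verts Q \<longrightarrow> \<alpha> v = 0)"
proof (induction rule: roots.induct)
  case (simple i)
  have "form (unit_vec i) (unit_vec i) = pairing (unit_vec i) i" using form_unit_vec simple by blast
  also have "\<dots> = 2" unfolding pairing_def unit_vec_def using opp_neq by (simp add: sum.neutral)
  finally show ?case using simple unfolding simple_root_eq by (auto simp: unit_vec_def)
next
  case (reflection \<alpha> i)
  then show ?case unfolding simple_reflection_eq[OF reflection(2)]
    using form_reflect reflect_other by metis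
qed

lemma finite_positive_roots: "finite (positive_roots Q)"
proof -
  obtain C where C: "C > 0" "\<And>\<alpha>. (\<Sum>v\<in>verts Q. (\<alpha> v)\<^sup>2) \<le> C * form \<alpha> \<alpha>" using coercive by blast
  have "positive_roots Q \<subseteq> {\<alpha>. \<forall>v. (v \<in> verts Q \<longrightarrow> \<alpha> v \<in> {0..2 * C}) \<and> (v \<notin> verts Q \<longrightarrow> \<alpha> v = 0)}"
  proof clarify
    fix \<alpha> v assume "\<alpha> \<in> positive_roots Q"
    then have \<alpha>: "\<alpha> \<in> roots Q" "\<And>i. \<alpha> i \<ge> 0" unfolding positive_roots_def by auto
    have "\<alpha> v \<le> 2 * C" if v: "v \<in> verts Q"
    proof -
      have "\<alpha> v \<le> (\<alpha> v)\<^sup>2" using \<alpha>(2)[of v] by (cases "\<alpha> v = 0") (auto simp: power2_eq_square mult_le_cancel_left1)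
      also have "\<dots> \<le> (\<Sum>v\<in>verts Q. (\<alpha> v)\<^sup>2)" by (rule member_le_sum) (use v finV in auto)
      also have "\<dots> \<le> 2 * C" using C(2)[of \<alpha>] root_norm[OF \<alpha>(1)] by simp
      finally show ?thesis .
    qed
    then show "(v \<in> verts Q \<longrightarrow> \<alpha> v \<in> {0..2 * C}) \<and> (v \<notin> verts Q \<longrightarrow> \<alpha> v = 0)"
      using \<alpha> root_norm by auto
  qed
  then show ?thesis using finite_set_of_finite_funs[OF finV, of "{0..2 * C}" 0] finite_subset by blast
qed

end

section \<open>Path algebras\<close>

text \<open>
  The product of paths follows the composition of maps: \<open>cat x y\<close> first runs through
  \<open>y\<close>.
\<close>

definition cmp :: "('v, 'e) path \<Rightarrow> ('v, 'e) path \<Rightarrow> bool" where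
  "cmp x y \<longleftrightarrow> snd (snd y) = fst x"

definition cat :: "('v, 'e) path \<Rightarrow> ('v, 'e) path \<Rightarrow> ('v, 'e) path" where
  "cat x y = (fst y, fst (snd y) @ fst (snd x), snd (snd x))"

definition delta :: "('v, 'e) path \<Rightarrow> ('v, 'e) path \<Rightarrow> 'k::field" where
  "delta z = (\<lambda>x. if x = z then 1 else 0)"

definition supp :: "(('v, 'e) path \<Rightarrow> 'k::field) \<Rightarrow> ('v, 'e) path set" where
  "supp f = {z. f z \<noteq> 0}"

locale fin_quiver =
  fixes D :: "('v, 'e) pre_digraph"
  assumes fin_verts: "finite (verts D)"
    and tail_verts: "a \<in> arcs D \<Longrightarrow> tail D a \<in> verts D"
    and head_verts: "a \<in> arcs D \<Longrightarrow> head D a \<in> verts D"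
begin

lemma paths_iff: "(u, p, v) \<in> paths D \<longleftrightarrow> u \<in> verts D \<and> set p \<subseteq> arcs D \<and> pre_digraph.cas D u p v"
  unfolding paths_def pre_digraph.awalk_def by simp

lemma cas_append: "pre_digraph.cas D u (p @ q) w \<longleftrightarrow> (\<exists>v. pre_digraph.cas D u p v \<and> pre_digraph.cas D v q w)"
  by (induction p arbitrary: u) (auto simp: pre_digraph.cas.simps)

lemma cas_unique: "pre_digraph.cas D u p v \<Longrightarrow> pre_digraph.cas D u p v' \<Longrightarrow> v = v'"
  by (induction p arbitrary: u) (auto simp: pre_digraph.cas.simps)

lemma cas_verts: "u \<in> verts D \<Longrightarrow> set p \<subseteq> arcs D \<Longrightarrow> pre_digraph.cas D u p v \<Longrightarrow> v \<in> verts D"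
proof (induction p arbitrary: u)
  case (Cons a p)
  then have "head D a \<in> verts D" using head_verts by simp
  then show ?case using Cons by (simp add: pre_digraph.cas.simps)
qed (simp add: pre_digraph.cas.simps)

lemma path_verts: "z \<in> paths D \<Longrightarrow> fst z \<in> verts D \<and> snd (snd z) \<in> verts D"
  using cas_verts by (cases z) (auto simp: paths_iff)

lemma trivial_path: "v \<in> verts D \<Longrightarrow> (v, [], v) \<in> paths D"
  by (simp add: paths_iff pre_digraph.cas.simps)

lemma arrow_path: "a \<in> arcs D \<Longrightarrow> (tail D a, [a], head D a) \<in> paths D"
  by (simp add: paths_iff pre_digraph.cas.simps tail_verts)

lemma cat_paths: "x \<in> paths D \<Longrightarrow> y \<in> paths D \<Longrightarrow> cmp x y \<Longrightarrow> cat x y \<in> paths D"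
  by (cases x; cases y) (auto simp: paths_iff cat_def cmp_def cas_append)

lemma factorizations_eq: "factorizations D z = {(x, y). x \<in> paths D \<and> y \<in> paths D \<and> cmp x y \<and> cat x y = z}"
  unfolding factorizations_def cmp_def cat_def by auto

lemma factorization_paths: "(x, y) \<in> factorizations D z \<Longrightarrow> z \<in> paths D"
  unfolding factorizations_eq mem_Collect_eq case_prod_conv using cat_paths by blast

lemma finite_factorizations: "finite (factorizations D z)"
proof -
  let ?l = "\<lambda>xy. length (fst (snd (snd xy)))"
  have "inj_on ?l (factorizations D z)"
  proof (rule inj_onI)
    fix a b assume a: "a \<in> factorizations D z" and b: "b \<in> factorizations D z" and l: "?l a = ?l b"
    obtain v q w u p where a': "a = ((v, q, w), (u, p, v))" "(v, q, w) \<in> paths D" "(u, p, v) \<in> paths D" "z = (u, p @ q, w)"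
      using a unfolding factorizations_def by blast
    obtain v' q' w' u' p' where b': "b = ((v', q', w'), (u', p', v'))" "(v', q', w') \<in> paths D" "(u', p', v') \<in> paths D" "z = (u', p' @ q', w')"
      using b unfolding factorizations_def by blast
    have "p = p'" "q = q'" "u = u'" "w = w'" using a'(1,4) b'(1,4) l by auto
    moreover have "v = v'" using a'(3) b'(3) calculation cas_unique by (auto simp: paths_iff)
    ultimately show "a = b" using a' b' by simp
  qed
  moreover have "?l ` factorizations D z \<subseteq> {..length (fst (snd z))}"
    unfolding factorizations_def by auto
  ultimately show ?thesis using finite_imageD finite_subset by blast
qed

abbreviation P :: "(('v, 'e) path \<Rightarrow> 'k::field) ring" where
  "P \<equiv> path_algebra D"

lemma carrier_P: "f \<in> carrier P \<longleftrightarrow> finite (supp f) \<and> supp f \<subseteq> paths D"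
  unfolding path_algebra_def supp_def by simp

lemma mult_P: "(f \<otimes>\<^bsub>P\<^esub> g) z = (\<Sum>(x, y)\<in>factorizations D z. f x * g y)"
  unfolding path_algebra_def by simp

lemma add_P: "f \<oplus>\<^bsub>P\<^esub> g = (\<lambda>z. f z + g z)"
  unfolding path_algebra_def by simp

lemma zero_P: "\<zero>\<^bsub>P\<^esub> = (\<lambda>_. 0)"
  unfolding path_algebra_def by simp

lemma one_P: "\<one>\<^bsub>P\<^esub> z = (if fst z \<in> verts D \<and> z = (fst z, [], fst z) then 1 else 0)"
  unfolding path_algebra_def by (cases z) auto

lemma supp_mult: "supp (f \<otimes>\<^bsub>P\<^esub> g) \<subseteq> (\<lambda>(x, y). cat x y) ` (supp f \<times> supp g) \<inter> paths D"
proof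
  fix z assume "z \<in> supp (f \<otimes>\<^bsub>P\<^esub> g)"
  then have "(\<Sum>(x, y)\<in>factorizations D z. f x * g y) \<noteq> 0" unfolding supp_def mult_P by simp
  then obtain xy where xy: "xy \<in> factorizations D z" "(\<lambda>(x, y). f x * g y) xy \<noteq> 0"
    by (meson sum.neutral)
  obtain x y where e: "xy = (x, y)" by (cases xy)
  have "(x, y) \<in> supp f \<times> supp g" using xy(2) e unfolding supp_def by auto
  moreover have "z = cat x y" using xy(1) e unfolding factorizations_eq by auto
  ultimately show "z \<in> (\<lambda>(x, y). cat x y) ` (supp f \<times> supp g) \<inter> paths D"
    using factorization_paths xy(1) e by blast
qed

lemma mult_closed: "f \<in> carrier P \<Longrightarrow> g \<in> carrier P \<Longrightarrow> f \<otimes>\<^bsub>P\<^esub> g \<in> carrier P"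
  unfolding carrier_P using supp_mult[of f g] by (meson finite_SigmaI finite_imageI finite_subset inf.boundedE)

lemma mult_assoc: "(f \<otimes>\<^bsub>P\<^esub> g) \<otimes>\<^bsub>P\<^esub> k = f \<otimes>\<^bsub>P\<^esub> (g \<otimes>\<^bsub>P\<^esub> k)"
proof
  fix z
  let ?F = "factorizations D"
  have "((f \<otimes>\<^bsub>P\<^esub> g) \<otimes>\<^bsub>P\<^esub> k) z = (\<Sum>ay\<in>?F z. \<Sum>xx\<in>?F (fst ay). f (fst xx) * g (snd xx) * k (snd ay))"
    unfolding mult_P by (rule sum.cong) (auto simp: sum_distrib_right case_prod_beta mult_P)
  also have "\<dots> = (\<Sum>(ay, xx)\<in>(SIGMA ay:?F z. ?F (fst ay)). f (fst xx) * g (snd xx) * k (snd ay))"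
    by (rule sum.Sigma) (auto simp: finite_factorizations)
  also have "\<dots> = (\<Sum>(xb, yy)\<in>(SIGMA xb:?F z. ?F (snd xb)). f (fst xb) * (g (fst yy) * k (snd yy)))"
  proof (rule sum.reindex_bij_witness
      [where j = "\<lambda>(ay, xx). ((fst xx, cat (snd xx) (snd ay)), (snd xx, snd ay))"
        and i = "\<lambda>(xb, yy). ((cat (fst xb) (fst yy), snd yy), (fst xb, fst yy))"])
  qed (auto simp: factorizations_eq cmp_def cat_def paths_iff cas_append)
  also have "\<dots> = (\<Sum>xb\<in>?F z. \<Sum>yy\<in>?F (snd xb). f (fst xb) * (g (fst yy) * k (snd yy)))"
    by (rule sum.Sigma[symmetric]) (auto simp: finite_factorizations)
  also have "\<dots> = (f \<otimes>\<^bsub>P\<^esub> (g \<otimes>\<^bsub>P\<^esub> k)) z"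
    unfolding mult_P by (rule sum.cong) (auto simp: sum_distrib_left case_prod_beta mult_P)
  finally show "((f \<otimes>\<^bsub>P\<^esub> g) \<otimes>\<^bsub>P\<^esub> k) z = (f \<otimes>\<^bsub>P\<^esub> (g \<otimes>\<^bsub>P\<^esub> k)) z" .
qed

lemma delta_mult:
  assumes "x \<in> paths D" "y \<in> paths D"
  shows "delta x \<otimes>\<^bsub>P\<^esub> delta y = (if cmp x y then delta (cat x y) else (\<lambda>_. 0 :: 'k::field))"
proof
  fix z
  have "((delta x :: _ \<Rightarrow> 'k) \<otimes>\<^bsub>P\<^esub> delta y) z = (\<Sum>xy\<in>factorizations D z. if xy = (x, y) then 1 else 0)"
    unfolding mult_P delta_def by (rule sum.cong) (auto split: if_splits)
  also have "\<dots> = (if (x, y) \<in> factorizations D z then 1 else 0)" by (simp add: finite_factorizations)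
  finally show "((delta x :: _ \<Rightarrow> 'k) \<otimes>\<^bsub>P\<^esub> delta y) z = (if cmp x y then delta (cat x y) else (\<lambda>_. 0)) z"
    using assms unfolding factorizations_eq delta_def by auto
qed

lemma delta_closed: "z \<in> paths D \<Longrightarrow> delta z \<in> carrier P"
  unfolding carrier_P delta_def supp_def by auto

lemma one_closed: "(\<one>\<^bsub>P\<^esub> :: _ \<Rightarrow> 'k::field) \<in> carrier P"
proof -
  have "supp (\<one>\<^bsub>P\<^esub> :: _ \<Rightarrow> 'k) \<subseteq> (\<lambda>v. (v, [], v)) ` verts D"
    unfolding supp_def one_P by (auto split: if_splits)
  moreover have "(\<lambda>v. (v, [], v)) ` verts D \<subseteq> paths D" using trivial_path by blast
  ultimately show ?thesis unfolding carrier_P using fin_verts by (meson finite_imageI finite_subset subset_trans)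
qed

lemma one_mult: assumes "f \<in> carrier P" shows "\<one>\<^bsub>P\<^esub> \<otimes>\<^bsub>P\<^esub> f = f"
proof
  fix z
  show "(\<one>\<^bsub>P\<^esub> \<otimes>\<^bsub>P\<^esub> f) z = f z"
  proof (cases "z \<in> paths D")
    case True
    obtain u p w where z: "z = (u, p, w)" by (cases z)
    have w: "w \<in> verts D" using path_verts[OF True] z by simp
    have "(\<one>\<^bsub>P\<^esub> \<otimes>\<^bsub>P\<^esub> f) z = (\<Sum>xy\<in>factorizations D z. if xy = ((w, [], w), z) then f z else 0)"
      unfolding mult_P by (rule sum.cong) (auto simp: one_P factorizations_def z w split: if_splits)
    also have "\<dots> = (if ((w, [], w), z) \<in> factorizations D z then f z else 0)" by (simp add: finite_factorizations)
    finally show ?thesis using True z trivial_path[OF w] unfolding factorizations_eq cmp_def cat_def by simp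
  next
    case False
    then have "factorizations D z = {}" using factorization_paths by fastforce
    moreover have "f z = 0" using assms False unfolding carrier_P supp_def by blast
    ultimately show ?thesis unfolding mult_P by simp
  qed
qed

lemma mult_one: assumes "f \<in> carrier P" shows "f \<otimes>\<^bsub>P\<^esub> \<one>\<^bsub>P\<^esub> = f"
proof
  fix z
  show "(f \<otimes>\<^bsub>P\<^esub> \<one>\<^bsub>P\<^esub>) z = f z"
  proof (cases "z \<in> paths D")
    case True
    obtain u p w where z: "z = (u, p, w)" by (cases z)
    have u: "u \<in> verts D" using path_verts[OF True] z by simp
    have "(f \<otimes>\<^bsub>P\<^esub> \<one>\<^bsub>P\<^esub>) z = (\<Sum>xy\<in>factorizations D z. if xy = (z, (u, [], u)) then f z else 0)"
      unfolding mult_P by (rule sum.cong) (auto simp: one_P factorizations_def z u split: if_splits)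
    also have "\<dots> = (if (z, (u, [], u)) \<in> factorizations D z then f z else 0)" by (simp add: finite_factorizations)
    finally show ?thesis using True z trivial_path[OF u] unfolding factorizations_eq cmp_def cat_def by simp
  next
    case False
    then have "factorizations D z = {}" using factorization_paths by fastforce
    moreover have "f z = 0" using assms False unfolding carrier_P supp_def by blast
    ultimately show ?thesis unfolding mult_P by simp
  qed
qed

lemma supp_add: "supp (\<lambda>z. f z + g z) \<subseteq> supp f \<union> supp g"
  unfolding supp_def by auto

lemma add_closed: "f \<in> carrier P \<Longrightarrow> g \<in> carrier P \<Longrightarrow> f \<oplus>\<^bsub>P\<^esub> g \<in> carrier P"
  unfolding carrier_P add_P using supp_add[of f g] by (meson Un_least finite_UnI finite_subset subset_trans)

lemma scaled_closed: "f \<in> carrier P \<Longrightarrow> (\<lambda>z. c * f z) \<in> carrier P"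
proof -
  assume f: "f \<in> carrier P"
  have "supp (\<lambda>z. c * f z) \<subseteq> supp f" unfolding supp_def by auto
  then show ?thesis using f unfolding carrier_P by (meson finite_subset subset_trans)
qed

lemma mult_add_left: "(f \<oplus>\<^bsub>P\<^esub> g) \<otimes>\<^bsub>P\<^esub> k = f \<otimes>\<^bsub>P\<^esub> k \<oplus>\<^bsub>P\<^esub> g \<otimes>\<^bsub>P\<^esub> k"
  by (rule ext) (simp add: mult_P add_P case_prod_beta distrib_right sum.distrib)

lemma mult_add_right: "k \<otimes>\<^bsub>P\<^esub> (f \<oplus>\<^bsub>P\<^esub> g) = k \<otimes>\<^bsub>P\<^esub> f \<oplus>\<^bsub>P\<^esub> k \<otimes>\<^bsub>P\<^esub> g"
  by (rule ext) (simp add: mult_P add_P case_prod_beta distrib_left sum.distrib)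

lemma mult_scaled_left: "(\<lambda>z. c * f z) \<otimes>\<^bsub>P\<^esub> g = (\<lambda>z. c * (f \<otimes>\<^bsub>P\<^esub> g) z)"
  by (rule ext) (simp add: mult_P case_prod_beta sum_distrib_left mult.assoc)

lemma mult_scaled_right: "f \<otimes>\<^bsub>P\<^esub> (\<lambda>z. c * g z) = (\<lambda>z. c * (f \<otimes>\<^bsub>P\<^esub> g) z)"
  by (rule ext) (simp add: mult_P case_prod_beta sum_distrib_left mult.left_commute)

lemma mult_zero_left: "(\<lambda>_. 0) \<otimes>\<^bsub>P\<^esub> f = (\<lambda>_. 0)"
  by (rule ext) (simp add: mult_P case_prod_beta)

lemma mult_zero_right: "f \<otimes>\<^bsub>P\<^esub> (\<lambda>_. 0) = (\<lambda>_. 0)"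
  by (rule ext) (simp add: mult_P case_prod_beta)

lemma ring_P: "ring P"
proof (rule ringI)
  show "abelian_group P"
  proof (rule abelian_groupI)
    show "\<exists>y\<in>carrier P. y \<oplus>\<^bsub>P\<^esub> x = \<zero>\<^bsub>P\<^esub>" if "x \<in> carrier P" for x
      using scaled_closed[OF that, of "- 1"] by (intro bexI[of _ "\<lambda>z. - 1 * x z"]) (simp_all add: add_P zero_P)
    show "\<zero>\<^bsub>P\<^esub> \<in> carrier P" by (simp add: carrier_P zero_P supp_def)
    show "x \<oplus>\<^bsub>P\<^esub> y \<in> carrier P" if "x \<in> carrier P" "y \<in> carrier P" for x y using add_closed that .
  qed (auto simp: add_P zero_P add.assoc add.commute)
  show "monoid P"
    by (rule monoidI) (auto simp: mult_closed one_closed mult_assoc one_mult mult_one)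
qed (rule mult_add_left mult_add_right)+

sublocale P: ring P by (rule ring_P)

lemma minus_P: assumes "f \<in> carrier P" "g \<in> carrier P" shows "f \<ominus>\<^bsub>P\<^esub> g = (\<lambda>z. f z - g z)"
proof -
  have "\<ominus>\<^bsub>P\<^esub> g = (\<lambda>z. - 1 * g z)"
    by (rule P.minus_equality[OF _ assms(2) scaled_closed[OF assms(2)]]) (simp add: add_P zero_P)
  then show ?thesis unfolding a_minus_def add_P by simp
qed

lemma path_algebra_induct [consumes 1, case_names zero add]:
  assumes "f \<in> carrier P" and "Q (\<lambda>_. 0)"
    and "\<And>f c z. f \<in> carrier P \<Longrightarrow> Q f \<Longrightarrow> z \<in> paths D \<Longrightarrow> Q (f \<oplus>\<^bsub>P\<^esub> (\<lambda>x. c * delta z x))"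
  shows "Q f"
proof -
  have "finite Z \<Longrightarrow> Z \<subseteq> paths D \<Longrightarrow> supp f \<subseteq> Z \<Longrightarrow> Q f" for Z f
  proof (induction Z arbitrary: f rule: finite_induct)
    case empty
    then have "f = (\<lambda>_. 0)" unfolding supp_def by auto
    then show ?case using assms(2) by simp
  next
    case (insert z Z)
    define g where "g = (\<lambda>x. if x = z then 0 else f x)"
    have g: "supp g \<subseteq> Z" using insert.prems unfolding supp_def g_def by auto
    then have "g \<in> carrier P" unfolding carrier_P using insert by (meson finite_subset insert_subset subset_trans)
    moreover have "Q g" using insert.IH g insert.prems by blast
    ultimately have "Q (g \<oplus>\<^bsub>P\<^esub> (\<lambda>x. f z * delta z x))" using assms(3) insert.prems by blast
    moreover have "g \<oplus>\<^bsub>P\<^esub> (\<lambda>x. f z * delta z x) = f" unfolding add_P g_def delta_def by auto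
    ultimately show ?case by simp
  qed
  then show ?thesis using assms(1) unfolding carrier_P by blast
qed

end

context vspace begin

text \<open>
  Evaluation of \<open>f\<close>, a linear combination of paths, by means of given vectors for the
  paths.
\<close>

definition lf :: "(('v, 'e) path \<Rightarrow> 'k) \<Rightarrow> (('v, 'e) path \<Rightarrow> 'w) \<Rightarrow> 'w" where
  "lf f H = (\<Sum>z\<in>supp f. f z *s H z)"

lemma lf_superset: "finite Z \<Longrightarrow> supp f \<subseteq> Z \<Longrightarrow> lf f H = (\<Sum>z\<in>Z. f z *s H z)"
  unfolding lf_def by (rule sum.mono_neutral_left) (auto simp: supp_def)

lemma lf_add:
  assumes "finite (supp f)" "finite (supp g)"
  shows "lf (\<lambda>z. f z + g z) H = lf f H + lf g H"
proof -
  have "supp (\<lambda>z. f z + g z) \<subseteq> supp f \<union> supp g" unfolding supp_def by auto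
  then show ?thesis
    using assms lf_superset[of "supp f \<union> supp g"] by (simp add: scale_left_distrib sum.distrib)
qed

lemma lf_scaled: assumes "finite (supp f)" shows "lf (\<lambda>z. c * f z) H = c *s lf f H"
proof -
  have "supp (\<lambda>z. c * f z) \<subseteq> supp f" unfolding supp_def by auto
  then show ?thesis using assms lf_superset[of "supp f"] by (simp add: scale_sum_right)
qed

lemma lf_delta: "lf (delta z) H = H z"
proof -
  have "supp (delta z :: _ \<Rightarrow> 'k) \<subseteq> {z}" unfolding supp_def delta_def by auto
  then show ?thesis using lf_superset[of "{z}"] by (simp add: delta_def)
qed

lemma lf_zero: "lf (\<lambda>_. 0) H = 0"
  unfolding lf_def supp_def by simp

lemma lf_plus: "lf f (\<lambda>z. H z + H' z) = lf f H + lf f H'"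
  unfolding lf_def by (simp add: scale_right_distrib sum.distrib)

lemma lin_lf: "lin L \<Longrightarrow> L (lf f H) = lf f (\<lambda>z. L (H z))"
  unfolding lf_def by (simp add: lin_sum lin_scale)

lemma lf_in_subspace: "subspace S \<Longrightarrow> (\<And>z. z \<in> supp f \<Longrightarrow> H z \<in> S) \<Longrightarrow> lf f H \<in> S"
  unfolding lf_def by (rule subspace_sum, assumption, rule subspace_scale, assumption) blast

lemma lf_cong: "(\<And>z. z \<in> supp f \<Longrightarrow> H z = H' z) \<Longrightarrow> lf f H = lf f H'"
  unfolding lf_def by (rule sum.cong) auto

text \<open>A rule for products of two paths extends bilinearly to the path algebra.\<close>

lemma lf_mult:
  fixes D :: "('v, 'e) pre_digraph"
  assumes D: "fin_quiver D" and f: "f \<in> carrier (path_algebra D)" and g: "g \<in> carrier (path_algebra D)"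
    and H: "\<And>x y. x \<in> paths D \<Longrightarrow> y \<in> paths D \<Longrightarrow> K x y = (if cmp x y then H (cat x y) else 0)"
  shows "lf (f \<otimes>\<^bsub>path_algebra D\<^esub> g) H = lf f (\<lambda>x. lf g (\<lambda>y. K x y))"
proof -
  interpret fin_quiver D by (rule D)
  note ff = f[unfolded carrier_P] and gg = g[unfolded carrier_P]
  have K: "lf g (\<lambda>y. K x y) = lf (delta x \<otimes>\<^bsub>P\<^esub> g) H" if x: "x \<in> paths D" for x
    using g
  proof (induction g rule: path_algebra_induct)
    case zero
    show ?case by (simp add: lf_zero mult_zero_right)
  next
    case (add g c z)
    have dz: "delta z \<in> carrier P" "(\<lambda>y. c * delta z y) \<in> carrier P" using add delta_closed scaled_closed by blast+
    have fin: "finite (supp g)" "finite (supp (\<lambda>y. c * delta z y))" "finite (supp (delta z :: _ \<Rightarrow> 'k))"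
      "finite (supp (delta x \<otimes>\<^bsub>P\<^esub> g))" "finite (supp (delta x \<otimes>\<^bsub>P\<^esub> delta z :: _ \<Rightarrow> 'k))"
      "finite (supp (delta x \<otimes>\<^bsub>P\<^esub> (\<lambda>y. c * delta z y)))"
      using add dz mult_closed[OF delta_closed[OF x]] unfolding carrier_P by blast+
    have "lf (delta x \<otimes>\<^bsub>P\<^esub> (g \<oplus>\<^bsub>P\<^esub> (\<lambda>y. c * delta z y))) H =
      lf (delta x \<otimes>\<^bsub>P\<^esub> g) H + c *s lf (delta x \<otimes>\<^bsub>P\<^esub> delta z) H"
      unfolding mult_add_right unfolding add_P lf_add[OF fin(4,6)] unfolding mult_scaled_right lf_scaled[OF fin(5)] ..
    also have "lf (delta x \<otimes>\<^bsub>P\<^esub> delta z) H = K x z"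
      unfolding delta_mult[OF x add(2)] H[OF x add(2)] by (simp add: lf_delta lf_zero)
    finally show ?case
      unfolding add.IH[symmetric] add_P lf_add[OF fin(1,2)] lf_scaled[OF fin(3)] lf_delta by simp
  qed
  have "lf (f \<otimes>\<^bsub>P\<^esub> g) H = lf f (\<lambda>x. lf (delta x \<otimes>\<^bsub>P\<^esub> g) H)"
    using f
  proof (induction f rule: path_algebra_induct)
    case zero
    show ?case by (simp add: lf_zero mult_zero_left)
  next
    case (add f c z)
    have dz: "delta z \<in> carrier P" "(\<lambda>y. c * delta z y) \<in> carrier P" using add delta_closed scaled_closed by blast+
    have fin: "finite (supp f)" "finite (supp (\<lambda>y. c * delta z y))" "finite (supp (delta z :: _ \<Rightarrow> 'k))"
      "finite (supp (f \<otimes>\<^bsub>P\<^esub> g))" "finite (supp (delta z \<otimes>\<^bsub>P\<^esub> g))"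
      "finite (supp ((\<lambda>y. c * delta z y) \<otimes>\<^bsub>P\<^esub> g))"
      using add dz mult_closed[OF _ g] unfolding carrier_P by blast+
    have "lf ((f \<oplus>\<^bsub>P\<^esub> (\<lambda>y. c * delta z y)) \<otimes>\<^bsub>P\<^esub> g) H =
      lf (f \<otimes>\<^bsub>P\<^esub> g) H + c *s lf (delta z \<otimes>\<^bsub>P\<^esub> g) H"
      unfolding mult_add_left unfolding add_P lf_add[OF fin(4,6)] unfolding mult_scaled_left lf_scaled[OF fin(5)] ..
    then show ?case
      unfolding add.IH add_P lf_add[OF fin(1,2)] lf_scaled[OF fin(3)] lf_delta .
  qed
  also have "\<dots> = lf f (\<lambda>x. lf g (\<lambda>y. K x y))"
    by (rule lf_cong) (use K ff in auto)
  finally show ?thesis .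
qed

end

section \<open>Modules over the preprojective algebra\<close>

text \<open>
  Elements of the preprojective algebra are cosets. It is more convenient to let the path algebra
  act, through \<open>act\<close>, and to remember that the ideal \<open>J\<close> acts as zero;
  \<open>sc\<close> is the action of the field.
\<close>

locale preproj_module = loop_free_quiver "verts Q" "arcs Q" "tail Q" "head Q"
  for Q :: "('v, 'e) pre_digraph" +
  fixes M :: "((('v, 'e + 'e) path \<Rightarrow> 'k::field) set, 'm) module"
  assumes mod: "left_module (preprojective_algebra Q) M"
begin

abbreviation D :: "('v, 'e + 'e) pre_digraph" where "D \<equiv> double_quiver Q"

abbreviation J :: "(('v, 'e + 'e) path \<Rightarrow> 'k) set" where "J \<equiv> preprojective_ideal Q"

abbreviation R :: "(('v, 'e + 'e) path \<Rightarrow> 'k) set ring" where "R \<equiv> preprojective_algebra Q"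

lemma D_simps [simp]: "verts D = verts Q" "tail D (Inl a) = tail Q a" "head D (Inl a) = head Q a"
  "tail D (Inr a) = head Q a" "head D (Inr a) = tail Q a"
  "Inl a \<in> arcs D \<longleftrightarrow> a \<in> arcs Q" "Inr a \<in> arcs D \<longleftrightarrow> a \<in> arcs Q"
  unfolding double_quiver_def by auto

sublocale fin_quiver D
proof
  show "tail D a \<in> verts D" "head D a \<in> verts D" if "a \<in> arcs D" for a
    using that tlV hdV by (cases a; simp)+
qed (simp add: finV)

sublocale L: left_module R M by (rule mod)

lemma arrow_delta: "arrow D b = delta (tail D b, [b], head D b)"
  unfolding arrow_def delta_def by simp

lemma arrow_closed: "b \<in> arcs D \<Longrightarrow> arrow D b \<in> carrier P"
  unfolding arrow_delta by (rule delta_closed) (rule arrow_path)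

definition rel_term :: "'e \<Rightarrow> ('v, 'e + 'e) path \<Rightarrow> 'k" where
  "rel_term a = (arrow D (Inl a) \<otimes>\<^bsub>P\<^esub> arrow D (Inr a)) \<ominus>\<^bsub>P\<^esub> (arrow D (Inr a) \<otimes>\<^bsub>P\<^esub> arrow D (Inl a))"

lemma rel_eq: "preprojective_relation Q = (\<Oplus>\<^bsub>P\<^esub>a\<in>arcs Q. rel_term a)"
  unfolding preprojective_relation_def rel_term_def Let_def ..

lemma rel_term_closed: "a \<in> arcs Q \<Longrightarrow> rel_term a \<in> carrier P"
  unfolding rel_term_def by (intro P.minus_closed mult_closed arrow_closed) auto

lemma rel_closed: "(preprojective_relation Q :: _ \<Rightarrow> 'k) \<in> carrier P"
  unfolding rel_eq by (rule P.finsum_closed) (use rel_term_closed in auto)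

sublocale I: ideal J P
  unfolding preprojective_ideal_def by (rule P.genideal_ideal) (use rel_closed in auto)

lemma rel_in_J: "preprojective_relation Q \<in> J"
  unfolding preprojective_ideal_def by (rule P.genideal_self') (rule rel_closed)

lemma J_minimal: "ideal K P \<Longrightarrow> preprojective_relation Q \<in> K \<Longrightarrow> J \<subseteq> K"
  unfolding preprojective_ideal_def by (rule P.genideal_minimal) auto

definition cls :: "(('v, 'e + 'e) path \<Rightarrow> 'k) \<Rightarrow> (('v, 'e + 'e) path \<Rightarrow> 'k) set" where
  "cls f = J +>\<^bsub>P\<^esub> f"

lemma R_eq: "R = P Quot J" unfolding preprojective_algebra_def ..

lemma cls_hom:
  assumes "f \<in> carrier P" "g \<in> carrier P"
  shows "cls f \<in> carrier R" "cls (f \<oplus>\<^bsub>P\<^esub> g) = cls f \<oplus>\<^bsub>R\<^esub> cls g" "cls (f \<otimes>\<^bsub>P\<^esub> g) = cls f \<otimes>\<^bsub>R\<^esub> cls g"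
    "cls \<one>\<^bsub>P\<^esub> = \<one>\<^bsub>R\<^esub>"
  using I.rcos_ring_hom assms unfolding R_eq Ring.ring_hom_def cls_def by auto

lemma cls_surj: assumes "r \<in> carrier R" obtains f where "f \<in> carrier P" "r = cls f"
  using assms unfolding R_eq FactRing_def A_RCOSETS_def' cls_def by auto

lemma cls_J: "f \<in> J \<Longrightarrow> cls f = \<zero>\<^bsub>R\<^esub>"
  unfolding cls_def R_eq FactRing_def using I.a_rcos_const by simp

lemma cls_eqD: assumes "f \<in> carrier P" "g \<in> carrier P" "cls f = cls g" shows "f \<ominus>\<^bsub>P\<^esub> g \<in> J"
proof -
  have "f \<in> J +>\<^bsub>P\<^esub> f" by (rule I.a_rcos_self[OF assms(1)])
  then have "f \<in> J +>\<^bsub>P\<^esub> g" using assms(3) unfolding cls_def by simp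
  then obtain j where j: "j \<in> J" "f = j \<oplus>\<^bsub>P\<^esub> g" unfolding a_r_coset_def' by blast
  have "j \<in> carrier P" using j(1) I.a_subset by blast
  then have "f \<ominus>\<^bsub>P\<^esub> g = j" using j(2) assms by (simp add: P.minus_eq P.a_assoc P.r_neg)
  then show ?thesis using j by simp
qed

definition act :: "(('v, 'e + 'e) path \<Rightarrow> 'k) \<Rightarrow> 'm \<Rightarrow> 'm" where
  "act f x = cls f \<odot>\<^bsub>M\<^esub> x"

definition sc :: "'k \<Rightarrow> 'm \<Rightarrow> 'm" where
  "sc c x = act (\<lambda>z. c * \<one>\<^bsub>P\<^esub> z) x"

lemma sc_eq: "preprojective_scalar Q c \<odot>\<^bsub>M\<^esub> x = sc c x"
  unfolding sc_def act_def cls_def preprojective_scalar_def Let_def ..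

lemma smult_zero: assumes x: "x \<in> carrier M" shows "\<zero>\<^bsub>R\<^esub> \<odot>\<^bsub>M\<^esub> x = \<zero>\<^bsub>M\<^esub>"
proof -
  have c: "\<zero>\<^bsub>R\<^esub> \<odot>\<^bsub>M\<^esub> x \<in> carrier M" using L.smult_closed x by simp
  have "\<zero>\<^bsub>R\<^esub> \<odot>\<^bsub>M\<^esub> x \<oplus>\<^bsub>M\<^esub> \<zero>\<^bsub>R\<^esub> \<odot>\<^bsub>M\<^esub> x = \<zero>\<^bsub>R\<^esub> \<odot>\<^bsub>M\<^esub> x \<oplus>\<^bsub>M\<^esub> \<zero>\<^bsub>M\<^esub>"
    using L.smult_l_distr[of "\<zero>\<^bsub>R\<^esub>" "\<zero>\<^bsub>R\<^esub>" x] x c by simp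
  then show ?thesis using c by simp
qed

lemma smult_zero_right: assumes r: "r \<in> carrier R" shows "r \<odot>\<^bsub>M\<^esub> \<zero>\<^bsub>M\<^esub> = \<zero>\<^bsub>M\<^esub>"
proof -
  have c: "r \<odot>\<^bsub>M\<^esub> \<zero>\<^bsub>M\<^esub> \<in> carrier M" using L.smult_closed r by simp
  have "r \<odot>\<^bsub>M\<^esub> \<zero>\<^bsub>M\<^esub> \<oplus>\<^bsub>M\<^esub> r \<odot>\<^bsub>M\<^esub> \<zero>\<^bsub>M\<^esub> = r \<odot>\<^bsub>M\<^esub> \<zero>\<^bsub>M\<^esub> \<oplus>\<^bsub>M\<^esub> \<zero>\<^bsub>M\<^esub>"
    using L.smult_r_distr[OF r, of "\<zero>\<^bsub>M\<^esub>" "\<zero>\<^bsub>M\<^esub>"] c by simp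
  then show ?thesis using c by simp
qed

context
  fixes f g :: "('v, 'e + 'e) path \<Rightarrow> 'k" and x :: 'm
  assumes f: "f \<in> carrier P" and g: "g \<in> carrier P" and x: "x \<in> carrier M"
begin

lemma act_closed: "act f x \<in> carrier M"
  unfolding act_def using L.smult_closed cls_hom(1)[OF f f] x by simp

lemma act_add: "act (f \<oplus>\<^bsub>P\<^esub> g) x = act f x \<oplus>\<^bsub>M\<^esub> act g x"
  unfolding act_def cls_hom(2)[OF f g] using L.smult_l_distr cls_hom(1)[OF f f] cls_hom(1)[OF g g] x by simp

lemma act_mult: "act (f \<otimes>\<^bsub>P\<^esub> g) x = act f (act g x)"
  unfolding act_def cls_hom(3)[OF f g] using L.smult_assoc cls_hom(1)[OF f f] cls_hom(1)[OF g g] x by simp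

lemma act_one: "act \<one>\<^bsub>P\<^esub> x = x"
  unfolding act_def cls_hom(4)[OF f f] using L.smult_one x by simp

lemma act_plus: "y \<in> carrier M \<Longrightarrow> act f (x \<oplus>\<^bsub>M\<^esub> y) = act f x \<oplus>\<^bsub>M\<^esub> act f y"
  unfolding act_def using L.smult_r_distr cls_hom(1)[OF f f] x by simp

lemma scalar_closed: "(\<lambda>z. c * \<one>\<^bsub>P\<^esub> z :: 'k) \<in> carrier P"
  by (rule scaled_closed[OF one_closed])

lemma sc_act: "sc c (act f x) = act (\<lambda>z. c * f z) x"
proof -
  have "act (\<lambda>z. c * f z) x = act ((\<lambda>z. c * \<one>\<^bsub>P\<^esub> z) \<otimes>\<^bsub>P\<^esub> f) x"
    unfolding mult_scaled_left one_mult[OF f] ..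
  then show ?thesis unfolding sc_def act_def cls_hom(3)[OF scalar_closed f]
    using L.smult_assoc cls_hom(1)[OF scalar_closed f] cls_hom(1)[OF f f] x by simp
qed

lemma act_sc: "act f (sc c x) = act (\<lambda>z. c * f z) x"
proof -
  have "act (\<lambda>z. c * f z) x = act (f \<otimes>\<^bsub>P\<^esub> (\<lambda>z. c * \<one>\<^bsub>P\<^esub> z)) x"
    unfolding mult_scaled_right mult_one[OF f] ..
  then show ?thesis unfolding sc_def act_def cls_hom(3)[OF f scalar_closed]
    using L.smult_assoc cls_hom(1)[OF scalar_closed f] cls_hom(1)[OF f f] x by simp
qed

end

lemma sc_closed: "x \<in> carrier M \<Longrightarrow> sc c x \<in> carrier M"
  unfolding sc_def by (rule act_closed[OF scaled_closed[OF one_closed] one_closed])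

lemma sc_plus: "x \<in> carrier M \<Longrightarrow> y \<in> carrier M \<Longrightarrow> sc c (x \<oplus>\<^bsub>M\<^esub> y) = sc c x \<oplus>\<^bsub>M\<^esub> sc c y"
  unfolding sc_def by (rule act_plus[OF scaled_closed[OF one_closed] one_closed])

lemma sc_sc: "x \<in> carrier M \<Longrightarrow> sc c (sc d x) = sc (c * d) x"
  unfolding sc_def[of d] sc_def[of "c * d"]
  using sc_act[OF scaled_closed[OF one_closed] one_closed] by (simp add: mult.assoc)

lemma sc_add: "x \<in> carrier M \<Longrightarrow> sc (c + d) x = sc c x \<oplus>\<^bsub>M\<^esub> sc d x"
  unfolding sc_def using act_add[OF scaled_closed[OF one_closed] scaled_closed[OF one_closed], of x c d]
  by (simp add: add_P distrib_right)

lemma sc_one: "x \<in> carrier M \<Longrightarrow> sc 1 x = x"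
  unfolding sc_def using act_one[OF one_closed one_closed] by simp

lemma sc_zero: "x \<in> carrier M \<Longrightarrow> sc 0 x = \<zero>\<^bsub>M\<^esub>"
  using sc_add[of x 0 0] sc_closed[of x 0] by (metis L.M.add.r_cancel_one' add.left_neutral)

lemma act_J: "f \<in> J \<Longrightarrow> x \<in> carrier M \<Longrightarrow> act f x = \<zero>\<^bsub>M\<^esub>"
  unfolding act_def by (simp add: cls_J smult_zero)

text \<open>
  A linear map from functions to the module, depending only on the coordinates \<open>\<iota> 0,
  ..., \<iota> (n - 1)\<close>.
\<close>

definition linear_parametrisation :: "(nat \<Rightarrow> 'x) \<Rightarrow> (('x \<Rightarrow> 'k) \<Rightarrow> 'm) \<Rightarrow> nat \<Rightarrow> bool" where
  "linear_parametrisation \<iota> lam n \<longleftrightarrow> (\<forall>x. lam x \<in> carrier M) \<and>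
     (\<forall>x y. lam (\<lambda>i. x i + y i) = lam x \<oplus>\<^bsub>M\<^esub> lam y) \<and>
     (\<forall>c x. lam (\<lambda>i. c * x i) = sc c (lam x)) \<and>
     (\<forall>x y. (\<forall>j<n. x (\<iota> j) = y (\<iota> j)) \<longrightarrow> lam x = lam y)"

lemma exists_parametrisation:
  fixes \<iota> :: "nat \<Rightarrow> 'x"
  assumes fd: "finite_dimensional (preprojective_scalar Q) M" and \<iota>: "inj \<iota>"
  obtains lam n where "linear_parametrisation \<iota> lam n" "\<And>m. m \<in> carrier M \<Longrightarrow> \<exists>x. lam x = m"
proof -
  obtain B where B: "finite B" "B \<subseteq> carrier M"
    "\<forall>x\<in>carrier M. \<exists>c. x = (\<Oplus>\<^bsub>M\<^esub>b\<in>B. preprojective_scalar Q (c b) \<odot>\<^bsub>M\<^esub> b)"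
    using fd unfolding finite_dimensional_def by blast
  have "\<exists>lam n. linear_parametrisation \<iota> lam n \<and> (\<forall>c. \<exists>x. lam x = (\<Oplus>\<^bsub>M\<^esub>b\<in>B. sc (c b) b))"
    using B(1,2)
  proof (induction B)
    case empty
    have "linear_parametrisation \<iota> (\<lambda>_. \<zero>\<^bsub>M\<^esub>) 0"
      unfolding linear_parametrisation_def
      by (simp add: sc_def act_def smult_zero_right cls_hom(1)[OF scaled_closed[OF one_closed] one_closed])
    then show ?case by (intro exI[of _ "\<lambda>_. \<zero>\<^bsub>M\<^esub>"] exI[of _ 0]) simp
  next
    case (insert b B)
    have "\<exists>lam n. linear_parametrisation \<iota> lam n \<and> (\<forall>c. \<exists>x. lam x = (\<Oplus>\<^bsub>M\<^esub>b\<in>B. sc (c b) b))"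
      by (rule insert.IH) (use insert in simp)
    then obtain lam n where p: "linear_parametrisation \<iota> lam n" and l5: "\<forall>c. \<exists>x. lam x = (\<Oplus>\<^bsub>M\<^esub>b\<in>B. sc (c b) b)"
      by (elim exE conjE)
    note l = p[unfolded linear_parametrisation_def]
    have l1: "lam x \<in> carrier M" for x using l by blast
    have l2: "lam (\<lambda>i. x i + y i) = lam x \<oplus>\<^bsub>M\<^esub> lam y" for x y using l by blast
    have l3: "lam (\<lambda>i. c * x i) = sc c (lam x)" for c x using l by blast
    have l4: "(\<forall>j<n. x (\<iota> j) = y (\<iota> j)) \<longrightarrow> lam x = lam y" for x y using l by blast
    have b: "b \<in> carrier M" using insert by simp
    define lam' where "lam' x = sc (x (\<iota> n)) b \<oplus>\<^bsub>M\<^esub> lam x" for x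
    have "linear_parametrisation \<iota> lam' (Suc n)"
      unfolding linear_parametrisation_def
    proof (intro conjI allI impI)
      show "lam' x \<in> carrier M" for x unfolding lam'_def using l1 sc_closed b by simp
      show "lam' (\<lambda>i. x i + y i) = lam' x \<oplus>\<^bsub>M\<^esub> lam' y" for x y
        unfolding lam'_def l2 sc_add[OF b] using l1 sc_closed b by (simp add: L.M.a_ac)
      show "lam' (\<lambda>i. c * x i) = sc c (lam' x)" for c x
        unfolding lam'_def l3 using l1 sc_closed b by (simp add: sc_plus sc_sc)
      show "lam' x = lam' y" if "\<forall>j<Suc n. x (\<iota> j) = y (\<iota> j)" for x y
        unfolding lam'_def using that l4[of x y] by simp
    qed
    moreover have "\<forall>c. \<exists>x. lam' x = (\<Oplus>\<^bsub>M\<^esub>b\<in>insert b B. sc (c b) b)"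
    proof
      fix c
      obtain x where x: "lam x = (\<Oplus>\<^bsub>M\<^esub>b\<in>B. sc (c b) b)" using l5 by blast
      define x' where "x' = x(\<iota> n := c b)"
      have "\<forall>j<n. x' (\<iota> j) = x (\<iota> j)" unfolding x'_def using \<iota> by (simp add: inj_eq)
      then have "lam x' = lam x" using l4 by blast
      then have "lam' x' = sc (c b) b \<oplus>\<^bsub>M\<^esub> (\<Oplus>\<^bsub>M\<^esub>b\<in>B. sc (c b) b)" unfolding lam'_def x by (simp add: x'_def)
      also have "\<dots> = (\<Oplus>\<^bsub>M\<^esub>b\<in>insert b B. sc (c b) b)"
        using insert sc_closed b by (subst L.M.finsum_insert) auto
      finally show "\<exists>x. lam' x = (\<Oplus>\<^bsub>M\<^esub>b\<in>insert b B. sc (c b) b)" by blast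
    qed
    ultimately show ?case by blast
  qed
  then obtain lam n where p: "linear_parametrisation \<iota> lam n" and l5: "\<forall>c. \<exists>x. lam x = (\<Oplus>\<^bsub>M\<^esub>b\<in>B. sc (c b) b)"
    by (elim exE conjE)
  have "\<exists>x. lam x = m" if m: "m \<in> carrier M" for m
  proof -
    obtain c where "m = (\<Oplus>\<^bsub>M\<^esub>b\<in>B. sc (c b) b)" using B(3) m unfolding sc_eq by blast
    then show ?thesis using l5 by metis
  qed
  then show thesis using that p by blast
qed

end

section \<open>Modules in coordinates\<close>

text \<open>
  The module is identified with a finite-dimensional subspace \<open>S\<close> of the ambient
  space: \<open>lam\<close> is a linear map onto \<open>M\<close>, defined everywhere, and
  \<open>kap\<close> is its inverse with values in \<open>S\<close>. In these coordinates the path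
  algebra acts by operators \<open>ac f\<close>; those of the trivial paths and of the arrows are
  \<open>ev\<close>, \<open>Ta\<close> and \<open>ph\<close>.
\<close>

locale coord_module = preproj_module Q M + quiver_reps scale ins up "verts Q" "arcs Q" "tail Q" "head Q"
  for Q :: "('v, 'e) pre_digraph"
  and M :: "((('v, 'e + 'e) path \<Rightarrow> 'k::field) set, 'm) module"
  and scale :: "'k \<Rightarrow> 'w::ab_group_add \<Rightarrow> 'w" (infixr \<open>*s\<close> 75)
  and ins up :: "'e \<Rightarrow> 'w \<Rightarrow> 'w" +
  fixes S :: "'w set" and lam :: "'w \<Rightarrow> 'm" and kap :: "'m \<Rightarrow> 'w"
  assumes fdim_S: "fdim S"
    and lam_closed: "lam x \<in> carrier M"
    and lam_add: "lam (x + y) = lam x \<oplus>\<^bsub>M\<^esub> lam y"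
    and lam_scale: "lam (c *s x) = sc c (lam x)"
    and kap_S: "m \<in> carrier M \<Longrightarrow> kap m \<in> S"
    and lam_kap: "m \<in> carrier M \<Longrightarrow> lam (kap m) = m"
    and kap_lam: "x \<in> S \<Longrightarrow> kap (lam x) = x"
begin

lemma subspace_S: "subspace S" by (rule fdim_subspaceD[OF fdim_S])

lemma lam_inj: "x \<in> S \<Longrightarrow> y \<in> S \<Longrightarrow> lam x = lam y \<Longrightarrow> x = y"
  using kap_lam by metis

lemma kap_add: "m \<in> carrier M \<Longrightarrow> m' \<in> carrier M \<Longrightarrow> kap (m \<oplus>\<^bsub>M\<^esub> m') = kap m + kap m'"
  by (rule lam_inj) (simp_all add: kap_S lam_kap lam_add subspace_add[OF subspace_S])

lemma kap_sc: "m \<in> carrier M \<Longrightarrow> kap (sc c m) = c *s kap m"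
  by (rule lam_inj) (simp_all add: kap_S lam_kap lam_scale sc_closed subspace_scale[OF subspace_S])

lemma lam_0: "lam 0 = \<zero>\<^bsub>M\<^esub>"
  using lam_scale[of 0 0] sc_zero[OF lam_closed[of 0]] by simp

lemma kap_0: "kap \<zero>\<^bsub>M\<^esub> = 0"
  using kap_lam[OF subspace_0[OF subspace_S]] lam_0 by simp

lemma lin_conj:
  assumes "\<And>m. m \<in> carrier M \<Longrightarrow> G m \<in> carrier M"
    and "\<And>m m'. m \<in> carrier M \<Longrightarrow> m' \<in> carrier M \<Longrightarrow> G (m \<oplus>\<^bsub>M\<^esub> m') = G m \<oplus>\<^bsub>M\<^esub> G m'"
    and "\<And>c m. m \<in> carrier M \<Longrightarrow> G (sc c m) = sc c (G m)"
  shows "lin (\<lambda>x. kap (G (lam x)))"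
  by (rule linI) (simp_all add: assms lam_add lam_scale lam_closed kap_add kap_sc)

definition ac :: "(('v, 'e + 'e) path \<Rightarrow> 'k) \<Rightarrow> 'w \<Rightarrow> 'w" where
  "ac f x = kap (act f (lam x))"

definition ev :: "'v \<Rightarrow> 'w \<Rightarrow> 'w" where
  "ev v = ac (delta (v, [], v))"

definition opr :: "'e + 'e \<Rightarrow> 'w \<Rightarrow> 'w" where
  "opr b = ac (arrow D b)"

definition Ta :: "'e \<Rightarrow> 'w \<Rightarrow> 'w" where "Ta a = opr (Inl a)"

definition ph :: "'e \<Rightarrow> 'w \<Rightarrow> 'w" where "ph a = opr (Inr a)"

lemma act_ok: "f \<in> carrier P \<Longrightarrow> m \<in> carrier M \<Longrightarrow> act f m \<in> carrier M"
  by (rule act_closed) auto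

lemma ac_S: "f \<in> carrier P \<Longrightarrow> ac f x \<in> S"
  unfolding ac_def by (intro kap_S act_ok lam_closed)

lemma lam_ac: "f \<in> carrier P \<Longrightarrow> lam (ac f x) = act f (lam x)"
  unfolding ac_def by (intro lam_kap act_ok lam_closed)

lemma lin_ac: "f \<in> carrier P \<Longrightarrow> lin (ac f)"
  unfolding ac_def[abs_def] by (rule lin_conj) (simp_all add: act_ok act_plus[of f f] act_sc[of f f] sc_act[of f f])

lemma ac_add: "f \<in> carrier P \<Longrightarrow> g \<in> carrier P \<Longrightarrow> ac (\<lambda>z. f z + g z) x = ac f x + ac g x"
  unfolding ac_def using act_add[of f g "lam x"] by (simp add: lam_closed kap_add act_ok add_P)

lemma ac_scaled: "f \<in> carrier P \<Longrightarrow> ac (\<lambda>z. c * f z) x = c *s ac f x"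
  unfolding ac_def using sc_act[of f f "lam x" c] by (simp add: lam_closed kap_sc[symmetric] act_ok)

lemma ac_mult: "f \<in> carrier P \<Longrightarrow> g \<in> carrier P \<Longrightarrow> ac (f \<otimes>\<^bsub>P\<^esub> g) x = ac f (ac g x)"
  unfolding ac_def by (simp add: act_mult lam_closed lam_kap act_ok)

lemma ac_one: "x \<in> S \<Longrightarrow> ac \<one>\<^bsub>P\<^esub> x = x"
  unfolding ac_def using act_one[OF one_closed one_closed lam_closed] by (simp add: kap_lam)

lemma ac_J: "f \<in> J \<Longrightarrow> ac f x = 0"
  unfolding ac_def by (simp add: act_J lam_closed kap_0)

lemma ac_zero: "ac (\<lambda>_. 0) x = 0"
  using ac_J[OF additive_subgroup.zero_closed[OF I.is_additive_subgroup]] by (simp add: zero_P)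

lemma ac_lf: "f \<in> carrier P \<Longrightarrow> ac f x = lf f (\<lambda>z. ac (delta z) x)"
proof (induction f rule: path_algebra_induct)
  case zero
  show ?case by (simp add: ac_zero lf_zero)
next
  case (add f c z)
  have d: "delta z \<in> carrier P" "(\<lambda>y. c * delta z y) \<in> carrier P" using add delta_closed scaled_closed by blast+
  have "finite (supp f)" "finite (supp (\<lambda>y. c * delta z y))" "finite (supp (delta z :: _ \<Rightarrow> 'k))"
    using add d unfolding carrier_P by blast+
  then show ?case
    unfolding add_P ac_add[OF add(1) d(2)] ac_scaled[OF d(1)] by (simp add: lf_add lf_scaled lf_delta add.IH)
qed

lemma ev_S: "v \<in> verts Q \<Longrightarrow> ev v x \<in> S"
  unfolding ev_def by (rule ac_S[OF delta_closed[OF trivial_path]]) simp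

lemma lin_ev: "v \<in> verts Q \<Longrightarrow> lin (ev v)"
  unfolding ev_def by (rule lin_ac[OF delta_closed[OF trivial_path]]) simp

lemma opr_S: "b \<in> arcs D \<Longrightarrow> opr b x \<in> S"
  unfolding opr_def by (rule ac_S[OF arrow_closed])

lemma lin_opr: "b \<in> arcs D \<Longrightarrow> lin (opr b)"
  unfolding opr_def by (rule lin_ac[OF arrow_closed])

lemma ac_delta_mult:
  assumes "x \<in> paths D" "y \<in> paths D"
  shows "ac (delta x) (ac (delta y) w) = (if cmp x y then ac (delta (cat x y)) w else 0)"
  using ac_mult[OF delta_closed[OF assms(1)] delta_closed[OF assms(2)], of w] delta_mult[OF assms, where 'k = 'k] ac_zero by auto

lemma ev_ev: "u \<in> verts Q \<Longrightarrow> v \<in> verts Q \<Longrightarrow> ev u (ev v x) = (if u = v then ev v x else 0)"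
  unfolding ev_def using ac_delta_mult[OF trivial_path trivial_path, of u v x] by (auto simp: cmp_def cat_def)

lemma opr_ev: "b \<in> arcs D \<Longrightarrow> opr b (ev (tail D b) x) = opr b x"
  unfolding ev_def opr_def arrow_delta
  using ac_delta_mult[OF arrow_path trivial_path[OF tail_verts], of b b x] by (auto simp: cmp_def cat_def)

lemma ev_opr: "b \<in> arcs D \<Longrightarrow> ev (head D b) (opr b x) = opr b x"
  unfolding ev_def opr_def arrow_delta
  using ac_delta_mult[OF trivial_path[OF head_verts] arrow_path, of b b x] by (auto simp: cmp_def cat_def)

lemma sum_ev: assumes x: "x \<in> S" shows "(\<Sum>v\<in>verts Q. ev v x) = x"
proof -
  let ?Z = "(\<lambda>v. (v, [], v)) ` verts Q"
  have "supp (\<one>\<^bsub>P\<^esub> :: _ \<Rightarrow> 'k) \<subseteq> ?Z" unfolding supp_def one_P by (auto split: if_splits)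
  then have "lf \<one>\<^bsub>P\<^esub> (\<lambda>z. ac (delta z) x) = (\<Sum>z\<in>?Z. \<one>\<^bsub>P\<^esub> z *s ac (delta z) x)"
    by (rule lf_superset[rotated]) (simp add: finV)
  also have "\<dots> = (\<Sum>v\<in>verts Q. ev v x)"
    by (subst sum.reindex) (auto simp: inj_on_def one_P ev_def)
  finally show ?thesis using ac_lf[OF one_closed, of x] ac_one[OF x] by simp
qed

primrec walk :: "('e + 'e) list \<Rightarrow> 'w \<Rightarrow> 'w" where
  "walk [] x = x"
| "walk (b # p) x = walk p (opr b x)"

lemma ac_path:
  assumes "(u, p, w) \<in> paths D"
  shows "ac (delta (u, p, w)) x = walk p (ev u x)"
  using assms
proof (induction p arbitrary: u x)
  case Nil
  then show ?case by (simp add: paths_iff pre_digraph.cas.simps ev_def)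
next
  case (Cons b p)
  have b: "b \<in> arcs D" "u = tail D b" and p: "(head D b, p, w) \<in> paths D"
    using Cons.prems head_verts by (auto simp: paths_iff pre_digraph.cas.simps simp del: D_simps)
  have "ac (delta (u, b # p, w)) x = ac (delta (head D b, p, w)) (opr b x)"
    unfolding opr_def arrow_delta using ac_delta_mult[OF p arrow_path[OF b(1)], of x] b(2)
    by (simp add: cmp_def cat_def)
  also have "\<dots> = walk p (ev (head D b) (opr b x))" by (rule Cons.IH[OF p])
  finally show ?case using ev_opr[OF b(1)] opr_ev[OF b(1)] b(2) by simp
qed

lemma qmod_S: "qmod S ev Ta"
  unfolding qmod_def
proof (intro conjI ballI)
  show "lin (Ta a)" "Ta a ` S \<subseteq> S" if "a \<in> arcs Q" for a
    unfolding Ta_def using lin_opr[of "Inl a"] opr_S[of "Inl a"] that by auto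
  show "Ta a (ev (tail Q a) x) = Ta a x" "ev (head Q a) (Ta a x) = Ta a x" if "a \<in> arcs Q" for a x
    unfolding Ta_def using opr_ev[of "Inl a" x] ev_opr[of "Inl a" x] that by simp_all
qed (use fdim_S lin_ev ev_S sum_ev ev_ev in auto)

lemma additive_rel:
  fixes F :: "(('v, 'e + 'e) path \<Rightarrow> 'k) \<Rightarrow> 'w"
  assumes add: "\<And>f g. f \<in> carrier P \<Longrightarrow> g \<in> carrier P \<Longrightarrow> F (\<lambda>z. f z + g z) = F f + F g"
    and sc: "\<And>f c. f \<in> carrier P \<Longrightarrow> F (\<lambda>z. c * f z) = c *s F f"
  shows "F (preprojective_relation Q) =
    (\<Sum>a\<in>arcs Q. F (arrow D (Inl a) \<otimes>\<^bsub>P\<^esub> arrow D (Inr a)) - F (arrow D (Inr a) \<otimes>\<^bsub>P\<^esub> arrow D (Inl a)))"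
proof -
  have "F (\<Oplus>\<^bsub>P\<^esub>a\<in>X. rel_term a) = (\<Sum>a\<in>X. F (rel_term a))" if "finite X" "X \<subseteq> arcs Q" for X
    using that
  proof (induction X)
    case empty
    have "F (\<lambda>z. 0 * \<zero>\<^bsub>P\<^esub> z) = 0 *s F \<zero>\<^bsub>P\<^esub>" by (rule sc) simp
    then show ?case by (simp add: zero_P)
  next
    case (insert a X)
    have "(\<Oplus>\<^bsub>P\<^esub>a\<in>insert a X. rel_term a) = rel_term a \<oplus>\<^bsub>P\<^esub> (\<Oplus>\<^bsub>P\<^esub>a\<in>X. rel_term a)"
      using insert rel_term_closed by (intro P.finsum_insert) auto
    then show ?case
      using insert rel_term_closed add[of "rel_term a" "\<Oplus>\<^bsub>P\<^esub>a\<in>X. rel_term a"] by (auto simp: add_P subset_iff Pi_def)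
  qed
  then have "F (preprojective_relation Q) = (\<Sum>a\<in>arcs Q. F (rel_term a))" unfolding rel_eq using finA by simp
  also have "\<dots> = (\<Sum>a\<in>arcs Q. F (arrow D (Inl a) \<otimes>\<^bsub>P\<^esub> arrow D (Inr a)) - F (arrow D (Inr a) \<otimes>\<^bsub>P\<^esub> arrow D (Inl a)))"
  proof (rule sum.cong)
    fix a assume a: "a \<in> arcs Q"
    let ?f = "arrow D (Inl a) \<otimes>\<^bsub>P\<^esub> arrow D (Inr a) :: _ \<Rightarrow> 'k" and ?g = "arrow D (Inr a) \<otimes>\<^bsub>P\<^esub> arrow D (Inl a) :: _ \<Rightarrow> 'k"
    have c12: "?f \<in> carrier P" "?g \<in> carrier P"
      using a by (auto intro!: mult_closed arrow_closed)
    note c = c12 scaled_closed[OF c12(2), of "- 1"]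
    have "rel_term a = (\<lambda>z. ?f z + (- 1) * ?g z)" unfolding rel_term_def minus_P[OF c(1,2)] by simp
    then show "F (rel_term a) = F ?f - F ?g" using add[OF c(1,3)] sc[OF c(2), of "- 1"] by simp
  qed simp
  finally show ?thesis .
qed

text \<open>The relation of the preprojective algebra acts as zero.\<close>

lemma tang_S: "tang S ev Ta ph"
  unfolding tang_def
proof (intro conjI ballI)
  show "lin (ph a)" "ph a ` S \<subseteq> S" if "a \<in> arcs Q" for a
    unfolding ph_def using lin_opr[of "Inr a"] opr_S[of "Inr a"] that by auto
  show "ph a (ev (head Q a) x) = ph a x" "ev (tail Q a) (ph a x) = ph a x" if "a \<in> arcs Q" for a x
    unfolding ph_def using opr_ev[of "Inr a" x] ev_opr[of "Inr a" x] that by simp_all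
  fix x assume "x \<in> S"
  have "0 = ac (preprojective_relation Q) x" by (rule ac_J[OF rel_in_J, symmetric])
  also have "\<dots> = (\<Sum>a\<in>arcs Q. ac (arrow D (Inl a) \<otimes>\<^bsub>P\<^esub> arrow D (Inr a)) x - ac (arrow D (Inr a) \<otimes>\<^bsub>P\<^esub> arrow D (Inl a)) x)"
    by (rule additive_rel) (simp_all add: ac_add ac_scaled)
  also have "\<dots> = (\<Sum>a\<in>arcs Q. Ta a (ph a x) - ph a (Ta a x))"
    by (rule sum.cong) (auto simp: ac_mult arrow_closed Ta_def ph_def opr_def)
  finally show "(\<Sum>a\<in>arcs Q. Ta a (ph a x) - ph a (Ta a x)) = 0" ..
qed

text \<open>
  These operators generate the action, so that stable subspaces are submodules and commuting maps
  are homomorphisms.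
\<close>

abbreviation Ops :: "('w \<Rightarrow> 'w) set" where "Ops \<equiv> ev ` verts Q \<union> Ta ` arcs Q \<union> ph ` arcs Q"

lemma ev_Ops: "v \<in> verts Q \<Longrightarrow> ev v \<in> Ops" by blast

lemma opr_Ops: "b \<in> arcs D \<Longrightarrow> opr b \<in> Ops"
  by (cases b) (auto simp: Ta_def ph_def)

lemma walk_stable: "stable Ops U \<Longrightarrow> set p \<subseteq> arcs D \<Longrightarrow> x \<in> U \<Longrightarrow> walk p x \<in> U"
proof (induction p arbitrary: x)
  case (Cons b p)
  have "opr b x \<in> U" using Cons.prems opr_Ops[of b] unfolding stable_def by auto
  then show ?case using Cons by simp
qed simp

lemma ac_stable:
  assumes U: "subspace U" "stable Ops U" and f: "f \<in> carrier P" and x: "x \<in> U"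
  shows "ac f x \<in> U"
  unfolding ac_lf[OF f]
proof (rule lf_in_subspace[OF U(1)])
  fix z assume "z \<in> supp f"
  then have z: "z \<in> paths D" using f unfolding carrier_P by blast
  obtain u p w where e: "z = (u, p, w)" by (cases z)
  have "u \<in> verts Q" "set p \<subseteq> arcs D" using z e by (auto simp: paths_iff)
  moreover from this have "ev u x \<in> U" using U(2) x unfolding stable_def by blast
  ultimately show "ac (delta z) x \<in> U" using walk_stable[OF U(2)] ac_path z e by simp
qed

lemma ac_commuting:
  assumes U: "subspace U" "stable Ops U" and F: "commuting Ops U F" and f: "f \<in> carrier P" and x: "x \<in> U"
  shows "F (ac f x) = ac f (F x)"
proof -
  have lF: "lin F" using F unfolding commuting_def by blast
  have w: "F (walk p y) = walk p (F y)" if "set p \<subseteq> arcs D" "y \<in> U" for p y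
    using that
  proof (induction p arbitrary: y)
    case (Cons b p)
    have o: "opr b \<in> Ops" using Cons.prems opr_Ops by simp
    have "opr b y \<in> U" using o U(2) Cons.prems unfolding stable_def by blast
    then show ?case using Cons F o unfolding commuting_def by simp
  qed simp
  have "F (ac f x) = lf f (\<lambda>z. F (ac (delta z) x))" unfolding ac_lf[OF f] by (rule lin_lf[OF lF])
  also have "\<dots> = lf f (\<lambda>z. ac (delta z) (F x))"
  proof (rule lf_cong)
    fix z assume "z \<in> supp f"
    then have z: "z \<in> paths D" using f unfolding carrier_P by blast
    obtain u p q where e: "z = (u, p, q)" by (cases z)
    have u: "u \<in> verts Q" "set p \<subseteq> arcs D" using z e by (auto simp: paths_iff)
    have "ev u x \<in> U" "F (ev u x) = ev u (F x)"
      using U(2) F x ev_Ops[OF u(1)] unfolding stable_def commuting_def by blast+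
    then show "F (ac (delta z) x) = ac (delta z) (F x)" using w[OF u(2)] ac_path z e by simp
  qed
  finally show ?thesis using ac_lf[OF f] by simp
qed

subsection \<open>Derivations\<close>

context
  fixes \<psi> :: "'e \<Rightarrow> 'w \<Rightarrow> 'w"
  assumes \<psi>: "tang S ev Ta \<psi>"
begin

text \<open>
  The derivation \<open>der\<close> of the path algebra with values in the endomorphisms of
  \<open>S\<close> that vanishes on trivial paths and on the arrows of \<open>Q\<close> and sends
  the reversed arrows to \<open>\<psi>\<close>. On a path it is computed by the product rule,
  differentiating one arrow at a time.
\<close>

definition bump :: "'e + 'e \<Rightarrow> 'w \<Rightarrow> 'w" where
  "bump b = (case b of Inl a \<Rightarrow> (\<lambda>x. 0) | Inr a \<Rightarrow> \<psi> a)"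

primrec dwalk :: "('e + 'e) list \<Rightarrow> 'w \<Rightarrow> 'w" where
  "dwalk [] x = 0"
| "dwalk (b # p) x = dwalk p (opr b x) + walk p (bump b x)"

definition dpath :: "('v, 'e + 'e) path \<Rightarrow> 'w \<Rightarrow> 'w" where
  "dpath z x = dwalk (fst (snd z)) (ev (fst z) x)"

definition der :: "(('v, 'e + 'e) path \<Rightarrow> 'k) \<Rightarrow> 'w \<Rightarrow> 'w" where
  "der f x = lf f (\<lambda>z. dpath z x)"

lemma lin_bump: "b \<in> arcs D \<Longrightarrow> lin (bump b)"
  unfolding bump_def using tangD(1)[OF \<psi>] lin_zero by (cases b) auto

lemma bump_S: "b \<in> arcs D \<Longrightarrow> x \<in> S \<Longrightarrow> bump b x \<in> S"
  unfolding bump_def using tangD(2)[OF \<psi>] subspace_0[OF subspace_S] by (cases b) auto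

lemma bump_ev: "b \<in> arcs D \<Longrightarrow> x \<in> S \<Longrightarrow> bump b (ev (tail D b) x) = bump b x"
  unfolding bump_def using tangD(3)[OF \<psi>] by (cases b) auto

lemma ev_bump: "b \<in> arcs D \<Longrightarrow> x \<in> S \<Longrightarrow> ev (head D b) (bump b x) = bump b x"
  unfolding bump_def using tangD(4)[OF \<psi>] lin_0[OF lin_ev] by (cases b) (auto simp: hdV)

lemma lin_walk: "set p \<subseteq> arcs D \<Longrightarrow> lin (walk p)"
proof (induction p)
  case Nil
  have "walk [] = (\<lambda>x. x)" by (rule ext) simp
  then show ?case using lin_ident by simp
next
  case (Cons b p)
  have "walk (b # p) = (\<lambda>x. walk p (opr b x))" by (rule ext) simp
  then show ?case using lin_comp[OF Cons.IH lin_opr] Cons.prems by simp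
qed

lemma lin_dwalk: "set p \<subseteq> arcs D \<Longrightarrow> lin (dwalk p)"
proof (induction p)
  case Nil
  have "dwalk [] = (\<lambda>x. 0)" by (rule ext) simp
  then show ?case using lin_zero by simp
next
  case (Cons b p)
  have "dwalk (b # p) = (\<lambda>x. dwalk p (opr b x) + walk p (bump b x))" by (rule ext) simp
  then show ?case
    using lin_plus[OF lin_comp[OF Cons.IH lin_opr] lin_comp[OF lin_walk lin_bump]] Cons.prems by simp
qed

lemma walk_S: "set p \<subseteq> arcs D \<Longrightarrow> x \<in> S \<Longrightarrow> walk p x \<in> S"
  by (induction p arbitrary: x) (simp_all add: opr_S)

lemma dwalk_S: "set p \<subseteq> arcs D \<Longrightarrow> x \<in> S \<Longrightarrow> dwalk p x \<in> S"
  by (induction p arbitrary: x) (simp_all add: opr_S subspace_0[OF subspace_S] subspace_add[OF subspace_S] walk_S bump_S)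

lemma walk_append: "walk (p @ q) x = walk q (walk p x)"
  by (induction p arbitrary: x) simp_all

lemma dwalk_append:
  assumes "set q \<subseteq> arcs D"
  shows "dwalk (p @ q) x = dwalk q (walk p x) + walk q (dwalk p x)"
  by (induction p arbitrary: x)
    (simp_all add: walk_append lin_0[OF lin_walk[OF assms]] lin_add[OF lin_walk[OF assms]] add.assoc)

lemma walk_end:
  assumes "set p \<subseteq> arcs D" "pre_digraph.cas D u p w" "x \<in> S" "ev u x = x" "u \<in> verts Q"
  shows "ev w (walk p x) = walk p x" "ev w (dwalk p x) = dwalk p x"
  using assms
proof (induction p arbitrary: u x)
  case Nil
  { case 1 then show ?case by (simp add: pre_digraph.cas.simps) }
  { case 2 then show ?case using lin_0[OF lin_ev] by (auto simp: pre_digraph.cas.simps) }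
next
  case (Cons b p)
  have walks: "ev w (walk p y) = walk p y"
    if "set (b # p) \<subseteq> arcs D" "pre_digraph.cas D u (b # p) w" "y \<in> S" "ev (head D b) y = y" for u y
    using Cons.IH(1)[of "head D b" y] that head_verts[of b] by (simp add: pre_digraph.cas.simps del: D_simps(2-5)) 
  { case 1
    then show ?case using walks[of u "opr b x"] ev_opr[of b x] opr_S[of b x] by simp }
  { case 2
    have b: "b \<in> arcs D" using 2 by simp
    have wv: "w \<in> verts Q" using cas_verts[of u "b # p" w] 2 by simp
    have "ev w (dwalk p (opr b x)) = dwalk p (opr b x)"
      using Cons.IH(2)[of "head D b" "opr b x"] 2 head_verts[OF b] ev_opr[OF b] opr_S[OF b]
      by (simp add: pre_digraph.cas.simps)
    moreover have "ev w (walk p (bump b x)) = walk p (bump b x)"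
      using walks[of u "bump b x"] 2 bump_S[OF b] ev_bump[OF b] by simp
    ultimately show ?case using lin_add[OF lin_ev[OF wv]] by simp }
qed

lemma dpath_S: "z \<in> paths D \<Longrightarrow> dpath z x \<in> S"
  unfolding dpath_def by (cases z) (auto simp: paths_iff intro: dwalk_S ev_S)

lemma lin_dpath: "z \<in> paths D \<Longrightarrow> lin (dpath z)"
  unfolding dpath_def[abs_def] by (cases z) (auto simp: paths_iff intro: lin_comp[OF lin_dwalk lin_ev])

lemma dpath_cat:
  assumes x: "x \<in> paths D" and y: "y \<in> paths D" and s: "s \<in> S"
  shows "dpath x (ac (delta y) s) + ac (delta x) (dpath y s) = (if cmp x y then dpath (cat x y) s else 0)"
proof -
  obtain v q w where xe: "x = (v, q, w)" by (cases x)
  obtain u p v' where ye: "y = (u, p, v')" by (cases y)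
  have X: "v \<in> verts Q" "set q \<subseteq> arcs D" "pre_digraph.cas D v q w" using x xe by (auto simp: paths_iff)
  have Y: "u \<in> verts Q" "set p \<subseteq> arcs D" "pre_digraph.cas D u p v'" using y ye by (auto simp: paths_iff)
  have v': "v' \<in> verts Q" using cas_verts[of u p v'] Y by simp
  have uu: "ev u (ev u s) = ev u s" using ev_ev[OF Y(1) Y(1)] by simp
  have e1: "ev v' (walk p (ev u s)) = walk p (ev u s)" and e2: "ev v' (dwalk p (ev u s)) = dwalk p (ev u s)"
    using walk_end[OF Y(2,3) ev_S[OF Y(1)] uu Y(1)] by auto
  have lhs: "dpath x (ac (delta y) s) + ac (delta x) (dpath y s) =
    dwalk q (ev v (walk p (ev u s))) + walk q (ev v (dwalk p (ev u s)))"
    using ac_path x y xe ye unfolding dpath_def by simp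
  have z: "ev v t = (if v = v' then t else 0)" if "ev v' t = t" for t
    using ev_ev[OF X(1) v', of t] that by auto
  show ?thesis
  proof (cases "v = v'")
    case True
    then have "cmp x y" unfolding cmp_def xe ye by simp
    then show ?thesis unfolding lhs z[OF e1] z[OF e2] using True dwalk_append[OF X(2)]
      by (simp add: xe ye cat_def dpath_def)
  next
    case False
    then have "\<not> cmp x y" unfolding cmp_def xe ye by simp
    then show ?thesis unfolding lhs z[OF e1] z[OF e2] using False lin_0[OF lin_walk[OF X(2)]] lin_0[OF lin_dwalk[OF X(2)]] by simp
  qed
qed

lemma der_S: "f \<in> carrier P \<Longrightarrow> der f x \<in> S"
  unfolding der_def by (rule lf_in_subspace[OF subspace_S]) (auto simp: carrier_P intro: dpath_S)

lemma lin_der: "f \<in> carrier P \<Longrightarrow> lin (der f)"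
  unfolding der_def[abs_def] lf_def
  by (rule lin_setsum, rule lin_smult, rule lin_dpath) (auto simp: carrier_P)

lemma der_add: "f \<in> carrier P \<Longrightarrow> g \<in> carrier P \<Longrightarrow> der (\<lambda>z. f z + g z) x = der f x + der g x"
  unfolding der_def by (rule lf_add) (auto simp: carrier_P)

lemma der_scaled: "f \<in> carrier P \<Longrightarrow> der (\<lambda>z. c * f z) x = c *s der f x"
  unfolding der_def by (rule lf_scaled) (auto simp: carrier_P)

lemma der_one: "der \<one>\<^bsub>P\<^esub> x = 0"
proof -
  have "lf \<one>\<^bsub>P\<^esub> (\<lambda>z. dpath z x) = lf \<one>\<^bsub>P\<^esub> (\<lambda>z. 0)"
  proof (rule lf_cong)
    fix z assume "z \<in> supp (\<one>\<^bsub>P\<^esub> :: _ \<Rightarrow> 'k)"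
    then have "fst (snd z) = []" unfolding supp_def one_P by (cases z) (auto split: if_splits)
    then show "dpath z x = 0" unfolding dpath_def by simp
  qed
  then show ?thesis unfolding der_def by (simp add: lf_def)
qed

lemma der_mult:
  assumes f: "f \<in> carrier P" and g: "g \<in> carrier P" and s: "s \<in> S"
  shows "der (f \<otimes>\<^bsub>P\<^esub> g) s = der f (ac g s) + ac f (der g s)"
proof -
  have fq: "fin_quiver D" by unfold_locales
  have "der (f \<otimes>\<^bsub>P\<^esub> g) s = lf f (\<lambda>x. lf g (\<lambda>y. dpath x (ac (delta y) s) + ac (delta x) (dpath y s)))"
    unfolding der_def by (rule lf_mult[OF fq f g]) (rule dpath_cat[OF _ _ s])
  also have "\<dots> = lf f (\<lambda>x. dpath x (ac g s) + ac (delta x) (der g s))"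
  proof (rule lf_cong)
    fix x assume "x \<in> supp f"
    then have x: "x \<in> paths D" using f unfolding carrier_P by blast
    show "lf g (\<lambda>y. dpath x (ac (delta y) s) + ac (delta x) (dpath y s)) = dpath x (ac g s) + ac (delta x) (der g s)"
      unfolding lf_plus ac_lf[OF g] der_def lin_lf[OF lin_dpath[OF x]] lin_lf[OF lin_ac[OF delta_closed[OF x]]] ..
  qed
  also have "\<dots> = der f (ac g s) + ac f (der g s)"
    unfolding lf_plus der_def[symmetric] ac_lf[OF f, symmetric] ..
  finally show ?thesis .
qed

lemma der_ev: "v \<in> verts Q \<Longrightarrow> der (delta (v, [], v)) x = 0"
  unfolding der_def lf_delta dpath_def by simp

lemma der_arrow: "b \<in> arcs D \<Longrightarrow> x \<in> S \<Longrightarrow> der (arrow D b) x = bump b x"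
  unfolding der_def arrow_delta lf_delta dpath_def by (simp add: bump_ev)

lemma der_rel: assumes s: "s \<in> S" shows "der (preprojective_relation Q) s = 0"
proof -
  have "der (preprojective_relation Q) s =
    (\<Sum>a\<in>arcs Q. der (arrow D (Inl a) \<otimes>\<^bsub>P\<^esub> arrow D (Inr a)) s - der (arrow D (Inr a) \<otimes>\<^bsub>P\<^esub> arrow D (Inl a)) s)"
    by (rule additive_rel) (simp_all add: der_add der_scaled)
  also have "\<dots> = (\<Sum>a\<in>arcs Q. Ta a (\<psi> a s) - \<psi> a (Ta a s))"
  proof (rule sum.cong)
    fix a assume a: "a \<in> arcs Q"
    have b: "Inl a \<in> arcs D" "Inr a \<in> arcs D" using a by auto
    show "der (arrow D (Inl a) \<otimes>\<^bsub>P\<^esub> arrow D (Inr a)) s - der (arrow D (Inr a) \<otimes>\<^bsub>P\<^esub> arrow D (Inl a)) s = Ta a (\<psi> a s) - \<psi> a (Ta a s)"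
      using der_mult[OF arrow_closed[OF b(1)] arrow_closed[OF b(2)] s] der_mult[OF arrow_closed[OF b(2)] arrow_closed[OF b(1)] s]
        der_arrow[OF b(1)] der_arrow[OF b(2)] ac_S[OF arrow_closed[OF b(1)]] ac_S[OF arrow_closed[OF b(2)]] s
        lin_0[OF lin_ac[OF arrow_closed[OF b(2)]]]
      by (simp add: bump_def Ta_def opr_def)
  qed simp
  also have "\<dots> = 0" by (rule tang_sum[OF \<psi> s])
  finally show ?thesis .
qed

text \<open>
  The derivation vanishes on the relation, since this is what \<open>tang\<close> says about
  \<open>\<psi>\<close>. As the ideal acts as zero, the elements of \<open>J\<close> with zero
  derivative form an ideal, which therefore is all of \<open>J\<close>.
\<close>

lemma der_J: assumes f: "f \<in> J" and s: "s \<in> S" shows "der f s = 0"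
proof -
  define K where "K = {f \<in> J. \<forall>s\<in>S. der f s = 0}"
  have Jc: "f \<in> carrier P" if "f \<in> J" for f using that I.a_subset by blast
  have "ideal K P"
  proof (rule idealI[OF P.ring_axioms])
    have sg: "subgroup J (add_monoid P)" by (rule I.a_subgroup)
    show "subgroup K (add_monoid P)"
    proof
      show "K \<subseteq> carrier (add_monoid P)" unfolding K_def using Jc by auto
      show "\<one>\<^bsub>add_monoid P\<^esub> \<in> K" unfolding K_def using I.zero_closed by (simp add: zero_P der_def lf_zero)
      show "x \<otimes>\<^bsub>add_monoid P\<^esub> y \<in> K" if "x \<in> K" "y \<in> K" for x y
        using that I.a_closed[of x y] Jc der_add[of x y] unfolding K_def by (auto simp: add_P)
      show "inv\<^bsub>add_monoid P\<^esub> x \<in> K" if x: "x \<in> K" for x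
      proof -
        have xJ: "x \<in> J" "x \<in> carrier P" using x Jc unfolding K_def by auto
        have "inv\<^bsub>add_monoid P\<^esub> x \<in> J" using subgroup.m_inv_closed[OF sg xJ(1)] .
        moreover have "inv\<^bsub>add_monoid P\<^esub> x = (\<lambda>z. (- 1) * x z)"
        proof -
          have "\<ominus>\<^bsub>P\<^esub> x = (\<lambda>z. (- 1) * x z)"
            by (rule P.minus_equality[OF _ xJ(2) scaled_closed[OF xJ(2)]]) (simp add: add_P zero_P)
          then show ?thesis unfolding a_inv_def .
        qed
        ultimately show ?thesis using x der_scaled[OF xJ(2), of "- 1"] unfolding K_def by simp
      qed
    qed
    fix a x :: "('v, 'e + 'e) path \<Rightarrow> 'k" assume "a \<in> K" and x: "x \<in> carrier P"
    then have a: "a \<in> J" "a \<in> carrier P" "\<And>s. s \<in> S \<Longrightarrow> der a s = 0" using Jc unfolding K_def by auto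
    show "x \<otimes>\<^bsub>P\<^esub> a \<in> K"
      unfolding K_def using I.I_l_closed[OF a(1) x] der_mult[OF x a(2)] a(3) ac_J[OF a(1)]
      by (simp add: lin_0[OF lin_der[OF x]] lin_0[OF lin_ac[OF x]])
    show "a \<otimes>\<^bsub>P\<^esub> x \<in> K"
      unfolding K_def using I.I_r_closed[OF a(1) x] der_mult[OF a(2) x] a(3) ac_S[OF x] ac_J[OF a(1)] by simp
  qed
  moreover have "preprojective_relation Q \<in> K" unfolding K_def using rel_in_J der_rel by simp
  ultimately have "J \<subseteq> K" by (rule J_minimal)
  then show ?thesis using f s unfolding K_def by blast
qed

end

end

section \<open>Vanishing self-extensions give rigidity\<close>

context coord_module begin

context
  fixes \<psi> :: "'e \<Rightarrow> 'w \<Rightarrow> 'w"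
  assumes \<psi>: "tang S ev Ta \<psi>"
begin

text \<open>
  The derivation descends to the preprojective algebra: by \<open>der_J\<close> the choice of the
  representative is immaterial.
\<close>

definition dr :: "(('v, 'e + 'e) path \<Rightarrow> 'k) set \<Rightarrow> 'm \<Rightarrow> 'm" where
  "dr r y = lam (der \<psi> (SOME f. f \<in> carrier P \<and> r = cls f) (kap y))"

lemma dr_cls: assumes f: "f \<in> carrier P" and y: "y \<in> carrier M" shows "dr (cls f) y = lam (der \<psi> f (kap y))"
proof -
  define g :: "('v, 'e + 'e) path \<Rightarrow> 'k" where "g = (SOME g. g \<in> carrier P \<and> cls f = cls g)"
  have "g \<in> carrier P \<and> cls f = cls g" unfolding g_def by (rule someI[of _ f]) (simp add: f)
  then have g: "g \<in> carrier P" "cls f = cls g" by auto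
  have "f \<ominus>\<^bsub>P\<^esub> g \<in> J" by (rule cls_eqD[OF f g])
  then have "der \<psi> (f \<ominus>\<^bsub>P\<^esub> g) (kap y) = 0" using der_J[OF \<psi>] kap_S[OF y] by blast
  moreover have "f \<ominus>\<^bsub>P\<^esub> g = (\<lambda>z. f z + (- 1) * g z)" unfolding minus_P[OF f g(1)] by simp
  ultimately have "der \<psi> f (kap y) - der \<psi> g (kap y) = 0"
    using der_add[OF \<psi> f scaled_closed[OF g(1), of "- 1"]] der_scaled[OF \<psi> g(1), of "- 1"] by simp
  then show ?thesis unfolding dr_def g_def[symmetric] by simp
qed

lemma dr_closed: "dr r y \<in> carrier M"
  unfolding dr_def by (rule lam_closed)

text \<open>
  The self-extension of \<open>M\<close> in which \<open>r\<close> acts by the upper triangular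
  matrix with \<open>r\<close> on the diagonal and \<open>dr r\<close> above it.
\<close>

definition middle :: "((('v, 'e + 'e) path \<Rightarrow> 'k) set, 'm \<times> 'm) module" where
  "middle = \<lparr>carrier = carrier M \<times> carrier M,
     monoid.mult = (\<lambda>_ _. (\<zero>\<^bsub>M\<^esub>, \<zero>\<^bsub>M\<^esub>)), one = (\<zero>\<^bsub>M\<^esub>, \<zero>\<^bsub>M\<^esub>),
     zero = (\<zero>\<^bsub>M\<^esub>, \<zero>\<^bsub>M\<^esub>),
     add = (\<lambda>(x, y) (x', y'). (x \<oplus>\<^bsub>M\<^esub> x', y \<oplus>\<^bsub>M\<^esub> y')),
     module.smult = (\<lambda>r (x, y). (r \<odot>\<^bsub>M\<^esub> x \<oplus>\<^bsub>M\<^esub> dr r y, r \<odot>\<^bsub>M\<^esub> y))\<rparr>"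

lemma middle_simps [simp]:
  "carrier middle = carrier M \<times> carrier M" "\<zero>\<^bsub>middle\<^esub> = (\<zero>\<^bsub>M\<^esub>, \<zero>\<^bsub>M\<^esub>)"
  "(x, y) \<oplus>\<^bsub>middle\<^esub> (x', y') = (x \<oplus>\<^bsub>M\<^esub> x', y \<oplus>\<^bsub>M\<^esub> y')"
  "r \<odot>\<^bsub>middle\<^esub> (x, y) = (r \<odot>\<^bsub>M\<^esub> x \<oplus>\<^bsub>M\<^esub> dr r y, r \<odot>\<^bsub>M\<^esub> y)"
  unfolding middle_def by simp_all

lemma dr_plus:
  assumes r: "r \<in> carrier R" and y: "y \<in> carrier M" "y' \<in> carrier M"
  shows "dr r (y \<oplus>\<^bsub>M\<^esub> y') = dr r y \<oplus>\<^bsub>M\<^esub> dr r y'"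
proof -
  obtain f where f: "f \<in> carrier P" "r = cls f" using cls_surj[OF r] .
  show ?thesis unfolding f(2) using y f(1)
    by (simp add: dr_cls kap_add lin_add[OF lin_der[OF \<psi> f(1)]] lam_add)
qed

lemma dr_add:
  assumes r: "r \<in> carrier R" "s \<in> carrier R" and y: "y \<in> carrier M"
  shows "dr (r \<oplus>\<^bsub>R\<^esub> s) y = dr r y \<oplus>\<^bsub>M\<^esub> dr s y"
proof -
  obtain f where f: "f \<in> carrier P" "r = cls f" using cls_surj[OF r(1)] .
  obtain g where g: "g \<in> carrier P" "s = cls g" using cls_surj[OF r(2)] .
  have "dr (r \<oplus>\<^bsub>R\<^esub> s) y = lam (der \<psi> (f \<oplus>\<^bsub>P\<^esub> g) (kap y))"
    unfolding f(2) g(2) cls_hom(2)[OF f(1) g(1), symmetric] by (rule dr_cls[OF add_closed[OF f(1) g(1)] y])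
  then show ?thesis
    unfolding add_P der_add[OF \<psi> f(1) g(1)] lam_add f(2) g(2) dr_cls[OF f(1) y] dr_cls[OF g(1) y] .
qed

lemma dr_mult:
  assumes r: "r \<in> carrier R" "s \<in> carrier R" and y: "y \<in> carrier M"
  shows "dr (r \<otimes>\<^bsub>R\<^esub> s) y = r \<odot>\<^bsub>M\<^esub> dr s y \<oplus>\<^bsub>M\<^esub> dr r (s \<odot>\<^bsub>M\<^esub> y)"
proof -
  obtain f where f: "f \<in> carrier P" "r = cls f" using cls_surj[OF r(1)] .
  obtain g where g: "g \<in> carrier P" "s = cls g" using cls_surj[OF r(2)] .
  have sy: "s \<odot>\<^bsub>M\<^esub> y = act g y" unfolding act_def g(2) ..
  have "dr (r \<otimes>\<^bsub>R\<^esub> s) y = lam (der \<psi> (f \<otimes>\<^bsub>P\<^esub> g) (kap y))"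
    unfolding f(2) g(2) cls_hom(3)[OF f(1) g(1), symmetric] by (rule dr_cls[OF mult_closed[OF f(1) g(1)] y])
  also have "\<dots> = lam (der \<psi> f (ac g (kap y))) \<oplus>\<^bsub>M\<^esub> lam (ac f (der \<psi> g (kap y)))"
    unfolding der_mult[OF \<psi> f(1) g(1) kap_S[OF y]] lam_add ..
  also have "lam (der \<psi> f (ac g (kap y))) = dr r (s \<odot>\<^bsub>M\<^esub> y)"
    unfolding f(2) sy dr_cls[OF f(1) act_ok[OF g(1) y]] ac_def lam_kap[OF y] ..
  also have "lam (ac f (der \<psi> g (kap y))) = r \<odot>\<^bsub>M\<^esub> dr s y"
    unfolding lam_ac[OF f(1)] g(2) dr_cls[OF g(1) y] f(2) act_def ..
  finally show ?thesis
    using L.M.a_comm[OF dr_closed L.smult_closed[OF r(1) dr_closed]] by simp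
qed

lemma dr_one: "y \<in> carrier M \<Longrightarrow> dr \<one>\<^bsub>R\<^esub> y = \<zero>\<^bsub>M\<^esub>"
  using dr_cls[OF one_closed, of y] cls_hom(4)[OF one_closed one_closed] der_one[OF \<psi>] lam_0 by simp

lemma left_module_middle: "left_module R middle"
proof (intro left_module.intro left_module_axioms.intro)
  show "ring R" by (rule L.R.ring_axioms)
  show "abelian_group middle"
  proof (rule abelian_groupI)
    fix x assume "x \<in> carrier middle"
    then obtain a b where x: "x = (a, b)" "a \<in> carrier M" "b \<in> carrier M" by auto
    show "\<exists>y\<in>carrier middle. y \<oplus>\<^bsub>middle\<^esub> x = \<zero>\<^bsub>middle\<^esub>"
      using x by (intro bexI[of _ "(\<ominus>\<^bsub>M\<^esub> a, \<ominus>\<^bsub>M\<^esub> b)"]) (auto simp: L.M.l_neg)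
  qed (auto simp: L.M.a_ac)
next
  fix a x assume a: "a \<in> carrier R" and x: "x \<in> carrier middle"
  then show "a \<odot>\<^bsub>middle\<^esub> x \<in> carrier middle" by (auto simp: L.smult_closed dr_closed)
next
  fix a b x assume a: "a \<in> carrier R" "b \<in> carrier R" and x: "x \<in> carrier middle"
  then show "(a \<oplus>\<^bsub>R\<^esub> b) \<odot>\<^bsub>middle\<^esub> x = a \<odot>\<^bsub>middle\<^esub> x \<oplus>\<^bsub>middle\<^esub> b \<odot>\<^bsub>middle\<^esub> x"
    by (auto simp: L.smult_closed dr_closed dr_add L.smult_l_distr L.M.a_ac)
next
  fix a x y assume a: "a \<in> carrier R" and x: "x \<in> carrier middle" "y \<in> carrier middle"
  then show "a \<odot>\<^bsub>middle\<^esub> (x \<oplus>\<^bsub>middle\<^esub> y) = a \<odot>\<^bsub>middle\<^esub> x \<oplus>\<^bsub>middle\<^esub> a \<odot>\<^bsub>middle\<^esub> y"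
    by (auto simp: L.smult_closed dr_closed dr_plus L.smult_r_distr L.M.a_ac)
next
  fix a b x assume a: "a \<in> carrier R" "b \<in> carrier R" and x: "x \<in> carrier middle"
  then show "(a \<otimes>\<^bsub>R\<^esub> b) \<odot>\<^bsub>middle\<^esub> x = a \<odot>\<^bsub>middle\<^esub> (b \<odot>\<^bsub>middle\<^esub> x)"
    by (auto simp: L.smult_closed dr_closed dr_mult L.smult_r_distr L.smult_assoc L.M.a_ac)
next
  fix x assume "x \<in> carrier middle"
  then show "\<one>\<^bsub>R\<^esub> \<odot>\<^bsub>middle\<^esub> x = x" by (auto simp: dr_one L.smult_one)
qed

lemma dr_zero_right: "r \<in> carrier R \<Longrightarrow> dr r \<zero>\<^bsub>M\<^esub> = \<zero>\<^bsub>M\<^esub>"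
  using dr_plus[of r "\<zero>\<^bsub>M\<^esub>" "\<zero>\<^bsub>M\<^esub>"] dr_closed by (metis L.M.add.r_cancel_one' L.M.l_zero L.M.zero_closed)

lemma middle_extension: "(middle, \<lambda>x. (x, \<zero>\<^bsub>M\<^esub>), snd) \<in> extensions R M M"
proof -
  have "(\<lambda>x. (x, \<zero>\<^bsub>M\<^esub>)) \<in> module_homs R M middle"
    unfolding module_homs_def by (auto simp: dr_zero_right smult_zero_right L.smult_closed)
  moreover have "snd \<in> module_homs R middle M"
    unfolding module_homs_def by auto
  ultimately show ?thesis
    unfolding extensions_def using left_module_middle by (auto simp: inj_on_def image_iff intro: bexI[of _ "(\<zero>\<^bsub>M\<^esub>, _)"])
qed

text \<open>
  The second component of a section of the extension is the identity, and its first component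
  \<open>G\<close> measures the failure of \<open>dr\<close> to vanish: it makes \<open>dr\<close>
  an inner derivation.
\<close>

lemma middle_splitting:
  assumes "Ext1 R M M = {Ext1_zero R M M}"
  obtains G where "\<And>y. y \<in> carrier M \<Longrightarrow> G y \<in> carrier M"
    "\<And>y y'. y \<in> carrier M \<Longrightarrow> y' \<in> carrier M \<Longrightarrow> G (y \<oplus>\<^bsub>M\<^esub> y') = G y \<oplus>\<^bsub>M\<^esub> G y'"
    "\<And>r y. r \<in> carrier R \<Longrightarrow> y \<in> carrier M \<Longrightarrow> G (r \<odot>\<^bsub>M\<^esub> y) = r \<odot>\<^bsub>M\<^esub> G y \<oplus>\<^bsub>M\<^esub> dr r y"
proof -
  let ?E = "(middle, \<lambda>x. (x, \<zero>\<^bsub>M\<^esub>), snd :: 'm \<times> 'm \<Rightarrow> 'm)"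
  have "extension_equiv R M M `` {?E} \<in> Ext1 R M M"
    unfolding Ext1_def by (rule quotientI[OF middle_extension])
  then have "extension_equiv R M M `` {?E} = extension_equiv R M M `` {split_extension M M}"
    using assms unfolding Ext1_zero_def by simp
  moreover have "(?E, ?E) \<in> extension_equiv R M M"
    unfolding extension_equiv_def using middle_extension by (auto simp: module_homs_def intro!: bexI[of _ "\<lambda>x. x"] L.smult_closed dr_closed)
  ultimately have "(split_extension M M, ?E) \<in> extension_equiv R M M" by blast
  then obtain \<Phi> where \<Phi>: "\<Phi> \<in> module_homs R (direct_sum M M) middle" "\<And>y. y \<in> carrier (direct_sum M M) \<Longrightarrow> snd (\<Phi> y) = snd y"
    unfolding extension_equiv_def split_extension_def by auto
  have add: "\<Phi> (x \<oplus>\<^bsub>direct_sum M M\<^esub> y) = \<Phi> x \<oplus>\<^bsub>middle\<^esub> \<Phi> y" if "x \<in> carrier M \<times> carrier M" "y \<in> carrier M \<times> carrier M" for x y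
    using \<Phi>(1) that unfolding module_homs_def direct_sum_def by auto
  have sm: "\<Phi> (r \<odot>\<^bsub>direct_sum M M\<^esub> x) = r \<odot>\<^bsub>middle\<^esub> \<Phi> x" if "r \<in> carrier R" "x \<in> carrier M \<times> carrier M" for r x
    using \<Phi>(1) that unfolding module_homs_def direct_sum_def by auto
  define G where "G y = fst (\<Phi> (\<zero>\<^bsub>M\<^esub>, y))" for y
  have \<Phi>G: "\<Phi> (\<zero>\<^bsub>M\<^esub>, y) = (G y, y)" "G y \<in> carrier M" if y: "y \<in> carrier M" for y
  proof -
    have "\<Phi> (\<zero>\<^bsub>M\<^esub>, y) \<in> carrier M \<times> carrier M" using \<Phi>(1) y unfolding module_homs_def direct_sum_def by auto
    then show "G y \<in> carrier M" unfolding G_def by auto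
    show "\<Phi> (\<zero>\<^bsub>M\<^esub>, y) = (G y, y)" unfolding G_def using \<Phi>(2)[of "(\<zero>\<^bsub>M\<^esub>, y)"] y
      by (auto simp: direct_sum_def prod_eq_iff)
  qed
  show thesis
  proof (rule that[OF \<Phi>G(2)])
    show "G (y \<oplus>\<^bsub>M\<^esub> y') = G y \<oplus>\<^bsub>M\<^esub> G y'" if y: "y \<in> carrier M" "y' \<in> carrier M" for y y'
      using add[of "(\<zero>\<^bsub>M\<^esub>, y)" "(\<zero>\<^bsub>M\<^esub>, y')"] y \<Phi>G(1) by (simp add: direct_sum_def)
    show "G (r \<odot>\<^bsub>M\<^esub> y) = r \<odot>\<^bsub>M\<^esub> G y \<oplus>\<^bsub>M\<^esub> dr r y" if r: "r \<in> carrier R" and y: "y \<in> carrier M" for r y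
      using sm[OF r, of "(\<zero>\<^bsub>M\<^esub>, y)"] y \<Phi>G(1) L.smult_closed[OF r y] by (simp add: direct_sum_def smult_zero_right[OF r])
  qed
qed

end

text \<open>
  In coordinates, the splitting says that \<open>der \<psi> f = g f - f g\<close> for all
  \<open>f\<close>. On trivial paths and on the arrows of \<open>Q\<close> this means that
  \<open>g\<close> is an endomorphism of the representation of \<open>Q\<close>; on the reversed
  arrows it exhibits \<open>\<psi>\<close> as the tangent vector induced by \<open>- g\<close>.
\<close>

lemma rigid_S:
  assumes "Ext1 R M M = {Ext1_zero R M M}"
  shows "rigid S ev Ta ph"
  unfolding rigid_def
proof (intro allI impI)
  fix \<psi> assume \<psi>: "tang S ev Ta \<psi>"
  obtain G where G: "\<And>y. y \<in> carrier M \<Longrightarrow> G y \<in> carrier M"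
    "\<And>y y'. y \<in> carrier M \<Longrightarrow> y' \<in> carrier M \<Longrightarrow> G (y \<oplus>\<^bsub>M\<^esub> y') = G y \<oplus>\<^bsub>M\<^esub> G y'"
    "\<And>r y. r \<in> carrier R \<Longrightarrow> y \<in> carrier M \<Longrightarrow> G (r \<odot>\<^bsub>M\<^esub> y) = r \<odot>\<^bsub>M\<^esub> G y \<oplus>\<^bsub>M\<^esub> dr \<psi> r y"
    using middle_splitting[OF \<psi> assms] by metis
  have Gact: "G (act f y) = act f (G y) \<oplus>\<^bsub>M\<^esub> lam (der \<psi> f (kap y))" if f: "f \<in> carrier P" and y: "y \<in> carrier M" for f y
    using G(3)[OF cls_hom(1)[OF f f] y] dr_cls[OF \<psi> f y] unfolding act_def by simp
  have Gsc: "G (sc c y) = sc c (G y)" if y: "y \<in> carrier M" for c y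
  proof -
    have "der \<psi> (\<lambda>z. c * \<one>\<^bsub>P\<^esub> z) (kap y) = 0"
      using der_scaled[OF \<psi> one_closed] der_one[OF \<psi>] by simp
    then show ?thesis
      using Gact[OF scaled_closed[OF one_closed] y] G(1)[OF y] lam_0 act_ok[OF scaled_closed[OF one_closed] G(1)[OF y]]
      unfolding sc_def by simp
  qed
  define g where "g x = kap (G (lam x))" for x
  have gl: "lin g" unfolding g_def[abs_def] by (rule lin_conj[OF G(1,2) Gsc])
  have gS: "g x \<in> S" for x unfolding g_def by (intro kap_S G(1) lam_closed)
  have gac: "g (ac f x) = ac f (g x) + der \<psi> f x" if f: "f \<in> carrier P" and x: "x \<in> S" for f x
  proof -
    have "g (ac f x) = kap (act f (G (lam x)) \<oplus>\<^bsub>M\<^esub> lam (der \<psi> f (kap (lam x))))"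
      unfolding g_def lam_ac[OF f] Gact[OF f lam_closed] ..
    also have "\<dots> = kap (act f (G (lam x))) + kap (lam (der \<psi> f x))"
      unfolding kap_lam[OF x] by (rule kap_add[OF act_ok[OF f G(1)[OF lam_closed]] lam_closed])
    also have "kap (lam (der \<psi> f x)) = der \<psi> f x" by (rule kap_lam[OF der_S[OF \<psi> f]])
    also have "kap (act f (G (lam x))) = ac f (g x)"
      unfolding ac_def g_def lam_kap[OF G(1)[OF lam_closed]] ..
    finally show ?thesis .
  qed
  define g' where "g' x = (- 1) *s g x" for x
  have g'l: "lin g'" unfolding g'_def[abs_def] by (rule lin_smult[OF gl])
  have dbr: "der \<psi> (arrow D b) x = bump \<psi> b x" if "b \<in> arcs D" "x \<in> S" for b x
    by (rule der_arrow[OF \<psi> that])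
  have "g' \<in> qend S ev Ta"
    unfolding qend_def
  proof (intro CollectI conjI ballI g'l)
    show "g' ` S \<subseteq> S" unfolding g'_def using gS subspace_scale[OF subspace_S] by blast
    show "g' (ev v x) = ev v (g' x)" if v: "v \<in> verts Q" and x: "x \<in> S" for v x
    proof -
      have "g (ev v x) = ev v (g x)"
        unfolding ev_def using gac[OF delta_closed[OF trivial_path] x] der_ev[OF \<psi> v] v by simp
      then show ?thesis unfolding g'_def by (simp add: pair.linear_neg[OF lin_ev[OF v]])
    qed
    show "g' (Ta a x) = Ta a (g' x)" if a: "a \<in> arcs Q" and x: "x \<in> S" for a x
    proof -
      have b: "Inl a \<in> arcs D" using a by simp
      have "g (opr (Inl a) x) = opr (Inl a) (g x)"
        unfolding opr_def using gac[OF arrow_closed[OF b] x] dbr[OF b x] by (simp add: bump_def[OF \<psi>])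
      then show ?thesis unfolding g'_def Ta_def by (simp add: pair.linear_neg[OF lin_opr[OF b]])
    qed
  qed
  moreover have "\<psi> a x = ph a (g' x) - g' (ph a x)" if a: "a \<in> arcs Q" and x: "x \<in> S" for a x
  proof -
    have b: "Inr a \<in> arcs D" using a by simp
    have "g (opr (Inr a) x) = opr (Inr a) (g x) + \<psi> a x"
      unfolding opr_def using gac[OF arrow_closed[OF b] x] dbr[OF b x] by (simp add: bump_def[OF \<psi>])
    then show ?thesis unfolding g'_def ph_def by (simp add: pair.linear_neg[OF lin_opr[OF b]])
  qed
  ultimately show "\<exists>g\<in>qend S ev Ta. \<forall>a\<in>arcs Q. \<forall>x\<in>S. \<psi> a x = ph a (g x) - g (ph a x)" by blast
qed

end

section \<open>Indecomposable summands\<close>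

context preproj_module begin

text \<open>
  Submodules, described without negation: additive inverses come from the action of the field.
\<close>

definition smod :: "'m set \<Rightarrow> bool" where
  "smod H \<longleftrightarrow> H \<subseteq> carrier M \<and> \<zero>\<^bsub>M\<^esub> \<in> H \<and> (\<forall>x\<in>H. \<forall>y\<in>H. x \<oplus>\<^bsub>M\<^esub> y \<in> H) \<and>
     (\<forall>r\<in>carrier R. \<forall>x\<in>H. r \<odot>\<^bsub>M\<^esub> x \<in> H)"

lemma smodD:
  assumes "smod H"
  shows "H \<subseteq> carrier M" "\<zero>\<^bsub>M\<^esub> \<in> H" "x \<in> H \<Longrightarrow> y \<in> H \<Longrightarrow> x \<oplus>\<^bsub>M\<^esub> y \<in> H"
    "r \<in> carrier R \<Longrightarrow> x \<in> H \<Longrightarrow> r \<odot>\<^bsub>M\<^esub> x \<in> H"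
  using assms unfolding smod_def by auto

lemma smod_carrier: "smod (carrier M)"
  unfolding smod_def by (auto simp: L.smult_closed)

lemma smod_act: "smod H \<Longrightarrow> f \<in> carrier P \<Longrightarrow> x \<in> H \<Longrightarrow> act f x \<in> H"
  unfolding act_def using smodD(4) cls_hom(1) by blast

lemma smod_sc: "smod H \<Longrightarrow> x \<in> H \<Longrightarrow> sc c x \<in> H"
  unfolding sc_def by (rule smod_act[OF _ scaled_closed[OF one_closed]])

lemma sc_neg: "x \<in> carrier M \<Longrightarrow> sc (- 1) x \<oplus>\<^bsub>M\<^esub> x = \<zero>\<^bsub>M\<^esub>"
  using sc_add[of x "- 1" 1] by (simp add: sc_one sc_zero)

lemma abelian_group_smod: assumes U: "smod U" shows "abelian_group (M\<lparr>carrier := U\<rparr>)"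
proof (rule abelian_groupI)
  note s = subsetD[OF smodD(1)[OF U]]
  show "\<exists>y\<in>carrier (M\<lparr>carrier := U\<rparr>). y \<oplus>\<^bsub>M\<lparr>carrier := U\<rparr>\<^esub> x = \<zero>\<^bsub>M\<lparr>carrier := U\<rparr>\<^esub>"
    if "x \<in> carrier (M\<lparr>carrier := U\<rparr>)" for x
    using that smod_sc[OF U, of x "- 1"] sc_neg[OF s, of x] by auto
qed (use smodD[OF U] in \<open>auto simp: L.M.a_ac subset_iff\<close>)

lemma submodule_iff:
  assumes U: "smod U"
  shows "submodule H R (M\<lparr>carrier := U\<rparr>) \<longleftrightarrow> smod H \<and> H \<subseteq> U"
proof
  assume "submodule H R (M\<lparr>carrier := U\<rparr>)"
  then have s: "subgroup H (add_monoid (M\<lparr>carrier := U\<rparr>))" and sm: "submodule_axioms H R (M\<lparr>carrier := U\<rparr>)"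
    unfolding submodule_def by blast+
  have HU: "H \<subseteq> U" using subgroup.subset[OF s] by simp
  moreover have "smod H"
    unfolding smod_def
  proof (intro conjI ballI)
    show "H \<subseteq> carrier M" using HU smodD(1)[OF U] by blast
    show "\<zero>\<^bsub>M\<^esub> \<in> H" using subgroup.one_closed[OF s] by simp
    show "x \<oplus>\<^bsub>M\<^esub> y \<in> H" if "x \<in> H" "y \<in> H" for x y using subgroup.m_closed[OF s that] by simp
    show "r \<odot>\<^bsub>M\<^esub> x \<in> H" if "r \<in> carrier R" "x \<in> H" for r x using sm that unfolding submodule_axioms_def by simp
  qed
  ultimately show "smod H \<and> H \<subseteq> U" by blast
next
  assume H: "smod H \<and> H \<subseteq> U"
  interpret U: abelian_group "M\<lparr>carrier := U\<rparr>" by (rule abelian_group_smod[OF U])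
  show "submodule H R (M\<lparr>carrier := U\<rparr>)"
  proof (intro submodule.intro submodule_axioms.intro)
    show "subgroup H (add_monoid (M\<lparr>carrier := U\<rparr>))"
    proof
      show "inv\<^bsub>add_monoid (M\<lparr>carrier := U\<rparr>)\<^esub> x \<in> H" if x: "x \<in> H" for x
      proof -
        have xc: "x \<in> U" "x \<in> carrier M" "sc (- 1) x \<in> H" using x H smodD(1)[of H] smod_sc[of H x] by auto
        have "\<ominus>\<^bsub>M\<lparr>carrier := U\<rparr>\<^esub> x = sc (- 1) x"
          by (rule U.minus_equality) (use xc H sc_neg in auto)
        then show ?thesis using xc(3) unfolding a_inv_def by simp
      qed
    qed (use H smodD[of H] in auto)
    show "a \<odot>\<^bsub>M\<lparr>carrier := U\<rparr>\<^esub> x \<in> H" if "a \<in> carrier R" "x \<in> H" for a x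
      using smodD(4)[of H] H that by simp
  qed
qed

lemma complementary_iff:
  assumes U: "smod U"
  shows "complementary R (M\<lparr>carrier := U\<rparr>) X Y \<longleftrightarrow>
    smod X \<and> smod Y \<and> X \<inter> Y = {\<zero>\<^bsub>M\<^esub>} \<and> {x \<oplus>\<^bsub>M\<^esub> y | x y. x \<in> X \<and> y \<in> Y} = U"
proof -
  have sum: "X <+>\<^bsub>M\<lparr>carrier := U\<rparr>\<^esub> Y = {x \<oplus>\<^bsub>M\<^esub> y | x y. x \<in> X \<and> y \<in> Y}"
    unfolding set_add_def set_mult_def by auto
  have "X \<subseteq> U \<and> Y \<subseteq> U" if XY: "smod X" "smod Y" "{x \<oplus>\<^bsub>M\<^esub> y | x y. x \<in> X \<and> y \<in> Y} = U"
  proof -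
    have "x \<in> U" if "x \<in> X" for x
    proof -
      have "x \<oplus>\<^bsub>M\<^esub> \<zero>\<^bsub>M\<^esub> \<in> U" using XY that smodD(2)[OF XY(2)] by blast
      then show ?thesis using that smodD(1)[OF XY(1)] by auto
    qed
    moreover have "y \<in> U" if "y \<in> Y" for y
    proof -
      have "\<zero>\<^bsub>M\<^esub> \<oplus>\<^bsub>M\<^esub> y \<in> U" using XY that smodD(2)[OF XY(1)] by blast
      then show ?thesis using that smodD(1)[OF XY(2)] by auto
    qed
    ultimately show ?thesis by blast
  qed
  then show ?thesis
    unfolding complementary_def submodule_iff[OF U] sum by auto
qed

lemma complementary_carrier:
  "complementary R M X Y \<longleftrightarrow>
    smod X \<and> smod Y \<and> X \<inter> Y = {\<zero>\<^bsub>M\<^esub>} \<and> {x \<oplus>\<^bsub>M\<^esub> y | x y. x \<in> X \<and> y \<in> Y} = carrier M"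
  using complementary_iff[OF smod_carrier, of X Y] by simp

lemma summand_smod: "U \<in> indecomposable_summands R M \<Longrightarrow> smod U"
  unfolding indecomposable_summands_def complementary_carrier by blast

abbreviation miso :: "'m set \<Rightarrow> 'm set \<Rightarrow> bool" where
  "miso U V \<equiv> module_iso R (M\<lparr>carrier := U\<rparr>) (M\<lparr>carrier := V\<rparr>)"

lemma miso_iff: "miso U V \<longleftrightarrow> (\<exists>f. bij_betw f U V \<and>
    (\<forall>x\<in>U. \<forall>y\<in>U. f (x \<oplus>\<^bsub>M\<^esub> y) = f x \<oplus>\<^bsub>M\<^esub> f y) \<and> (\<forall>r\<in>carrier R. \<forall>x\<in>U. f (r \<odot>\<^bsub>M\<^esub> x) = r \<odot>\<^bsub>M\<^esub> f x))"
  unfolding module_iso_def module_homs_def by (auto simp: bij_betw_def)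

lemma miso_refl: "miso U U"
  unfolding miso_iff by (rule exI[of _ "\<lambda>x. x"]) (auto simp: bij_betw_def)

lemma miso_sym: assumes U: "smod U" and f: "miso U V" shows "miso V U"
proof -
  obtain f where b: "bij_betw f U V" and f: "\<And>x y. x \<in> U \<Longrightarrow> y \<in> U \<Longrightarrow> f (x \<oplus>\<^bsub>M\<^esub> y) = f x \<oplus>\<^bsub>M\<^esub> f y"
    "\<And>r x. r \<in> carrier R \<Longrightarrow> x \<in> U \<Longrightarrow> f (r \<odot>\<^bsub>M\<^esub> x) = r \<odot>\<^bsub>M\<^esub> f x"
    using f unfolding miso_iff by blast
  let ?g = "the_inv_into U f"
  have inj: "inj_on f U" using b unfolding bij_betw_def by blast
  have g: "?g y \<in> U" "f (?g y) = y" if "y \<in> V" for y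
    using the_inv_into_into[OF inj _ order_refl] f_the_inv_into_f[OF inj] that b unfolding bij_betw_def by blast+
  have gf: "?g (f x) = x" if "x \<in> U" for x using the_inv_into_f_f[OF inj that] .
  have "?g (x \<oplus>\<^bsub>M\<^esub> y) = ?g x \<oplus>\<^bsub>M\<^esub> ?g y" if "x \<in> V" "y \<in> V" for x y
    using gf[OF smodD(3)[OF U g(1)[OF that(1)] g(1)[OF that(2)]]] f(1) g that by simp
  moreover have "?g (r \<odot>\<^bsub>M\<^esub> x) = r \<odot>\<^bsub>M\<^esub> ?g x" if "r \<in> carrier R" "x \<in> V" for r x
    using gf[OF smodD(4)[OF U that(1) g(1)[OF that(2)]]] f(2) g that by simp
  ultimately show ?thesis unfolding miso_iff using bij_betw_the_inv_into[OF b] by blast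
qed

lemma miso_trans: assumes "miso U V" "miso V W" shows "miso U W"
proof -
  obtain f where f: "bij_betw f U V" "\<And>x y. x \<in> U \<Longrightarrow> y \<in> U \<Longrightarrow> f (x \<oplus>\<^bsub>M\<^esub> y) = f x \<oplus>\<^bsub>M\<^esub> f y"
    "\<And>r x. r \<in> carrier R \<Longrightarrow> x \<in> U \<Longrightarrow> f (r \<odot>\<^bsub>M\<^esub> x) = r \<odot>\<^bsub>M\<^esub> f x"
    using assms(1) unfolding miso_iff by blast
  obtain g where g: "bij_betw g V W" "\<And>x y. x \<in> V \<Longrightarrow> y \<in> V \<Longrightarrow> g (x \<oplus>\<^bsub>M\<^esub> y) = g x \<oplus>\<^bsub>M\<^esub> g y"
    "\<And>r x. r \<in> carrier R \<Longrightarrow> x \<in> V \<Longrightarrow> g (r \<odot>\<^bsub>M\<^esub> x) = r \<odot>\<^bsub>M\<^esub> g x"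
    using assms(2) unfolding miso_iff by blast
  have fV: "f x \<in> V" if "x \<in> U" for x using f(1) that unfolding bij_betw_def by blast
  show ?thesis
    unfolding miso_iff
    by (rule exI[of _ "g \<circ> f"]) (use bij_betw_trans[OF f(1) g(1)] f(2,3) g(2,3) fV in auto)
qed

lemma equiv_miso:
  "equiv (indecomposable_summands R M)
    {(U, V). U \<in> indecomposable_summands R M \<and> V \<in> indecomposable_summands R M \<and> miso U V}"
  by (rule equivI) (auto intro!: refl_onI symI transI intro: miso_refl miso_sym miso_trans summand_smod)

end

context coord_module begin

lemma kap_space: assumes X: "smod X" shows "subspace (kap ` X)" "kap ` X \<subseteq> S" "stable Ops (kap ` X)" "lam ` kap ` X = X"
proof -
  have c: "x \<in> carrier M" if "x \<in> X" for x using that smodD(1)[OF X] by blast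
  show "kap ` X \<subseteq> S" using kap_S c by blast
  show "lam ` kap ` X = X" using lam_kap c by (auto simp: image_image)
  show "subspace (kap ` X)"
  proof (rule subspaceI)
    show "0 \<in> kap ` X" using kap_0 smodD(2)[OF X] by (metis imageI)
    show "x + y \<in> kap ` X" if "x \<in> kap ` X" "y \<in> kap ` X" for x y
      using that smodD(3)[OF X] kap_add c by (auto simp: image_iff) metis
    show "k *s x \<in> kap ` X" if "x \<in> kap ` X" for k x
      using that smod_sc[OF X] kap_sc c by (auto simp: image_iff) metis
  qed
  have a: "ac f ` kap ` X \<subseteq> kap ` X" if f: "f \<in> carrier P" for f
    unfolding ac_def using smod_act[OF X f] c by (auto simp: lam_kap)
  have "opr b ` kap ` X \<subseteq> kap ` X" if "b \<in> arcs D" for b unfolding opr_def by (rule a[OF arrow_closed[OF that]])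
  moreover have "ev v ` kap ` X \<subseteq> kap ` X" if "v \<in> verts Q" for v
    unfolding ev_def by (rule a[OF delta_closed[OF trivial_path]]) (use that in simp)
  ultimately have "\<omega> ` kap ` X \<subseteq> kap ` X" if "\<omega> \<in> Ops" for \<omega>
    using that opr_Ops by (auto simp: Ta_def[abs_def] ph_def[abs_def] double_quiver_def image_subset_iff)
  then show "stable Ops (kap ` X)" unfolding stable_def by blast
qed

lemma smod_lam: assumes W: "subspace W" "W \<subseteq> S" "stable Ops W" shows "smod (lam ` W)" "kap ` lam ` W = W"
proof -
  show "kap ` lam ` W = W" using kap_lam W(2) by (auto simp: image_image subset_iff)
  show "smod (lam ` W)"
    unfolding smod_def
  proof (intro conjI ballI)
    show "lam ` W \<subseteq> carrier M" using lam_closed by blast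
    show "\<zero>\<^bsub>M\<^esub> \<in> lam ` W" using lam_0 subspace_0[OF W(1)] by (metis imageI)
    show "x \<oplus>\<^bsub>M\<^esub> y \<in> lam ` W" if "x \<in> lam ` W" "y \<in> lam ` W" for x y
    proof -
      obtain a b where "a \<in> W" "b \<in> W" "x = lam a" "y = lam b" using \<open>x \<in> lam ` W\<close> \<open>y \<in> lam ` W\<close> by blast
      then show ?thesis using lam_add[of a b] subspace_add[OF W(1), of a b] by (metis imageI)
    qed
    show "r \<odot>\<^bsub>M\<^esub> x \<in> lam ` W" if "r \<in> carrier R" "x \<in> lam ` W" for r x
    proof -
      obtain f where f: "f \<in> carrier P" "r = cls f" using cls_surj[OF \<open>r \<in> carrier R\<close>] .
      obtain a where a: "a \<in> W" "x = lam a" using \<open>x \<in> lam ` W\<close> by blast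
      have "r \<odot>\<^bsub>M\<^esub> x = lam (ac f a)" unfolding lam_ac[OF f(1)] act_def f(2) a(2) ..
      then show ?thesis using ac_stable[OF W(1,3) f(1) a(1)] by simp
    qed
  qed
qed

lemma indec_kap:
  assumes U: "smod U" and i: "indecomposable R (M\<lparr>carrier := U\<rparr>)"
  shows "indec Ops (kap ` U)"
  unfolding indec_def
proof (intro conjI allI impI)
  note k = kap_space[OF U]
  show "fdim (kap ` U)" by (rule fdim_subset[OF fdim_S k(1,2)])
  show "stable Ops (kap ` U)" by (rule k(3))
  show "kap ` U \<noteq> {0}"
  proof
    assume "kap ` U = {0}"
    then have "U = {\<zero>\<^bsub>M\<^esub>}" using k(4) lam_0 by auto
    then show False using i unfolding indecomposable_def by simp
  qed
  fix W W' assume d: "dsum (kap ` U) W W'" and st: "stable Ops W" "stable Ops W'"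
  have sub: "subspace W" "subspace W'" "W \<subseteq> S" "W' \<subseteq> S"
    using dsum_subspace[OF d] dsum_subset[OF d] k(2) by blast+
  note s1 = smod_lam[OF sub(1,3) st(1)] and s2 = smod_lam[OF sub(2,4) st(2)]
  have "complementary R (M\<lparr>carrier := U\<rparr>) (lam ` W) (lam ` W')"
    unfolding complementary_iff[OF U]
  proof (intro conjI s1 s2)
    show "lam ` W \<inter> lam ` W' = {\<zero>\<^bsub>M\<^esub>}"
    proof
      show "lam ` W \<inter> lam ` W' \<subseteq> {\<zero>\<^bsub>M\<^esub>}"
      proof
        fix m assume "m \<in> lam ` W \<inter> lam ` W'"
        then obtain w w' where w: "w \<in> W" "w' \<in> W'" "m = lam w" "m = lam w'" by blast
        then have "w = w'" using lam_inj sub by (metis subsetD)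
        then have "w \<in> W \<inter> W'" using w by blast
        then have "w = 0" using d unfolding dsum_def by blast
        then show "m \<in> {\<zero>\<^bsub>M\<^esub>}" using w lam_0 by simp
      qed
    qed (use smodD(2)[OF s1(1)] smodD(2)[OF s2(1)] in blast)
    show "{x \<oplus>\<^bsub>M\<^esub> y |x y. x \<in> lam ` W \<and> y \<in> lam ` W'} = U"
    proof (rule subset_antisym; rule subsetI)
      fix m assume "m \<in> {x \<oplus>\<^bsub>M\<^esub> y |x y. x \<in> lam ` W \<and> y \<in> lam ` W'}"
      then obtain a b where ab: "a \<in> W" "b \<in> W'" "m = lam a \<oplus>\<^bsub>M\<^esub> lam b" by blast
      have "a + b \<in> kap ` U" using d ab(1,2) unfolding dsum_def by blast
      then have "lam (a + b) \<in> U" using k(4) by blast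
      then show "m \<in> U" unfolding ab(3) lam_add .
    next
      fix m assume "m \<in> U"
      then have "kap m \<in> kap ` U" "lam (kap m) = m" using smodD(1)[OF U] lam_kap by blast+
      then obtain a b where ab: "a \<in> W" "b \<in> W'" "kap m = a + b" "lam (kap m) = m" using dsumE[OF d] by metis
      then have "m = lam a \<oplus>\<^bsub>M\<^esub> lam b" using lam_add[of a b] by simp
      then show "m \<in> {x \<oplus>\<^bsub>M\<^esub> y |x y. x \<in> lam ` W \<and> y \<in> lam ` W'}" using ab(1,2) by blast
    qed
  qed
  then have "lam ` W = {\<zero>\<^bsub>M\<^esub>} \<or> lam ` W' = {\<zero>\<^bsub>M\<^esub>}" using i unfolding indecomposable_def by simp
  then show "W = {0} \<or> W' = {0}" using s1(2) s2(2) kap_0 by (metis image_empty image_insert)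
qed

lemma summand_projection:
  assumes c: "complementary R M U V"
  obtains \<pi> where "\<And>x. x \<in> S \<Longrightarrow> \<pi> x \<in> kap ` U" "\<And>x. x \<in> kap ` U \<Longrightarrow> \<pi> x = x" "commuting Ops S \<pi>"
proof -
  have U: "smod U" "smod V" "U \<inter> V = {\<zero>\<^bsub>M\<^esub>}" "{x \<oplus>\<^bsub>M\<^esub> y | x y. x \<in> U \<and> y \<in> V} = carrier M"
    using c unfolding complementary_carrier by blast+
  note kU = kap_space[OF U(1)] and kV = kap_space[OF U(2)]
  have cU: "x \<in> carrier M" if "x \<in> U \<or> x \<in> V" for x using that smodD(1)[OF U(1)] smodD(1)[OF U(2)] by blast
  have d: "dsum S (kap ` U) (kap ` V)"
  proof (rule dsumI[OF kU(1) kV(1) kU(2) kV(2) subspace_S])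
    show "x = 0" if "x \<in> kap ` U" "x \<in> kap ` V" for x
    proof -
      have "lam x \<in> U \<inter> V" using that kU(4) kV(4) by blast
      then have "lam x = lam 0" using U(3) lam_0 by auto
      then show ?thesis using lam_inj that kU(2) subspace_0[OF subspace_S] by blast
    qed
    fix x assume x: "x \<in> S"
    obtain u v where uv: "u \<in> U" "v \<in> V" "lam x = u \<oplus>\<^bsub>M\<^esub> v" using U(4) lam_closed[of x] by blast
    then have "x = kap u + kap v" using kap_lam[OF x] kap_add cU by metis
    then show "\<exists>a\<in>kap ` U. \<exists>b\<in>kap ` V. x = a + b" using uv by blast
  qed
  obtain \<pi> where p: "lin \<pi>" "\<And>x. x \<in> kap ` U \<Longrightarrow> \<pi> x = x" "\<And>x. x \<in> kap ` V \<Longrightarrow> \<pi> x = 0"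
    using lin_on_dsum[OF d lin_ident lin_zero] by metis
  have dec: "\<pi> (a + b) = a" if "a \<in> kap ` U" "b \<in> kap ` V" for a b
    using p(2)[OF that(1)] p(3)[OF that(2)] by (simp add: lin_add[OF p(1)])
  show thesis
  proof (rule that[OF _ p(2)])
    show "\<pi> x \<in> kap ` U" if "x \<in> S" for x using dsumE[OF d that] dec by metis
    have "\<pi> (\<omega> x) = \<omega> (\<pi> x)" if o: "\<omega> \<in> Ops" and x: "x \<in> S" for \<omega> x
    proof -
      obtain a b where ab: "a \<in> kap ` U" "b \<in> kap ` V" "x = a + b" using dsumE[OF d x] .
      have lo: "lin \<omega>" using o lin_ev lin_opr[of "Inl _"] lin_opr[of "Inr _"] by (auto simp: Ta_def ph_def)
      have "\<omega> a \<in> kap ` U" "\<omega> b \<in> kap ` V" using kU(3) kV(3) o ab unfolding stable_def by blast+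
      then show ?thesis using dec ab lin_add[OF lo] by simp
    qed
    then show "commuting Ops S \<pi>" unfolding commuting_def using p(1) by blast
  qed
qed

lemma miso_of_commuting:
  assumes U: "smod U" "smod U'" and F: "commuting Ops (kap ` U) F" "bij_betw F (kap ` U) (kap ` U')"
  shows "miso U U'"
  unfolding miso_iff
proof (intro exI[of _ "\<lambda>m. lam (F (kap m))"] conjI ballI)
  note kU = kap_space[OF U(1)] and kU' = kap_space[OF U(2)]
  have lF: "lin F" using F unfolding commuting_def by blast
  have c: "x \<in> carrier M" if "x \<in> U" for x using that smodD(1)[OF U(1)] by blast
  have "bij_betw kap U (kap ` U)" unfolding bij_betw_def using lam_kap c by (auto intro!: inj_onI) metis
  moreover have "bij_betw lam (kap ` U') U'"
    unfolding bij_betw_def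
    by (intro conjI kU'(4) inj_onI) (rule lam_inj[OF subsetD[OF kU'(2)] subsetD[OF kU'(2)]])
  ultimately have "bij_betw (lam \<circ> (F \<circ> kap)) U U'" using F(2) bij_betw_trans by metis
  then show "bij_betw (\<lambda>m. lam (F (kap m))) U U'" by (simp add: comp_def)
  show "lam (F (kap (x \<oplus>\<^bsub>M\<^esub> y))) = lam (F (kap x)) \<oplus>\<^bsub>M\<^esub> lam (F (kap y))" if "x \<in> U" "y \<in> U" for x y
    using that c by (simp add: kap_add lin_add[OF lF] lam_add)
  show "lam (F (kap (r \<odot>\<^bsub>M\<^esub> x))) = r \<odot>\<^bsub>M\<^esub> lam (F (kap x))" if r: "r \<in> carrier R" and x: "x \<in> U" for r x
  proof -
    obtain f where f: "f \<in> carrier P" "r = cls f" using cls_surj[OF r] .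
    have "kap (r \<odot>\<^bsub>M\<^esub> x) = ac f (kap x)" unfolding ac_def act_def f(2) lam_kap[OF c[OF x]] ..
    then have "lam (F (kap (r \<odot>\<^bsub>M\<^esub> x))) = lam (ac f (F (kap x)))"
      using ac_commuting[OF kU(1,3) F(1) f(1)] x by simp
    also have "\<dots> = r \<odot>\<^bsub>M\<^esub> lam (F (kap x))" unfolding lam_ac[OF f(1)] act_def f(2) ..
    finally show ?thesis .
  qed
qed

text \<open>
  In coordinates, non-isomorphic indecomposable summands of \<open>M\<close> become a
  \<open>summand_family\<close>.
\<close>

lemma card_noniso_summands_le:
  fixes cins cup :: "nat \<times> nat \<Rightarrow> 'w \<Rightarrow> 'w" and h :: "'v \<Rightarrow> int" and I :: "nat set" and U :: "nat \<Rightarrow> 'm set"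
  assumes inf: "infinite (UNIV :: 'k set)" and ext: "Ext1 R M M = {Ext1_zero R M M}"
    and copies: "slots scale cins cup"
    and h: "\<And>a. a \<in> arcs Q \<Longrightarrow> h (tail Q a) = h (head Q a) + 1"
    and V: "verts Q \<noteq> {}" and C: "C > 0"
    and coercive: "\<And>\<alpha>. (\<Sum>v\<in>verts Q. (\<alpha> v)\<^sup>2) \<le> C * form \<alpha> \<alpha>"
    and fin: "finite (active h)"
    and I: "finite I" and U: "\<And>i. i \<in> I \<Longrightarrow> U i \<in> indecomposable_summands R M"
    and non: "\<And>i j. i \<in> I \<Longrightarrow> j \<in> I \<Longrightarrow> i \<noteq> j \<Longrightarrow> \<not> miso (U i) (U j)"
  shows "card I \<le> card (active h)"
proof -
  have "\<forall>i\<in>I. \<exists>\<pi>. (\<forall>x\<in>S. \<pi> x \<in> kap ` U i) \<and> (\<forall>x\<in>kap ` U i. \<pi> x = x) \<and> commuting Ops S \<pi>"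
  proof
    fix i assume "i \<in> I"
    then obtain V where "complementary R M (U i) V" using U unfolding indecomposable_summands_def by blast
    from summand_projection[OF this]
    show "\<exists>\<pi>. (\<forall>x\<in>S. \<pi> x \<in> kap ` U i) \<and> (\<forall>x\<in>kap ` U i. \<pi> x = x) \<and> commuting Ops S \<pi>" by metis
  qed
  then obtain \<pi> where \<pi>: "\<And>i. i \<in> I \<Longrightarrow> (\<forall>x\<in>S. \<pi> i x \<in> kap ` U i) \<and> (\<forall>x\<in>kap ` U i. \<pi> i x = x) \<and> commuting Ops S (\<pi> i)"
    by metis
  have smU: "smod (U i)" if "i \<in> I" for i using U summand_smod that by blast
  interpret copies: slots scale cins cup by (rule copies)
  interpret F: summand_family scale ins up "verts Q" "arcs Q" "tail Q" "head Q" cins cup S ev Ta ph I "\<lambda>i. kap ` U i" \<pi> h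
  proof
    show "infinite (UNIV :: 'k set)" by (rule inf)
    show "qmod S ev Ta" by (rule qmod_S)
    show "tang S ev Ta ph" by (rule tang_S)
    show "rigid S ev Ta ph" by (rule rigid_S[OF ext])
    show "h (tail Q a) = h (head Q a) + 1" if "a \<in> arcs Q" for a by (rule h[OF that])
    show "finite I" by (rule I)
    show "kap ` U i \<subseteq> S" if "i \<in> I" for i using kap_space(2)[OF smU[OF that]] .
    show "\<pi> i x \<in> kap ` U i" if "i \<in> I" "x \<in> S" for i x using \<pi> that by blast
    show "\<pi> i x = x" if "i \<in> I" "x \<in> kap ` U i" for i x using \<pi> that by blast
    show "commuting Ops S (\<pi> i)" if "i \<in> I" for i using \<pi> that by blast
    show "indec Ops (kap ` U i)" if "i \<in> I" for i
      by (rule indec_kap[OF smU[OF that]]) (use U[OF that] in \<open>simp add: indecomposable_summands_def\<close>)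
    show "\<not> bij_betw f (kap ` U i) (kap ` U j)" if "i \<in> I" "j \<in> I" "i \<noteq> j" "commuting Ops (kap ` U i) f" for i j f
      using miso_of_commuting[OF smU smU] non that by blast
  qed
  show ?thesis by (rule F.card_le_active[OF V C coercive fin])
qed

end

definition fscale :: "'k::field \<Rightarrow> ('x \<Rightarrow> 'k) \<Rightarrow> 'x \<Rightarrow> 'k" where
  "fscale c x = (\<lambda>i. c * x i)"

lemma vector_space_fscale: "vector_space fscale"
  by unfold_locales (auto simp: fscale_def fun_eq_iff algebra_simps)

text \<open>
  Functions of a list and a number. Prefixing the list by a label \<open>a\<close> embeds a copy
  of the whole space, and different labels give independent copies.
\<close>

definition list_ins :: "'a \<Rightarrow> ('a list \<times> nat \<Rightarrow> 'k::field) \<Rightarrow> 'a list \<times> nat \<Rightarrow> 'k" where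
  "list_ins a x = (\<lambda>(l, n). case l of [] \<Rightarrow> 0 | b # l' \<Rightarrow> if b = a then x (l', n) else 0)"

definition list_up :: "'a \<Rightarrow> ('a list \<times> nat \<Rightarrow> 'k::field) \<Rightarrow> 'a list \<times> nat \<Rightarrow> 'k" where
  "list_up a x = (\<lambda>(l, n). x (a # l, n))"

lemma slots_list:
  fixes c :: "'s \<Rightarrow> 'a"
  assumes "inj c"
  shows "slots (fscale :: 'k::field \<Rightarrow> ('a list \<times> nat \<Rightarrow> 'k) \<Rightarrow> _) (\<lambda>a. list_ins (c a)) (\<lambda>a. list_up (c a))"
proof -
  interpret vspace "fscale :: 'k \<Rightarrow> ('a list \<times> nat \<Rightarrow> 'k) \<Rightarrow> _" by (intro vspace.intro vector_space_fscale)
  show ?thesis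
  proof (intro slots.intro slots_axioms.intro vspace_axioms)
    show "lin (list_ins (c a))" for a
      by (rule linI) (auto simp: list_ins_def fscale_def fun_eq_iff split: list.split)
    show "lin (list_up (c a))" for a
      by (rule linI) (auto simp: list_up_def fscale_def fun_eq_iff)
    show "list_up (c a) (list_ins (c b) y) = (if a = b then y else 0)" for a b and y :: "'a list \<times> nat \<Rightarrow> 'k"
      using assms by (auto simp: list_up_def list_ins_def fun_eq_iff inj_eq)
  qed
qed

text \<open>
  Over a finite field, the product of all \<open>X - a\<close>, plus \<open>1\<close>, has no
  root.
\<close>

lemma infinite_alg_closed: "infinite (UNIV :: 'k::alg_closed_field set)"
proof
  assume fin: "finite (UNIV :: 'k set)"
  define p :: "'k poly" where "p = (\<Prod>a\<in>UNIV. [:- a, 1:]) + 1"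
  have ev: "poly p x = 1" for x
    unfolding p_def using fin by (simp add: poly_prod prod_zero_iff)
  have "degree (\<Prod>a\<in>(UNIV :: 'k set). [:- a, 1:]) = card (UNIV :: 'k set)"
    by (subst degree_prod_eq_sum_degree) auto
  moreover have "card (UNIV :: 'k set) > 0" using fin by (simp add: card_gt_0_iff)
  ultimately have "degree p > 0" unfolding p_def by (subst degree_add_eq_left) auto
  then obtain x where "poly p x = 0" using alg_closed_imp_poly_has_root by blast
  then show False using ev by simp
qed

context coord_module begin

text \<open>
  The vectors \<open>beta k\<close> are roots by construction; for active \<open>k\<close> they
  are nonnegative and distinct.
\<close>

lemma active_bound:
  assumes dynkin: "dynkin_quiver Q" and h: "graded h" and V: "verts Q \<noteq> {}"
  shows "finite (active h)" "card (active h) \<le> card (positive_roots Q)"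
proof -
  interpret Y: dynkin Q by (rule dynkin.intro[OF dynkin])
  have rw_roots: "rw h j n \<alpha> \<in> roots Q" if "\<alpha> \<in> roots Q" for j n \<alpha>
  proof (induction n arbitrary: j)
    case (Suc n)
    have i: "ik h j \<in> verts Q" using pick_min(1)[OF V] .
    show ?case
      using roots.reflection[OF Suc i, of "Suc j"] Y.simple_reflection_eq[OF i] by (simp add: rw.simps[OF V h])
  qed (simp add: rw.simps[OF V h] that)
  have sub: "beta h ` active h \<subseteq> positive_roots Q"
  proof
    fix \<alpha> assume "\<alpha> \<in> beta h ` active h"
    then obtain k where k: "k \<in> active h" "\<alpha> = beta h k" by blast
    have "unit_vec (ik h k) \<in> roots Q"
      using roots.simple[of "ik h k" Q] pick_min(1)[OF V] Y.simple_root_eq by simp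
    then have "\<alpha> \<in> roots Q" unfolding k(2) beta_def[OF V h] by (rule rw_roots)
    moreover have "\<alpha> v \<ge> 0" for v unfolding k(2) by (rule beta_nonneg[OF V h k(1)])
    ultimately show "\<alpha> \<in> positive_roots Q" unfolding positive_roots_def by blast
  qed
  note inj = inj_beta[OF V h] and f = Y.finite_positive_roots
  show "finite (active h)" using inj f sub by (meson finite_imageD finite_subset)
  show "card (active h) \<le> card (positive_roots Q)" by (rule card_inj_on_le[OF inj sub f])
qed

end

theorem corollary1p2:
  fixes Q :: "('v, 'e) pre_digraph"
    and M :: "((('v, 'e + 'e) path \<Rightarrow> 'k::alg_closed_field) set, 'm) module"
  assumes "dynkin_quiver Q"
    and "left_module (preprojective_algebra Q) M"
    and "finite_dimensional (preprojective_scalar Q) M"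
    and "Ext1 (preprojective_algebra Q) M M = {Ext1_zero (preprojective_algebra Q) M M}"
  shows "finite (indecomposable_summand_classes (preprojective_algebra Q) M) \<and>
         card (indecomposable_summand_classes (preprojective_algebra Q) M) \<le> card (positive_roots Q)"
proof -
  interpret Y: dynkin Q by (rule dynkin.intro[OF assms(1)])
  interpret X: preproj_module Q M
    by (intro preproj_module.intro preproj_module_axioms.intro Y.loop_free_quiver_axioms assms(2))
  (* the coordinates of the module use the empty list; the labels Inl of the arrows serve for
     reflections and the labels Inr for sums of summands *)
  define \<iota> where "\<iota> j = ([] :: ('e + nat \<times> nat) list, j :: nat)" for j
  define ins :: "'e \<Rightarrow> _ \<Rightarrow> ('e + nat \<times> nat) list \<times> nat \<Rightarrow> 'k" where "ins a = list_ins (Inl a)" for a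
  define up :: "'e \<Rightarrow> _ \<Rightarrow> ('e + nat \<times> nat) list \<times> nat \<Rightarrow> 'k" where "up a = list_up (Inl a)" for a
  define cins :: "nat \<times> nat \<Rightarrow> _ \<Rightarrow> ('e + nat \<times> nat) list \<times> nat \<Rightarrow> 'k" where "cins s = list_ins (Inr s)" for s
  define cup :: "nat \<times> nat \<Rightarrow> _ \<Rightarrow> ('e + nat \<times> nat) list \<times> nat \<Rightarrow> 'k" where "cup s = list_up (Inr s)" for s
  interpret arr: slots "fscale :: 'k \<Rightarrow> (('e + nat \<times> nat) list \<times> nat \<Rightarrow> 'k) \<Rightarrow> _" ins up
    unfolding ins_def[abs_def] up_def[abs_def] by (rule slots_list) simp
  interpret reps: quiver_reps "fscale :: 'k \<Rightarrow> (('e + nat \<times> nat) list \<times> nat \<Rightarrow> 'k) \<Rightarrow> _" ins up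
    "verts Q" "arcs Q" "tail Q" "head Q" by unfold_locales
  have copies: "slots (fscale :: 'k \<Rightarrow> (('e + nat \<times> nat) list \<times> nat \<Rightarrow> 'k) \<Rightarrow> _) cins cup"
    unfolding cins_def[abs_def] cup_def[abs_def] by (rule slots_list) simp
  have "inj \<iota>" unfolding \<iota>_def by (rule injI) simp
  then obtain lam n where lam: "X.linear_parametrisation \<iota> lam n" "\<And>m. m \<in> carrier M \<Longrightarrow> \<exists>x. lam x = m"
    using X.exists_parametrisation[OF assms(3)] by blast
  note l = lam(1)[unfolded X.linear_parametrisation_def]
  have lam_closed: "lam x \<in> carrier M" for x using l by blast
  have lam_add: "lam (x + y) = lam x \<oplus>\<^bsub>M\<^esub> lam y" for x y using l unfolding plus_fun_def by blast
  have lam_scale: "lam (fscale c x) = X.sc c (lam x)" for c x using l unfolding fscale_def by blast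
  have lam_cong: "(\<forall>j<n. x (\<iota> j) = y (\<iota> j)) \<longrightarrow> lam x = lam y" for x y using l by blast
  (* lam maps Kn onto the module; a complement S of its kernel in Kn is mapped isomorphically *)
  define Kn where "Kn = {x :: ('e + nat \<times> nat) list \<times> nat \<Rightarrow> 'k. \<forall>i. i \<notin> \<iota> ` {..<n} \<longrightarrow> x i = 0}"
  have sK: "arr.subspace Kn" unfolding Kn_def by (rule arr.subspaceI) (auto simp: fscale_def)
  have fK: "arr.fdim Kn"
    unfolding arr.fdim_def
  proof (intro conjI sK exI[of _ "(\<lambda>j i. if i = \<iota> j then 1 else 0) ` {..<n}"])
    show "Kn \<subseteq> arr.span ((\<lambda>j i. if i = \<iota> j then 1 else 0) ` {..<n})"
    proof
      fix x assume x: "x \<in> Kn"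
      have "x = (\<Sum>j<n. fscale (x (\<iota> j)) (\<lambda>i. if i = \<iota> j then 1 else 0))"
      proof
        fix i
        have s: "(\<Sum>j<n. fscale (x (\<iota> j)) (\<lambda>i. if i = \<iota> j then 1 else 0)) i = (\<Sum>j<n. if i = \<iota> j then x (\<iota> j) else 0)"
          by (induction n) (auto simp: fscale_def)
        show "x i = (\<Sum>j<n. fscale (x (\<iota> j)) (\<lambda>i. if i = \<iota> j then 1 else 0)) i"
        proof (cases "i \<in> \<iota> ` {..<n}")
          case True
          then obtain k where k: "k < n" "i = \<iota> k" by blast
          have "(\<Sum>j<n. if i = \<iota> j then x (\<iota> j) else 0) = (\<Sum>j<n. if k = j then x (\<iota> j) else 0)"
            by (rule sum.cong) (use k \<open>inj \<iota>\<close> in \<open>auto simp: inj_eq\<close>)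
          then show ?thesis unfolding s using k by simp
        next
          case False
          then have "(\<Sum>j<n. if i = \<iota> j then x (\<iota> j) else 0) = 0" by (intro sum.neutral) auto
          moreover have "x i = 0" using x False unfolding Kn_def by blast
          ultimately show ?thesis unfolding s by simp
        qed
      qed
      also have "\<dots> \<in> arr.span ((\<lambda>j i. if i = \<iota> j then 1 else 0) ` {..<n})"
        by (intro arr.span_sum arr.span_scale arr.span_base) blast
      finally show "x \<in> arr.span ((\<lambda>j i. if i = \<iota> j then 1 else 0) ` {..<n})" .
    qed
  qed simp
  have lam0: "lam 0 = \<zero>\<^bsub>M\<^esub>"
    using lam_scale[of 0 0] X.sc_zero[OF lam_closed[of 0]] by (simp add: fscale_def zero_fun_def)
  define Z where "Z = {x \<in> Kn. lam x = \<zero>\<^bsub>M\<^esub>}"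
  have sZ: "arr.subspace Z"
    unfolding Z_def
    by (rule arr.subspaceI)
      (auto simp: lam0 lam_add lam_scale arr.subspace_0[OF sK] arr.subspace_add[OF sK] arr.subspace_scale[OF sK]
        X.sc_def X.act_def X.smult_zero_right X.cls_hom(1)[OF X.scaled_closed[OF X.one_closed] X.one_closed])
  have "Z \<subseteq> Kn" unfolding Z_def by blast
  then obtain S where S: "arr.dsum Kn Z S" using arr.exists_complement[OF sK sZ] by blast
  have sS: "arr.subspace S" "S \<subseteq> Kn" using arr.dsum_subspace[OF S] arr.dsum_subset[OF S] by blast+
  have inj: "x = y" if "x \<in> S" "y \<in> S" "lam x = lam y" for x y
  proof -
    have d: "x - y \<in> S" using arr.subspace_diff[OF sS(1) that(1,2)] .
    have "lam (x - y) \<oplus>\<^bsub>M\<^esub> lam y = \<zero>\<^bsub>M\<^esub> \<oplus>\<^bsub>M\<^esub> lam y" using lam_add[of "x - y" y] that(3) lam_closed by simp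
    then have "lam (x - y) = \<zero>\<^bsub>M\<^esub>" using X.L.M.add.right_cancel lam_closed X.L.M.zero_closed by metis
    then have "x - y \<in> Z \<inter> S" using d sS unfolding Z_def by blast
    then have "x - y = 0" using S unfolding arr.dsum_def by blast
    then show ?thesis by simp
  qed
  have surj: "\<exists>x\<in>S. lam x = m" if m: "m \<in> carrier M" for m
  proof -
    obtain x where x: "lam x = m" using lam(2)[OF m] by blast
    define x' where "x' i = (if i \<in> \<iota> ` {..<n} then x i else 0)" for i
    have "x' \<in> Kn" unfolding Kn_def x'_def by simp
    then obtain z s where zs: "z \<in> Z" "s \<in> S" "x' = z + s" using arr.dsumE[OF S] by metis
    have "\<forall>j<n. x' (\<iota> j) = x (\<iota> j)" unfolding x'_def by simp
    then have "lam x' = m" using lam_cong x by metis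
    then have "lam s = m" using zs lam_closed[of s] unfolding Z_def by (simp add: lam_add)
    then show ?thesis using zs by blast
  qed
  define kap where "kap m = (SOME x. x \<in> S \<and> lam x = m)" for m
  have kap: "kap m \<in> S \<and> lam (kap m) = m" if "m \<in> carrier M" for m
    unfolding kap_def using surj[OF that] by (metis (mono_tags, lifting) someI_ex)
  interpret CM: coord_module Q M "fscale :: 'k \<Rightarrow> (('e + nat \<times> nat) list \<times> nat \<Rightarrow> 'k) \<Rightarrow> _" ins up S lam kap
  proof
    show "arr.fdim S" by (rule arr.fdim_subset[OF fK sS])
    show "kap (lam x) = x" if "x \<in> S" for x using inj kap lam_closed that by blast
  qed (use lam_closed lam_add lam_scale kap in auto)
  obtain h :: "'v \<Rightarrow> int" where h: "\<And>a. a \<in> arcs Q \<Longrightarrow> h (tail Q a) = h (head Q a) + 1"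
    using Y.exists_height by blast
  have gh: "reps.graded h" unfolding reps.graded_def using h by simp
  obtain C where C: "C > 0" "\<And>\<alpha>. (\<Sum>v\<in>verts Q. (\<alpha> v)\<^sup>2) \<le> C * Y.form \<alpha> \<alpha>" using Y.coercive by blast
  note act = CM.active_bound[OF assms(1) gh Y.verts_nonempty]
  let ?IS = "indecomposable_summands X.R M"
  let ?r = "{(U, V). U \<in> ?IS \<and> V \<in> ?IS \<and> X.miso U V}"
  let ?C = "indecomposable_summand_classes X.R M"
  have Ceq: "?C = ?IS // ?r" unfolding indecomposable_summand_classes_def ..
  (* finite sets of classes are enough: a uniform bound for them also gives finiteness *)
  have bound: "card K \<le> card (positive_roots Q)" if K: "finite K" "K \<subseteq> ?C" for K
  proof -
    obtain c where c: "bij_betw c {..<card K} K"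
      using ex_bij_betw_nat_finite[OF K(1)] unfolding atLeast0LessThan by (elim exE)
    have cC: "c i \<in> ?C" if "i < card K" for i using c K(2) that unfolding bij_betw_def by blast
    define P where "P i U \<longleftrightarrow> U \<in> ?IS \<and> c i = ?r `` {U}" for i U
    have "\<exists>U. P i U" if i: "i < card K" for i
    proof -
      have "c i \<in> ?IS // ?r" using cC[OF i] unfolding Ceq .
      then show ?thesis by (rule quotientE) (unfold P_def, rule exI, rule conjI)
    qed
    then have "\<forall>i. \<exists>U. i < card K \<longrightarrow> P i U" by simp
    then obtain U where "\<forall>i. i < card K \<longrightarrow> P i (U i)" by (rule choice[THEN exE])
    then have U: "U i \<in> ?IS \<and> c i = ?r `` {U i}" if "i < card K" for i using that unfolding P_def by simp
    have "card {..<card K} \<le> card (reps.active h)"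
    proof (rule CM.card_noniso_summands_le[OF infinite_alg_closed assms(4) copies h Y.verts_nonempty C act(1)])
      show "U i \<in> ?IS" if "i \<in> {..<card K}" for i using U that by simp
      show "\<not> X.miso (U i) (U j)" if ij: "i \<in> {..<card K}" "j \<in> {..<card K}" "i \<noteq> j" for i j
      proof
        assume "X.miso (U i) (U j)"
        then have "(U i, U j) \<in> ?r" using U ij by auto
        then have "?r `` {U i} = ?r `` {U j}" by (rule equiv_class_eq[OF X.equiv_miso])
        then have "c i = c j" using U ij by auto
        then show False using c ij unfolding bij_betw_def inj_on_def by blast
      qed
    qed simp_all
    then show ?thesis using act(2) by simp
  qed
  show ?thesis by (rule finite_if_finite_subsets_card_bdd) (use bound in blast)
qed

end
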